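(* Let $0\le k\le n$ and $f\in\operatorname{Bound}(k,n)$. For a vertex $g$ of the bounded affine Lascoux–Schützenberger tree of $f$, let $\pi_g$ be the unique path from the root to $g$ and $\operatorname{sgn}(\pi_g)$ the product of its edge labels ($\pm1$). Then in $\Lambda^{n-k}(k)$, \[ G_f=\sum_{g}\operatorname{sgn}(\pi_g)\,\overline{s}_{\lambda(g)}, \] where $g$ runs over the leaves of the tree (counted as vertices, possibly with repeated labels).
   Context: Affine permutations $\widetilde S_n$: bijections $f:\mathbb{Z}\to\mathbb{Z}$ with $f(i+n)=f(i)+n$. $\tau(i)=i+1$; $s_i$ swaps $i+pn,i+1+pn$ for all $p$; $\widetilde S_n^0=\langle s_0,\dots,s_{n-1}\rangle$; $f=\tau^{\operatorname{av}(f)}g$ uniquely with $g\in\widetilde S^0_n$. $\ell(f)=\#\{(i,j):1\le i\le n,\ i<j,\ f(i)>f(j)\}$. For $i<j$ with $i\not\equiv j\pmod n$, $t_{ij}$ swaps $i+pn$ and $j+pn$ for all $p$. Bruhat cover: $f\lessdot ft_{ij}$ iff $\ell(ft_{ij})=\ell(f)+1$. $\operatorname{Bound}(k,n)$: $f$ with $i\le f(i)\le i+n$ for all $i$ and exactly $k$ of $f(1),\dots,f(n)$ exceeding $n$. For $r\in\mathbb{Z}$: $\Phi^+(f,r)=\{ft_{rj}: r<j,\ f\lessdot ft_{rj}\}$, $\Phi^-(f,r)=\{ft_{ir}: i<r,\ f\lessdot ft_{ir}\}$, and $B\Phi^\pm(f,r)=\Phi^\pm(f,r)\cap\operatorname{Bound}(k,n)$.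 The maximal inversion of $g\in\operatorname{Bound}(k,n)$ is the lexicographically largest $(r,s)$ with $1\le r<s\le n$ and $g(r)>g(s)$; if none exists $g$ is $0$-Grassmannian. The bounded affine L-S tree of $f$ is the rooted tree with vertices labeled by elements of $\operatorname{Bound}(k,n)$ and edges labeled $+$ or $-$: the root is $f$; a $0$-Grassmannian vertex $g$ has no children; otherwise, with $(r,s)$ the maximal inversion of $g$, $g$ has as children the elements of $B\Phi^-(gt_{rs},r)$ (edges labeled $+$) and of $B\Phi^+(gt_{rs},r)\setminus\{g\}$ (edges labeled $-$). For $0$-Grassmannian $g\in\operatorname{Bound}(k,n)$, $w=g\tau^{-k}$ restricts to a permutation of $[n]$, and $\lambda(g)$ is the partition obtained by sorting $(c_1(w),\dots,c_n(w))$ decreasingly, where $c_i(w)=\#\{i'>i: w(i)>w(i')\}$. Symmetric functions: a sequence $i_1,\dots,i_m$ in $\mathbb{Z}/n\mathbb{Z}$ is cyclically decreasing if entries are distinct and whenever $j,j+1$ both appear, $j+1$ comes first; $g\in\widetilde S^0_n$ is cyclically decreasing if it is the product $s_{i_1}\cdots s_{i_m}$ of such a sequence. $\widetilde F_f=\sum x_1^{\ell(f_1)}x_2^{\ell(f_2)}\cdots$ over factorizations $\tau^{-\operatorname{av}(f)}f=f_1f_2\cdots$ with $\sum\ell(f_i)=\ell(f)$ and each $f_i$ cyclically decreasing. $\Lambda^{n-k}(k)$ is $\mathbb{Z}[x_1,\dots,x_k]^{S_k}$ modulo the ideal generated by $h_d(x_1,\dots,x_k)$, $d>n-k$; $\overline{F}$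 denotes the image of $F(x_1,\dots,x_k)$; $G_f=\overline{\widetilde F_f}$; $\overline{s}_\lambda$ is the image of the Schur polynomial. *)

theory Defs
  imports
    "HOL-Library.Poly_Mapping"
    "HOL-Library.FuncSet"
    "HOL-Number_Theory.Cong"
    "HOL-Combinatorics.Permutations"
    "HOL-Algebra.Bij"
    "HOL-Algebra.Generated_Groups"
    "HOL-Algebra.Ideal"
    "HOL-Algebra.QuotRing"
begin

section \<open>Affine permutations\<close>

definition affine_perms :: "nat \<Rightarrow> (int \<Rightarrow> int) set" where
  "affine_perms n = {f. bij f \<and> (\<forall>i. f (i + int n) = f i + int n)}"

text \<open>The power \<open>\<tau>\<^sup>m\<close> of the shift \<open>\<tau>\<close>.\<close>

definition tau_pow :: "int \<Rightarrow> int \<Rightarrow> int" where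
  "tau_pow m = (\<lambda>i. i + m)"

text \<open>The map \<open>t\<^sub>i\<^sub>j\<close>, meaningful for \<open>i \<not>\<equiv> j (mod n)\<close>. It is the identity if \<open>i \<equiv> j\<close>, so that
  for \<open>n = 1\<close> the group \<open>\<langle>s\<^sub>0\<rangle>\<close> below is trivial.\<close>

definition aff_transp :: "nat \<Rightarrow> int \<Rightarrow> int \<Rightarrow> int \<Rightarrow> int" where
  "aff_transp n i j x =
     (if [i = j] (mod int n) then x
      else if [x = i] (mod int n) then x + (j - i)
      else if [x = j] (mod int n) then x - (j - i)
      else x)"

definition simple_refl :: "nat \<Rightarrow> nat \<Rightarrow> int \<Rightarrow> int" where
  "simple_refl n i = aff_transp n (int i) (int i + 1)"

definition affine_perms0 :: "nat \<Rightarrow> (int \<Rightarrow> int) set" where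
  "affine_perms0 n = generate (BijGroup UNIV) (simple_refl n ` {..<n})"

definition av :: "nat \<Rightarrow> (int \<Rightarrow> int) \<Rightarrow> int" where
  "av n f = (THE m. \<exists>g \<in> affine_perms0 n. f = tau_pow m \<circ> g)"

definition aff_length :: "nat \<Rightarrow> (int \<Rightarrow> int) \<Rightarrow> nat" where
  "aff_length n f = card {(i, j). 1 \<le> i \<and> i \<le> int n \<and> i < j \<and> f i > f j}"

definition bruhat_cover :: "nat \<Rightarrow> (int \<Rightarrow> int) \<Rightarrow> int \<Rightarrow> int \<Rightarrow> bool" where
  "bruhat_cover n f i j \<longleftrightarrow>
     i < j \<and> \<not> [i = j] (mod int n) \<and>
     aff_length n (f \<circ> aff_transp n i j) = aff_length n f + 1"

definition Bound :: "nat \<Rightarrow> nat \<Rightarrow> (int \<Rightarrow> int) set" where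
  "Bound k n = {f \<in> affine_perms n.
     (\<forall>i. i \<le> f i \<and> f i \<le> i + int n) \<and>
     card {i \<in> {1..int n}. f i > int n} = k}"

definition Phi_plus :: "nat \<Rightarrow> (int \<Rightarrow> int) \<Rightarrow> int \<Rightarrow> (int \<Rightarrow> int) set" where
  "Phi_plus n f r = {f \<circ> aff_transp n r j | j. bruhat_cover n f r j}"

definition Phi_minus :: "nat \<Rightarrow> (int \<Rightarrow> int) \<Rightarrow> int \<Rightarrow> (int \<Rightarrow> int) set" where
  "Phi_minus n f r = {f \<circ> aff_transp n i r | i. bruhat_cover n f i r}"

definition BPhi_plus :: "nat \<Rightarrow> nat \<Rightarrow> (int \<Rightarrow> int) \<Rightarrow> int \<Rightarrow> (int \<Rightarrow> int) set" where
  "BPhi_plus k n f r = Phi_plus n f r \<inter> Bound k n"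

definition BPhi_minus :: "nat \<Rightarrow> nat \<Rightarrow> (int \<Rightarrow> int) \<Rightarrow> int \<Rightarrow> (int \<Rightarrow> int) set" where
  "BPhi_minus k n f r = Phi_minus n f r \<inter> Bound k n"


section \<open>The bounded affine Lascoux--Schuetzenberger tree\<close>

definition window_inversions :: "nat \<Rightarrow> (int \<Rightarrow> int) \<Rightarrow> (int \<times> int) set" where
  "window_inversions n g = {(r, s). 1 \<le> r \<and> r < s \<and> s \<le> int n \<and> g r > g s}"

definition is_max_inversion :: "nat \<Rightarrow> (int \<Rightarrow> int) \<Rightarrow> int \<Rightarrow> int \<Rightarrow> bool" where
  "is_max_inversion n g r s \<longleftrightarrow>
     (r, s) \<in> window_inversions n g \<and>
     (\<forall>(r', s') \<in> window_inversions n g. r' < r \<or> (r' = r \<and> s' \<le> s))"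

text \<open>The children of a vertex labeled \<open>g\<close>, each paired with the sign of the edge leading to it.
  There are none if \<open>g\<close> is 0-Grassmannian, since \<open>g\<close> then has no maximal inversion.\<close>

definition ls_children :: "nat \<Rightarrow> nat \<Rightarrow> (int \<Rightarrow> int) \<Rightarrow> (int \<times> (int \<Rightarrow> int)) set" where
  "ls_children k n g =
     {(1, h) | h r s. is_max_inversion n g r s \<and>
        h \<in> BPhi_minus k n (g \<circ> aff_transp n r s) r} \<union>
     {(-1, h) | h r s. is_max_inversion n g r s \<and>
        h \<in> BPhi_plus k n (g \<circ> aff_transp n r s) r - {g}}"

text \<open>A vertex of the tree is represented by the path leading to it from the root, recorded as the
  list of (edge sign, label of the lower end) along the path. Hence distinct vertices remain
  distinct even when their labels agree.\<close>

definition vertex_label :: "(int \<Rightarrow> int) \<Rightarrow> (int \<times> (int \<Rightarrow> int)) list \<Rightarrow> int \<Rightarrow> int" where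
  "vertex_label f p = (if p = [] then f else snd (last p))"

inductive_set ls_vertices :: "nat \<Rightarrow> nat \<Rightarrow> (int \<Rightarrow> int) \<Rightarrow> (int \<times> (int \<Rightarrow> int)) list set"
  for k n :: nat and f :: "int \<Rightarrow> int" where
  root: "[] \<in> ls_vertices k n f"
| child: "\<lbrakk>p \<in> ls_vertices k n f; c \<in> ls_children k n (vertex_label f p)\<rbrakk>
    \<Longrightarrow> p @ [c] \<in> ls_vertices k n f"

definition ls_leaves :: "nat \<Rightarrow> nat \<Rightarrow> (int \<Rightarrow> int) \<Rightarrow> (int \<times> (int \<Rightarrow> int)) list set" where
  "ls_leaves k n f = {p \<in> ls_vertices k n f. ls_children k n (vertex_label f p) = {}}"

definition path_sign :: "(int \<times> (int \<Rightarrow> int)) list \<Rightarrow> int" where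
  "path_sign p = prod_list (map fst p)"

definition perm_code :: "nat \<Rightarrow> (int \<Rightarrow> int) \<Rightarrow> int \<Rightarrow> nat" where
  "perm_code n w i = card {i'. i < i' \<and> i' \<le> int n \<and> w i > w i'}"

text \<open>A partition is a weakly decreasing list, trailing zeros allowed.\<close>

definition ls_shape :: "nat \<Rightarrow> nat \<Rightarrow> (int \<Rightarrow> int) \<Rightarrow> nat list" where
  "ls_shape k n g = rev (sort (map (perm_code n (g \<circ> tau_pow (- int k))) [1..int n]))"


section \<open>Symmetric functions\<close>

text \<open>Monomials are finitely supported exponent vectors; the variable \<open>x\<^sub>i\<close> (\<open>i \<ge> 1\<close>) has
  index \<open>i - 1\<close>.\<close>

type_synonym monom = "nat \<Rightarrow>\<^sub>0 nat"
type_synonym mpoly = "monom \<Rightarrow>\<^sub>0 int"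

definition var :: "nat \<Rightarrow> mpoly" where
  "var i = Poly_Mapping.single (Poly_Mapping.single i 1) 1"

text \<open>Residues modulo \<open>n\<close> are represented by \<open>0, \<dots>, n - 1\<close>.\<close>

definition cyc_decreasing_seq :: "nat \<Rightarrow> nat list \<Rightarrow> bool" where
  "cyc_decreasing_seq n js \<longleftrightarrow>
     set js \<subseteq> {..<n} \<and> distinct js \<and>
     (\<forall>p < length js. \<forall>q < length js. js ! q = (js ! p + 1) mod n \<longrightarrow> q < p)"

definition perm_product :: "(int \<Rightarrow> int) list \<Rightarrow> int \<Rightarrow> int" where
  "perm_product gs = foldr (\<circ>) gs id"

definition cyc_decreasing :: "nat \<Rightarrow> (int \<Rightarrow> int) set" where
  "cyc_decreasing n = {perm_product (map (simple_refl n) js) | js. cyc_decreasing_seq n js}"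

text \<open>The factorizations \<open>\<tau>\<^bsup>-av(f)\<^esup> f = f\<^sub>1 f\<^sub>2 \<cdots>\<close>; an infinite product is meaningful only if all but
  finitely many factors are the identity.\<close>

definition cyc_factorizations :: "nat \<Rightarrow> (int \<Rightarrow> int) \<Rightarrow> (nat \<Rightarrow> int \<Rightarrow> int) set" where
  "cyc_factorizations n f = {fs.
     (\<forall>i. fs i \<in> cyc_decreasing n) \<and>
     (\<exists>N. (\<forall>i \<ge> N. fs i = id) \<and>
        perm_product (map fs [0..<N]) = tau_pow (- av n f) \<circ> f \<and>
        (\<Sum>i<N. aff_length n (fs i)) = aff_length n f)}"

text \<open>The affine Stanley symmetric function, a formal power series in infinitely many variables,
  given by its coefficients.\<close>

definition affine_stanley :: "nat \<Rightarrow> (int \<Rightarrow> int) \<Rightarrow> monom \<Rightarrow> int" where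
  "affine_stanley n f m =
     int (card {fs \<in> cyc_factorizations n f. \<forall>i. aff_length n (fs i) = Poly_Mapping.lookup m i})"

text \<open>The polynomial \<open>F(x\<^sub>1, \<dots>, x\<^sub>k)\<close> obtained from a power series \<open>F\<close> of bounded degree by setting
  the remaining variables to zero.\<close>

definition specialize :: "nat \<Rightarrow> (monom \<Rightarrow> int) \<Rightarrow> mpoly" where
  "specialize k F =
     (\<Sum>m | Poly_Mapping.keys m \<subseteq> {..<k} \<and> F m \<noteq> 0. Poly_Mapping.single m (F m))"

definition complete_homogeneous :: "nat \<Rightarrow> nat \<Rightarrow> mpoly" where
  "complete_homogeneous k d =
     (\<Sum>m | Poly_Mapping.keys m \<subseteq> {..<k} \<and> (\<Sum>i<k. Poly_Mapping.lookup m i) = d.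
        Poly_Mapping.single m 1)"

definition diagram :: "nat list \<Rightarrow> (nat \<times> nat) set" where
  "diagram lam = {(i, j). i < length lam \<and> j < lam ! i}"

definition ssyt :: "nat \<Rightarrow> nat list \<Rightarrow> (nat \<times> nat \<Rightarrow> nat) set" where
  "ssyt k lam = {T \<in> diagram lam \<rightarrow>\<^sub>E {..<k}.
     (\<forall>i j. (i, Suc j) \<in> diagram lam \<longrightarrow> T (i, j) \<le> T (i, Suc j)) \<and>
     (\<forall>i j. (Suc i, j) \<in> diagram lam \<longrightarrow> T (i, j) < T (Suc i, j))}"

definition schur_poly :: "nat \<Rightarrow> nat list \<Rightarrow> mpoly" where
  "schur_poly k lam = (\<Sum>T \<in> ssyt k lam. \<Prod>c \<in> diagram lam. var (T c))"

text \<open>The ring \<open>\<int>[x\<^sub>1, \<dots>, x\<^sub>k]\<^bsup>S\<^sub>k\<^esup>\<close>; permuting the variables of a polynomial permutes the exponent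
  vectors of its monomials.\<close>

definition symmetric_polys :: "nat \<Rightarrow> mpoly set" where
  "symmetric_polys k = {p.
     (\<forall>m \<in> Poly_Mapping.keys p. Poly_Mapping.keys m \<subseteq> {..<k}) \<and>
     (\<forall>\<sigma>. \<sigma> permutes {..<k} \<longrightarrow>
        (\<forall>m. Poly_Mapping.lookup p (Poly_Mapping.map_key \<sigma> m) = Poly_Mapping.lookup p m))}"

definition sym_ring :: "nat \<Rightarrow> mpoly ring" where
  "sym_ring k = \<lparr>carrier = symmetric_polys k, mult = (*), one = 1, zero = 0, add = (+)\<rparr>"

definition Lambda_ideal :: "nat \<Rightarrow> nat \<Rightarrow> mpoly set" where
  "Lambda_ideal k n = genideal (sym_ring k) {complete_homogeneous k d | d. d > n - k}"

definition Lambda :: "nat \<Rightarrow> nat \<Rightarrow> mpoly set ring" where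
  "Lambda k n = sym_ring k Quot Lambda_ideal k n"

definition Lambda_image :: "nat \<Rightarrow> nat \<Rightarrow> mpoly \<Rightarrow> mpoly set" where
  "Lambda_image k n p = Lambda_ideal k n +>\<^bsub>sym_ring k\<^esub> p"

definition G_class :: "nat \<Rightarrow> nat \<Rightarrow> (int \<Rightarrow> int) \<Rightarrow> mpoly set" where
  "G_class k n f = Lambda_image k n (specialize k (affine_stanley n f))"

definition schur_class :: "nat \<Rightarrow> nat \<Rightarrow> nat list \<Rightarrow> mpoly set" where
  "schur_class k n lam = Lambda_image k n (schur_poly k lam)"

end

theory Submission
  imports Defs "Jordan_Normal_Form.Determinant" "HOL-Computational_Algebra.Formal_Power_Series"
begin

text \<open>
  Let \<open>FP k w\<close> be the generating polynomial of the factorizations of \<open>w\<close> into \<open>k\<close> cyclically decreasing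
  elements; with \<open>w = \<tau>\<^sup>-\<^sup>k f\<close> it represents \<open>G\<^sub>f\<close>. The signed sum \<open>D\<^sub>r\<close> over all covers \<open>v \<lessdot> v t\<^sub>r\<^sub>j\<close>
  commutes with multiplication by the sum of the cyclically decreasing elements of a given length and kills the
  identity, hence kills \<open>FP k\<close>: this is the transition identity for an edge set of the tree. Its unbounded terms vanish
  in the quotient: if \<open>f i < i\<close>, then \<open>FP k w = 0\<close> because each factor lowers a value by at most one; if
  \<open>f i > i + n\<close>, then the Cauchy determinant for \<open>FP k\<close> reduces modulo the ideal to a \<open>k \<times> k\<close> Toeplitz minor, whose
  complementary minor is a polynomial in \<open>n - k\<close> operators each lowering by at most one in the other direction.
  Along the tree the energy \<open>\<Sum> f(i)\<^sup>2\<close> increases, or stays constant while the maximal inversion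
  decreases, so the tree is finite. At a 0-Grassmannian leaf the cyclically decreasing factorizations satisfy the
  branching rule of semistandard tableaux, which gives the Schur polynomial. The same transition identity shows that the
  cyclically decreasing sums commute: the commutator is killed by all \<open>D\<^sub>r\<close>, so it suffices to check it on
  Grassmannian elements.
\<close>

section \<open>Affine permutations and covers\<close>

text \<open>A single cyclically decreasing element does not commute with D_r: deleting a factor s_c
  leaves a correction that compares \<open>v r\<close> with c and with the end of the run of the
  support starting at c. The corrections cancel only in the sum over all supports of one size,
  because for a fixed remaining support the run ends are a cyclic rotation of the deleted residues.
  The determinant argument substitutes operators for commuting variables, so commutativity has to
  come first; this is not circular, since the transition identity rests on single simple reflections
  only. The number n - k arises as the size of the minor complementary to the k x k one: the
  reciprocal of the operator series consists, up to sign, of cyclically increasing elements, and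
  every entry of the inverse matrix is linear in them. Finally, leaves are defined by the absence of
  children, so a non-Grassmannian vertex whose other covers are all unbounded would spoil the sum; a
  count of values shows that a bounded cover to the left always exists.\<close>

lemma nat_down_closed:
  assumes "finite (K::nat set)" "\<And>i. Suc i \<in> K \<Longrightarrow> i \<in> K" shows "K = {..<card K}"
proof -
  have a: "{..i} \<subseteq> K" if "i \<in> K" for i using that
  proof (induction i)
    case (Suc i) then show ?case using assms(2)[of i] by (auto simp: atMost_Suc)
  qed auto
  have "K \<subseteq> {..<card K}"
  proof
    fix i assume "i \<in> K"
    then have "card {..i} \<le> card K" using a assms(1) by (intro card_mono) auto
    then show "i \<in> {..<card K}" by simp
  qed
  then show ?thesis using card_subset_eq[of "{..<card K}" K] by simp
qed

locale affine_window =
  fixes n :: nat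
  assumes n_pos: "1 \<le> n"
begin

abbreviation iv :: "(int \<Rightarrow> int) \<Rightarrow> int \<Rightarrow> int" where "iv \<equiv> inv_into UNIV"
abbreviation aff :: "(int \<Rightarrow> int) \<Rightarrow> bool" where "aff f \<equiv> f \<in> affine_perms n"
abbreviation tr :: "int \<Rightarrow> int \<Rightarrow> int \<Rightarrow> int" where "tr \<equiv> aff_transp n"
abbreviation len :: "(int \<Rightarrow> int) \<Rightarrow> nat" where "len \<equiv> aff_length n"
abbreviation cg :: "int \<Rightarrow> int \<Rightarrow> bool" where "cg a b \<equiv> [a = b] (mod int n)"
abbreviation sr :: "int \<Rightarrow> int \<Rightarrow> int" where "sr i \<equiv> tr i (i + 1)"

section \<open>Periodicity, inverses and reflections\<close>

lemma cg_iff: "cg a b \<longleftrightarrow> (\<exists>c. b = a + c * int n)"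
  by (simp add: cong_iff_lin mult.commute)

lemma aff_bij: "aff f \<Longrightarrow> bij f"
  by (simp add: affine_perms_def)

lemma aff_inj: "aff f \<Longrightarrow> f x = f y \<longleftrightarrow> x = y"
  using aff_bij bij_is_inj inj_eq by metis

lemma aff_shift:
  assumes "aff f" shows "f (i + c * int n) = f i + c * int n"
proof -
  have s: "f (i + int n) = f i + int n" for i using assms by (simp add: affine_perms_def)
  have p: "f (i + int m * int n) = f i + int m * int n" for i m
  proof (induction m)
    case (Suc m)
    have "f (i + int (Suc m) * int n) = f ((i + int m * int n) + int n)" by (simp add: algebra_simps)
    also have "\<dots> = f i + int (Suc m) * int n" using s[of "i + int m * int n"] Suc by (simp add: algebra_simps)
    finally show ?case .
  qed simp
  show ?thesis
  proof (cases "c \<ge> 0")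
    case True then show ?thesis using p[of i "nat c"] by simp
  next
    case False then show ?thesis using p[of "i + c * int n" "nat (- c)"] by (simp add: algebra_simps)
  qed
qed

lemma aff_cg: assumes "aff f" shows "cg (f i) (f j) \<longleftrightarrow> cg i j"
proof
  assume "cg (f i) (f j)"
  then obtain c where "f j = f i + c * int n" by (auto simp: cg_iff)
  then have "f j = f (i + c * int n)" using assms by (simp add: aff_shift)
  then show "cg i j" using assms by (auto simp: cg_iff aff_inj)
qed (use assms in \<open>auto simp: cg_iff aff_shift\<close>)

lemma aff_id: "aff id" by (simp add: affine_perms_def)

lemma aff_comp: "aff f \<Longrightarrow> aff g \<Longrightarrow> aff (f \<circ> g)"
  by (simp add: affine_perms_def bij_comp)

lemma aff_inv_f[simp]: "aff f \<Longrightarrow> iv f (f x) = x"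
  by (simp add: aff_bij bij_is_inj)

lemma aff_f_inv[simp]: "aff f \<Longrightarrow> f (iv f x) = x"
  by (simp add: aff_bij bij_is_surj surj_f_inv_f)

lemma aff_inv: assumes "aff f" shows "aff (iv f)"
proof -
  have "iv f (i + int n) = iv f i + int n" for i
  proof -
    have "f (iv f i + int n) = i + int n" using aff_shift[OF assms, of "iv f i" 1] assms by simp
    then show ?thesis using assms by (metis aff_inv_f)
  qed
  then show ?thesis using assms by (simp add: affine_perms_def bij_imp_bij_inv)
qed

lemma aff_tau: "aff (tau_pow m)"
  unfolding affine_perms_def tau_pow_def
  by (auto intro!: o_bij[where g="\<lambda>i. i - m"] simp: fun_eq_iff)

lemma aff_inv_comp: "aff f \<Longrightarrow> iv f \<circ> f = id" "aff f \<Longrightarrow> f \<circ> iv f = id"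
  by (auto simp: fun_eq_iff)

lemma aff_inv_comp2: "aff f \<Longrightarrow> iv f \<circ> (f \<circ> g) = g" "aff f \<Longrightarrow> f \<circ> (iv f \<circ> g) = g"
  by (auto simp: fun_eq_iff)

lemma aff_inv_distrib: "aff f \<Longrightarrow> aff g \<Longrightarrow> iv (f \<circ> g) = iv g \<circ> iv f"
  by (simp add: aff_bij o_inv_distrib)

lemma tr_commute: "tr a b = tr b a"
proof
  fix x
  have "cg x a \<Longrightarrow> cg x b \<Longrightarrow> cg a b" by (meson cong_sym cong_trans)
  then show "tr a b x = tr b a x" unfolding aff_transp_def by (auto simp: cong_sym_eq)
qed

lemma tr_shift: "tr (a + c * int n) (b + c * int n) = tr a b"
  by (rule ext) (simp add: aff_transp_def cong_def)

lemma tr_at: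
  assumes "\<not> cg a b"
  shows "tr a b (a + c * int n) = b + c * int n" "tr a b (b + c * int n) = a + c * int n"
  using assms by (auto simp: aff_transp_def cong_def)

lemma tr_at0: assumes "\<not> cg a b" shows "tr a b a = b" "tr a b b = a"
  using tr_at[OF assms, of 0] by auto

lemma tr_other: "\<not> cg x a \<Longrightarrow> \<not> cg x b \<Longrightarrow> tr a b x = x"
  by (auto simp: aff_transp_def)

lemma tr_cases:
  obtains (1) c where "x = a + c * int n" | (2) c where "x = b + c * int n"
    | (3) "\<not> cg x a" "\<not> cg x b"
  by (metis cg_iff cong_sym_eq)

lemma tr_tr: "tr a b (tr a b x) = x"
proof (cases "cg a b")
  case True then show ?thesis by (simp add: aff_transp_def)
next
  case False
  show ?thesis by (rule tr_cases[of x a _ b]) (auto simp: tr_at[OF False] tr_other)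
qed

lemma tr_invol: "tr a b \<circ> tr a b = id"
  by (simp add: fun_eq_iff tr_tr)

lemma tr_invol2: "tr a b \<circ> (tr a b \<circ> f) = f" "f \<circ> tr a b \<circ> tr a b = f"
  by (simp_all add: fun_eq_iff tr_tr)

lemma aff_tr: "aff (tr a b)"
proof -
  have "tr a b (i + int n) = tr a b i + int n" for i
    by (simp add: aff_transp_def cong_def)
  then show ?thesis
    using tr_invol by (simp add: affine_perms_def o_bij[OF tr_invol tr_invol])
qed

lemma inv_tr: "iv (tr a b) = tr a b"
  by (rule inv_unique_comp) (simp_all add: tr_invol)

lemma comp_tr: assumes "aff f" shows "f \<circ> tr a b = tr (f a) (f b) \<circ> f"
proof
  fix x
  show "(f \<circ> tr a b) x = (tr (f a) (f b) \<circ> f) x"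
  proof (cases "cg a b")
    case True then show ?thesis using assms by (simp add: aff_transp_def aff_cg)
  next
    case False
    then have nf: "\<not> cg (f a) (f b)" using assms by (simp add: aff_cg)
    show ?thesis
      by (rule tr_cases[of x a _ b])
        (use assms in \<open>auto simp: tr_at[OF False] tr_at[OF nf] tr_other aff_shift aff_cg\<close>)
  qed
qed

lemma tr_comp_inv: assumes "aff w" shows "tr i j \<circ> w = w \<circ> tr (iv w i) (iv w j)"
  using comp_tr[OF assms, of "iv w i" "iv w j"] assms by simp

lemma tr_inj: assumes "\<not> cg r j" "\<not> cg r j'" "tr r j = tr r j'" shows "j = j'"
  using assms tr_at0 by metis

section \<open>Length, and how a reflection changes it\<close>

definition Inv :: "(int \<Rightarrow> int) \<Rightarrow> (int \<times> int) set" where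
  "Inv f = {(i, j). 1 \<le> i \<and> i \<le> int n \<and> i < j \<and> f i > f j}"

lemma len_Inv: "len f = card (Inv f)" by (simp add: aff_length_def Inv_def)

lemma window_shift: obtains c where "1 \<le> i + c * int n" "i + c * int n \<le> int n"
proof -
  have "i + (- ((i - 1) div int n)) * int n = (i - 1) mod int n + 1"
    by (simp add: minus_div_mult_eq_mod[symmetric] algebra_simps)
  moreover have "0 \<le> (i - 1) mod int n" "(i - 1) mod int n < int n" using n_pos by auto
  ultimately show ?thesis using that[of "- ((i - 1) div int n)"] by linarith
qed

lemma window_shift_unique:
  assumes "1 \<le> i" "i \<le> int n" "1 \<le> i + c * int n" "i + c * int n \<le> int n" shows "c = 0"
proof (rule ccontr)
  assume "c \<noteq> 0"
  then consider "c \<ge> 1" | "c \<le> -1" by linarith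
  then show False
  proof cases
    case 1 then have "c * int n \<ge> int n" using n_pos by (simp add: mult_le_cancel_right1)
    then show False using assms by linarith
  next
    case 2 then have "c * int n \<le> -1 * int n" by (intro mult_right_mono) auto
    then show False using assms by linarith
  qed
qed

text \<open>The displacement \<open>f i - i\<close> is n-periodic, so its maximum over one window
  bounds it everywhere.\<close>

lemma aff_displacement: assumes "aff f" obtains M where "\<And>i. \<bar>f i - i\<bar> \<le> M"
proof -
  define M where "M = Max ((\<lambda>i. \<bar>f i - i\<bar>) ` {1..int n})"
  have "\<bar>f i - i\<bar> \<le> M" for i
  proof -
    obtain c where c: "1 \<le> i + c * int n" "i + c * int n \<le> int n" using window_shift .
    have "\<bar>f i - i\<bar> = \<bar>f (i + c * int n) - (i + c * int n)\<bar>" using assms by (simp add: aff_shift)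
    also have "\<dots> \<le> M" unfolding M_def by (rule Max_ge) (use c in auto)
    finally show ?thesis .
  qed
  then show ?thesis using that by blast
qed

lemma finite_Inv: assumes "aff f" shows "finite (Inv f)"
proof -
  obtain M where M: "\<And>i. \<bar>f i - i\<bar> \<le> M" using aff_displacement[OF assms] by blast
  \<comment> \<open>An inversion (i, j) satisfies j <= f j + M < f i + M <= i + 2 M.\<close>
  have "Inv f \<subseteq> {1..int n} \<times> {1..int n + 2 * M}"
  proof clarsimp
    fix i j assume "(i, j) \<in> Inv f"
    then have "1 \<le> i" "i \<le> int n" "i < j" "f i > f j" by (auto simp: Inv_def)
    then show "1 \<le> i \<and> i \<le> int n \<and> 1 \<le> j \<and> j \<le> int n + 2 * M" using M[of i] M[of j] by auto
  qed
  then show ?thesis by (rule finite_subset) auto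
qed

definition nrm :: "int \<times> int \<Rightarrow> int \<times> int" where
  "nrm p = (let d = int n * ((fst p - 1) div int n) in (fst p - d, snd p - d))"

definition Pairs :: "(int \<times> int) set" where "Pairs = {(i, j). 1 \<le> i \<and> i \<le> int n \<and> i < j}"

lemma nrm_shift: "nrm (i + c * int n, j + c * int n) = nrm (i, j)"
proof -
  have "(i + c * int n - 1) div int n = c + (i - 1) div int n"
    using n_pos div_mult_self1[of "int n" "i - 1" c] by (simp add: algebra_simps)
  then show ?thesis by (simp add: nrm_def Let_def algebra_simps)
qed

lemma nrm_ex: "\<exists>c. nrm (i, j) = (i + c * int n, j + c * int n) \<and>
    1 \<le> i + c * int n \<and> i + c * int n \<le> int n"
proof -
  have "i - int n * ((i - 1) div int n) = (i - 1) mod int n + 1"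
    by (simp add: minus_mult_div_eq_mod[symmetric] algebra_simps)
  moreover have "0 \<le> (i - 1) mod int n" "(i - 1) mod int n < int n" using n_pos by auto
  ultimately have "1 \<le> i - int n * ((i - 1) div int n)" "i - int n * ((i - 1) div int n) \<le> int n"
    by linarith+
  then show ?thesis
    by (intro exI[of _ "- ((i - 1) div int n)"]) (auto simp: nrm_def Let_def algebra_simps)
qed

lemma nrm_Pairs: "p \<in> Pairs \<Longrightarrow> nrm p = p"
proof -
  assume "p \<in> Pairs"
  then obtain i j where p: "p = (i, j)" "1 \<le> i" "i \<le> int n" by (auto simp: Pairs_def)
  then have "(i - 1) div int n = 0" by simp
  then show ?thesis using p by (simp add: nrm_def Let_def)
qed

context
  fixes a b :: int
  assumes ab: "a < b" and nab: "\<not> cg a b"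
begin

text \<open>\<open>tr a b\<close> moves the class of \<open>a\<close> up, the class of
  \<open>b\<close> down, and nothing else. A reversed pair therefore has its left entry in the class
  of \<open>a\<close> or its right entry in the class of \<open>b\<close>.\<close>

lemma tr_reversal:
  assumes "i < j" "tr a b i > tr a b j"
  obtains (1) c where "i = a + c * int n" "\<not> cg j a" "\<not> cg j b" "j < b + c * int n"
    | (2) c where "j = b + c * int n" "\<not> cg i a" "\<not> cg i b" "a + c * int n < i"
    | (3) c d where "i = a + c * int n" "j = b + d * int n" "b + c * int n > a + d * int n"
proof -
  note T = tr_at[OF nab] tr_other
  show ?thesis
  proof (cases rule: tr_cases[of i a _ b])
    case i: (1 c)
    show ?thesis
    proof (cases rule: tr_cases[of j a _ b])
      case (1 d) then show ?thesis using i assms T ab by auto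
    next
      case (2 d) then show ?thesis using i assms T(1)[of c] T(2)[of d] that(3)[of c d] by simp
    next
      case 3 then show ?thesis using i assms T(1)[of c] tr_other[of j a b] that(1)[of c] by simp
    qed
  next
    case i: (2 c)
    show ?thesis
      by (cases rule: tr_cases[of j a _ b]) (use i assms T that ab in auto)
  next
    case i: 3
    show ?thesis
    proof (cases rule: tr_cases[of j a _ b])
      case (1 d) then show ?thesis using i assms T(1)[of d] tr_other[of i a b] ab by simp
    next
      case (2 d) then show ?thesis using i assms T(2)[of d] tr_other[of i a b] that(2)[of d] by simp
    next
      case 3 then show ?thesis using i assms tr_other[of i a b] tr_other[of j a b] by simp
    qed
  qed
qed

text \<open>Away from the pairs reversed by \<open>t\<^sub>a\<^sub>b\<close>, applying \<open>t\<^sub>a\<^sub>b\<close> to positions matches the inversions of \<open>v\<close>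
  with those of \<open>v t\<^sub>a\<^sub>b\<close>; \<open>nrm\<close> shifts a pair back into the window.\<close>

definition psi0 :: "int \<times> int \<Rightarrow> int \<times> int" where
  "psi0 p = (if tr a b (fst p) < tr a b (snd p) then (tr a b (fst p), tr a b (snd p)) else p)"

lemma psi0_shift: "psi0 (i + c * int n, j + c * int n) =
    (fst (psi0 (i, j)) + c * int n, snd (psi0 (i, j)) + c * int n)"
  by (simp add: psi0_def aff_shift[OF aff_tr])

lemma psi0_psi0: "i < j \<Longrightarrow> psi0 (psi0 (i, j)) = (i, j)"
  by (auto simp: psi0_def tr_tr)

lemma psi0_less: "i < j \<Longrightarrow> fst (psi0 (i, j)) < snd (psi0 (i, j))"
  by (auto simp: psi0_def)

text \<open>\<open>psi0\<close> is an involution that commutes with translation, so it induces an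
  involution on window representatives. The injectivity of the matching comes from here.\<close>

lemma nrm_psi0_invol: "p \<in> Pairs \<Longrightarrow> nrm (psi0 (nrm (psi0 p))) = p"
proof -
  assume P: "p \<in> Pairs"
  then obtain i j where p: "p = (i, j)" "i < j" by (auto simp: Pairs_def)
  obtain i' j' where q: "psi0 p = (i', j')" by fastforce
  obtain c where c: "nrm (i', j') = (i' + c * int n, j' + c * int n)" using nrm_ex by blast
  have "psi0 (i', j') = (i, j)" using q p psi0_psi0[of i j] by simp
  then show ?thesis using c q p nrm_Pairs[OF P] by (simp add: psi0_shift nrm_shift)
qed

context
  fixes v :: "int \<Rightarrow> int"
  assumes v: "aff v" and vab: "v a < v b"
begin

text \<open>The inversions of \<open>v \<circ> tr a b\<close> that the matching with the inversions
  of \<open>v\<close> does not reach.\<close>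

definition new_inv :: "(int \<times> int) set" where
  "new_inv = {(i, j) \<in> Pairs. tr a b i > tr a b j \<and> v i < v j \<and> v (tr a b i) > v (tr a b j)}"

text \<open>On a reversed pair the reflection raises the value at the left entry or lowers the value
  at the right entry, because \<open>v a < v b\<close>. An inversion already present
  survives.\<close>

lemma reversed_inversion:
  assumes "i < j" "tr a b i > tr a b j" "v i > v j" shows "v (tr a b i) > v (tr a b j)"
  using assms(1,2)
  by (cases rule: tr_reversal)
    (use assms v vab in \<open>auto simp: aff_shift tr_at[OF nab] tr_other\<close>)

lemma Inv_comp_tr: "Inv (v \<circ> tr a b) = (nrm \<circ> psi0) ` Inv v \<union> new_inv"
proof (intro equalityI subsetI)
  fix p assume pI: "p \<in> Inv (v \<circ> tr a b)"
  then obtain i j where p: "p = (i, j)" "1 \<le> i" "i \<le> int n" "i < j" "v (tr a b i) > v (tr a b j)"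
    by (auto simp: Inv_def)
  then have pP: "p \<in> Pairs" by (simp add: Pairs_def)
  let ?q = "nrm (psi0 p)"
  have im: "p \<in> (nrm \<circ> psi0) ` Inv v" if "?q \<in> Inv v"
    using nrm_psi0_invol[OF pP] that by (metis comp_apply image_eqI)
  show "p \<in> (nrm \<circ> psi0) ` Inv v \<union> new_inv"
  proof (cases "tr a b i < tr a b j")
    case True
    then have "psi0 p = (tr a b i, tr a b j)" using p by (simp add: psi0_def)
    then have "?q \<in> Inv v" using nrm_ex[of "tr a b i" "tr a b j"] True p v
      by (auto simp: Inv_def aff_shift)
    then show ?thesis using im by blast
  next
    case False
    then have gt: "tr a b i > tr a b j" using p aff_inj[OF aff_tr, of a b i j] by linarith
    show ?thesis
    proof (cases "v i > v j")
      case True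
      have "?q = p" using False p nrm_Pairs[OF pP] by (simp add: psi0_def)
      then show ?thesis using True p im by (simp add: Inv_def)
    next
      case False
      then have "v i < v j" using p aff_inj[OF v, of i j] by linarith
      then show ?thesis using p gt pP by (simp add: new_inv_def)
    qed
  qed
next
  fix p assume "p \<in> (nrm \<circ> psi0) ` Inv v \<union> new_inv"
  then show "p \<in> Inv (v \<circ> tr a b)"
  proof
    assume "p \<in> new_inv" then show ?thesis by (auto simp: new_inv_def Inv_def Pairs_def)
  next
    assume "p \<in> (nrm \<circ> psi0) ` Inv v"
    then obtain i j where p: "p = nrm (psi0 (i, j))" "1 \<le> i" "i \<le> int n" "i < j" "v i > v j"
      by (auto simp: Inv_def)
    obtain i' j' where q: "psi0 (i, j) = (i', j')" by fastforce
    have l: "i' < j'" using psi0_less[of i j] p q by simp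
    have gt: "v (tr a b i') > v (tr a b j')"
    proof (cases "tr a b i < tr a b j")
      case True then show ?thesis using q p by (auto simp: psi0_def tr_tr)
    next
      case False
      then have "tr a b i > tr a b j" using p aff_inj[OF aff_tr, of a b i j] by linarith
      then show ?thesis using q p False reversed_inversion by (auto simp: psi0_def)
    qed
    then show ?thesis using nrm_ex[of i' j'] p q l v
      by (auto simp: Inv_def aff_shift aff_shift[OF aff_tr])
  qed
qed

lemma len_comp_tr: "len (v \<circ> tr a b) = len v + card new_inv"
proof -
  have sub: "Inv v \<subseteq> Pairs" by (auto simp: Inv_def Pairs_def)
  have "inj_on (nrm \<circ> psi0) Pairs"
    using nrm_psi0_invol by (intro inj_on_inverseI[where g="nrm \<circ> psi0"]) auto
  then have c: "card ((nrm \<circ> psi0) ` Inv v) = card (Inv v)"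
    using sub by (meson card_image inj_on_subset)
  \<comment> \<open>A new inversion is fixed by \<open>psi0\<close>, so a preimage among the
    inversions of \<open>v\<close> would be the pair itself, which \<open>v\<close> does not
    invert.\<close>
  have dis: "(nrm \<circ> psi0) ` Inv v \<inter> new_inv = {}"
  proof (rule ccontr)
    assume "\<not> ?thesis"
    then obtain p q where pq: "p \<in> new_inv" "q \<in> Inv v" "p = nrm (psi0 q)" by auto
    then have "q = nrm (psi0 p)" using nrm_psi0_invol[of q] sub by auto
    also have "psi0 p = p" using pq(1) by (auto simp: new_inv_def psi0_def)
    also have "nrm p = p" using pq(1) nrm_Pairs by (auto simp: new_inv_def)
    finally show False using pq by (auto simp: new_inv_def Inv_def)
  qed
  have "finite (Inv (v \<circ> tr a b))" using finite_Inv aff_comp v aff_tr by blast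
  then have "finite ((nrm \<circ> psi0) ` Inv v)" "finite new_inv" using Inv_comp_tr by auto
  then show ?thesis unfolding len_Inv Inv_comp_tr using c dis by (simp add: card_Un_disjoint)
qed

lemma finite_new_inv: "finite new_inv"
  using finite_Inv[OF aff_comp[OF v aff_tr]] Inv_comp_tr by (metis finite_Un)

lemma new_invI:
  assumes "i < j" "tr a b i > tr a b j" "v i < v j" "v (tr a b i) > v (tr a b j)"
  shows "nrm (i, j) \<in> new_inv"
  using nrm_ex[of i j] assms v
  by (auto simp: new_inv_def Pairs_def aff_shift aff_shift[OF aff_tr])

lemma ab_new_inv: "nrm (a, b) \<in> new_inv"
  using ab vab by (intro new_invI) (auto simp: tr_at0[OF nab])

lemma nrm_diff: "nrm (i, j) = nrm (i', j') \<Longrightarrow> j - i = j' - i'"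
  by (auto simp: nrm_def Let_def)

text \<open>The class of (a, b) is always new, so the count is one exactly when no other class is
  new.\<close>

lemma card_new_inv: "card new_inv = 1 \<longleftrightarrow> \<not> (\<exists>m. a < m \<and> m < b \<and> v a < v m \<and> v m < v b)"
proof
  assume "card new_inv = 1"
  then obtain q where q: "new_inv = {q}" by (auto simp: card_1_singleton_iff)
  show "\<not> (\<exists>m. a < m \<and> m < b \<and> v a < v m \<and> v m < v b)"
  proof
    assume "\<exists>m. a < m \<and> m < b \<and> v a < v m \<and> v m < v b"
    then obtain m where m: "a < m" "m < b" "v a < v m" "v m < v b" by blast
    \<comment> \<open>The intermediate point produces a second class, told apart by its smaller
      difference, which \<open>nrm\<close> preserves.\<close>
    have "\<exists>i j. nrm (i, j) \<in> new_inv \<and> j - i < b - a"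
    proof (cases rule: tr_cases[of m a _ b])
      case (1 c)
      then have "nrm (m, b) \<in> new_inv" using m v
        by (intro new_invI) (auto simp: tr_at0[OF nab] tr_at[OF nab] aff_shift)
      then show ?thesis using m by (intro exI[of _ m] exI[of _ b]) auto
    next
      case (2 c)
      then have "nrm (a, m) \<in> new_inv" using m v
        by (intro new_invI) (auto simp: tr_at0[OF nab] tr_at[OF nab] aff_shift)
      then show ?thesis using m by (intro exI[of _ a] exI[of _ m]) auto
    next
      case 3
      then have "nrm (a, m) \<in> new_inv" using m v
        by (intro new_invI) (auto simp: tr_at0[OF nab] tr_other)
      then show ?thesis using m by (intro exI[of _ a] exI[of _ m]) auto
    qed
    then show False using q ab_new_inv nrm_diff by (metis less_irrefl singletonD)
  qed
next
  assume no: "\<not> (\<exists>m. a < m \<and> m < b \<and> v a < v m \<and> v m < v b)"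
  have "p = nrm (a, b)" if pn: "p \<in> new_inv" for p
  proof -
    obtain i j where p: "p = (i, j)" "p \<in> Pairs" "i < j" "tr a b i > tr a b j" "v i < v j"
      "v (tr a b i) > v (tr a b j)" using pn by (auto simp: new_inv_def Pairs_def)
    note T = tr_at[OF nab] tr_other aff_shift[OF v]
    show ?thesis using p(3,4)
    proof (cases rule: tr_reversal)
      case (1 c)
      have "v (j - c * int n) = v j - c * int n" using aff_shift[OF v, of j "-c"] by simp
      then have "a < j - c * int n \<and> j - c * int n < b \<and> v a < v (j - c * int n) \<and> v (j - c * int n) < v b"
        using 1 p T by auto
      then show ?thesis using no by blast
    next
      case (2 c)
      have "v (i - c * int n) = v i - c * int n" using aff_shift[OF v, of i "-c"] by simp
      then have "a < i - c * int n \<and> i - c * int n < b \<and> v a < v (i - c * int n) \<and> v (i - c * int n) < v b"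
        using 2 p T by auto
      then show ?thesis using no by blast
    next
      \<comment> \<open>Both ends are translates, possibly by different multiples of n. Unless the
        two shifts agree, a translate of \<open>b\<close> or of \<open>a\<close> is an intermediate
        point.\<close>
      case (3 c d)
      have e1: "v (b + (d - c) * int n) = v b + (d - c) * int n" "v (a + (d - c) * int n) = v a + (d - c) * int n"
        by (simp_all add: T(4))
      define C D where "C = c * int n" and "D = d * int n"
      have e2: "(d - c) * int n = D - C" by (simp add: C_def D_def algebra_simps)
      note e1 = e1[unfolded e2]
      have h: "a + C < b + D" "b + C > a + D" "v a + C < v b + D" "v b + C > v a + D"
        using 3 p T by (auto simp: C_def D_def)
      consider "C = D" | "D < C" | "C < D" by linarith
      then show ?thesis
      proof cases
        case 1
        then have "p = (a + c * int n, b + c * int n)" unfolding p(1) 3(1,2) C_def D_def by auto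
        then show ?thesis using nrm_Pairs[OF p(2)] by (simp add: nrm_shift)
      next
        case 2
        then have "a < b + (d - c) * int n \<and> b + (d - c) * int n < b \<and> v a < v (b + (d - c) * int n) \<and>
          v (b + (d - c) * int n) < v b" unfolding e2 e1 using h by auto
        then show ?thesis using no by blast
      next
        case 3
        then have "a < a + (d - c) * int n \<and> a + (d - c) * int n < b \<and> v a < v (a + (d - c) * int n) \<and>
          v (a + (d - c) * int n) < v b" unfolding e2 e1 using h by auto
        then show ?thesis using no by blast
      qed
    qed
  qed
  then have "new_inv = {nrm (a, b)}" using ab_new_inv by blast
  then show "card new_inv = 1" by simp
qed

end
end

section \<open>Bruhat covers, simple reflections and the exchange property\<close>

lemma len_tr_less:
  assumes "a < b" "\<not> cg a b" "aff v" "v a < v b" shows "len v < len (v \<circ> tr a b)"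
  using len_comp_tr[OF assms] ab_new_inv[OF assms] finite_new_inv[OF assms]
  by (metis card_gt_0_iff empty_iff less_add_same_cancel1)

lemma len_tr_greater:
  assumes "a < b" "\<not> cg a b" "aff v" "v a > v b" shows "len (v \<circ> tr a b) < len v"
proof -
  have "len (v \<circ> tr a b) < len (v \<circ> tr a b \<circ> tr a b)"
    using assms by (intro len_tr_less) (auto simp: tr_at0 aff_comp aff_tr)
  then show ?thesis by (simp add: tr_invol2)
qed

lemma cover_iff:
  assumes "a < b" "\<not> cg a b" "aff v" "v a < v b"
  shows "len (v \<circ> tr a b) = len v + 1 \<longleftrightarrow> \<not> (\<exists>m. a < m \<and> m < b \<and> v a < v m \<and> v m < v b)"
  using len_comp_tr[OF assms] card_new_inv[OF assms] by simp

lemma cover_less: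
  assumes "a < b" "\<not> cg a b" "aff v" "len (v \<circ> tr a b) = len v + 1" shows "v a < v b"
  using len_tr_greater[OF assms(1-3)] aff_inj[OF assms(3), of a b] assms by (metis add_lessD1 less_irrefl linorder_neqE)

lemma not_cg_Suc: "2 \<le> n \<Longrightarrow> \<not> cg i (i + 1)"
  using zdvd_not_zless[of 1 "int n"] by (auto simp: cong_iff_dvd_diff)

text \<open>No value lies strictly between i and i + 1, so nothing can obstruct the cover and the
  length changes by exactly one.\<close>

lemma len_sr:
  assumes "2 \<le> n" "aff w"
  shows "iv w i < iv w (i + 1) \<Longrightarrow> len (sr i \<circ> w) = len w + 1"
    and "iv w i > iv w (i + 1) \<Longrightarrow> len w = len (sr i \<circ> w) + 1"
proof -
  have up: "len (sr i \<circ> w) = len w + 1" if w: "aff w" and l: "iv w i < iv w (i + 1)" for w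
  proof -
    have nc: "\<not> cg (iv w i) (iv w (i + 1))" using aff_cg[OF aff_inv[OF w]] not_cg_Suc[OF assms(1)] by blast
    show ?thesis unfolding tr_comp_inv[OF w]
      by (subst cover_iff[OF l nc w]) (use w in auto)
  qed
  show "iv w i < iv w (i + 1) \<Longrightarrow> len (sr i \<circ> w) = len w + 1" using up assms by blast
  assume gt: "iv w i > iv w (i + 1)"
  have a: "aff (sr i \<circ> w)" using assms aff_comp aff_tr by blast
  have "iv (sr i \<circ> w) = iv w \<circ> sr i" using assms by (simp add: aff_inv_distrib aff_tr inv_tr)
  then have "iv (sr i \<circ> w) i < iv (sr i \<circ> w) (i + 1)" using gt tr_at0[OF not_cg_Suc[OF assms(1)]] by simp
  then have "len (sr i \<circ> (sr i \<circ> w)) = len (sr i \<circ> w) + 1" using up[OF a] by blast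
  then show "len w = len (sr i \<circ> w) + 1" by (simp add: tr_invol2)
qed

lemma inv_sr_neq: "2 \<le> n \<Longrightarrow> aff w \<Longrightarrow> iv w i \<noteq> iv w (i + 1)"
  using aff_inj[OF aff_inv] by simp

lemma len_sr_cases:
  assumes "2 \<le> n" "aff w"
  obtains "iv w i < iv w (i + 1)" "len (sr i \<circ> w) = len w + 1"
    | "iv w i > iv w (i + 1)" "len w = len (sr i \<circ> w) + 1"
  using len_sr[OF assms] inv_sr_neq[OF assms, of i] by (metis linorder_neqE)

text \<open>The values i and i + 1 occur at positions p < q whose order the reflection must reverse.
  Since a cover has no intermediate point, the reversal is possible only if (p, q) is a translate of
  (a, b).\<close>

lemma exchange_less:
  assumes n2: "2 \<le> n" and v: "aff v" and ab: "a < b" "\<not> cg a b"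
    and up: "len (v \<circ> tr a b) = len v + 1" "len (sr i \<circ> v) = len v + 1"
      "len (sr i \<circ> (v \<circ> tr a b)) = len v"
  shows "sr i \<circ> v = v \<circ> tr a b"
proof -
  define p q where "p = iv v i" and "q = iv v (i + 1)"
  have vp: "v p = i" "v q = i + 1" using v by (auto simp: p_def q_def)
  have vt: "aff (v \<circ> tr a b)" using v aff_comp aff_tr by blast
  have it: "iv (v \<circ> tr a b) = tr a b \<circ> iv v" using v by (simp add: aff_inv_distrib aff_tr inv_tr)
  have pq: "p < q" using up(2) by (cases rule: len_sr_cases[OF n2 v, of i]) (auto simp: p_def q_def)
  \<comment> \<open>s_i lengthens \<open>v\<close> but shortens \<open>v \<circ> tr a b\<close>, so
    the positions of i and i + 1 change order.\<close>
  have tpq: "tr a b p > tr a b q"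
    using up it by (cases rule: len_sr_cases[OF n2 vt, of i]) (auto simp: p_def q_def)
  have vab: "v a < v b" using cover_less ab v up by blast
  have no: "\<not> (\<exists>m. a < m \<and> m < b \<and> v a < v m \<and> v m < v b)" using cover_iff[OF ab v vab] up by blast
  have sv: "sr i \<circ> v = v \<circ> tr p q" using tr_comp_inv[OF v] by (simp add: p_def q_def)
  consider (1) c where "p = a + c * int n" "q < b + c * int n"
    | (2) c where "q = b + c * int n" "a + c * int n < p"
    | (3) c d where "p = a + c * int n" "q = b + d * int n" "b + c * int n > a + d * int n"
    by (rule tr_reversal[OF ab pq tpq]) blast+
  then show ?thesis
  proof cases
    case (1 c)
    have m: "v (q - c * int n) = v q - c * int n" using aff_shift[OF v, of q "-c"] by simp
    have va: "v a = i - c * int n" using vp 1 aff_shift[OF v, of a c] by simp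
    have "q - c * int n < b" using 1 by simp
    then have "v b \<noteq> v (q - c * int n)" using aff_inj[OF v, of b "q - c * int n"] by linarith
    then have "a < q - c * int n \<and> q - c * int n < b \<and> v a < v (q - c * int n) \<and> v (q - c * int n) < v b"
      using 1 m va vp vab pq by linarith
    then show ?thesis using no by blast
  next
    case (2 c)
    have m: "v (p - c * int n) = v p - c * int n" using aff_shift[OF v, of p "-c"] by simp
    have vb: "v b = i + 1 - c * int n" using vp 2 aff_shift[OF v, of b c] by simp
    have "a < p - c * int n" using 2 by simp
    then have "v a \<noteq> v (p - c * int n)" using aff_inj[OF v, of a "p - c * int n"] by linarith
    then have "a < p - c * int n \<and> p - c * int n < b \<and> v a < v (p - c * int n) \<and> v (p - c * int n) < v b"
      using 2 m vb vp vab pq by linarith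
    then show ?thesis using no by blast
  next
    case (3 c d)
    define C D where "C = c * int n" and "D = d * int n"
    have va: "v a = i - C" "v b = i + 1 - D" using vp 3 aff_shift[OF v] by (auto simp: C_def D_def)
    show ?thesis
    proof (cases "C = D")
      case True
      then have "tr p q = tr a b" using 3 tr_shift[of a c b] by (auto simp: C_def D_def)
      then show ?thesis using sv by simp
    next
      case False
      have e: "v (b + (d - c) * int n) = v b + (d - c) * int n" by (simp add: aff_shift[OF v])
      have e2: "(d - c) * int n = D - C" by (simp add: C_def D_def algebra_simps)
      have pq': "p = a + C" "q = b + D" using 3 by (simp_all add: C_def D_def)
      have "a < b + (d - c) * int n \<and> b + (d - c) * int n < b \<and> v a < v (b + (d - c) * int n) \<and>
          v (b + (d - c) * int n) < v b"
        unfolding e2 e[unfolded e2] using va False vab pq pq' by auto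
      then show ?thesis using no by blast
    qed
  qed
qed

lemma exchange:
  assumes "2 \<le> n" "aff v" "\<not> cg r j" "len (v \<circ> tr r j) = len v + 1" "len (sr i \<circ> v) = len v + 1"
      "len (sr i \<circ> (v \<circ> tr r j)) = len v"
  shows "sr i \<circ> v = v \<circ> tr r j"
proof -
  have "r \<noteq> j" using assms(3) by auto
  then consider "r < j" | "j < r" by linarith
  then show ?thesis
  proof cases
    case 1 then show ?thesis using exchange_less assms by blast
  next
    case 2
    then show ?thesis using exchange_less[of v j r i] assms tr_commute[of r j] by (simp add: cong_sym_eq)
  qed
qed

text \<open>Positions on both sides of r are collected; the sign of \<open>j - r\<close> later
  separates the plus covers from the minus covers.\<close>

definition Cov :: "(int \<Rightarrow> int) \<Rightarrow> int \<Rightarrow> int set" where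
  "Cov v r = {j. \<not> cg r j \<and> len (v \<circ> tr r j) = len v + 1}"

text \<open>Translating j by n towards r would give an intermediate point, unless j is within n of r
  or \<open>v j\<close> is within n of \<open>v r\<close>.\<close>

lemma finite_Cov: assumes v: "aff v" shows "finite (Cov v r)"
proof -
  have "Cov v r \<subseteq> {r - int n..r + int n} \<union> iv v ` {v r - int n..v r + int n}"
  proof
    fix j assume j: "j \<in> Cov v r"
    have jr: "j \<noteq> r" using j by (auto simp: Cov_def)
    have jv: "j = iv v (v j)" using v by simp
    show "j \<in> {r - int n..r + int n} \<union> iv v ` {v r - int n..v r + int n}"
    proof (cases "r < j")
      case True
      have a: "\<not> cg r j" "len (v \<circ> tr r j) = len v + 1" using j by (auto simp: Cov_def)
      have less: "v r < v j" using cover_less[OF True a(1) v a(2)] .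
      have no: "\<not> (\<exists>m. r < m \<and> m < j \<and> v r < v m \<and> v m < v j)" using cover_iff[OF True a(1) v less] a by blast
      have "v (j - int n) = v j - int n" using aff_shift[OF v, of j "-1"] by simp
      moreover have "\<not> (r < j - int n \<and> j - int n < j \<and> v r < v (j - int n) \<and> v (j - int n) < v j)"
        using no by blast
      ultimately have "j - int n \<le> r \<or> v j - int n \<le> v r" using n_pos by auto
      then show ?thesis using True less jv by (auto intro!: image_eqI[of j _ "v j"])
    next
      case False
      then have True: "j < r" using jr by simp
      have a: "\<not> cg j r" "len (v \<circ> tr j r) = len v + 1"
        using j tr_commute[of r j] by (auto simp: Cov_def cong_sym_eq)
      have less: "v j < v r" using cover_less[OF True a(1) v a(2)] .
      have no: "\<not> (\<exists>m. j < m \<and> m < r \<and> v j < v m \<and> v m < v r)" using cover_iff[OF True a(1) v less] a by blast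
      have e: "v (j + int n) = v j + int n" using aff_shift[OF v, of j "1"] by simp
      have "\<not> (j < j + int n \<and> j + int n < r \<and> v j < v (j + int n) \<and> v (j + int n) < v r)"
        using no by blast
      then have "j + int n \<ge> r \<or> v j + int n \<ge> v r" using n_pos e by auto
      then show ?thesis using True less jv by (auto intro!: image_eqI[of j _ "v j"])
    qed
  qed
  then show ?thesis by (rule finite_subset) auto
qed

text \<open>n times the average displacement \<open>av\<close>, but computable: an additive
  invariant that vanishes on reflections.\<close>

definition lev :: "(int \<Rightarrow> int) \<Rightarrow> int" where "lev f = (\<Sum>i\<in>{1..int n}. f i - i)"

definition red :: "int \<Rightarrow> int" where "red x = (x - 1) mod int n + 1"

lemma red_window: "red x \<in> {1..int n}"
proof -
  have "0 \<le> (x - 1) mod int n" "(x - 1) mod int n < int n" using n_pos by auto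
  then show ?thesis by (simp add: red_def)
qed

lemma red_shift: "\<exists>c. red x = x + c * int n"
  by (intro exI[of _ "- ((x - 1) div int n)"])
    (simp add: red_def minus_div_mult_eq_mod[symmetric] algebra_simps)

lemma red_eq_iff: "red x = red y \<longleftrightarrow> cg x y"
  unfolding red_def by (auto simp: cong_iff_dvd_diff mod_eq_dvd_iff)

lemma red_bij: assumes "aff g" shows "bij_betw (red \<circ> g) {1..int n} {1..int n}"
proof -
  have "inj_on (red \<circ> g) {1..int n}"
  proof (rule inj_onI)
    fix x y assume h: "x \<in> {1..int n}" "y \<in> {1..int n}" "(red \<circ> g) x = (red \<circ> g) y"
    then have "cg x y" using assms by (simp add: red_eq_iff aff_cg)
    then obtain c where "y = x + c * int n" by (auto simp: cg_iff)
    then show "x = y" using h window_shift_unique[of x c] by auto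
  qed
  moreover have "(red \<circ> g) ` {1..int n} \<subseteq> {1..int n}" using red_window by auto
  ultimately show ?thesis unfolding bij_betw_def using endo_inj_surj[of "{1..int n}" "red \<circ> g"] by blast
qed

lemma periodic_sum:
  fixes h :: "int \<Rightarrow> 'b::comm_monoid_add"
  assumes "aff g" "\<And>i c. h (i + c * int n) = h i"
  shows "(\<Sum>i\<in>{1..int n}. h (g i)) = (\<Sum>i\<in>{1..int n}. h i)"
proof -
  have "h (g i) = h ((red \<circ> g) i)" for i using red_shift[of "g i"] assms(2) by (metis comp_apply)
  then show ?thesis using sum.reindex_bij_betw[OF red_bij[OF assms(1)], of h] by simp
qed

lemma lev_comp: assumes "aff f" "aff g" shows "lev (f \<circ> g) = lev f + lev g"
proof -
  have "lev (f \<circ> g) = (\<Sum>i\<in>{1..int n}. f (g i) - g i) + (\<Sum>i\<in>{1..int n}. g i - i)"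
    unfolding lev_def by (simp add: sum.distrib[symmetric])
  also have "(\<Sum>i\<in>{1..int n}. f (g i) - g i) = lev f" unfolding lev_def
    using periodic_sum[OF assms(2), of "\<lambda>x. f x - x"] assms by (simp add: aff_shift)
  finally show ?thesis by (simp add: lev_def)
qed

lemma lev_tau: "lev (tau_pow m) = m * int n"
  by (simp add: lev_def tau_pow_def)

lemma lev_id: "lev id = 0" by (simp add: lev_def)

lemma lev_tr: "lev (tr a b) = 0"
proof -
  have "lev (tr a b) + lev (tr a b) = 0" using lev_comp[OF aff_tr aff_tr, of a b a b] by (simp add: tr_invol lev_id)
  then show ?thesis by simp
qed

lemma lev_comp_tr: "aff v \<Longrightarrow> lev (v \<circ> tr a b) = lev v"
  by (simp add: lev_comp aff_tr lev_tr)

lemma tau_tau: "tau_pow a \<circ> tau_pow b = tau_pow (a + b)" "tau_pow 0 = id"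
  by (auto simp: tau_pow_def fun_eq_iff)

lemma len_tau_left: "len (tau_pow m \<circ> f) = len f"
  by (simp add: aff_length_def tau_pow_def)

lemma len_id: "len id = 0" 
proof -
  have "{(i, j). 1 \<le> i \<and> i \<le> int n \<and> i < j \<and> id i > id j} = {}" by auto
  then show ?thesis unfolding aff_length_def by (metis card.empty)
qed

end

section \<open>Cyclically decreasing elements and the transition identity\<close>

context affine_window begin

text \<open>\<open>cd J\<close> is the product of the \<open>s\<^sub>j\<close> with \<open>j \<in> J\<close> in cyclically decreasing order, in closed form: a maximal run of \<open>J\<close>
  becomes a cycle lowering all its entries by one except the first, which jumps to the end of the run.\<close>

definition mem :: "nat set \<Rightarrow> int \<Rightarrow> bool" where "mem J x \<longleftrightarrow> nat (x mod int n) \<in> J"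
definition nxt :: "nat set \<Rightarrow> int \<Rightarrow> int" where "nxt J x = x + int (LEAST d. \<not> mem J (x + int d))"
definition cd :: "nat set \<Rightarrow> int \<Rightarrow> int" where "cd J x = (if mem J (x - 1) then x - 1 else nxt J x)"

abbreviation proper :: "nat set \<Rightarrow> bool" where "proper J \<equiv> J \<subset> {..<n}"

lemma mem_cg: "cg x y \<Longrightarrow> mem J x = mem J y" by (simp add: mem_def cong_def)

lemma mem_shift: "mem J (x + c * int n) = mem J x" by (simp add: mem_def)

lemma mem_nat: "j < n \<Longrightarrow> mem J (int j) \<longleftrightarrow> j \<in> J"
  by (simp add: mem_def nat_mod_distrib)

lemma mem_empty[simp]: "\<not> mem {} x" by (simp add: mem_def)

lemma mem_Un: "mem (A \<union> B) x \<longleftrightarrow> mem A x \<or> mem B x" by (simp add: mem_def)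

lemma cg_nat_mod: "cg x (int (nat (x mod int n)))"
  using n_pos by (simp add: cong_def)

lemma nat_mod_less: "nat (x mod int n) < n"
  using n_pos by (simp add: nat_less_iff)

lemma cg_nat_eq: "j < n \<Longrightarrow> cg x (int j) \<longleftrightarrow> nat (x mod int n) = j"
  using n_pos by (auto simp: cong_def)

lemma mem_insert: "j < n \<Longrightarrow> mem (insert j K) x \<longleftrightarrow> cg x (int j) \<or> mem K x"
  by (simp add: mem_def cg_nat_eq)

lemma finite_proper: "proper J \<Longrightarrow> finite J"
  by (meson finite_lessThan finite_subset psubset_imp_subset)

lemma card_proper: "proper J \<Longrightarrow> card J < n"
  using psubset_card_mono[of "{..<n}" J] by simp

lemma proper_iff: "proper J \<longleftrightarrow> J \<subseteq> {..<n} \<and> card J < n"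
proof
  assume "J \<subseteq> {..<n} \<and> card J < n"
  then show "proper J" by (metis card_lessThan less_irrefl psubsetI)
qed (use card_proper in \<open>simp add: psubset_imp_subset\<close>)

lemma ex_nonmem: assumes "proper J" shows "\<exists>d<n. \<not> mem J (x + int d)"
proof -
  obtain c where c: "c < n" "c \<notin> J" using assms by auto
  let ?d = "nat ((int c - x) mod int n)"
  have "cg (x + int ?d) (int c)" using n_pos by (simp add: cong_def mod_simps)
  then have "\<not> mem J (x + int ?d)" using c mem_cg mem_nat by blast
  then show ?thesis using nat_mod_less by blast
qed

lemma nxt_props:
  assumes "proper J"
  shows "x \<le> nxt J x" "\<not> mem J (nxt J x)" "\<And>y. x \<le> y \<Longrightarrow> y < nxt J x \<Longrightarrow> mem J y" "nxt J x < x + int n"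
proof -
  let ?d = "LEAST d. \<not> mem J (x + int d)"
  obtain d where d: "d < n" "\<not> mem J (x + int d)" using ex_nonmem[OF assms] by blast
  show "x \<le> nxt J x" by (simp add: nxt_def)
  show "\<not> mem J (nxt J x)" unfolding nxt_def by (rule LeastI) (rule d)
  have "?d \<le> d" using d by (intro Least_le)
  then show "nxt J x < x + int n" using d by (simp add: nxt_def)
  fix y assume y: "x \<le> y" "y < nxt J x"
  then have "nat (y - x) < ?d" by (simp add: nxt_def)
  then have "mem J (x + int (nat (y - x)))" using not_less_Least by blast
  then show "mem J y" using y by simp
qed

lemma nxt_eqI:
  assumes "proper J" "x \<le> z" "\<not> mem J z" "\<And>y. x \<le> y \<Longrightarrow> y < z \<Longrightarrow> mem J y"
  shows "nxt J x = z"
  using nxt_props[OF assms(1), of x] assms by (metis linorder_neqE)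

lemma nxt_self: "proper J \<Longrightarrow> \<not> mem J x \<Longrightarrow> nxt J x = x"
  by (rule nxt_eqI) auto

lemma proper_two: "proper (insert j K) \<Longrightarrow> 2 \<le> n"
  using card_proper[of "insert j K"] finite_proper[of "insert j K"] by (auto simp: card_insert_if card_gt_0_iff)

lemma proper_mono: "proper J \<Longrightarrow> K \<subseteq> J \<Longrightarrow> proper K" by blast

lemma proper_empty: "proper {}" using n_pos by (simp add: proper_iff)

lemma cd_empty: "cd {} = id"
  using nxt_self[OF proper_empty] by (auto simp: cd_def fun_eq_iff)

text \<open>This ties the closed form to the product. The run of K that ends at j - 1, possibly
  empty, grows by j, so the entry that jumped to j now jumps to j + 1, and j + 1 itself drops to j;
  all other images avoid the classes of j and j + 1.\<close>

lemma cd_insert: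
  assumes P: "proper (insert j K)" and j: "j < n" "j \<notin> K" "\<not> mem K (int j + 1)"
  shows "cd (insert j K) = sr (int j) \<circ> cd K"
proof
  fix x
  have n2: "2 \<le> n" using proper_two[OF P] .
  have PK: "proper K" using P by blast
  note K = nxt_props[OF PK, of x]
  note M = mem_insert[OF j(1), of K]
  have nc: "\<not> cg (int j) (int j + 1)" using not_cg_Suc[OF n2] .
  have jK: "\<not> mem K y" if "cg y (int j)" for y using that mem_cg mem_nat[OF j(1)] j(2) by blast
  have j1K: "\<not> mem K y" if "cg y (int j + 1)" for y using that mem_cg j(3) by blast
  have pm: "cg (y - 1) (int j) \<longleftrightarrow> cg y (int j + 1)" for y
    by (metis add_diff_cancel_right' cong_add_rcancel diff_add_cancel)
  define y where "y = cd K x"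
  consider (1) "cg y (int j)" | (2) "cg y (int j + 1)" | (3) "\<not> cg y (int j)" "\<not> cg y (int j + 1)" by blast
  then show "cd (insert j K) x = (sr (int j) \<circ> cd K) x"
  proof cases
    case 1
    then have nm: "\<not> mem K (x - 1)" and yn: "y = nxt K x" using jK by (auto simp: y_def cd_def split: if_splits)
    have "\<not> cg x (int j + 1)"
    proof
      assume h: "cg x (int j + 1)"
      then have "y = x" using yn nxt_self[OF PK j1K] by simp
      then show False using 1 h nc by (meson cong_sym cong_trans)
    qed
    then have a: "\<not> mem (insert j K) (x - 1)" using nm M pm by blast
    have y1: "cg (y + 1) (int j + 1)" using 1 by (simp add: cong_add_rcancel)
    have "nxt (insert j K) x = y + 1"
    proof (rule nxt_eqI[OF P])
      show "x \<le> y + 1" using K(1) yn by simp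
      show "\<not> mem (insert j K) (y + 1)" using M y1 j1K nc by (metis cong_sym cong_trans)
      show "mem (insert j K) z" if "x \<le> z" "z < y + 1" for z
      proof (cases "z = y")
        case True then show ?thesis using 1 M by simp
      next
        case False then show ?thesis using that K(3) yn M by simp
      qed
    qed
    then have "cd (insert j K) x = y + 1" using a by (simp add: cd_def)
    moreover have "sr (int j) y = y + 1" using 1 nc by (simp add: aff_transp_def)
    ultimately show ?thesis by (simp add: y_def)
  next
    case 2
    then have yn: "y = nxt K x" using j1K by (auto simp: y_def cd_def split: if_splits)
    have "y = x"
    proof (rule ccontr)
      assume "y \<noteq> x"
      then have "mem K (y - 1)" using K(1) K(3)[of "y - 1"] yn by simp
      then show False using jK 2 pm by blast
    qed
    then have "mem (insert j K) (x - 1)" using M 2 pm by blast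
    then have "cd (insert j K) x = x - 1" by (simp add: cd_def)
    moreover have "sr (int j) y = y - 1" using 2 nc by (auto simp: aff_transp_def dest: cong_trans cong_sym)
    ultimately show ?thesis using \<open>y = x\<close> by (simp add: y_def)
  next
    case 3
    have "cd (insert j K) x = y"
    proof (cases "mem K (x - 1)")
      case True then show ?thesis using M by (simp add: cd_def y_def)
    next
      case False
      then have yn: "y = nxt K x" by (simp add: y_def cd_def)
      have "\<not> cg x (int j + 1)"
      proof
        assume h: "cg x (int j + 1)"
        then have "y = x" using yn nxt_self[OF PK j1K] by simp
        then show False using 3 h by simp
      qed
      then have a: "\<not> mem (insert j K) (x - 1)" using False M pm by blast
      have "nxt (insert j K) x = y" by (rule nxt_eqI[OF P]) (use K yn M 3 in auto)
      then show ?thesis using a by (simp add: cd_def)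
    qed
    moreover have "sr (int j) y = y" using 3 by (simp add: tr_other)
    ultimately show ?thesis by (simp add: y_def)
  qed
qed

lemma succ_nonmem:
  assumes "proper J" "J \<noteq> {}" shows "\<exists>j\<in>J. \<not> mem J (int j + 1)"
proof (rule ccontr)
  assume "\<not> ?thesis"
  then have h: "\<And>j. j \<in> J \<Longrightarrow> mem J (int j + 1)" by blast
  obtain j0 where j0: "j0 \<in> J" using assms by blast
  have step: "mem J (x + 1)" if "mem J x" for x
  proof -
    have "mem J (int (nat (x mod int n)) + 1)" using that h[of "nat (x mod int n)"] by (simp only: mem_def)
    moreover have "cg (int (nat (x mod int n)) + 1) (x + 1)"
      using cg_nat_mod[of x] by (simp add: cong_add_rcancel cong_sym_eq)
    ultimately show ?thesis using mem_cg by blast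
  qed
  have "mem J (int j0 + int d)" for d
  proof (induction d)
    case 0 then show ?case using j0 assms(1) mem_nat by auto
  next
    case (Suc d) then show ?case using step[of "int j0 + int d"] by (simp add: algebra_simps)
  qed
  then show False using ex_nonmem[OF assms(1)] by blast
qed

text \<open>An element whose successor is absent can serve as the leftmost factor, so induction over
  supports peels off one simple reflection from the left.\<close>

lemma proper_induct[consumes 1, case_names empty insert]:
  assumes "proper J" "P {}"
    "\<And>j K. proper (insert j K) \<Longrightarrow> j < n \<Longrightarrow> j \<notin> K \<Longrightarrow> \<not> mem K (int j + 1) \<Longrightarrow> P K \<Longrightarrow> P (insert j K)"
  shows "P J"
  using assms(1)
proof (induction "card J" arbitrary: J)
  case 0 then show ?case using assms(2) finite_proper[OF 0(2)] by simp
next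
  case (Suc m)
  have "J \<noteq> {}" using Suc(2) by auto
  then obtain j where j: "j \<in> J" "\<not> mem J (int j + 1)" using succ_nonmem Suc(3) by blast
  have i: "J = insert j (J - {j})" using j by blast
  have "P (J - {j})" using Suc j finite_proper[OF Suc(3)] by (intro Suc(1)) auto
  moreover have "\<not> mem (J - {j}) (int j + 1)" using j by (simp add: mem_def)
  moreover have "j < n" using j Suc(3) by auto
  ultimately show ?case using assms(3)[of j "J - {j}"] i Suc(3) by auto
qed

lemma aff_cd: "proper J \<Longrightarrow> aff (cd J)"
proof (induction rule: proper_induct)
  case empty then show ?case using aff_id by (simp only: cd_empty)
next
  case (insert j K) then show ?case using aff_comp[OF aff_tr, of "cd K"] cd_insert[OF insert(1-4)] by metis
qed

lemma cd_ge: "proper J \<Longrightarrow> cd J x \<ge> x - 1"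
  using nxt_props(1)[of J x] by (simp add: cd_def)

lemma cd_eq_pred: "proper J \<Longrightarrow> cd J x = x - 1 \<longleftrightarrow> mem J (x - 1)"
  using nxt_props(1)[of J x] by (simp add: cd_def)

text \<open>The support is recovered from the entries that are lowered by one.\<close>

lemma cd_inj: assumes "proper J" "proper K" "cd J = cd K" shows "J = K"
proof -
  have "mem J x = mem K x" for x
    using cd_eq_pred[OF assms(1), of "x + 1"] cd_eq_pred[OF assms(2), of "x + 1"] assms(3) by simp
  then show ?thesis using assms mem_nat by (metis lessThan_iff psubsetD subsetI subset_antisym)
qed

text \<open>\<open>cd K\<close> fixes j + 1 while the preimage of j is at most j, so multiplying by
  s_j on the left lengthens.\<close>

lemma len_cd: "proper J \<Longrightarrow> len (cd J) = card J"
proof (induction rule: proper_induct)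
  case empty then show ?case using len_id by (simp only: cd_empty card.empty)
next
  case (insert j K)
  have PK: "proper K" using insert by blast
  have n2: "2 \<le> n" using proper_two insert by blast
  have jK: "\<not> mem K (int j)" using insert mem_nat by blast
  have e: "cd K (int j + 1) = int j + 1" using jK nxt_self[OF PK insert(4)] by (simp add: cd_def)
  then have i1: "iv (cd K) (int j + 1) = int j + 1" using aff_cd[OF PK] by (metis aff_inv_f)
  define x where "x = iv (cd K) (int j)"
  have "cd K x = int j" using aff_cd[OF PK] by (simp add: x_def)
  then have "x \<le> int j + 1" "x \<noteq> int j + 1" using cd_ge[OF PK, of x] e by auto
  then have "iv (cd K) (int j) < iv (cd K) (int j + 1)" using i1 by (simp add: x_def)
  then have "len (sr (int j) \<circ> cd K) = len (cd K) + 1" using len_sr(1)[OF n2 aff_cd[OF PK]] by blast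
  then have "len (cd (insert j K)) = card K + 1" using cd_insert[OF insert(1-4)] insert(5) by metis
  then show ?case using insert(3) finite_proper[OF PK] by simp
qed

text \<open>If no element of A has its successor in B, all factors from A may stand to the left of
  those from B in cyclically decreasing order.\<close>

lemma cd_union:
  assumes "proper A" "proper (A \<union> B)" "A \<inter> B = {}" "\<And>a. a \<in> A \<Longrightarrow> \<not> mem B (int a + 1)"
  shows "cd (A \<union> B) = cd A \<circ> cd B"
  using assms
proof (induction rule: proper_induct)
  case empty then show ?case by (simp add: cd_empty)
next
  case (insert j K)
  have "cd (insert j K \<union> B) = sr (int j) \<circ> cd (K \<union> B)"
    using cd_insert[of j "K \<union> B"] insert by (auto simp: mem_Un)
  also have "cd (K \<union> B) = cd K \<circ> cd B" using insert by (intro insert(5)) auto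
  finally show ?case using cd_insert[OF insert(1-4)] by (simp add: comp_assoc)
qed

lemma len_sr_bounds: assumes "aff w" shows "len (sr i \<circ> w) \<le> len w + 1" "len w \<le> len (sr i \<circ> w) + 1"
proof -
  have "len (sr i \<circ> w) \<le> len w + 1 \<and> len w \<le> len (sr i \<circ> w) + 1"
  proof (cases "2 \<le> n")
    case True show ?thesis by (rule len_sr_cases[OF True assms, of i]) auto
  next
    \<comment> \<open>For n = 1 all residues coincide and \<open>sr i\<close> is the
      identity.\<close>
    case False
    then have "n = 1" using n_pos by simp
    then have "sr i \<circ> w = w" by (auto simp: aff_transp_def fun_eq_iff)
    then show ?thesis by simp
  qed
  then show "len (sr i \<circ> w) \<le> len w + 1" "len w \<le> len (sr i \<circ> w) + 1" by auto
qed

lemma len_cd_comp: "proper J \<Longrightarrow> aff w \<Longrightarrow> len (cd J \<circ> w) \<le> card J + len w \<and> len w \<le> card J + len (cd J \<circ> w)"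
proof (induction rule: proper_induct)
  case empty then show ?case by (simp add: cd_empty)
next
  case (insert j K)
  have PK: "proper K" using insert by blast
  have "aff (cd K \<circ> w)" using aff_comp aff_cd PK insert by blast
  note b = len_sr_bounds[OF this, of "int j"]
  have "cd (insert j K) \<circ> w = sr (int j) \<circ> (cd K \<circ> w)" using cd_insert[OF insert(1-4)] by (simp add: comp_assoc)
  moreover have "card (insert j K) = card K + 1" using insert(3) finite_proper[OF PK] by simp
  moreover have "len (cd K \<circ> w) \<le> card K + len w" "len w \<le> card K + len (cd K \<circ> w)" using insert(5)[OF insert(6)] by blast+
  ultimately show ?case using b by presburger
qed

lemma len_ivcd_comp: assumes "proper J" "aff w"
  shows "len (iv (cd J) \<circ> w) \<le> card J + len w \<and> len w \<le> card J + len (iv (cd J) \<circ> w)"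
  using len_cd_comp[OF assms(1), of "iv (cd J) \<circ> w"] aff_cd[OF assms(1)] assms(2)
  by (simp add: aff_comp aff_inv aff_inv_comp2)

text \<open>\<open>UJ\<close>, \<open>US\<close> and \<open>Lop\<close> are left multiplications in the nilCoxeter algebra, acting on coefficient functions:
  \<open>UJ J \<phi> w\<close> is the coefficient of \<open>w\<close> in \<open>cd J \<cdot> \<phi>\<close>.\<close>

definition UJ :: "nat set \<Rightarrow> ((int \<Rightarrow> int) \<Rightarrow> 'b::comm_ring_1) \<Rightarrow> (int \<Rightarrow> int) \<Rightarrow> 'b" where
  "UJ J \<phi> w = (if len (iv (cd J) \<circ> w) + card J = len w then \<phi> (iv (cd J) \<circ> w) else 0)"

definition US :: "int \<Rightarrow> ((int \<Rightarrow> int) \<Rightarrow> 'b::comm_ring_1) \<Rightarrow> (int \<Rightarrow> int) \<Rightarrow> 'b" where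
  "US i \<phi> w = (if len (sr i \<circ> w) + 1 = len w then \<phi> (sr i \<circ> w) else 0)"

definition Lop :: "nat \<Rightarrow> ((int \<Rightarrow> int) \<Rightarrow> 'b::comm_ring_1) \<Rightarrow> (int \<Rightarrow> int) \<Rightarrow> 'b" where
  "Lop m \<phi> w = (\<Sum>J | proper J \<and> card J = m. UJ J \<phi> w)"

definition Dop :: "int \<Rightarrow> ((int \<Rightarrow> int) \<Rightarrow> 'b::comm_ring_1) \<Rightarrow> (int \<Rightarrow> int) \<Rightarrow> 'b" where
  "Dop r \<phi> v = (\<Sum>j\<in>Cov v r. of_int (sgn (j - r)) * \<phi> (v \<circ> tr r j))"

lemma UJ_empty: "UJ {} \<phi> w = \<phi> w"
  using inv_id by (auto simp: UJ_def cd_empty)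

text \<open>Each factor changes the length by at most its own size, so additivity of the total
  forces additivity at each of the two steps.\<close>

lemma UJ_insert:
  assumes P: "proper (insert j K)" and j: "j < n" "j \<notin> K" "\<not> mem K (int j + 1)" and w: "aff w"
  shows "UJ (insert j K) \<phi> w = US (int j) (UJ K \<phi>) w"
proof -
  have PK: "proper K" using P by blast
  have a: "aff (sr (int j) \<circ> w)" using w aff_comp aff_tr by blast
  have e: "iv (cd (insert j K)) \<circ> w = iv (cd K) \<circ> (sr (int j) \<circ> w)"
    using cd_insert[OF P j] aff_cd[OF PK] by (simp add: aff_inv_distrib aff_tr inv_tr comp_assoc)
  have c: "card (insert j K) = card K + 1" using j finite_proper[OF PK] by simp
  show ?thesis unfolding UJ_def US_def e c
    using len_ivcd_comp[OF PK a] len_sr_bounds[OF w, of "int j"] by auto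
qed

section \<open>Commuting left multiplications with signed sums over covers\<close>

lemma Dop_cong: "aff v \<Longrightarrow> (\<And>w. aff w \<Longrightarrow> \<phi> w = \<psi> w) \<Longrightarrow> Dop r \<phi> v = Dop r \<psi> v"
  unfolding Dop_def by (intro sum.cong) (auto simp: aff_comp aff_tr)

lemma UJ_cong: "proper J \<Longrightarrow> aff v \<Longrightarrow> (\<And>w. aff w \<Longrightarrow> \<phi> w = \<psi> w) \<Longrightarrow> UJ J \<phi> v = UJ J \<psi> v"
  unfolding UJ_def by (auto simp: aff_comp aff_inv aff_cd)

lemma Lop_cong: "aff v \<Longrightarrow> (\<And>w. aff w \<Longrightarrow> \<phi> w = \<psi> w) \<Longrightarrow> Lop m \<phi> v = Lop m \<psi> v"
  unfolding Lop_def by (intro sum.cong) (auto intro: UJ_cong)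

lemma US_cong: "aff v \<Longrightarrow> (\<And>w. aff w \<Longrightarrow> \<phi> w = \<psi> w) \<Longrightarrow> US i \<phi> v = US i \<psi> v"
  unfolding US_def by (auto simp: aff_comp aff_tr)

text \<open>For given r at most one j represents the reflection \<open>tr p q\<close>. It exists
  when r is congruent to p or to q, and these two cases have opposite signs.\<close>

lemma sum_same_reflection:
  assumes "\<not> cg p q"
  shows "(\<Sum>j | \<not> cg r j \<and> tr r j = tr p q. of_int (sgn (j - r)))
    = (of_int (sgn (q - p)) * (of_bool (cg r p) - of_bool (cg r q)) :: 'b::comm_ring_1)"
proof -
  let ?R = "{j. \<not> cg r j \<and> tr r j = tr p q}"
  have sub: "?R \<subseteq> {tr p q r}"
  proof
    fix j assume j: "j \<in> ?R"
    then have "tr r j r = j" using tr_at0(1)[of r j] by blast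
    then show "j \<in> {tr p q r}" using j by simp
  qed
  have single_gen: "A \<subseteq> {z} \<Longrightarrow> y \<in> A \<Longrightarrow> A = {y}" for A and y z :: int by blast
  note single = single_gen[OF sub]
  show ?thesis
  proof (cases rule: tr_cases[of r p _ q])
    case (1 c)
    have "\<not> cg r (q + c * int n)" unfolding 1 cong_add_rcancel by (rule assms)
    moreover have "tr r (q + c * int n) = tr p q" unfolding 1 by (rule tr_shift)
    ultimately have "q + c * int n \<in> ?R" by blast
    then have "?R = {q + c * int n}" by (rule single)
    moreover have "cg r p" unfolding 1 by (simp add: cong_def)
    moreover have "\<not> cg r q" using \<open>cg r p\<close> assms by (meson cong_sym cong_trans)
    ultimately show ?thesis using 1 by simp
  next
    case (2 c)
    have "\<not> cg r (p + c * int n)" unfolding 2 cong_add_rcancel using assms by (simp add: cong_sym_eq)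
    moreover have "tr r (p + c * int n) = tr p q" unfolding 2 tr_shift by (rule tr_commute)
    ultimately have "p + c * int n \<in> ?R" by blast
    then have "?R = {p + c * int n}" by (rule single)
    moreover have "cg r q" unfolding 2 by (simp add: cong_def)
    moreover have "\<not> cg r p" using \<open>cg r q\<close> assms by (meson cong_sym cong_trans)
    moreover have "sgn (p - q) = - sgn (q - p)" by (simp add: sgn_if)
    ultimately show ?thesis using 2 by simp
  next
    case 3
    then have "tr p q r = r" by (simp add: tr_other)
    then have "?R = {}" using sub by auto
    then have "(\<Sum>j\<in>?R. of_int (sgn (j - r))) = (0 :: 'b)" by (simp only: sum.empty)
    then show ?thesis using 3 by simp
  qed
qed

text \<open>Reflections act on the right and s_i on the left, so the two orders differ only where
  the length conditions do. By \<open>exchange\<close> this happens only for the reflection with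
  \<open>sr i \<circ> v = v \<circ> tr p q\<close>, and its term is a signed
  \<open>\<phi> v\<close>.\<close>

lemma Dop_US:
  fixes \<phi> :: "(int \<Rightarrow> int) \<Rightarrow> 'b::comm_ring_1"
  assumes n2: "2 \<le> n" and v: "aff v"
  shows "Dop r (US i \<phi>) v = US i (Dop r \<phi>) v + (of_bool (cg (v r) i) - of_bool (cg (v r) (i + 1))) * \<phi> v"
proof -
  define p q where "p = iv v i" and "q = iv v (i + 1)"
  have vp: "v p = i" "v q = i + 1" using v by (auto simp: p_def q_def)
  have npq: "\<not> cg p q" using aff_cg[OF v, of p q] vp not_cg_Suc[OF n2] by simp
  have sv: "sr i \<circ> v = v \<circ> tr p q" using tr_comp_inv[OF v] by (simp add: p_def q_def)
  have asv: "aff (sr i \<circ> v)" using v aff_comp aff_tr by blast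
  have at: "aff (v \<circ> tr r j)" for j using v aff_comp aff_tr by blast
  have vinj: "v \<circ> f = v \<circ> g \<longleftrightarrow> f = g" for f g using v aff_inj[OF v] by (auto simp: fun_eq_iff)
  let ?R = "{j. \<not> cg r j \<and> tr r j = tr p q}"
  let ?s = "\<lambda>j. of_int (sgn (j - r)) :: 'b"
  let ?A = "{j \<in> Cov v r. len (sr i \<circ> (v \<circ> tr r j)) + 1 = len (v \<circ> tr r j)}"
  have cgs: "of_bool (cg (v r) i) - of_bool (cg (v r) (i + 1)) = (of_bool (cg r p) - of_bool (cg r q) :: 'b)"
    using aff_cg[OF v, of r p] aff_cg[OF v, of r q] vp by simp
  have fin: "finite (Cov w r)" if "aff w" for w using finite_Cov that by blast
  have D1: "Dop r (US i \<phi>) v = (\<Sum>j\<in>?A. ?s j * \<phi> (sr i \<circ> (v \<circ> tr r j)))"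
    unfolding Dop_def US_def by (subst sum.inter_filter[OF fin[OF v]]) (auto intro!: sum.cong)
  have RR: "sr i \<circ> (v \<circ> tr r j) = v" if "j \<in> ?R" for j
  proof -
    have "v \<circ> tr r j = sr i \<circ> v" using that sv by simp
    then show ?thesis by (simp add: tr_invol2)
  qed
  have sumR: "(\<Sum>j\<in>?R. ?s j * \<phi> (sr i \<circ> (v \<circ> tr r j))) = of_int (sgn (q - p)) * (of_bool (cg r p) - of_bool (cg r q)) * \<phi> v"
  proof -
    have "(\<Sum>j\<in>?R. ?s j * \<phi> (sr i \<circ> (v \<circ> tr r j))) = (\<Sum>j\<in>?R. ?s j * \<phi> v)"
      using RR by (intro sum.cong refl) metis
    also have "\<dots> = (\<Sum>j\<in>?R. ?s j) * \<phi> v" by (simp add: sum_distrib_right)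
    also have "(\<Sum>j\<in>?R. ?s j) = of_int (sgn (q - p)) * (of_bool (cg r p) - of_bool (cg r q))"
      by (rule sum_same_reflection[OF npq])
    finally show ?thesis .
  qed
  show ?thesis
  proof (cases rule: len_sr_cases[OF n2 v, of i])
    case 1
    \<comment> \<open>Here s_i v covers v, and by \<open>exchange\<close> only the reflection that
      gives s_i v survives.\<close>
    have "?A = ?R"
    proof (intro equalityI subsetI)
      fix j assume "j \<in> ?A"
      then have h: "\<not> cg r j" "len (v \<circ> tr r j) = len v + 1" "len (sr i \<circ> (v \<circ> tr r j)) = len v" by (auto simp: Cov_def)
      then have "sr i \<circ> v = v \<circ> tr r j" using exchange[OF n2 v] 1 by blast
      then have "tr r j = tr p q" using sv vinj by metis
      then show "j \<in> ?R" using h by simp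
    next
      fix j assume j: "j \<in> ?R"
      then have "v \<circ> tr r j = sr i \<circ> v" using sv by simp
      then show "j \<in> ?A" using 1 RR[OF j] j by (simp add: Cov_def)
    qed
    moreover have "US i (Dop r \<phi>) v = 0" using 1 by (simp add: US_def)
    moreover have "sgn (q - p) = 1" using 1 by (simp add: p_def q_def)
    ultimately show ?thesis using D1 sumR cgs by simp
  next
    case 2
    have com: "sr i \<circ> v \<circ> tr r j = sr i \<circ> (v \<circ> tr r j)" for j by (simp add: comp_assoc)
    have U: "US i (Dop r \<phi>) v = (\<Sum>j\<in>Cov (sr i \<circ> v) r. ?s j * \<phi> (sr i \<circ> (v \<circ> tr r j)))"
      using 2 by (simp add: US_def Dop_def com)
    \<comment> \<open>Here s_i shortens v: the covers of s_i v are the covers of v that s_i still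
      shortens, together with the way back to v.\<close>
    have "Cov (sr i \<circ> v) r = ?A \<union> ?R"
    proof (intro equalityI subsetI)
      fix j assume "j \<in> Cov (sr i \<circ> v) r"
      then have h: "\<not> cg r j" "len (sr i \<circ> (v \<circ> tr r j)) = len v" using 2 by (auto simp: Cov_def com)
      show "j \<in> ?A \<union> ?R"
      proof (cases rule: len_sr_cases[OF n2 at[of j], of i])
        case 2 then show ?thesis using h by (simp add: Cov_def)
      next
        case up: 1
        have "v \<circ> tr r j \<circ> tr r j = v" by (simp add: tr_invol2)
        then have "sr i \<circ> (v \<circ> tr r j) = v" using exchange[OF n2 at[of j] h(1), of i] up h 2 by simp
        then have "v \<circ> tr r j = sr i \<circ> v" by (metis tr_invol2(1))
        then have "tr r j = tr p q" using sv vinj by metis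
        then show ?thesis using h by simp
      qed
    next
      fix j assume "j \<in> ?A \<union> ?R"
      then show "j \<in> Cov (sr i \<circ> v) r"
      proof
        assume "j \<in> ?A" then show ?thesis using 2 by (simp add: Cov_def com)
      next
        assume j: "j \<in> ?R" then show ?thesis using 2 RR[OF j] by (simp add: Cov_def com)
      qed
    qed
    moreover have "?A \<inter> ?R = {}"
    proof -
      have "j \<notin> ?R" if "j \<in> ?A" for j
      proof
        assume "j \<in> ?R"
        then have "v \<circ> tr r j = sr i \<circ> v" using sv by simp
        then show False using that 2 by (simp add: Cov_def)
      qed
      then show ?thesis by blast
    qed
    moreover have "finite ?A" "finite (Cov (sr i \<circ> v) r)" using fin v asv by auto
    ultimately have "US i (Dop r \<phi>) v = Dop r (US i \<phi>) v + (\<Sum>j\<in>?R. ?s j * \<phi> (sr i \<circ> (v \<circ> tr r j)))"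
      unfolding U D1 by (metis (no_types, lifting) finite_Un sum.union_disjoint)
    moreover have "sgn (q - p) = -1" using 2 by (simp add: p_def q_def)
    ultimately show ?thesis using sumR cgs by simp
  qed
qed

text \<open>The run from c grows by one exactly when it ended in the class of j, and it never ends
  in the class of j + 1.\<close>

lemma nxt_insert:
  assumes P: "proper (insert j K)" and j: "j < n" "j \<notin> K" "\<not> mem K (int j + 1)" and c: "c \<in> K"
  shows "nxt (insert j K) (int c) = sr (int j) (nxt K (int c))"
proof -
  have PK: "proper K" using P by blast
  have n2: "2 \<le> n" using proper_two[OF P] .
  note K = nxt_props[OF PK, of "int c"]
  note M = mem_insert[OF j(1), of K]
  define y where "y = nxt K (int c)"
  have nc: "\<not> cg (int j) (int j + 1)" using not_cg_Suc[OF n2] .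
  have cK: "mem K (int c)" using c PK mem_nat by auto
  have jK: "\<not> mem K z" if "cg z (int j)" for z using that mem_cg mem_nat[OF j(1)] j(2) by blast
  have j1K: "\<not> mem K z" if "cg z (int j + 1)" for z using that mem_cg j(3) by blast
  have lt: "int c < y" using K(1,2) cK by (metis order_le_less y_def)
  have ny: "\<not> cg y (int j + 1)"
  proof
    assume "cg y (int j + 1)"
    then have "cg (y - 1) (int j)" by (metis add_diff_cancel_right' cong_add_rcancel diff_add_cancel)
    moreover have "mem K (y - 1)" using K(3)[of "y - 1"] lt by (simp add: y_def)
    ultimately show False using jK by blast
  qed
  show ?thesis
  proof (cases "cg y (int j)")
    case True
    then have y1: "cg (y + 1) (int j + 1)" by (simp add: cong_add_rcancel)
    have "nxt (insert j K) (int c) = y + 1"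
    proof (rule nxt_eqI[OF P])
      show "\<not> mem (insert j K) (y + 1)" using M y1 j1K nc by (metis cong_sym cong_trans)
      show "mem (insert j K) z" if "int c \<le> z" "z < y + 1" for z
        using that True K(3)[of z] M by (cases "z = y") (auto simp: y_def)
    qed (use lt in simp)
    moreover have "sr (int j) y = y + 1" using True nc by (simp add: aff_transp_def)
    ultimately show ?thesis by (simp add: y_def)
  next
    case False
    have "nxt (insert j K) (int c) = y" by (rule nxt_eqI[OF P]) (use K M False in \<open>auto simp: y_def\<close>)
    then show ?thesis using False ny tr_other by (simp add: y_def)
  qed
qed

text \<open>This iterates \<open>Dop_US\<close>. The correction from s_c begins as the difference of
  the indicators of c and c + 1; the factors to the left of s_c push c + 1 to the end of the run of
  J from c.\<close>

lemma Dop_UJ: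
  fixes \<phi> :: "(int \<Rightarrow> int) \<Rightarrow> 'b::comm_ring_1"
  assumes "proper J" "aff v"
  shows "Dop r (UJ J \<phi>) v = UJ J (Dop r \<phi>) v +
    (\<Sum>c\<in>J. (of_bool (cg (v r) (int c)) - of_bool (cg (v r) (nxt J (int c)))) * UJ (J - {c}) \<phi> v)"
  using assms
proof (induction arbitrary: v rule: proper_induct)
  case empty
  have "Dop r (UJ {} \<phi>) v = Dop r \<phi> v" using empty by (intro Dop_cong) (auto simp: UJ_empty)
  then show ?case by (simp add: UJ_empty)
next
  case (insert j K)
  note ins = insert(1-4)
  have PK: "proper K" using insert by blast
  have n2: "2 \<le> n" using proper_two[OF ins(1)] .
  have nc: "\<not> cg (int j) (int j + 1)" using not_cg_Suc[OF n2] .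
  let ?g = "\<lambda>K c w. (of_bool (cg (w r) (int c)) - of_bool (cg (w r) (nxt K (int c))) :: 'b)"
  have asv: "aff (sr (int j) \<circ> v)" using insert aff_comp aff_tr by blast
  have "Dop r (UJ (insert j K) \<phi>) v = Dop r (US (int j) (UJ K \<phi>)) v"
    using insert by (intro Dop_cong) (auto simp: UJ_insert)
  also have "\<dots> = US (int j) (Dop r (UJ K \<phi>)) v +
      (of_bool (cg (v r) (int j)) - of_bool (cg (v r) (int j + 1))) * UJ K \<phi> v"
    by (rule Dop_US) (use n2 insert in auto)
  also have "US (int j) (Dop r (UJ K \<phi>)) v =
      US (int j) (\<lambda>w. UJ K (Dop r \<phi>) w + (\<Sum>c\<in>K. ?g K c w * UJ (K - {c}) \<phi> w)) v"
    by (rule US_cong) (use insert in auto)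
  also have "\<dots> = US (int j) (UJ K (Dop r \<phi>)) v
      + (\<Sum>c\<in>K. ?g K c (sr (int j) \<circ> v) * US (int j) (UJ (K - {c}) \<phi>) v)"
    by (simp add: US_def)
  also have "US (int j) (UJ K (Dop r \<phi>)) v = UJ (insert j K) (Dop r \<phi>) v"
    using UJ_insert[OF ins] insert by metis
  also have "(\<Sum>c\<in>K. ?g K c (sr (int j) \<circ> v) * US (int j) (UJ (K - {c}) \<phi>) v)
     = (\<Sum>c\<in>K. ?g (insert j K) c v * UJ (insert j K - {c}) \<phi> v)"
  proof (rule sum.cong[OF refl])
    fix c assume c: "c \<in> K"
    have cn: "c < n" using c PK by auto
    have sc: "cg (sr (int j) x) y \<longleftrightarrow> cg x (sr (int j) y)" for x y
      using aff_cg[OF aff_tr, of "int j" "int j + 1" x "sr (int j) y"] by (simp add: tr_tr)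
    have "\<not> cg (int c) (int j)" using c ins(2,3) cn cg_nat_eq[OF ins(2), of "int c"] by (auto simp: nat_mod_distrib)
    moreover have "\<not> cg (int c) (int j + 1)" using c ins(4) mem_cg mem_nat[OF cn] by blast
    ultimately have "sr (int j) (int c) = int c" using tr_other by blast
    then have g: "?g K c (sr (int j) \<circ> v) = ?g (insert j K) c v"
      using sc nxt_insert[OF ins c] by simp
    have e: "insert j K - {c} = insert j (K - {c})" using c ins by auto
    have "UJ (insert j (K - {c})) \<phi> v = US (int j) (UJ (K - {c}) \<phi>) v"
    proof (rule UJ_insert)
      show "proper (insert j (K - {c}))" using ins(1) by blast
      show "\<not> mem (K - {c}) (int j + 1)" using ins(4) by (simp add: mem_def)
    qed (use insert in auto)
    then show "?g K c (sr (int j) \<circ> v) * US (int j) (UJ (K - {c}) \<phi>) v = ?g (insert j K) c v * UJ (insert j K - {c}) \<phi> v"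
      using g e by simp
  qed
  finally have 1: "Dop r (UJ (insert j K) \<phi>) v = UJ (insert j K) (Dop r \<phi>) v +
     (\<Sum>c\<in>K. ?g (insert j K) c v * UJ (insert j K - {c}) \<phi> v) +
      (of_bool (cg (v r) (int j)) - of_bool (cg (v r) (int j + 1))) * UJ K \<phi> v" .
  have "nxt (insert j K) (int j) = int j + 1"
  proof (rule nxt_eqI[OF ins(1)])
    have "\<not> cg (int j + 1) (int j)" using nc by (simp add: cong_sym_eq)
    then show "\<not> mem (insert j K) (int j + 1)" using mem_insert[OF ins(2)] ins(4) by blast
    show "mem (insert j K) y" if "int j \<le> y" "y < int j + 1" for y
      using that mem_insert[OF ins(2)] by (metis cong_refl order_antisym zle_add1_eq_le zless_imp_add1_zle)
  qed simp
  moreover have "insert j K - {j} = K" using ins by auto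
  ultimately have 2: "(\<Sum>c\<in>insert j K. ?g (insert j K) c v * UJ (insert j K - {c}) \<phi> v)
      = (of_bool (cg (v r) (int j)) - of_bool (cg (v r) (int j + 1))) * UJ K \<phi> v
       + (\<Sum>c\<in>K. ?g (insert j K) c v * UJ (insert j K - {c}) \<phi> v)"
    using ins finite_proper[OF PK] by simp
  show ?case unfolding 1 2 by (simp add: algebra_simps)
qed

text \<open>The map is the cyclic successor on the complement of K: from c it walks through K to the
  next residue outside K. The size condition guarantees a residue other than c.\<close>

lemma nxt_bij:
  assumes K: "K \<subseteq> {..<n}" "card K + 1 < n"
  shows "bij_betw (\<lambda>c. nat (nxt (insert c K) (int c) mod int n)) ({..<n} - K) ({..<n} - K)"
proof -
  let ?f = "\<lambda>c. nat (nxt (insert c K) (int c) mod int n)"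
  have fK: "finite K" using K finite_subset by blast
  have P: "proper (insert c K)" if "c < n" for c
    using that K fK by (auto simp: proper_iff card_insert_if)
  have "?f ` ({..<n} - K) \<subseteq> {..<n} - K"
  proof
    fix d assume "d \<in> ?f ` ({..<n} - K)"
    then obtain c where c: "c < n" "c \<notin> K" "d = ?f c" by auto
    have "\<not> mem K (nxt (insert c K) (int c))" using nxt_props(2)[OF P[OF c(1)], of "int c"] mem_insert[OF c(1)] by blast
    then show "d \<in> {..<n} - K" using c nat_mod_less by (auto simp: mem_def)
  qed
  moreover have "inj_on ?f ({..<n} - K)"
  proof (rule inj_onI)
    fix c c' assume h: "c \<in> {..<n} - K" "c' \<in> {..<n} - K" "?f c = ?f c'"
    define y y' where "y = nxt (insert c K) (int c)" and "y' = nxt (insert c' K) (int c')"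
    have c: "c < n" "c' < n" using h by auto
    have mK: "\<not> mem K x" if "cg x (int c) \<or> cg x (int c')" for x
      using that h c mem_cg mem_nat by blast
    have "cg y y'" using h(3) cg_nat_mod[of y] cg_nat_mod[of y'] by (metis cong_sym cong_trans y_def y'_def)
    then obtain k where k: "y = y' + k * int n" by (metis cg_iff cong_sym)
    have lt: "x < nxt (insert d K) x \<and> (\<forall>z. x < z \<longrightarrow> z < nxt (insert d K) x \<longrightarrow> mem K z)" if "d < n" "x = int d" for d x
    proof -
      note N = nxt_props[OF P[OF that(1)], of x]
      have m: "mem (insert d K) x" using that mem_insert[OF that(1)] by simp
      have "x < nxt (insert d K) x" using N(1,2) m by (metis order_le_less)
      moreover have "mem K z" if z: "x < z" "z < nxt (insert d K) x" for z
      proof -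
        have "mem (insert d K) z" using N(3) z by simp
        moreover have "\<not> cg z (int d)"
        proof
          assume "cg z (int d)"
          then have "int n dvd z - x" using \<open>x = int d\<close> by (simp add: cong_iff_dvd_diff)
          then have "int n \<le> z - x" using z by (intro zdvd_imp_le) auto
          then show False using N(4) z by simp
        qed
        ultimately show ?thesis using mem_insert[OF \<open>d < n\<close>] by blast
      qed
      ultimately show ?thesis by blast
    qed
    define x where "x = int c' + k * int n"
    have cx: "cg x (int c')" by (simp add: x_def cong_def)
    have A: "int c < y" "\<And>z. int c < z \<Longrightarrow> z < y \<Longrightarrow> mem K z" using lt[OF c(1) refl] by (auto simp: y_def)
    have B: "x < y" "\<And>z. x < z \<Longrightarrow> z < y \<Longrightarrow> mem K z"
    proof -
      show "x < y" using lt[OF c(2) refl] k by (simp add: y'_def x_def)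
      fix z assume z: "x < z" "z < y"
      then have "mem K (z + (- k) * int n)" using lt[OF c(2) refl] k by (auto simp: y'_def x_def)
      then show "mem K z" using mem_shift by blast
    qed
    \<comment> \<open>Two arcs ending at the same point are nested, so a longer one would contain
      the start of the other in its interior, where all residues belong to K.\<close>
    have "int c = x"
    proof (rule ccontr)
      assume "int c \<noteq> x"
      then consider "int c < x" | "x < int c" by linarith
      then show False
      proof cases
        case 1 then show False using A(2)[of x] B(1) mK[of x] cx by blast
      next
        case 2 then show False using B(2)[of "int c"] A(1) mK[of "int c"] cong_refl by blast
      qed
    qed
    then have "cg (int c) (int c')" using cx by simp
    then show "c = c'" using c cg_nat_eq[of c' "int c"] by (simp add: nat_mod_distrib)
  qed
  ultimately show ?thesis unfolding bij_betw_def using endo_inj_surj[of "{..<n} - K" ?f] by blast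
qed

text \<open>The corrections are regrouped by the remaining support K = J - {c}. For fixed K they
  telescope, since by \<open>nxt_bij\<close> the run ends permute the residues outside K.\<close>

lemma Dop_Lop:
  fixes \<phi> :: "(int \<Rightarrow> int) \<Rightarrow> 'b::comm_ring_1"
  assumes v: "aff v" shows "Dop r (Lop m \<phi>) v = Lop m (Dop r \<phi>) v"
proof -
  let ?g = "\<lambda>J c. (of_bool (cg (v r) (int c)) - of_bool (cg (v r) (nxt J (int c))) :: 'b)"
  let ?S = "{J. proper J \<and> card J = m}"
  have fS: "finite ?S" by (rule finite_subset[of _ "Pow {..<n}"]) auto
  have "Dop r (Lop m \<phi>) v = (\<Sum>J\<in>?S. Dop r (UJ J \<phi>) v)"
    unfolding Dop_def Lop_def sum_distrib_left by (rule sum.swap)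
  also have "\<dots> = (\<Sum>J\<in>?S. UJ J (Dop r \<phi>) v) + (\<Sum>J\<in>?S. \<Sum>c\<in>J. ?g J c * UJ (J - {c}) \<phi> v)"
    unfolding sum.distrib[symmetric] by (intro sum.cong refl Dop_UJ) (use v in auto)
  also have "(\<Sum>J\<in>?S. \<Sum>c\<in>J. ?g J c * UJ (J - {c}) \<phi> v) = 0"
  proof (cases "1 \<le> m \<and> m < n")
    case False
    have emp: "J = {}" if "J \<in> ?S" for J
    proof -
      have "m < n" using that card_proper[of J] by simp
      then have "m = 0" using False by simp
      then show ?thesis using that finite_proper[of J] by simp
    qed
    show ?thesis
    proof (rule sum.neutral, rule ballI)
      fix J assume "J \<in> ?S"
      then have "J = {}" by (rule emp)
      then show "(\<Sum>c\<in>J. ?g J c * UJ (J - {c}) \<phi> v) = 0" by (simp only: sum.empty)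
    qed
  next
    case True
    let ?T = "{K. K \<subseteq> {..<n} \<and> card K = m - 1}"
    have fT: "finite ?T" by (rule finite_subset[of _ "Pow {..<n}"]) auto
    have "(\<Sum>J\<in>?S. \<Sum>c\<in>J. ?g J c * UJ (J - {c}) \<phi> v)
       = (\<Sum>(J, c)\<in>(SIGMA J:?S. J). ?g J c * UJ (J - {c}) \<phi> v)"
      by (rule sum.Sigma[OF fS]) (simp add: finite_proper)
    also have "\<dots> = (\<Sum>(K, c)\<in>(SIGMA K:?T. {..<n} - K). ?g (insert c K) c * UJ K \<phi> v)"
    proof (rule sum.reindex_bij_witness[where i="\<lambda>(K, c). (insert c K, c)" and j="\<lambda>(J, c). (J - {c}, c)"])
      fix p assume "p \<in> (SIGMA J:?S. J)"
      then obtain J c where p: "p = (J, c)" "proper J" "card J = m" "c \<in> J" by auto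
      then have i: "insert c (J - {c}) = J" by blast
      show "(\<lambda>(K, c). (insert c K, c)) ((\<lambda>(J, c). (J - {c}, c)) p) = p" using p i by simp
      show "(\<lambda>(J, c). (J - {c}, c)) p \<in> (SIGMA K:?T. {..<n} - K)"
        using p finite_proper[of J] by (simp add: psubset_imp_subset) blast
      show "(\<lambda>(K, c). ?g (insert c K) c * UJ K \<phi> v) ((\<lambda>(J, c). (J - {c}, c)) p) = (\<lambda>(J, c). ?g J c * UJ (J - {c}) \<phi> v) p"
        using p i by simp
    next
      fix p assume "p \<in> (SIGMA K:?T. {..<n} - K)"
      then obtain K c where p: "p = (K, c)" "K \<subseteq> {..<n}" "card K = m - 1" "c < n" "c \<notin> K" by auto
      have "finite K" using p finite_subset by blast
      then have "card (insert c K) = m" using p True by simp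
      then show "(\<lambda>(K, c). (insert c K, c)) p \<in> (SIGMA J:?S. J)" using p True by (auto simp: proper_iff)
      show "(\<lambda>(J, c). (J - {c}, c)) ((\<lambda>(K, c). (insert c K, c)) p) = p" using p by auto
    qed
    also have "\<dots> = (\<Sum>K\<in>?T. \<Sum>c\<in>{..<n} - K. ?g (insert c K) c * UJ K \<phi> v)"
      by (rule sum.Sigma[symmetric]) (use fT in auto)
    also have "\<dots> = 0"
    proof (rule sum.neutral, clarify)
      fix K assume K: "K \<subseteq> {..<n}" "card K = m - 1"
      let ?f = "\<lambda>c. nat (nxt (insert c K) (int c) mod int n)"
      have b: "bij_betw ?f ({..<n} - K) ({..<n} - K)" using nxt_bij K True by auto
      have "(\<Sum>c\<in>{..<n} - K. of_bool (cg (v r) (nxt (insert c K) (int c)))) = (\<Sum>c\<in>{..<n} - K. (of_bool (cg (v r) (int (?f c))) :: 'b))"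
      proof (rule sum.cong[OF refl])
        fix c
        have "cg (v r) y \<longleftrightarrow> cg (v r) (int (nat (y mod int n)))" for y
          using cg_nat_mod[of y] by (meson cong_sym cong_trans)
        then show "of_bool (cg (v r) (nxt (insert c K) (int c))) = (of_bool (cg (v r) (int (?f c))) :: 'b)"
          by presburger
      qed
      also have "\<dots> = (\<Sum>c\<in>{..<n} - K. of_bool (cg (v r) (int c)))"
        using sum.reindex_bij_betw[OF b, of "\<lambda>c. of_bool (cg (v r) (int c)) :: 'b"] .
      finally have "(\<Sum>c\<in>{..<n} - K. ?g (insert c K) c) = 0" by (simp add: sum_subtractf)
      then show "(\<Sum>c\<in>{..<n} - K. ?g (insert c K) c * UJ K \<phi> v) = 0"
        unfolding sum_distrib_right[symmetric] by simp
    qed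
    finally show ?thesis .
  qed
  finally show ?thesis unfolding Lop_def[of m "Dop r \<phi>"] by simp
qed

end

section \<open>The energy of an affine permutation\<close>

context affine_window begin

text \<open>An inversion of \<open>x \<circ> y\<close> that is not one of y is carried by y to an
  inversion of x, injectively on window representatives.\<close>

lemma len_comp_le: assumes x: "aff x" and y: "aff y" shows "len (x \<circ> y) \<le> len x + len y"
proof -
  let ?S = "{p \<in> Pairs. nrm (y (fst p), y (snd p)) \<in> Inv x}"
  have inj: "inj_on (\<lambda>p. nrm (y (fst p), y (snd p))) ?S"
  proof (rule inj_onI)
    fix p p' assume h: "p \<in> ?S" "p' \<in> ?S" "nrm (y (fst p), y (snd p)) = nrm (y (fst p'), y (snd p'))"
    obtain i j where p: "p = (i, j)" "1 \<le> i" "i \<le> int n" using h by (auto simp: Pairs_def)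
    obtain i' j' where p': "p' = (i', j')" "1 \<le> i'" "i' \<le> int n" using h by (auto simp: Pairs_def)
    obtain c where c: "nrm (y i, y j) = (y i + c * int n, y j + c * int n)" using nrm_ex by blast
    obtain d where d: "nrm (y i', y j') = (y i' + d * int n, y j' + d * int n)" using nrm_ex by blast
    have "y (i + c * int n) = y (i' + d * int n)" "y (j + c * int n) = y (j' + d * int n)"
      using h(3) p p' c d by (auto simp: aff_shift[OF y])
    then have e: "i + c * int n = i' + d * int n" "j + c * int n = j' + d * int n" using aff_inj[OF y] by auto
    then have i': "i' = i + (c - d) * int n" by (simp add: algebra_simps)
    then have "c - d = 0" using window_shift_unique[of i "c - d"] p p' by simp
    then show "p = p'" using p p' e by simp
  qed
  have fS: "finite ?S"
  proof (rule finite_imageD[OF _ inj])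
    show "finite ((\<lambda>p. nrm (y (fst p), y (snd p))) ` ?S)"
      by (rule finite_subset[OF _ finite_Inv[OF x]]) auto
  qed
  have cS: "card ?S \<le> card (Inv x)"
    by (rule card_inj_on_le[OF inj _ finite_Inv[OF x]]) auto
  have "Inv (x \<circ> y) \<subseteq> Inv y \<union> ?S"
  proof
    fix p assume "p \<in> Inv (x \<circ> y)"
    then obtain i j where p: "p = (i, j)" "1 \<le> i" "i \<le> int n" "i < j" "x (y i) > x (y j)" by (auto simp: Inv_def)
    show "p \<in> Inv y \<union> ?S"
    proof (cases "y i > y j")
      case True then show ?thesis using p by (simp add: Inv_def)
    next
      case False
      then have "y i < y j" using aff_inj[OF y, of i j] p by linarith
      then have "nrm (y i, y j) \<in> Inv x" using nrm_ex[of "y i" "y j"] p by (auto simp: Inv_def aff_shift[OF x])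
      then show ?thesis using p by (simp add: Pairs_def)
    qed
  qed
  then have "card (Inv (x \<circ> y)) \<le> card (Inv y \<union> ?S)"
    using fS finite_Inv[OF y] by (intro card_mono) auto
  also have "\<dots> \<le> card (Inv y) + card ?S" by (rule card_Un_le)
  finally show ?thesis using cS by (simp add: len_Inv)
qed

definition energy :: "(int \<Rightarrow> int) \<Rightarrow> int" where "energy f = (\<Sum>i\<in>{1..int n}. (f i)\<^sup>2)"

text \<open>The maximal inversion as one integer. Base n + 1 exceeds every s in the window, so
  numeric order is lexicographic; 0 stands for no inversion and lies below all codes.\<close>

definition invcode :: "(int \<Rightarrow> int) \<Rightarrow> int" where
  "invcode f = Max (insert 0 ((\<lambda>(r, s). r * (int n + 1) + s) ` window_inversions n f))"

lemma finite_winv: "finite (window_inversions n f)"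
  by (rule finite_subset[of _ "{1..int n} \<times> {1..int n}"]) (auto simp: window_inversions_def)

lemma code_less:
  assumes "1 \<le> (s::int)" "s \<le> int n" "1 \<le> s'" "s' \<le> int n"
  shows "r' * (int n + 1) + s' \<le> r * (int n + 1) + s \<longleftrightarrow> r' < r \<or> r' = r \<and> s' \<le> s"
proof (cases r' r rule: linorder_cases)
  case less
  then have "(r' + 1) * (int n + 1) \<le> r * (int n + 1)" by (intro mult_right_mono) auto
  then show ?thesis using less assms by (simp add: algebra_simps)
next
  case equal then show ?thesis by simp
next
  case greater
  then have "(r + 1) * (int n + 1) \<le> r' * (int n + 1)" by (intro mult_right_mono) auto
  then show ?thesis using greater assms by (simp add: algebra_simps)
qed

lemma max_inversion_exists:
  assumes "window_inversions n f \<noteq> {}" obtains r s where "is_max_inversion n f r s"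
proof -
  let ?c = "\<lambda>(r, s). r * (int n + 1) + s"
  have "Max (?c ` window_inversions n f) \<in> ?c ` window_inversions n f"
    using assms finite_winv by (intro Max_in) auto
  then obtain r s where rs: "(r, s) \<in> window_inversions n f" "Max (?c ` window_inversions n f) = r * (int n + 1) + s" by auto
  have "r' < r \<or> (r' = r \<and> s' \<le> s)" if "(r', s') \<in> window_inversions n f" for r' s'
  proof -
    have "?c (r', s') \<le> Max (?c ` window_inversions n f)" by (intro Max_ge) (use that finite_winv in auto)
    then show ?thesis using code_less[of s s' r' r] rs that by (auto simp: window_inversions_def)
  qed
  then show ?thesis using that[of r s] rs by (auto simp: is_max_inversion_def)
qed

lemma max_inversion_unique: "is_max_inversion n f r s \<Longrightarrow> is_max_inversion n f r' s' \<Longrightarrow> r' = r \<and> s' = s"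
  by (fastforce simp: is_max_inversion_def)

lemma invcode_less:
  assumes "is_max_inversion n f r s"
    and "\<And>r' s'. (r', s') \<in> window_inversions n g \<Longrightarrow> r' < r \<or> (r' = r \<and> s' < s)"
  shows "invcode g < invcode f"
proof -
  let ?c = "\<lambda>(r, s). r * (int n + 1) + s"
  have rs: "(r, s) \<in> window_inversions n f" using assms by (simp add: is_max_inversion_def)
  then have b: "1 \<le> r" "r < s" "s \<le> int n" by (auto simp: window_inversions_def)
  have "?c (r, s) \<le> invcode f" unfolding invcode_def by (intro Max_ge) (use rs finite_winv in auto)
  moreover have "x < ?c (r, s)" if xin: "x \<in> insert 0 (?c ` window_inversions n g)" for x
  proof (cases "x = 0")
    case True
    have "0 < r * (int n + 1)" using b by (intro mult_pos_pos) auto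
    then show ?thesis unfolding case_prod_conv using True b by linarith
  next
    case False
    then obtain r' s' where h: "(r', s') \<in> window_inversions n g" "x = ?c (r', s')" using xin by auto
    have "\<not> ?c (r, s) \<le> ?c (r', s')"
      using code_less[of s' s r r'] assms(2)[OF h(1)] h(1) b by (auto simp: window_inversions_def)
    then show ?thesis using h by simp
  qed
  then have "invcode g < ?c (r, s)" unfolding invcode_def using finite_winv by (subst Max_less_iff) auto
  ultimately show ?thesis by linarith
qed

section \<open>Energy and maximal inversions under a cover\<close>

lemma window_not_cg: "1 \<le> i \<Longrightarrow> i < j \<Longrightarrow> j \<le> int n \<Longrightarrow> \<not> cg i j"
proof
  assume h: "1 \<le> i" "i < j" "j \<le> int n" "cg i j"
  then obtain c where c: "j = i + c * int n" by (auto simp: cg_iff)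
  then have "c = 0" using window_shift_unique[of i c] h by simp
  then show False using c h by simp
qed

text \<open>Only the window representatives of a and b change value. Their squares cancel and leave
  a cross term, which is zero when a and b lie in the same window.\<close>

lemma energy_tr:
  assumes v: "aff v" and nab: "\<not> cg a b"
    and a: "1 \<le> a + \<alpha> * int n" "a + \<alpha> * int n \<le> int n" and b: "1 \<le> b + \<beta> * int n" "b + \<beta> * int n \<le> int n"
  shows "energy (v \<circ> tr a b) = energy v + 2 * (v b - v a) * ((\<alpha> - \<beta>) * int n)"
proof -
  let ?a = "a + \<alpha> * int n" and ?b = "b + \<beta> * int n"
  have ne: "?a \<noteq> ?b"
  proof
    assume "?a = ?b"
    then have "b = a + (\<alpha> - \<beta>) * int n" by (simp add: algebra_simps)
    then show False using nab by (auto simp: cg_iff)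
  qed
  have "energy (v \<circ> tr a b) - energy v = (\<Sum>i\<in>{1..int n}. (v (tr a b i))\<^sup>2 - (v i)\<^sup>2)"
    by (simp add: energy_def sum_subtractf)
  also have "\<dots> = (\<Sum>i\<in>{?a, ?b}. (v (tr a b i))\<^sup>2 - (v i)\<^sup>2)"
  proof (rule sum.mono_neutral_right)
    show "{?a, ?b} \<subseteq> {1..int n}" using a b by auto
    show "\<forall>i\<in>{1..int n} - {?a, ?b}. (v (tr a b i))\<^sup>2 - (v i)\<^sup>2 = 0"
    proof
      fix i assume i: "i \<in> {1..int n} - {?a, ?b}"
      have "\<not> cg i a"
      proof
        assume "cg i a"
        then obtain c where "a = i + c * int n" by (auto simp: cg_iff)
        then have e: "?a = i + (c + \<alpha>) * int n" by (simp add: algebra_simps)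
        then have "c + \<alpha> = 0" using window_shift_unique[of i "c + \<alpha>"] i a by simp
        then show False using e i by simp
      qed
      moreover have "\<not> cg i b"
      proof
        assume "cg i b"
        then obtain c where "b = i + c * int n" by (auto simp: cg_iff)
        then have e: "?b = i + (c + \<beta>) * int n" by (simp add: algebra_simps)
        then have "c + \<beta> = 0" using window_shift_unique[of i "c + \<beta>"] i b by simp
        then show False using e i by simp
      qed
      ultimately show "(v (tr a b i))\<^sup>2 - (v i)\<^sup>2 = 0" by (simp add: tr_other)
    qed
  qed simp
  also have "\<dots> = ((v b + \<alpha> * int n)\<^sup>2 - (v a + \<alpha> * int n)\<^sup>2) + ((v a + \<beta> * int n)\<^sup>2 - (v b + \<beta> * int n)\<^sup>2)"
    using ne by (simp add: tr_at[OF nab] aff_shift[OF v])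
  also have "\<dots> = 2 * (v b - v a) * ((\<alpha> - \<beta>) * int n)" by (simp add: power2_eq_square algebra_simps)
  finally show ?thesis by simp
qed

text \<open>Maximality makes f increasing to the right of r and keeps \<open>f r\<close> below every
  entry after s. Hence a position strictly between r and s has a value below \<open>f s\<close>, and
  f covers \<open>f \<circ> tr r s\<close>.\<close>

lemma max_inv_facts:
  assumes f: "aff f" and m: "is_max_inversion n f r s"
  shows "1 \<le> r" "r < s" "s \<le> int n" "f r > f s" "\<not> cg r s"
    "\<And>i i'. r < i \<Longrightarrow> i < i' \<Longrightarrow> i' \<le> int n \<Longrightarrow> f i < f i'"
    "\<And>i. s < i \<Longrightarrow> i \<le> int n \<Longrightarrow> f r < f i"
    "s \<in> Cov (f \<circ> tr r s) r" "f \<circ> tr r s \<circ> tr r s = f"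
proof -
  show 1: "1 \<le> r" "r < s" "s \<le> int n" "f r > f s" using m by (auto simp: is_max_inversion_def window_inversions_def)
  show nc: "\<not> cg r s" using window_not_cg 1 by blast
  have mx: "r' < r \<or> r' = r \<and> s' \<le> s" if "1 \<le> r'" "r' < s'" "s' \<le> int n" "f r' > f s'" for r' s'
    using m that unfolding is_max_inversion_def window_inversions_def by blast
  show inc: "f i < f i'" if "r < i" "i < i'" "i' \<le> int n" for i i'
    using mx[of i i'] that 1 aff_inj[OF f, of i i'] by force
  show "f r < f i" if "s < i" "i \<le> int n" for i
    using mx[of r i] that 1 aff_inj[OF f, of r i] by force
  show ff: "f \<circ> tr r s \<circ> tr r s = f" by (simp add: tr_invol2)
  let ?v = "f \<circ> tr r s"
  have v: "aff ?v" using f aff_comp aff_tr by blast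
  have vr: "?v r = f s" "?v s = f r" using tr_at0[OF nc] by auto
  have "\<not> (\<exists>m. r < m \<and> m < s \<and> ?v r < ?v m \<and> ?v m < ?v s)"
  proof
    assume "\<exists>m. r < m \<and> m < s \<and> ?v r < ?v m \<and> ?v m < ?v s"
    then obtain m where m: "r < m" "m < s" "?v r < ?v m" by blast
    have "tr r s m = m" using m 1 window_not_cg[of r m] window_not_cg[of m s] by (intro tr_other) (auto simp: cong_sym_eq)
    then show False using inc[of m s] m 1 vr by simp
  qed
  then have "len (?v \<circ> tr r s) = len ?v + 1" using cover_iff[OF 1(2) nc v] vr 1 by simp
  then show "s \<in> Cov ?v r" using nc by (simp add: Cov_def)
qed

text \<open>Passing to \<open>f \<circ> tr r s\<close> keeps the energy. A cover that leaves the
  window increases it: to the right a larger value is exchanged across a positive shift, to the left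
  a smaller one across a negative shift. A cover inside the window must go to the left and lowers
  the maximal inversion.\<close>

lemma child_measure:
  assumes f: "aff f" and m: "is_max_inversion n f r s" and j: "j \<in> Cov (f \<circ> tr r s) r" "j \<noteq> s"
  shows "energy (f \<circ> tr r s \<circ> tr r j) > energy f \<or>
    energy (f \<circ> tr r s \<circ> tr r j) = energy f \<and> invcode (f \<circ> tr r s \<circ> tr r j) < invcode f"
proof -
  note F = max_inv_facts[OF f m]
  define v where "v = f \<circ> tr r s"
  have v: "aff v" using f aff_comp aff_tr by (simp add: v_def)
  have vr: "v r = f s" "v s = f r" using tr_at0[OF F(5)] by (auto simp: v_def)
  have vo: "v i = f i" if "1 \<le> i" "i \<le> int n" "i \<noteq> r" "i \<noteq> s" for i
  proof -
    have "\<not> cg i r" "\<not> cg i s" using that F(1-3) window_not_cg[of i r] window_not_cg[of r i] window_not_cg[of i s] window_not_cg[of s i]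
      by (auto simp: cong_sym_eq linorder_neq_iff)
    then show ?thesis by (simp add: v_def tr_other)
  qed
  have ev: "energy v = energy f"
    unfolding v_def using energy_tr[OF f F(5), of 0 0] F(1-3) by simp
  have jc: "\<not> cg r j" "len (v \<circ> tr r j) = len v + 1" using j by (auto simp: Cov_def v_def)
  obtain \<gamma> where g: "1 \<le> j + \<gamma> * int n" "j + \<gamma> * int n \<le> int n" using window_shift .
  have er: "energy (v \<circ> tr r j) = energy f + 2 * (v j - v r) * ((- \<gamma>) * int n)"
    using energy_tr[OF v jc(1), of 0 \<gamma>] F(1-3) g ev by simp
  have "j \<noteq> r" using jc by auto
  then consider "r < j" | "j < r" by linarith
  then show ?thesis
  proof cases
    case 1
    have less: "v r < v j" using cover_less[OF 1 jc(1) v jc(2)] .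
    have no: "\<not> (\<exists>m. r < m \<and> m < j \<and> v r < v m \<and> v m < v j)" using cover_iff[OF 1 jc(1) v less] jc by blast
    \<comment> \<open>Inside the window no j > r other than s is possible: before s the value is
      below \<open>f s\<close>, and beyond s the position s is an intermediate point.\<close>
    have "\<gamma> < 0"
    proof (rule ccontr)
      assume "\<not> \<gamma> < 0"
      have "j \<le> int n" using g \<open>\<not> \<gamma> < 0\<close> by (smt (verit) mult_nonneg_nonneg of_nat_0_le_iff)
      consider "j < s" | "s < j" using j(2) by linarith
      then show False
      proof cases
        case lt: 1
        then have "v j = f j" using vo[of j] 1 F(1-3) by simp
        moreover have "f j < f s" using F(6)[of j s] 1 lt F(1-3) by simp
        ultimately show False using less vr by simp
      next
        case 2
        then have "v j = f j" using vo[of j] 1 F(1-3) \<open>j \<le> int n\<close> by simp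
        moreover have "f r < f j" using F(7)[of j] 2 \<open>j \<le> int n\<close> by simp
        ultimately have "r < s \<and> s < j \<and> v r < v s \<and> v s < v j" using 2 F(2,4) vr by simp
        then show False using no by blast
      qed
    qed
    then have "2 * (v j - v r) * ((- \<gamma>) * int n) > 0" using less n_pos by (intro mult_pos_pos) auto
    then show ?thesis using er unfolding v_def[symmetric] by linarith
  next
    case 2
    have jc': "\<not> cg j r" "len (v \<circ> tr j r) = len v + 1" using jc unfolding tr_commute[of j r] by (auto simp: cong_sym_eq)
    have less: "v j < v r" using cover_less[OF 2 jc'(1) v jc'(2)] .
    show ?thesis
    proof (cases "\<gamma> > 0")
      case True
      then have "2 * (v j - v r) * ((- \<gamma>) * int n) > 0" using less n_pos by (intro mult_neg_neg) auto
      then show ?thesis using er unfolding v_def[symmetric] by linarith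
    next
      case False
      then have "\<gamma> * int n \<le> 0" by (simp add: mult_nonpos_nonneg)
      then have j1: "1 \<le> j" using g by linarith
      have "\<gamma> = 0" using window_shift_unique[of j \<gamma>] g j1 2 F(1-3) by simp
      then have e: "energy (v \<circ> tr r j) = energy f" using er by simp
      define w where "w = v \<circ> tr r j"
      have wr: "w r = v j" "w j = f s" using tr_at0[OF jc(1)] vr by (auto simp: w_def)
      have wo: "w i = v i" if "1 \<le> i" "i \<le> int n" "i \<noteq> r" "i \<noteq> j" for i
      proof -
        have "\<not> cg i r" "\<not> cg i j" using that F(1-3) j1 2 window_not_cg[of i r] window_not_cg[of r i] window_not_cg[of i j] window_not_cg[of j i]
          by (auto simp: cong_sym_eq linorder_neq_iff)
        then show ?thesis by (simp add: w_def tr_other)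
      qed
      have ws: "w s = f r" using wo[of s] F(1-3) 2 vr by simp
      have wi: "w i = f i" if "r < i" "i \<le> int n" "i \<noteq> s" for i using wo[of i] vo[of i] that F(1-3) 2 by simp
      \<comment> \<open>The new value at r lies below \<open>f s\<close>, and position s regains
        \<open>f r\<close>. So no inversion starts to the right of r, and none pairs r with a
        position from s on.\<close>
      have "invcode w < invcode f"
      proof (rule invcode_less[OF m])
        fix r' s' assume "(r', s') \<in> window_inversions n w"
        then have h: "1 \<le> r'" "r' < s'" "s' \<le> int n" "w r' > w s'" by (auto simp: window_inversions_def)
        have "r' \<le> r"
        proof (rule ccontr)
          assume r': "\<not> r' \<le> r"
          have ord: "f r' < f s'" using F(6)[of r' s'] h r' by simp
          show False
          proof (cases "s' = s")
            case True
            then show False using h r' ws wi[of r'] ord F(4) by simp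
          next
            case s': False
            show False
            proof (cases "r' = s")
              case True then show False using ws wi[of s'] F(7)[of s'] h s' r' by simp
            next
              case False then show False using wi[of r'] wi[of s'] h s' r' ord by simp
            qed
          qed
        qed
        moreover have "s' < s" if "r' = r"
        proof (rule ccontr)
          assume s': "\<not> s' < s"
          show False
          proof (cases "s' = s")
            case True then show False using h that ws wr less vr F(4) by simp
          next
            case False
            then show False using h that s' wi[of s'] F(7)[of s'] F(2,4) wr less vr by simp
          qed
        qed
        ultimately show "r' < r \<or> r' = r \<and> s' < s" by linarith
      qed
      then show ?thesis using e unfolding v_def[symmetric] w_def by blast
    qed
  qed
qed

text \<open>Extremal counterexample: take one of largest energy and, among those, of smallest code.
  By \<open>child_measure\<close> every other term of the signed sum at
  \<open>f \<circ> tr r s\<close> vanishes, and so does the term of f. Finite support provides the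
  extremum.\<close>

lemma grassmannian_determines:
  fixes X :: "(int \<Rightarrow> int) \<Rightarrow> 'b::comm_ring_1"
  assumes D: "\<And>v r. aff v \<Longrightarrow> Dop r X v = 0" and fin: "finite {w. aff w \<and> X w \<noteq> 0}"
    and G: "\<And>w. aff w \<Longrightarrow> window_inversions n w = {} \<Longrightarrow> X w = 0" and w: "aff w"
  shows "X w = 0"
proof (rule ccontr)
  assume nz: "X w \<noteq> 0"
  let ?S = "{w. aff w \<and> X w \<noteq> 0}"
  define M where "M = Max (energy ` ?S)"
  have ne: "?S \<noteq> {}" using nz w by blast
  have "M \<in> energy ` ?S" unfolding M_def using fin ne by (intro Max_in) auto
  then have ne2: "{w \<in> ?S. energy w = M} \<noteq> {}" by auto
  have fin2: "finite {w \<in> ?S. energy w = M}" by (rule finite_subset[OF _ fin]) auto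
  define c where "c = Min (invcode ` {w \<in> ?S. energy w = M})"
  have "c \<in> invcode ` {w \<in> ?S. energy w = M}" unfolding c_def using ne2 by (intro Min_in finite_imageI[OF fin2]) simp
  then obtain f where f: "aff f" "X f \<noteq> 0" "energy f = M" "invcode f = c" by auto
  have eM: "energy h \<le> M" if "aff h" "X h \<noteq> 0" for h
    unfolding M_def by (rule Max_ge) (use that fin in auto)
  have cM: "c \<le> invcode h" if "aff h" "X h \<noteq> 0" "energy h = M" for h
    unfolding c_def by (rule Min_le[OF finite_imageI[OF fin2]]) (use that in auto)
  have "window_inversions n f \<noteq> {}" using G f by blast
  then obtain r s where m: "is_max_inversion n f r s" using max_inversion_exists by blast
  note F = max_inv_facts[OF f(1) m]
  let ?v = "f \<circ> tr r s"
  have v: "aff ?v" using f aff_comp aff_tr by blast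
  have z: "X (?v \<circ> tr r j) = 0" if "j \<in> Cov ?v r" "j \<noteq> s" for j
  proof (rule ccontr)
    assume nz: "X (?v \<circ> tr r j) \<noteq> 0"
    have a: "aff (?v \<circ> tr r j)" using v aff_comp aff_tr by blast
    show False using child_measure[OF f(1) m that] eM[OF a nz] cM[OF a nz] f by linarith
  qed
  have "Dop r X ?v = of_int (sgn (s - r)) * X (?v \<circ> tr r s) + (\<Sum>j\<in>Cov ?v r - {s}. of_int (sgn (j - r)) * X (?v \<circ> tr r j))"
    unfolding Dop_def by (rule sum.remove) (use finite_Cov[OF v] F in auto)
  also have "(\<Sum>j\<in>Cov ?v r - {s}. of_int (sgn (j - r)) * X (?v \<circ> tr r j)) = 0"
    by (intro sum.neutral) (auto simp: z)
  finally have "0 = of_int (sgn (s - r)) * X f" unfolding D[OF v] F(9) by simp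
  then have "X f = 0" using F(2) by simp
  then show False using f by blast
qed

text \<open>\<open>Cf as w\<close> is the coefficient of \<open>w\<close> in the product of the cyclically decreasing sums of lengths \<open>as\<close>.\<close>

primrec Cf :: "nat list \<Rightarrow> (int \<Rightarrow> int) \<Rightarrow> int" where
  "Cf [] = (\<lambda>w. of_bool (w = id))"
| "Cf (a # as) = Lop a (Cf as)"

lemma Dop_Cf: "aff v \<Longrightarrow> Dop r (Cf as) v = 0"
proof (induction as arbitrary: v)
  case Nil
  have "v \<circ> tr r j \<noteq> id" if "j \<in> Cov v r" for j
    using that len_id by (auto simp: Cov_def)
  then show ?case by (auto simp: Dop_def intro!: sum.neutral)
next
  case (Cons a as)
  have "Dop r (Cf (a # as)) v = Lop a (Dop r (Cf as)) v" using Dop_Lop[OF Cons(2)] by simp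
  also have "\<dots> = Lop a (\<lambda>_. 0) v" using Cons by (intro Lop_cong) auto
  also have "\<dots> = 0" by (simp add: Lop_def UJ_def)
  finally show ?case .
qed

text \<open>No length condition appears: the functions that use it impose
  \<open>len w = a + b\<close>, which makes the factorization length additive.\<close>

definition PP :: "nat \<Rightarrow> nat \<Rightarrow> (int \<Rightarrow> int) \<Rightarrow> (nat set \<times> nat set) set" where
  "PP a b w = {(J, K). proper J \<and> card J = a \<and> proper K \<and> card K = b \<and> cd J \<circ> cd K = w}"

lemma UJ_delta:
  assumes "proper K" "aff u" shows "UJ K (\<lambda>w. of_bool (w = id)) u = (of_bool (u = cd K) :: int)"
proof -
  have "iv (cd K) \<circ> u = id \<longleftrightarrow> u = cd K"
    using aff_cd[OF assms(1)] aff_inv_comp2(2)[of "cd K" u] aff_inv_comp(1)[of "cd K"] by (metis comp_id)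
  then show ?thesis using len_cd[OF assms(1)] len_id aff_inv_comp(1)[OF aff_cd[OF assms(1)]]
    by (auto simp: UJ_def)
qed

lemma finite_sets: "finite {J. proper J \<and> card J = m}"
  by (rule finite_subset[of _ "Pow {..<n}"]) auto

lemma Cf_pair:
  assumes w: "aff w" shows "Cf [a, b] w = (if len w = a + b then int (card (PP a b w)) else 0)"
proof -
  let ?A = "\<lambda>a. {J. proper J \<and> card J = a}"
  have fPP: "PP a b w \<subseteq> ?A a \<times> ?A b" by (auto simp: PP_def)
  have "Cf [a, b] w = (\<Sum>J\<in>?A a. UJ J (Cf [b]) w)" by (simp add: Lop_def)
  also have "\<dots> = (\<Sum>J\<in>?A a. \<Sum>K\<in>?A b. of_bool (len w = a + b \<and> (J, K) \<in> PP a b w))"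
  proof (rule sum.cong[OF refl])
    fix J assume "J \<in> ?A a"
    then have J: "proper J" "card J = a" by auto
    have u: "aff (iv (cd J) \<circ> w)" using J w aff_comp aff_inv aff_cd by blast
    have "Cf [b] (iv (cd J) \<circ> w) = (\<Sum>K\<in>?A b. of_bool (iv (cd J) \<circ> w = cd K))"
      using u by (auto simp: Lop_def UJ_delta simp del: comp_apply intro!: sum.cong)
    moreover have "iv (cd J) \<circ> w = cd K \<longleftrightarrow> cd J \<circ> cd K = w" for K
      using aff_cd[OF J(1)] by (metis aff_inv_comp2)
    ultimately have c: "Cf [b] (iv (cd J) \<circ> w) = (\<Sum>K\<in>?A b. of_bool (cd J \<circ> cd K = w))" by simp
    have l: "len (iv (cd J) \<circ> w) = b" if "cd J \<circ> cd K = w" "proper K" "card K = b" for K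
      using that aff_cd[OF J(1)] len_cd by (metis aff_inv_comp2(1))
    have "UJ J (Cf [b]) w = (\<Sum>K\<in>?A b. if len (iv (cd J) \<circ> w) + a = len w then of_bool (cd J \<circ> cd K = w) else 0)"
      unfolding UJ_def using J c by simp
    also have "\<dots> = (\<Sum>K\<in>?A b. of_bool (len w = a + b \<and> (J, K) \<in> PP a b w))"
    proof (rule sum.cong[OF refl])
      fix K assume "K \<in> ?A b"
      then have K: "proper K" "card K = b" by auto
      show "(if len (iv (cd J) \<circ> w) + a = len w then of_bool (cd J \<circ> cd K = w) else 0) = (of_bool (len w = a + b \<and> (J, K) \<in> PP a b w) :: int)"
        using l[OF _ K] J K by (auto simp: PP_def simp del: comp_apply)
    qed
    finally show "UJ J (Cf [b]) w = (\<Sum>K\<in>?A b. of_bool (len w = a + b \<and> (J, K) \<in> PP a b w))" .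
  qed
  also have "\<dots> = (\<Sum>p\<in>?A a \<times> ?A b. of_bool (len w = a + b \<and> p \<in> PP a b w))"
    by (simp add: sum.cartesian_product case_prod_unfold)
  also have "\<dots> = (if len w = a + b then int (card (PP a b w)) else 0)"
  proof -
    have "(\<Sum>p\<in>?A a \<times> ?A b. of_bool (p \<in> PP a b w)) = int (card (PP a b w))"
      using fPP finite_sets by (simp add: of_bool_def sum.If_cases Int_absorb1)
    then show ?thesis by simp
  qed
  finally show ?thesis .
qed

section \<open>Shapes of the two factors of a Grassmannian element\<close>

lemma sr_reversal:
  assumes n2: "2 \<le> n" and "x < y" "sr j x > sr j y"
  shows "\<exists>c. x = j + c * int n \<and> y = j + 1 + c * int n"
proof -
  have nc: "\<not> cg j (j + 1)" using not_cg_Suc[OF n2] .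
  have jj: "j < j + 1" by simp
  show ?thesis
  proof (rule tr_reversal[OF jj nc assms(2,3)])
    fix c d assume h: "x = j + c * int n" "y = j + 1 + d * int n" "j + d * int n < j + 1 + c * int n"
    then have "c * int n = d * int n" using assms(2) by linarith
    then show ?thesis using h by auto
  qed (use assms(2) in auto)
qed

text \<open>A simple reflection undoes only an inversion with values congruent to c and c + 1 and
  adjacent; it would then shorten the product, contrary to additivity.\<close>

lemma inversion_mono:
  assumes "proper J" "aff y" "len (cd J \<circ> y) = card J + len y" "i < j" "y i > y j"
  shows "cd J (y i) > cd J (y j)"
  using assms(1,3)
proof (induction rule: proper_induct)
  case empty then show ?case using assms by (simp add: cd_empty)
next
  case (insert c K)
  have PK: "proper K" using insert by blast
  have n2: "2 \<le> n" using proper_two insert by blast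
  define z where "z = cd K \<circ> y"
  have z: "aff z" using aff_cd[OF PK] assms aff_comp by (simp add: z_def)
  have e: "cd (insert c K) \<circ> y = sr (int c) \<circ> z" using cd_insert[OF insert(1-4)] by (simp add: z_def comp_assoc)
  have card: "card (insert c K) = card K + 1" using insert finite_proper[OF PK] by simp
  have l: "len (cd K \<circ> y) \<le> card K + len y" using len_cd_comp[OF PK assms(2)] by blast
  have "len (sr (int c) \<circ> z) \<le> len z + 1" using len_sr_bounds[OF z] by blast
  then have l2: "len z = card K + len y" "len (sr (int c) \<circ> z) = len z + 1"
    using insert(6) l unfolding e card z_def by linarith+
  have gt: "z i > z j" using insert(5)[OF l2(1)[unfolded z_def]] by (simp add: z_def)
  have up: "iv z (int c) < iv z (int c + 1)" by (rule len_sr_cases[OF n2 z, of "int c"]) (use l2 in auto)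
  have "sr (int c) (z i) > sr (int c) (z j)"
  proof (rule ccontr)
    assume "\<not> ?thesis"
    then have "sr (int c) (z j) > sr (int c) (z i)"
      using aff_inj[OF aff_tr, of "int c" "int c + 1" "z i" "z j"] gt by linarith
    then obtain d where d: "z j = int c + d * int n" "z i = int c + 1 + d * int n"
      using sr_reversal[OF n2 gt] by blast
    have "j = iv z (int c) + d * int n" "i = iv z (int c + 1) + d * int n"
      using d aff_inv_f[OF z] aff_shift[OF aff_inv[OF z]] by metis+
    then show False using up assms(4) by simp
  qed
  then show ?case using e by (metis comp_apply)
qed

text \<open>The j consecutive residues -1, 0, ..., j - 2.\<close>

definition As :: "nat \<Rightarrow> nat set" where "As j = (if j = 0 then {} else insert (n - 1) {..<j - 1})"

lemma As_props: assumes "j < n" shows "card (As j) = j" "As j \<subseteq> {..<n}"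
  using assms by (auto simp: As_def)

lemma As_disjoint: assumes "j \<le> b" "p < n" shows "As j \<inter> {b..<p} = {}"
  using assms by (auto simp: As_def)

lemma proper_As: assumes "j \<le> b" "b \<le> p" "p < n" shows "proper (As j \<union> {b..<p})" "card (As j \<union> {b..<p}) = j + (p - b)"
proof -
  have "j < n" using assms by simp
  then show c: "card (As j \<union> {b..<p}) = j + (p - b)"
    using As_disjoint[OF assms(1,3)] As_props[of j] finite_subset[of "As j" "{..<n}"] by (subst card_Un_disjoint) auto
  show "proper (As j \<union> {b..<p})" unfolding proper_iff using c As_props[OF \<open>j < n\<close>] assms by auto
qed

text \<open>Moving the block from b to p - 1 into the right factor yields an expression free of b.
  Two values of b can thus be compared, which is how the factor sizes get exchanged.\<close>

lemma cd_As:
  assumes "j \<le> b" "b \<le> p" "p < n"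
  shows "cd (As j \<union> {b..<p}) \<circ> cd {..<b} = cd (As j) \<circ> cd {..<p}"
proof -
  have P: "proper (As j \<union> {b..<p})" using proper_As(1)[OF assms] .
  have m: "mem S (int c + 1) \<longleftrightarrow> c + 1 \<in> S" if "c + 1 < n" for c S
    using mem_nat[OF that, of S] by (simp add: add.commute)
  have 1: "cd (As j \<union> {b..<p}) = cd (As j) \<circ> cd {b..<p}"
  proof (rule cd_union)
    show "proper (As j)" using P by blast
    fix c assume c: "c \<in> As j"
    show "\<not> mem {b..<p} (int c + 1)"
    proof (cases "c = n - 1")
      \<comment> \<open>Only the wrap from n - 1 to 0 needs care: \<open>As j\<close> is nonempty
        here, so 0 < j <= b and 0 is outside the block.\<close>
      case True
      then have "int c + 1 = 0 + 1 * int n" using n_pos by simp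
      then have "mem {b..<p} (int c + 1) \<longleftrightarrow> mem {b..<p} (int 0)" using mem_shift[of "{b..<p}" 0 1] by simp
      also have "\<dots> \<longleftrightarrow> 0 \<in> {b..<p}" by (rule mem_nat) (use n_pos in simp)
      finally show ?thesis using c assms by (auto simp: As_def split: if_splits)
    next
      case False
      then have "c < j - 1" using c by (auto simp: As_def split: if_splits)
      then show ?thesis using m[of c "{b..<p}"] assms by auto
    qed
  qed (use P As_disjoint assms in auto)
  have e: "{b..<p} \<union> {..<b} = {..<p}" using assms by auto
  have "cd ({b..<p} \<union> {..<b}) = cd {b..<p} \<circ> cd {..<b}"
  proof (rule cd_union)
    show "proper {b..<p}" using P by blast
    show "proper ({b..<p} \<union> {..<b})" unfolding e proper_iff using assms by auto
    fix c assume "c \<in> {b..<p}"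
    then show "\<not> mem {..<b} (int c + 1)" using m[of c "{..<b}"] assms by auto
  qed auto
  then show ?thesis using 1 e by (simp add: comp_assoc)
qed

text \<open>The start of a run jumps past everything in the run, whose other entries drop by one.
  This is the source of all inversions used below.\<close>

lemma cd_jump:
  assumes "proper J" "x < y" "\<not> mem J (x - 1)" "\<And>z. x \<le> z \<Longrightarrow> z < y \<Longrightarrow> mem J z"
  shows "cd J x > cd J y"
proof -
  have "cd J y = y - 1" using assms by (simp add: cd_def)
  moreover have "cd J x = nxt J x" using assms by (simp add: cd_def)
  moreover have "nxt J x \<ge> y" using nxt_props(1,2)[OF assms(1), of x] assms(4) by (meson linorder_not_le)
  ultimately show ?thesis by linarith
qed

text \<open>A run of K starting at a residue other than 0 inverts two adjacent window positions, and
  that inversion persists in the product. A run starting at 0 makes its jump at the last window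
  position, where it does no harm.\<close>

lemma grassmannian_right_factor:
  assumes J: "proper J" and K: "proper K" and g: "len (cd J \<circ> cd K) = card J + card K"
    "window_inversions n (cd J \<circ> cd K) = {}"
  shows "K = {..<card K}"
proof (rule nat_down_closed[OF finite_proper[OF K]])
  fix i assume i: "Suc i \<in> K"
  show "i \<in> K"
  proof (rule ccontr)
    assume "i \<notin> K"
    have sn: "Suc i < n" using i K by auto
    have "\<not> mem K (int (Suc i) - 1)" using \<open>i \<notin> K\<close> mem_nat[of i K] sn by simp
    moreover have "mem K (int (Suc i))" using i mem_nat[OF sn] by blast
    moreover have "z = int (Suc i)" if "int (Suc i) \<le> z" "z < int (Suc i) + 1" for z using that by linarith
    ultimately have "cd K (int (Suc i)) > cd K (int (Suc i) + 1)"
      by (intro cd_jump[OF K]) (simp, blast, metis)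
    then have "cd J (cd K (int (Suc i))) > cd J (cd K (int (Suc i) + 1))"
      using inversion_mono[OF J aff_cd[OF K]] g(1) len_cd[OF K] by simp
    then have "(int (Suc i), int (Suc i) + 1) \<in> window_inversions n (cd J \<circ> cd K)"
      using sn by (simp add: window_inversions_def)
    then show False using g by blast
  qed
qed

end

section \<open>Commutation of the cyclically decreasing sums\<close>

context affine_window begin

lemma mem_lessThan_iff: "mem {..<b} x \<longleftrightarrow> x mod int n < int b"
  using n_pos by (auto simp: mem_def nat_less_iff)

lemma cd_initial:
  assumes "b < n"
  shows "\<And>x. 1 \<le> x \<Longrightarrow> x \<le> int b \<Longrightarrow> cd {..<b} x = x - 1"
    and "\<And>x. int b < x \<Longrightarrow> x < int n \<Longrightarrow> cd {..<b} x = x"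
    and "cd {..<b} (int n) = int n + int b"
proof -
  have P: "proper {..<b}" unfolding proper_iff using assms by auto
  show "cd {..<b} x = x - 1" if "1 \<le> x" "x \<le> int b" for x
    using that assms by (simp add: cd_def mem_lessThan_iff)
  show "cd {..<b} x = x" if "int b < x" "x < int n" for x
  proof -
    have "\<not> mem {..<b} (x - 1)" "\<not> mem {..<b} x" using that by (auto simp: mem_lessThan_iff)
    then show ?thesis using nxt_self[OF P] by (simp add: cd_def)
  qed
  have nm: "(int n - 1) mod int n = int n - 1" using n_pos by (intro mod_pos_pos_trivial) auto
  have "\<not> mem {..<b} (int n - 1)" unfolding mem_lessThan_iff nm using assms by simp
  moreover have "nxt {..<b} (int n) = int n + int b"
  proof (rule nxt_eqI[OF P])
    show "\<not> mem {..<b} (int n + int b)" using assms by (simp add: mem_lessThan_iff)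
    fix y assume y: "int n \<le> y" "y < int n + int b"
    have "y mod int n = (y - int n) mod int n" by simp
    also have "\<dots> = y - int n" using y assms by (intro mod_pos_pos_trivial) auto
    finally show "mem {..<b} y" using y by (simp add: mem_lessThan_iff)
  qed simp
  ultimately show "cd {..<b} (int n) = int n + int b" by (simp add: cd_def)
qed

lemma mem_descend:
  assumes "\<And>x. lo < x \<Longrightarrow> x \<le> hi \<Longrightarrow> mem J x \<Longrightarrow> mem J (x - 1)" "mem J y" "y \<le> hi" "lo \<le> x" "x \<le> y"
  shows "mem J x"
proof -
  have "mem J (y - int d)" if "y - int d \<ge> lo" for d using that
  proof (induction d)
    case 0 then show ?case using assms by simp
  next
    case (Suc d)
    then have "mem J (y - int d)" by simp
    then have "mem J (y - int d - 1)" using assms(1)[of "y - int d"] Suc(2) assms(3) by simp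
    then show ?case by (simp add: algebra_simps)
  qed
  from this[of "nat (y - x)"] show ?thesis using assms by simp
qed

text \<open>After the right factor, adjacent window positions mostly carry adjacent values. The
  absence of descents then makes J downward closed on the two ranges from -1 to b - 2 and from b to
  n - 2, and b - 1 is excluded separately.\<close>

lemma grassmannian_left_factor:
  assumes J: "proper J" and b: "0 < b" "b < n"
    and g: "len (cd J \<circ> cd {..<b}) = card J + b" "window_inversions n (cd J \<circ> cd {..<b}) = {}"
  obtains j p where "j \<le> b" "b \<le> p" "p < n" "J = As j \<union> {b..<p}"
proof -
  let ?b = "int b" and ?n = "int n"
  have PK: "proper {..<b}" unfolding proper_iff using b by auto
  have step: "\<not> cd J (cd {..<b} i) > cd J (cd {..<b} (i + 1))" if "1 \<le> i" "i < ?n" for i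
    using g(2) that by (auto simp: window_inversions_def)
  note K = cd_initial[OF b(2)]
  have adj: "mem J (x - 1)" if "mem J x" "\<not> cd J x > cd J (x + 1)" for x
  proof (rule ccontr)
    assume h: "\<not> mem J (x - 1)"
    have "z = x" if "x \<le> z" "z < x + 1" for z using that by linarith
    then show False using cd_jump[OF J _ h, of "x + 1"] that by (metis less_add_one)
  qed
  \<comment> \<open>Positions x + 1 and x + 2 carry the values x and x + 1, so a run of J starting
    at x would be a descent.\<close>
  have c1: "mem J (x - 1)" if "-1 < x" "x \<le> ?b - 2" "mem J x" for x
    using adj[OF that(3)] step[of "x + 1"] K(1)[of "x + 1"] K(1)[of "x + 2"] that b by (simp add: add.commute)
  have c3: "mem J (x - 1)" if "?b < x" "x \<le> ?n - 2" "mem J x" for x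
    using adj[OF that(3)] step[of x] K(2)[of x] K(2)[of "x + 1"] that b by simp
  have per: "mem J (x + ?n) = mem J x" for x using mem_shift[of J x 1] by simp
  \<comment> \<open>If b - 2 is absent, a factor s_{b-1} at the right of \<open>cd J\<close> cancels
    against the left end of \<open>cd {..<b}\<close>, contradicting additivity. If it is present, J
    is forced to contain every residue.\<close>
  have b1: "\<not> mem J (?b - 1)"
  proof
    assume m: "mem J (?b - 1)"
    show False
    proof (cases "mem J (?b - 2)")
      case False
      have bJ: "b - 1 \<in> J" using m mem_nat[of "b - 1" J] b by (simp add: of_nat_diff)
      define A where "A = J - {b - 1}"
      have JA: "J = A \<union> {b - 1}" "A \<inter> {b - 1} = {}" using bJ by (auto simp: A_def)
      have PA: "proper A" using J by (auto simp: A_def)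
      have s: "cd {b - 1} = sr (?b - 1)"
      proof -
        have "proper (insert (b - 1) {})" using proper_mono[OF J, of "insert (b - 1) {}"] bJ by simp
        then have "cd {b - 1} = sr (int (b - 1)) \<circ> cd {}" using b by (intro cd_insert) auto
        then show ?thesis using b by (simp add: cd_empty of_nat_diff)
      qed
      have "cd (A \<union> {b - 1}) = cd A \<circ> cd {b - 1}"
      proof (rule cd_union[OF PA _ JA(2)])
        show "proper (A \<union> {b - 1})" using J JA by simp
        fix a assume a: "a \<in> A"
        show "\<not> mem {b - 1} (int a + 1)"
        proof
          assume "mem {b - 1} (int a + 1)"
          then have "cg (int a + 1) (int (b - 1))" using b cg_nat_eq[of "b - 1" "int a + 1"] by (simp add: mem_def)
          then have "cg (int a) (?b - 2)"
            using b cong_diff[of "int a + 1" "int (b - 1)" ?n 1 1] by (simp add: of_nat_diff)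
          moreover have "mem J (int a)" using a J mem_nat by (auto simp: A_def)
          ultimately show False using False mem_cg by blast
        qed
      qed
      moreover have "cd {..<b} = sr (?b - 1) \<circ> cd {..<b - 1}"
      proof -
        have i: "{..<b} = insert (b - 1) {..<b - 1}" using b by auto
        have "cd (insert (b - 1) {..<b - 1}) = sr (int (b - 1)) \<circ> cd {..<b - 1}"
        proof (rule cd_insert)
          show "proper (insert (b - 1) {..<b - 1})" using PK i by simp
          show "\<not> mem {..<b - 1} (int (b - 1) + 1)" using b by (simp add: mem_lessThan_iff)
        qed (use b in auto)
        then show ?thesis using i b by (simp add: of_nat_diff)
      qed
      ultimately have "cd J \<circ> cd {..<b} = cd A \<circ> cd {..<b - 1}"
        using JA(1) s by (metis comp_assoc tr_invol2(1))
      moreover have "len (cd A \<circ> cd {..<b - 1}) \<le> card A + (b - 1)"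
      proof -
        have P1: "proper {..<b - 1}" unfolding proper_iff using b by auto
        then show ?thesis using len_cd_comp[OF PA aff_cd[OF P1]] len_cd[OF P1] by simp
      qed
      moreover have "card A < card J" using bJ finite_proper[OF J] unfolding A_def by (rule card_Diff1_less[rotated])
      ultimately show False using g(1) by simp
    next
      case True
      have low: "mem J x" if "-1 \<le> x" "x \<le> ?b - 1" for x
        using mem_descend[of "-1" "?b - 2" J "?b - 2" x] c1 True that m by (cases "x = ?b - 1") auto
      have all: "mem J x" if "-1 \<le> x" "x \<le> ?n - 2" for x
      proof (cases "x \<le> ?b - 1")
        case True then show ?thesis using low that by simp
      next
        case False
        then have bn: "b + 2 \<le> n" using that by simp
        \<comment> \<open>Otherwise the run of J starting at n - 1 reaches beyond n + b - 1 and
          produces a descent at the last two window positions, whose values are n - 1 and n +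
          b.\<close>
        have "mem J (?n - 2)"
        proof (rule ccontr)
          assume h: "\<not> mem J (?n - 2)"
          have "cd J (?n - 1) > cd J (?n + ?b)"
          proof (rule cd_jump[OF J])
            show "\<not> mem J (?n - 1 - 1)" using h by simp
            fix z assume "?n - 1 \<le> z" "z < ?n + ?b"
            then have "mem J (z - ?n)" using low by simp
            then show "mem J z" using per[of "z - ?n"] by simp
          qed simp
          moreover have "cd {..<b} (?n - 1) = ?n - 1" using K(2)[of "?n - 1"] bn by simp
          ultimately show False using step[of "?n - 1"] K(3) bn by simp
        qed
        then show ?thesis using mem_descend[of ?b "?n - 2" J "?n - 2" x] c3 that False by simp
      qed
      obtain d where d: "d < n" "\<not> mem J (-1 + int d)" using ex_nonmem[OF J] by blast
      then show False using all[of "-1 + int d"] by simp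
    qed
  qed
  define p1 where "p1 = nxt J (-1)"
  note N1 = nxt_props[OF J, of "-1", folded p1_def]
  have p1b: "p1 \<le> ?b - 1" using N1(3)[of "?b - 1"] b1 b by force
  have m1: "mem J x \<longleftrightarrow> x < p1" if "-1 \<le> x" "x \<le> ?b - 1" for x
  proof
    assume mx: "mem J x"
    show "x < p1"
    proof (rule ccontr)
      assume "\<not> x < p1"
      moreover have "x \<noteq> ?b - 1" using mx b1 by auto
      ultimately have "mem J p1" using mem_descend[of "-1" "?b - 2" J x p1] c1 mx N1(1) that by simp
      then show False using N1 by blast
    qed
  qed (use N1(3) that in auto)
  \<comment> \<open>Capped at n - 1, because that residue is already accounted for as -1.\<close>
  define p2 where "p2 = min (nxt J ?b) (?n - 1)"
  note N2 = nxt_props[OF J, of ?b]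
  have m2: "mem J x \<longleftrightarrow> x < p2" if "?b \<le> x" "x \<le> ?n - 2" for x
  proof
    assume mx: "mem J x"
    have "x < nxt J ?b"
    proof (rule ccontr)
      assume "\<not> x < nxt J ?b"
      then have "mem J (nxt J ?b)" using mem_descend[of ?b "?n - 2" J x "nxt J ?b"] c3 mx N2(1) that by simp
      then show False using N2 by blast
    qed
    then show "x < p2" using that by (simp add: p2_def)
  qed (use N2(3) that in \<open>auto simp: p2_def\<close>)
  define j p where "j = nat (p1 + 1)" and "p = nat p2"
  have jj: "int j = p1 + 1" using N1(1) by (simp add: j_def)
  have pp: "int p = p2" "?b \<le> p2" "p2 \<le> ?n - 1" using N2(1) b by (auto simp: p_def p2_def)
  have 1: "j \<le> b" "b \<le> p" "p < n" using jj pp p1b by linarith+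
  have "J = As j \<union> {b..<p}"
  proof -
    have "x \<in> J \<longleftrightarrow> x \<in> As j \<union> {b..<p}" if x: "x < n" for x
    proof -
    have xJ: "x \<in> J \<longleftrightarrow> mem J (int x)" using mem_nat[OF x, of J] by simp
    show ?thesis
    proof (cases "x = n - 1")
      case True
      have "mem J (int x) \<longleftrightarrow> mem J (-1)" using per[of "-1"] True n_pos by (simp add: of_nat_diff)
      then have "x \<in> J \<longleftrightarrow> -1 < p1" using xJ m1[of "-1"] b by simp
      also have "\<dots> \<longleftrightarrow> 0 < j" using jj by linarith
      finally have "x \<in> J \<longleftrightarrow> 0 < j" .
      then show ?thesis using True 1 by (auto simp: As_def)
    next
      case False
      show ?thesis
      proof (cases "x < b")
        case True
        then have "x \<in> J \<longleftrightarrow> int x < p1" using xJ m1[of "int x"] by simp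
        also have "\<dots> \<longleftrightarrow> x + 1 < j" using jj by linarith
        finally have "x \<in> J \<longleftrightarrow> x + 1 < j" .
        then show ?thesis using True False by (auto simp: As_def)
      next
        case f2: False
        then have "?b \<le> int x" "int x \<le> ?n - 2" using False x by linarith+
        then have "x \<in> J \<longleftrightarrow> int x < p2" using xJ m2[of "int x"] by simp
        also have "\<dots> \<longleftrightarrow> x < p" using pp(1) by linarith
        finally have "x \<in> J \<longleftrightarrow> x < p" .
        moreover have "x \<notin> As j" using f2 False 1 by (auto simp: As_def)
        ultimately show ?thesis using f2 by auto
      qed
    qed
    qed
    moreover have "As j \<union> {b..<p} \<subseteq> {..<n}" using proper_As(1)[OF 1] by blast
    ultimately show ?thesis using J by blast
  qed
  then show ?thesis using that 1 by blast
qed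

text \<open>In the normal form a = j + (p - b). Keeping j and p and replacing b by a gives the
  swapped sizes, and \<open>cd_As\<close> shows that the product is unchanged. The case b = 0 is
  treated apart since the shape of the left factor needs a nonempty right factor.\<close>

lemma grassmannian_pair_swap:
  assumes g: "window_inversions n g = {}" "len g = a + b" and ne: "PP a b g \<noteq> {}"
  shows "PP b a g \<noteq> {}"
proof -
  obtain J K where JK: "proper J" "card J = a" "proper K" "card K = b" "cd J \<circ> cd K = g"
    using ne by (auto simp: PP_def simp del: comp_apply)
  have K: "K = {..<b}" using grassmannian_right_factor[OF JK(1,3)] JK g by simp
  show ?thesis
  proof (cases "b = 0")
    case True
    then have "K = {}" using K by simp
    then have "({}, J) \<in> PP b a g" using JK True cd_empty proper_empty by (simp add: PP_def)
    then show ?thesis by blast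
  next
    case False
    have bn: "b < n" using JK card_proper by blast
    obtain j p where jp: "j \<le> b" "b \<le> p" "p < n" "J = As j \<union> {b..<p}"
    proof (rule grassmannian_left_factor[OF JK(1) _ bn])
      show "0 < b" using False by simp
      show "len (cd J \<circ> cd {..<b}) = card J + b" using JK g K by metis
      show "window_inversions n (cd J \<circ> cd {..<b}) = {}" using JK g K by metis
    qed blast
    have a: "a = j + (p - b)" using proper_As(2)[OF jp(1-3)] jp(4) JK(2) by simp
    then have ja: "j \<le> a" "a \<le> p" "j + (p - a) = b" using jp by auto
    have "cd (As j \<union> {a..<p}) \<circ> cd {..<a} = g"
      using cd_As[OF ja(1,2) jp(3)] cd_As[OF jp(1-3)] JK K jp by metis
    moreover have "proper {..<a}" unfolding proper_iff using JK(2) card_proper[OF JK(1)] by simp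
    ultimately have "(As j \<union> {a..<p}, {..<a}) \<in> PP b a g"
      using proper_As[OF ja(1,2) jp(3)] ja by (simp add: PP_def)
    then show ?thesis by blast
  qed
qed

text \<open>The right factor is an initial segment, hence determined by its size, and the left
  factor follows by cancellation.\<close>

lemma grassmannian_pair_unique:
  assumes g: "window_inversions n g = {}" "len g = a + b" and p: "p \<in> PP a b g" "q \<in> PP a b g"
  shows "p = q"
proof -
  obtain J K where JK: "p = (J, K)" "proper J" "card J = a" "proper K" "card K = b" "cd J \<circ> cd K = g"
    using p by (auto simp: PP_def simp del: comp_apply)
  obtain J' K' where JK': "q = (J', K')" "proper J'" "card J' = a" "proper K'" "card K' = b" "cd J' \<circ> cd K' = g"
    using p by (auto simp: PP_def simp del: comp_apply)
  have "K = K'" using grassmannian_right_factor[OF JK(2,4)] grassmannian_right_factor[OF JK'(2,4)] JK JK' g by simp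
  moreover from this have "cd J = cd J'"
    using JK(6) JK'(6) aff_inv_comp(2)[OF aff_cd[OF JK(4)]] by (metis comp_assoc comp_id)
  then have "J = J'" using cd_inj JK JK' by blast
  ultimately show ?thesis using JK JK' by simp
qed

lemma card_le_oneI: "(\<And>p q. p \<in> A \<Longrightarrow> q \<in> A \<Longrightarrow> p = q) \<Longrightarrow> card A = of_bool (A \<noteq> {})"
proof (cases "A = {}")
  case False
  assume h: "\<And>p q. p \<in> A \<Longrightarrow> q \<in> A \<Longrightarrow> p = q"
  obtain p where "p \<in> A" using False by blast
  then have "A = {p}" using h by blast
  then show ?thesis by simp
qed simp

lemma Cf_commute_pair: assumes w: "aff w" shows "Cf [a, b] w = Cf [b, a] w"
proof -
  define X where "X = (\<lambda>w. Cf [a, b] w - Cf [b, a] w)"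
  have "X w = 0"
  proof (rule grassmannian_determines[OF _ _ _ w])
    fix v r assume v: "aff v"
    have "Dop r X v = Dop r (Cf [a, b]) v - Dop r (Cf [b, a]) v"
      by (simp add: Dop_def X_def sum_subtractf algebra_simps del: Cf.simps)
    then show "Dop r X v = 0" by (simp only: Dop_Cf[OF v] diff_self)
  next
    have "{w. aff w \<and> X w \<noteq> 0} \<subseteq> (\<lambda>(J, K). cd J \<circ> cd K) ` (Pow {..<n} \<times> Pow {..<n})"
    proof clarsimp
      fix w assume w: "aff w" "X w \<noteq> 0"
      then have "PP a b w \<noteq> {} \<or> PP b a w \<noteq> {}" unfolding X_def Cf_pair[OF w(1)] by (auto split: if_splits)
      then obtain J K where "(J, K) \<in> PP a b w \<or> (J, K) \<in> PP b a w" by (metis ex_in_conv surj_pair)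
      then have h: "proper J \<and> proper K \<and> cd J \<circ> cd K = w" by (simp only: PP_def mem_Collect_eq case_prod_conv) metis
      show "w \<in> (\<lambda>(J, K). cd J \<circ> cd K) ` (Pow {..<n} \<times> Pow {..<n})"
        by (rule image_eqI[of _ _ "(J, K)"]) (use h in \<open>auto simp del: comp_apply\<close>)
    qed
    then show "finite {w. aff w \<and> X w \<noteq> 0}" by (rule finite_subset) auto
  next
    fix g assume g: "aff g" "window_inversions n g = {}"
    show "X g = 0"
    proof (cases "len g = a + b")
      case True
      have "card (PP a b g) = of_bool (PP a b g \<noteq> {})"
        by (rule card_le_oneI) (use grassmannian_pair_unique[OF g(2) True] in blast)
      moreover have "card (PP b a g) = of_bool (PP b a g \<noteq> {})"
        by (rule card_le_oneI) (use grassmannian_pair_unique[OF g(2), of b a] True in auto)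
      moreover have "PP a b g \<noteq> {} \<longleftrightarrow> PP b a g \<noteq> {}"
        using grassmannian_pair_swap[OF g(2)] True by (metis add.commute)
      ultimately show ?thesis unfolding X_def Cf_pair[OF g(1)] by (simp add: add.commute)
    next
      case False then show ?thesis unfolding X_def Cf_pair[OF g(1)] by (simp add: add.commute)
    qed
  qed
  then show ?thesis by (simp add: X_def)
qed

lemma card_PP_commute: assumes "aff x" "len x = a + b" shows "card (PP a b x) = card (PP b a x)"
  using Cf_commute_pair[OF assms(1), of a b] Cf_pair[OF assms(1)] assms(2) by (simp add: add.commute del: Cf.simps)

text \<open>Grouping the pairs of factors by their product x leaves only the number of pairs as
  coefficient. This transfers commutation from the coefficient functions \<open>Cf\<close> to an
  arbitrary \<open>\<phi>\<close>.\<close>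

lemma Lop_pair:
  fixes \<phi> :: "(int \<Rightarrow> int) \<Rightarrow> 'b::comm_ring_1"
  assumes w: "aff w"
  defines "Xs \<equiv> (\<lambda>(J, K). cd J \<circ> cd K) ` ({J. proper J} \<times> {K. proper K})"
  shows "Lop a (Lop b \<phi>) w = (\<Sum>x | x \<in> Xs \<and> len (iv x \<circ> w) + (a + b) = len w \<and> len x = a + b.
     of_nat (card (PP a b x)) * \<phi> (iv x \<circ> w))"
proof -
  let ?A = "\<lambda>a. {J. proper J \<and> card J = a}"
  let ?Y = "{x. x \<in> Xs \<and> len (iv x \<circ> w) + (a + b) = len w \<and> len x = a + b}"
  let ?good = "\<lambda>x. len (iv x \<circ> w) + (a + b) = len w"
  have fin: "finite Xs" unfolding Xs_def
    by (rule finite_imageI, rule finite_subset[of _ "Pow {..<n} \<times> Pow {..<n}"]) auto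
  have "Lop a (Lop b \<phi>) w = (\<Sum>J\<in>?A a. \<Sum>K\<in>?A b. if ?good (cd J \<circ> cd K) then \<phi> (iv (cd J \<circ> cd K) \<circ> w) else 0)"
    unfolding Lop_def[of a]
  proof (rule sum.cong[OF refl])
    fix J assume "J \<in> ?A a"
    then have J: "proper J" "card J = a" by auto
    let ?u = "iv (cd J) \<circ> w"
    have u: "aff ?u" using J w aff_comp aff_inv aff_cd by blast
    have e: "iv (cd J \<circ> cd K) \<circ> w = iv (cd K) \<circ> ?u" if "proper K" for K
      using aff_inv_distrib[OF aff_cd[OF J(1)] aff_cd[OF that]] by (simp add: comp_assoc)
    have "UJ J (Lop b \<phi>) w = (\<Sum>K\<in>?A b. if len ?u + card J = len w then UJ K \<phi> ?u else 0)"
      unfolding UJ_def[of J] Lop_def by simp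
    also have "\<dots> = (\<Sum>K\<in>?A b. if ?good (cd J \<circ> cd K) then \<phi> (iv (cd J \<circ> cd K) \<circ> w) else 0)"
    proof (rule sum.cong[OF refl])
      fix K assume "K \<in> ?A b"
      then have K: "proper K" "card K = b" by auto
      show "(if len ?u + card J = len w then UJ K \<phi> ?u else 0) = (if ?good (cd J \<circ> cd K) then \<phi> (iv (cd J \<circ> cd K) \<circ> w) else 0)"
        unfolding e[OF K(1)] UJ_def using J K len_ivcd_comp[OF K(1) u] len_ivcd_comp[OF J(1) w] by auto
    qed
    finally show "UJ J (Lop b \<phi>) w = (\<Sum>K\<in>?A b. if ?good (cd J \<circ> cd K) then \<phi> (iv (cd J \<circ> cd K) \<circ> w) else 0)" .
  qed
  also have "\<dots> = (\<Sum>p\<in>?A a \<times> ?A b. if ?good (cd (fst p) \<circ> cd (snd p)) then \<phi> (iv (cd (fst p) \<circ> cd (snd p)) \<circ> w) else 0)"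
    by (simp add: sum.cartesian_product case_prod_unfold)
  also have "\<dots> = (\<Sum>p\<in>{p \<in> ?A a \<times> ?A b. ?good (cd (fst p) \<circ> cd (snd p))}. \<phi> (iv (cd (fst p) \<circ> cd (snd p)) \<circ> w))"
    using finite_sets by (intro sum.inter_filter[symmetric]) auto
  also have "\<dots> = (\<Sum>x\<in>?Y. \<Sum>p\<in>{p \<in> {p \<in> ?A a \<times> ?A b. ?good (cd (fst p) \<circ> cd (snd p))}. cd (fst p) \<circ> cd (snd p) = x}. \<phi> (iv (cd (fst p) \<circ> cd (snd p)) \<circ> w))"
  proof (rule sum.group[symmetric])
    show "finite {p \<in> ?A a \<times> ?A b. ?good (cd (fst p) \<circ> cd (snd p))}"
      using finite_sets by (intro finite_subset[OF _ finite_cartesian_product[OF finite_sets[of a] finite_sets[of b]]]) auto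
    show "finite ?Y" using fin by simp
    show "(\<lambda>p. cd (fst p) \<circ> cd (snd p)) ` {p \<in> ?A a \<times> ?A b. ?good (cd (fst p) \<circ> cd (snd p))} \<subseteq> ?Y"
    proof
      fix x assume "x \<in> (\<lambda>p. cd (fst p) \<circ> cd (snd p)) ` {p \<in> ?A a \<times> ?A b. ?good (cd (fst p) \<circ> cd (snd p))}"
      then obtain p where p: "p \<in> ?A a \<times> ?A b" "?good (cd (fst p) \<circ> cd (snd p))" "x = cd (fst p) \<circ> cd (snd p)" by blast
      define J K where "J = fst p" and "K = snd p"
      have h: "proper J" "card J = a" "proper K" "card K = b" "x = cd J \<circ> cd K" "?good x"
        using p unfolding J_def K_def by (simp_all add: mem_Times_iff)
      have x: "aff x" using h aff_comp aff_cd by blast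
      \<comment> \<open>Subadditivity forces the product x of the two factors to have its full
        length.\<close>
      have "len w \<le> len x + len (iv x \<circ> w)"
        using len_comp_le[OF x, of "iv x \<circ> w"] x w aff_inv aff_comp by (simp add: aff_inv_comp2)
      moreover have "len x \<le> a + b" using h len_cd_comp[OF h(1) aff_cd[OF h(3)]] len_cd[OF h(3)] by simp
      ultimately have "len x = a + b" using h(6) by simp
      moreover have "x \<in> Xs" unfolding Xs_def by (rule image_eqI[of _ _ "(J, K)"]) (use h in simp_all)
      ultimately show "x \<in> ?Y" using h by blast
    qed
  qed
  also have "\<dots> = (\<Sum>x\<in>?Y. of_nat (card (PP a b x)) * \<phi> (iv x \<circ> w))"
  proof (rule sum.cong[OF refl])
    fix x assume x: "x \<in> ?Y"
    have "{p \<in> {p \<in> ?A a \<times> ?A b. ?good (cd (fst p) \<circ> cd (snd p))}. cd (fst p) \<circ> cd (snd p) = x} = PP a b x"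
      using x by (auto simp: PP_def simp del: comp_apply)
    moreover have "(\<Sum>p\<in>PP a b x. \<phi> (iv (cd (fst p) \<circ> cd (snd p)) \<circ> w)) = (\<Sum>p\<in>PP a b x. \<phi> (iv x \<circ> w))"
      by (rule sum.cong[OF refl]) (auto simp: PP_def simp del: comp_apply)
    ultimately show "(\<Sum>p\<in>{p \<in> {p \<in> ?A a \<times> ?A b. ?good (cd (fst p) \<circ> cd (snd p))}. cd (fst p) \<circ> cd (snd p) = x}. \<phi> (iv (cd (fst p) \<circ> cd (snd p)) \<circ> w)) = of_nat (card (PP a b x)) * \<phi> (iv x \<circ> w)"
      by simp
  qed
  finally show ?thesis .
qed

lemma Lop_commute:
  fixes \<phi> :: "(int \<Rightarrow> int) \<Rightarrow> 'b::comm_ring_1"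
  assumes w: "aff w" shows "Lop a (Lop b \<phi>) w = Lop b (Lop a \<phi>) w"
  unfolding Lop_pair[OF w]
proof (rule sum.cong)
  fix x assume "x \<in> {x \<in> (\<lambda>(J, K). cd J \<circ> cd K) ` ({J. proper J} \<times> {K. proper K}). len (iv x \<circ> w) + (b + a) = len w \<and> len x = b + a}"
  then have "aff x" "len x = a + b" using aff_comp aff_cd by auto
  then show "of_nat (card (PP a b x)) * \<phi> (iv x \<circ> w) = of_nat (card (PP b a x)) * \<phi> (iv x \<circ> w)"
    using card_PP_commute by metis
qed (simp add: add.commute)

lemma Cf_move: "aff w \<Longrightarrow> Cf (us @ a # vs) w = Cf (a # us @ vs) w"
proof (induction us arbitrary: w)
  case (Cons u us)
  have "Cf ((u # us) @ a # vs) w = Lop u (Cf (a # us @ vs)) w"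
    using Cons by (auto intro!: Lop_cong)
  also have "\<dots> = Lop a (Lop u (Cf (us @ vs))) w" using Lop_commute[OF Cons(2)] by simp
  finally show ?case by simp
qed simp

lemma Cf_perm: "aff w \<Longrightarrow> mset as = mset bs \<Longrightarrow> Cf as w = Cf bs w"
proof (induction as arbitrary: bs w)
  case (Cons a as)
  have "a \<in> set bs" using Cons(3) by (metis list.set_intros(1) set_mset_mset)
  then obtain us vs where bs: "bs = us @ a # vs" by (meson split_list)
  have m: "mset as = mset (us @ vs)" using Cons(3) bs by simp
  have "Cf (a # as) w = Lop a (Cf (us @ vs)) w" using Cons m by (auto intro!: Lop_cong)
  then show ?case using Cf_move[OF Cons(2), of us a vs] bs by simp
qed simp

end

section \<open>Complete homogeneous polynomials and Toeplitz determinants\<close>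

lemma poly_mapping_sum_single:
  "p = (\<Sum>k\<in>Poly_Mapping.keys p. Poly_Mapping.single k (Poly_Mapping.lookup p k))"
proof (rule poly_mapping_eqI)
  fix i
  have "Poly_Mapping.lookup (\<Sum>k\<in>Poly_Mapping.keys p. Poly_Mapping.single k (Poly_Mapping.lookup p k)) i
    = (\<Sum>k\<in>Poly_Mapping.keys p. if k = i then Poly_Mapping.lookup p k else 0)"
    by (simp add: lookup_sum lookup_single when_def)
  then show "Poly_Mapping.lookup p i = Poly_Mapping.lookup (\<Sum>k\<in>Poly_Mapping.keys p. Poly_Mapping.single k (Poly_Mapping.lookup p k)) i"
    by (simp add: in_keys_iff)
qed

lemma poly_mapping_single_induct [case_names single add]:
  fixes p :: "'a \<Rightarrow>\<^sub>0 'b::comm_monoid_add"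
  assumes "\<And>k v. P (Poly_Mapping.single k v)" "\<And>p q. P p \<Longrightarrow> P q \<Longrightarrow> P (p + q)"
  shows "P p"
proof -
  have "P (\<Sum>k\<in>A. Poly_Mapping.single k (Poly_Mapping.lookup p k))" if "finite A" for A
    using that
  proof (induction A)
    case empty then show ?case using assms(1)[of undefined 0] by simp
  next
    case (insert x F) then show ?case using assms by simp
  qed
  then show ?thesis using poly_mapping_sum_single[of p] by (metis finite_keys)
qed

lemma sum_closed:
  assumes "0 \<in> C" "\<And>a b. a \<in> C \<Longrightarrow> b \<in> C \<Longrightarrow> a + b \<in> C" "\<And>x. x \<in> X \<Longrightarrow> f x \<in> C"
  shows "sum f X \<in> C"
  using assms(3) by (induction X rule: infinite_finite_induct) (auto simp: assms(1,2))

text \<open>Three sets of coefficients occur, so that the statement serves both a subring and an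
  ideal.\<close>

lemma lookup_mult_closed:
  fixes p q :: "'a::monoid_add \<Rightarrow>\<^sub>0 'b::semiring_0"
  assumes C: "0 \<in> C" "\<And>a b. a \<in> C \<Longrightarrow> b \<in> C \<Longrightarrow> a + b \<in> C"
    and p: "\<And>k. Poly_Mapping.lookup p k \<in> A" and q: "\<And>k. Poly_Mapping.lookup q k \<in> B"
    and AB: "\<And>a b. a \<in> A \<Longrightarrow> b \<in> B \<Longrightarrow> a * b \<in> C"
  shows "Poly_Mapping.lookup (p * q) k \<in> C"
proof -
  have "p * q = (\<Sum>i\<in>Poly_Mapping.keys p. Poly_Mapping.single i (Poly_Mapping.lookup p i)) *
     (\<Sum>j\<in>Poly_Mapping.keys q. Poly_Mapping.single j (Poly_Mapping.lookup q j))"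
    using poly_mapping_sum_single[of p] poly_mapping_sum_single[of q] by simp
  also have "\<dots> = (\<Sum>i\<in>Poly_Mapping.keys p. \<Sum>j\<in>Poly_Mapping.keys q.
     Poly_Mapping.single (i + j) (Poly_Mapping.lookup p i * Poly_Mapping.lookup q j))"
    by (simp add: sum_product mult_single)
  finally have e: "Poly_Mapping.lookup (p * q) k = (\<Sum>i\<in>Poly_Mapping.keys p. \<Sum>j\<in>Poly_Mapping.keys q.
     (Poly_Mapping.lookup p i * Poly_Mapping.lookup q j when i + j = k))"
    by (simp add: lookup_sum lookup_single)
  show ?thesis unfolding e by (intro sum_closed C) (auto simp: when_def C AB p q)
qed

lemma lookup_single_mult:
  fixes p :: "'a::cancel_comm_monoid_add \<Rightarrow>\<^sub>0 'b::comm_semiring_1"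
  shows "Poly_Mapping.lookup (Poly_Mapping.single k 1 * p) (k + m) = Poly_Mapping.lookup p m"
  by (induction p rule: poly_mapping_single_induct)
    (auto simp: mult_single lookup_single when_def distrib_left lookup_add)

lemma lookup_var_mult:
  "Poly_Mapping.lookup (var k * p) m =
    (if Poly_Mapping.lookup m k = 0 then 0 else Poly_Mapping.lookup p (m - Poly_Mapping.single k 1))"
proof (cases "Poly_Mapping.lookup m k = 0")
  case True
  have ne: "Poly_Mapping.single k 1 + j \<noteq> m" for j
  proof
    assume "Poly_Mapping.single k 1 + j = m"
    then have "Poly_Mapping.lookup m k = 1 + Poly_Mapping.lookup j k" by (auto simp: lookup_add)
    then show False using True by simp
  qed
  show ?thesis using True ne unfolding var_def
    by (induction p rule: poly_mapping_single_induct) (auto simp: mult_single lookup_single distrib_left lookup_add)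
next
  case False
  have "m = Poly_Mapping.single k 1 + (m - Poly_Mapping.single k 1)"
    by (rule poly_mapping_eqI) (use False in \<open>auto simp: lookup_add lookup_minus lookup_single when_def\<close>)
  then show ?thesis using False lookup_single_mult[of "Poly_Mapping.single k 1" p "m - Poly_Mapping.single k 1"]
    unfolding var_def by simp
qed

lemma var_power: "var i ^ e = Poly_Mapping.single (Poly_Mapping.single i e) 1"
  by (induction e) (auto simp: var_def mult_single single_add[symmetric])

lemma prod_var_power:
  "(\<Prod>i\<in>S. var i ^ e i) = Poly_Mapping.single (\<Sum>i\<in>S. Poly_Mapping.single i (e i)) 1"
  by (induction S rule: infinite_finite_induct) (auto simp: var_power mult_single)

lemma lookup_sum_single:
  "finite S \<Longrightarrow> Poly_Mapping.lookup (\<Sum>i\<in>S. Poly_Mapping.single i (e i)) j = (if j \<in> S then e j else 0)"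
  by (simp add: lookup_sum lookup_single when_def)

lemma finite_monoms:
  assumes "finite S" shows "finite {m :: monom. Poly_Mapping.keys m \<subseteq> S \<and> (\<forall>i. Poly_Mapping.lookup m i \<le> d)}"
proof -
  let ?M = "{m :: monom. Poly_Mapping.keys m \<subseteq> S \<and> (\<forall>i. Poly_Mapping.lookup m i \<le> d)}"
  have "inj_on (\<lambda>m. restrict (Poly_Mapping.lookup m) S) ?M"
  proof (rule inj_onI)
    fix m m' assume h: "m \<in> ?M" "m' \<in> ?M" "restrict (Poly_Mapping.lookup m) S = restrict (Poly_Mapping.lookup m') S"
    show "m = m'"
    proof (rule poly_mapping_eqI)
      fix i show "Poly_Mapping.lookup m i = Poly_Mapping.lookup m' i"
      proof (cases "i \<in> S")
        case True then show ?thesis using h(3) by (metis restrict_apply')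
      next
        case False
        then have "i \<notin> Poly_Mapping.keys m" "i \<notin> Poly_Mapping.keys m'" using h by auto
        then show ?thesis by (simp add: in_keys_iff)
      qed
    qed
  qed
  moreover have "(\<lambda>m. restrict (Poly_Mapping.lookup m) S) ` ?M \<subseteq> (S \<rightarrow>\<^sub>E {..d})" by auto
  ultimately show ?thesis using assms by (meson finite_PiE finite_atMost finite_subset inj_on_finite)
qed

lemma finite_degree_monoms:
  "finite {m :: monom. Poly_Mapping.keys m \<subseteq> {..<k} \<and> (\<Sum>i<k. Poly_Mapping.lookup m i) = d}"
proof (rule finite_subset[OF _ finite_monoms[of "{..<k}" d]])
  show "{m :: monom. Poly_Mapping.keys m \<subseteq> {..<k} \<and> (\<Sum>i<k. Poly_Mapping.lookup m i) = d}
    \<subseteq> {m. Poly_Mapping.keys m \<subseteq> {..<k} \<and> (\<forall>i. Poly_Mapping.lookup m i \<le> d)}"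
  proof clarify
    fix m :: monom and i assume m: "Poly_Mapping.keys m \<subseteq> {..<k}" "d = (\<Sum>i<k. Poly_Mapping.lookup m i)"
    show "Poly_Mapping.lookup m i \<le> (\<Sum>i<k. Poly_Mapping.lookup m i)"
    proof (cases "i < k")
      case True then show ?thesis by (intro member_le_sum) auto
    next
      case False
      then have "i \<notin> Poly_Mapping.keys m" using m by auto
      then show ?thesis by (simp add: in_keys_iff)
    qed
  qed
qed simp

section \<open>Generating series of the complete homogeneous polynomials\<close>

lemma lookup_complete_homogeneous:
  "Poly_Mapping.lookup (complete_homogeneous k d) m =
    of_bool (Poly_Mapping.keys m \<subseteq> {..<k} \<and> (\<Sum>i<k. Poly_Mapping.lookup m i) = d)"
  unfolding complete_homogeneous_def lookup_sum lookup_single when_def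
  by (subst sum.delta[OF finite_degree_monoms]) simp

lemma complete_homogeneous_Suc:
  "complete_homogeneous (Suc k) (Suc d) = complete_homogeneous k (Suc d) + var k * complete_homogeneous (Suc k) d"
proof (rule poly_mapping_eqI)
  fix m :: monom
  show "Poly_Mapping.lookup (complete_homogeneous (Suc k) (Suc d)) m =
    Poly_Mapping.lookup (complete_homogeneous k (Suc d) + var k * complete_homogeneous (Suc k) d) m"
  proof (cases "Poly_Mapping.lookup m k = 0")
    case True
    then have "k \<notin> Poly_Mapping.keys m" by (simp add: in_keys_iff)
    then have "Poly_Mapping.keys m \<subseteq> {..<Suc k} \<longleftrightarrow> Poly_Mapping.keys m \<subseteq> {..<k}" using less_Suc_eq by auto
    then show ?thesis using True by (simp add: lookup_add lookup_complete_homogeneous lookup_var_mult)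
  next
    case False
    define m' where "m' = m - Poly_Mapping.single k 1"
    have m: "m = m' + Poly_Mapping.single k 1" unfolding m'_def
      by (rule poly_mapping_eqI) (use False in \<open>auto simp: lookup_add lookup_minus lookup_single when_def\<close>)
    have km: "k \<in> Poly_Mapping.keys m" using False by (simp add: in_keys_iff)
    have "Poly_Mapping.keys m = insert k (Poly_Mapping.keys m')"
      unfolding m by (auto simp: in_keys_iff lookup_add lookup_single when_def split: if_splits)
    then have 1: "Poly_Mapping.keys m \<subseteq> {..<Suc k} \<longleftrightarrow> Poly_Mapping.keys m' \<subseteq> {..<Suc k}" by auto
    have "(\<Sum>i<k. Poly_Mapping.lookup m i) = (\<Sum>i<k. Poly_Mapping.lookup m' i)"
      unfolding m by (intro sum.cong) (auto simp: lookup_add lookup_single)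
    then have 2: "(\<Sum>i<Suc k. Poly_Mapping.lookup m i) = Suc (\<Sum>i<Suc k. Poly_Mapping.lookup m' i)"
      by (simp add: m lookup_add)
    have 3: "\<not> Poly_Mapping.keys m \<subseteq> {..<k}" using km by auto
    show ?thesis unfolding lookup_add lookup_var_mult lookup_complete_homogeneous m'_def[symmetric] 1 2
      using False 3 by simp
  qed
qed

lemma complete_homogeneous_0: "complete_homogeneous k 0 = 1"
proof (rule poly_mapping_eqI)
  fix m :: monom
  have "Poly_Mapping.keys m \<subseteq> {..<k} \<and> (\<Sum>i<k. Poly_Mapping.lookup m i) = 0 \<longleftrightarrow> m = 0"
  proof
    assume h: "Poly_Mapping.keys m \<subseteq> {..<k} \<and> (\<Sum>i<k. Poly_Mapping.lookup m i) = 0"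
    then have "i \<notin> Poly_Mapping.keys m" for i by (cases "i < k") (auto simp: in_keys_iff)
    then show "m = 0" using keys_eq_empty by blast
  qed simp
  then show "Poly_Mapping.lookup (complete_homogeneous k 0) m = Poly_Mapping.lookup 1 m"
    by (simp add: lookup_complete_homogeneous lookup_one when_def)
qed

lemma complete_homogeneous_no_vars: "complete_homogeneous 0 (Suc d) = 0"
  by (rule poly_mapping_eqI) (simp add: lookup_complete_homogeneous)

text \<open>The factor 1 - x t, whose reciprocal is the geometric series in x t.\<close>

definition geo :: "mpoly \<Rightarrow> mpoly fps" where "geo x = 1 - fps_const x * fps_X"

lemma geo_nth_0 [simp]: "fps_nth (geo x) 0 = 1" by (simp add: geo_def)

lemma geo_mult_nth: "fps_nth (f * geo x) m = fps_nth f m - (if m = 0 then 0 else x * fps_nth f (m - 1))"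
proof -
  have "f * geo x = f - fps_const x * (fps_X * f)" by (simp add: geo_def algebra_simps)
  then show ?thesis by simp
qed

lemma complete_homogeneous_fps: "Abs_fps (complete_homogeneous k) * (\<Prod>l<k. geo (var l)) = 1"
proof (induction k)
  case 0
  have "complete_homogeneous 0 m = (if m = 0 then 1 else 0)" for m
    by (cases m) (auto simp: complete_homogeneous_0 complete_homogeneous_no_vars)
  then show ?case by (simp add: fps_eq_iff)
next
  case (Suc k)
  have "Abs_fps (complete_homogeneous (Suc k)) * geo (var k) = Abs_fps (complete_homogeneous k)"
  proof (rule fps_ext)
    fix m show "fps_nth (Abs_fps (complete_homogeneous (Suc k)) * geo (var k)) m = fps_nth (Abs_fps (complete_homogeneous k)) m"
      by (cases m) (auto simp: geo_mult_nth complete_homogeneous_0 complete_homogeneous_Suc)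
  qed
  moreover have "Abs_fps (complete_homogeneous (Suc k)) * (\<Prod>l<Suc k. geo (var l)) =
      (Abs_fps (complete_homogeneous (Suc k)) * geo (var k)) * (\<Prod>l<k. geo (var l))"
    by (simp add: mult.assoc mult.left_commute)
  ultimately show ?case using Suc by simp
qed

lemma geo_inverse: "Abs_fps (\<lambda>m. x ^ m) * geo x = 1"
proof (rule fps_ext)
  fix m show "fps_nth (Abs_fps (\<lambda>m. x ^ m) * geo x) m = fps_nth 1 m"
    by (cases m) (auto simp: geo_mult_nth)
qed

text \<open>Up to the sign (-1)^l, the l-th elementary symmetric polynomial in the variables other
  than \<open>var i\<close>.\<close>

definition Qc :: "nat \<Rightarrow> nat \<Rightarrow> nat \<Rightarrow> mpoly" where
  "Qc k i l = fps_nth (\<Prod>l'\<in>{..<k} - {i}. geo (var l')) l"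

lemma prod_geo_nth: "finite S \<Longrightarrow> card S < l \<Longrightarrow> fps_nth (\<Prod>l'\<in>S. geo (var l')) l = 0"
proof (induction S arbitrary: l rule: finite_induct)
  case (insert x F)
  then have "card F < l" "card F < l - 1" by auto
  have "fps_nth (\<Prod>l'\<in>insert x F. geo (var l')) l = fps_nth ((\<Prod>l'\<in>F. geo (var l')) * geo (var x)) l"
    using insert by (simp add: mult.commute)
  also have "\<dots> = 0" unfolding geo_mult_nth using insert.IH[OF \<open>card F < l\<close>] insert.IH[OF \<open>card F < l - 1\<close>] by simp
  finally show ?case .
qed simp

text \<open>Entry of the lower triangular Toeplitz matrix with symbol g.\<close>

definition tp :: "(nat \<Rightarrow> 'a::zero) \<Rightarrow> nat \<Rightarrow> nat \<Rightarrow> 'a" where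
  "tp g i j = (if j \<le> i then g (i - j) else 0)"

text \<open>Multiplying the series of the complete homogeneous polynomials by all factors 1 - x t
  except the i-th leaves the geometric series of \<open>var i\<close>. The multiplier has degree
  below k, so k terms suffice.\<close>

lemma var_power_expand:
  assumes "i < k" shows "var i ^ m = (\<Sum>l<k. Qc k i l * tp (complete_homogeneous k) m l)"
proof -
  let ?H = "Abs_fps (complete_homogeneous k)" and ?Q = "\<Prod>l'\<in>{..<k} - {i}. geo (var l')"
  have "(\<Prod>l<k. geo (var l)) = geo (var i) * ?Q" using assms by (simp add: prod.remove)
  then have "?H * (geo (var i) * ?Q) = 1" using complete_homogeneous_fps[of k] by simp
  then have "Abs_fps (\<lambda>m. var i ^ m) * (?H * (geo (var i) * ?Q)) = Abs_fps (\<lambda>m. var i ^ m)" by simp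
  then have "(Abs_fps (\<lambda>m. var i ^ m) * geo (var i)) * (?Q * ?H) = Abs_fps (\<lambda>m. var i ^ m)"
    by (simp add: mult.commute mult.left_commute)
  then have e: "?Q * ?H = Abs_fps (\<lambda>m. var i ^ m)" by (simp add: geo_inverse)
  have "var i ^ m = fps_nth (?Q * ?H) m" using e by simp
  also have "\<dots> = (\<Sum>l=0..m. Qc k i l * complete_homogeneous k (m - l))" by (simp add: fps_mult_nth Qc_def)
  also have "\<dots> = (\<Sum>l\<in>{..m} \<inter> {..<k}. Qc k i l * tp (complete_homogeneous k) m l)"
  proof -
    have z: "Qc k i l = 0" if "k \<le> l" for l unfolding Qc_def
      by (rule prod_geo_nth) (use assms that in auto)
    have "(\<Sum>l=0..m. Qc k i l * complete_homogeneous k (m - l)) = (\<Sum>l\<in>{..m}. Qc k i l * tp (complete_homogeneous k) m l)"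
      by (intro sum.cong) (auto simp: tp_def)
    also have "\<dots> = (\<Sum>l\<in>{..m} \<inter> {..<k}. Qc k i l * tp (complete_homogeneous k) m l)"
      by (rule sum.mono_neutral_right) (use z in \<open>force simp: not_less\<close>)+
    finally show ?thesis .
  qed
  also have "\<dots> = (\<Sum>l<k. Qc k i l * tp (complete_homogeneous k) m l)"
    by (rule sum.mono_neutral_left) (auto simp: tp_def)
  finally show ?thesis .
qed

text \<open>The coefficients of the reciprocal of the power series with coefficients \<open>g\<close>.\<close>

function seqinv :: "(nat \<Rightarrow> 'a::comm_ring_1) \<Rightarrow> nat \<Rightarrow> 'a" where
  "seqinv g m = (if m = 0 then 1 else - (\<Sum>i<m. g (m - i) * seqinv g i))"
  by pat_completeness auto
termination by (relation "measure snd") auto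
declare seqinv.simps[simp del]

lemma seqinv_0: "seqinv g 0 = 1" by (simp add: seqinv.simps)

lemma seqinv_conv:
  assumes "g 0 = 1" shows "(\<Sum>i\<le>m. g (m - i) * seqinv g i) = of_bool (m = 0)"
proof (cases m)
  case 0 then show ?thesis using assms by (simp add: seqinv_0)
next
  case (Suc m')
  have "(\<Sum>i\<le>m. g (m - i) * seqinv g i) = (\<Sum>i<m. g (m - i) * seqinv g i) + seqinv g m"
    using assms by (simp add: lessThan_Suc_atMost[symmetric])
  also have "seqinv g m = - (\<Sum>i<m. g (m - i) * seqinv g i)" using Suc by (subst seqinv.simps) simp
  finally show ?thesis using Suc by simp
qed

text \<open>Products of Toeplitz matrices convolve their symbols, and triangularity makes the
  truncation to size N exact.\<close>

lemma tp_inverse: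
  assumes "g 0 = 1" "i < N" "j < N"
  shows "(\<Sum>l<N. tp g i l * tp (seqinv g) l j) = of_bool (i = j)"
    and "(\<Sum>l<N. tp (seqinv g) i l * tp g l j) = of_bool (i = j)"
proof -
  have main: "(\<Sum>l<N. tp f i l * tp h l j) = (if j \<le> i then (\<Sum>s\<le>i - j. f (i - j - s) * h s) else 0)" for f h :: "nat \<Rightarrow> 'a"
  proof (cases "j \<le> i")
    case True
    have "(\<Sum>l<N. tp f i l * tp h l j) = (\<Sum>l\<in>{j..i}. tp f i l * tp h l j)"
      by (rule sum.mono_neutral_right) (use assms in \<open>auto simp: tp_def\<close>)
    also have "\<dots> = (\<Sum>s\<le>i - j. f (i - j - s) * h s)"
      by (rule sum.reindex_bij_witness[where i="\<lambda>s. s + j" and j="\<lambda>l. l - j"]) (use True in \<open>auto simp: tp_def\<close>)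
    finally show ?thesis using True by simp
  next
    case False
    then have "tp f i l * tp h l j = 0" for l by (auto simp: tp_def)
    then show ?thesis using False by simp
  qed
  show "(\<Sum>l<N. tp g i l * tp (seqinv g) l j) = of_bool (i = j)"
    unfolding main using seqinv_conv[of g "i - j", OF assms(1)] by auto
  have sw: "(\<Sum>s\<le>m. seqinv g (m - s) * g s) = (\<Sum>s\<le>m. g (m - s) * seqinv g s)" for m
    by (rule sum.reindex_bij_witness[where i="\<lambda>s. m - s" and j="\<lambda>s. m - s"]) auto
  show "(\<Sum>l<N. tp (seqinv g) i l * tp g l j) = of_bool (i = j)"
    unfolding main sw using seqinv_conv[of g "i - j", OF assms(1)] by auto
qed

text \<open>Jacobi's complementary minor identity: take unit columns followed by the last n - k
  columns of the inverse B, multiply by A, and compare the determinants of the resulting block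
  triangular matrices.\<close>

lemma det_principal_minor:
  fixes A B :: "'a::idom mat"
  assumes A: "A \<in> carrier_mat n n" and B: "B \<in> carrier_mat n n" and AB: "A * B = 1\<^sub>m n" and k: "k \<le> n"
  shows "det (mat k k (\<lambda>(i, j). A $$ (i, j))) = det A * det (mat (n - k) (n - k) (\<lambda>(i, j). B $$ (k + i, k + j)))"
proof -
  let ?M = "mat n n (\<lambda>(i, j). if j < k then of_bool (i = j) else B $$ (i, j))"
  have M: "?M \<in> carrier_mat n n" by simp
  have Meq: "?M = four_block_mat (1\<^sub>m k) (mat k (n - k) (\<lambda>(i, j). B $$ (i, k + j))) (0\<^sub>m (n - k) k)
      (mat (n - k) (n - k) (\<lambda>(i, j). B $$ (k + i, k + j)))"
    by (rule eq_matI) (use k in auto)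
  have dM: "det ?M = det (mat (n - k) (n - k) (\<lambda>(i, j). B $$ (k + i, k + j)))"
    unfolding Meq by (subst det_four_block_mat_lower_left_zero[of _ k _ "n - k"]) auto
  have AM: "(A * ?M) $$ (i, j) = (if j < k then A $$ (i, j) else of_bool (i = j))" if "i < n" "j < n" for i j
  proof -
    have "(A * ?M) $$ (i, j) = (\<Sum>l<n. A $$ (i, l) * ?M $$ (l, j))"
      using that A by (simp add: scalar_prod_def atLeast0LessThan)
    also have "\<dots> = (if j < k then A $$ (i, j) else of_bool (i = j))"
    proof (cases "j < k")
      case True
      have "(\<Sum>l<n. A $$ (i, l) * ?M $$ (l, j)) = (\<Sum>l<n. if l = j then A $$ (i, l) else 0)"
        by (rule sum.cong) (use True that in auto)
      then show ?thesis using True that by simp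
    next
      case False
      have "(\<Sum>l<n. A $$ (i, l) * ?M $$ (l, j)) = (A * B) $$ (i, j)"
        using False that A B by (simp add: scalar_prod_def atLeast0LessThan)
      then show ?thesis using False AB that by simp
    qed
    finally show ?thesis .
  qed
  have AMeq: "A * ?M = four_block_mat (mat k k (\<lambda>(i, j). A $$ (i, j))) (0\<^sub>m k (n - k))
     (mat (n - k) k (\<lambda>(i, j). A $$ (k + i, j))) (1\<^sub>m (n - k))"
    by (rule eq_matI) (use k A AM in \<open>auto simp del: index_mult_mat(1)\<close>)
  have "det (A * ?M) = det (mat k k (\<lambda>(i, j). A $$ (i, j)))"
    unfolding AMeq by (subst det_four_block_mat_upper_right_zero[of _ k _ "n - k"]) auto
  then show ?thesis using det_mult[OF A M] dM by simp
qed

section \<open>Vandermonde and Cauchy determinants\<close>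

lemma prod_list_ones: "(\<And>x. x \<in> set xs \<Longrightarrow> x = 1) \<Longrightarrow> prod_list xs = (1 :: 'a::monoid_mult)"
  by (induction xs) auto

lemma lookup_of_int_mult:
  "Poly_Mapping.lookup (of_int c * (p :: mpoly)) m = c * Poly_Mapping.lookup p m"
proof -
  have "Poly_Mapping.lookup (of_nat c * p) m = int c * Poly_Mapping.lookup p m" for c
    by (induction c) (auto simp: lookup_add algebra_simps)
  then show ?thesis by (cases c rule: int_cases2) simp_all
qed

text \<open>No other permutation has the exponent vector of the identity, so that monomial survives
  with coefficient 1.\<close>

lemma vandermonde_nonzero: "det (mat k k (\<lambda>(i, j). var i ^ j)) \<noteq> 0"
proof -
  let ?r = "\<lambda>p. \<Sum>i\<in>{0..<k}. Poly_Mapping.single i (p i) :: monom"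
  let ?V = "mat k k (\<lambda>(i, j). var i ^ j)"
  have "det ?V = (\<Sum>p | p permutes {0..<k}. signof p * (\<Prod>i = 0..<k. ?V $$ (i, p i)))"
    by (subst det_def'[of _ k]) auto
  also have "\<dots> = (\<Sum>p | p permutes {0..<k}. signof p * Poly_Mapping.single (?r p) 1)"
  proof (rule sum.cong[OF refl])
    fix p assume p: "p \<in> {p. p permutes {0..<k}}"
    have "(\<Prod>i = 0..<k. ?V $$ (i, p i)) = (\<Prod>i = 0..<k. var i ^ p i)"
      by (rule prod.cong) (use p permutes_in_image[of p "{0..<k}"] in auto)
    then show "signof p * (\<Prod>i = 0..<k. ?V $$ (i, p i)) = signof p * Poly_Mapping.single (?r p) 1"
      by (simp add: prod_var_power)
  qed
  finally have d: "det ?V = (\<Sum>p | p permutes {0..<k}. signof p * Poly_Mapping.single (?r p) 1)" .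
  have inj: "p = id" if "p permutes {0..<k}" "?r p = ?r id" for p
  proof
    fix i
    show "p i = id i"
    proof (cases "i < k")
      case True
      have "Poly_Mapping.lookup (?r p) i = Poly_Mapping.lookup (?r id) i" using that by simp
      then show ?thesis using True by (simp add: lookup_sum_single)
    next
      case False then show ?thesis using that(1) by (simp add: permutes_not_in)
    qed
  qed
  have sg: "Poly_Mapping.lookup (signof p * Poly_Mapping.single (?r p) 1 :: mpoly) (?r id) = (if p = id then 1 else 0)"
    if "p permutes {0..<k}" for p
    using inj[OF that] by (auto simp: lookup_of_int_mult lookup_single when_def)
  have "Poly_Mapping.lookup (det ?V) (?r id) = (\<Sum>p | p permutes {0..<k}. if p = id then 1 else 0)"
    unfolding d lookup_sum by (rule sum.cong[OF refl]) (rule sg, simp)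
  also have "\<dots> = 1" by (subst sum.delta) (auto simp: permutes_id finite_permutations)
  finally show ?thesis by auto
qed

text \<open>Polynomials in a second set of indeterminates, which will stand for the operators
  \<open>Lop m\<close>, over the ring of polynomials in the x variables.\<close>

type_synonym upoly = "monom \<Rightarrow>\<^sub>0 mpoly"

abbreviation cst :: "mpoly \<Rightarrow> upoly" where "cst \<equiv> Poly_Mapping.single 0"

lemma cst_hom: "comm_ring_hom cst"
  by unfold_locales (auto simp: single_add mult_single)

text \<open>Let Q hold the coefficients of \<open>var_power_expand\<close>. Then Q times B is the
  Vandermonde matrix with row i scaled by the i-th factor, while Q times a unitriangular matrix is
  the Vandermonde matrix itself; the nonzero Vandermonde determinant cancels. The range n + k leaves
  room for shifting h by up to k - 1.\<close>

lemma det_cauchy: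
  fixes h :: "nat \<Rightarrow> upoly" and n k :: nat
  assumes h: "\<And>m. n \<le> m \<Longrightarrow> h m = 0"
  defines "B \<equiv> mat k k (\<lambda>(l, j). \<Sum>m<n + k. cst (tp (complete_homogeneous k) m l) * tp h m j)"
  shows "(\<Prod>i<k. \<Sum>m<n. cst (var i ^ m) * h m) = det B"
proof -
  interpret c: comm_ring_hom cst by (rule cst_hom)
  let ?V = "mat k k (\<lambda>(i, j). var i ^ j)" and ?Q = "mat k k (\<lambda>(i, l). Qc k i l)"
  let ?H = "\<lambda>i. \<Sum>m<n. cst (var i ^ m) * h m"
  have "?V = ?Q * mat k k (\<lambda>(l, j). tp (complete_homogeneous k) j l)"
  proof (rule eq_matI)
    fix i j assume ij: "i < dim_row (?Q * mat k k (\<lambda>(l, j). tp (complete_homogeneous k) j l))"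
      "j < dim_col (?Q * mat k k (\<lambda>(l, j). tp (complete_homogeneous k) j l))"
    then show "?V $$ (i, j) = (?Q * mat k k (\<lambda>(l, j). tp (complete_homogeneous k) j l)) $$ (i, j)"
      using var_power_expand[of i k j] by (simp add: scalar_prod_def atLeast0LessThan)
  qed auto
  moreover have "det (mat k k (\<lambda>(l, j). tp (complete_homogeneous k) j l)) = 1"
    by (subst det_upper_triangular[of _ k])
      (auto simp: upper_triangular_def tp_def diag_mat_def complete_homogeneous_0 intro!: prod_list_ones)
  ultimately have QV: "det ?Q = det ?V" by (simp add: det_mult[of _ k])
  have Bc: "B \<in> carrier_mat k k" by (simp add: B_def)
  have "map_mat cst ?Q * B = mat k k (\<lambda>(i, j). ?H i * cst (var i ^ j))"
  proof (rule eq_matI)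
    fix i j assume "i < dim_row (mat k k (\<lambda>(i, j). ?H i * cst (var i ^ j)))" "j < dim_col (mat k k (\<lambda>(i, j). ?H i * cst (var i ^ j)))"
    then have ij: "i < k" "j < k" by auto
    have "(map_mat cst ?Q * B) $$ (i, j) = (\<Sum>l<k. cst (Qc k i l) * (\<Sum>m<n + k. cst (tp (complete_homogeneous k) m l) * tp h m j))"
      using ij by (simp add: B_def scalar_prod_def atLeast0LessThan)
    also have "\<dots> = (\<Sum>m<n + k. (\<Sum>l<k. cst (Qc k i l) * cst (tp (complete_homogeneous k) m l)) * tp h m j)"
      unfolding sum_distrib_left sum_distrib_right by (subst sum.swap) (simp add: mult.assoc)
    also have "\<dots> = (\<Sum>m<n + k. cst (var i ^ m) * tp h m j)"
      unfolding var_power_expand[OF ij(1)] by (simp add: c.hom_sum c.hom_mult)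
    also have "\<dots> = (\<Sum>m\<in>{j..<n + j}. cst (var i ^ m) * tp h m j)"
      by (rule sum.mono_neutral_right) (use ij h in \<open>auto simp: tp_def\<close>)
    also have "\<dots> = (\<Sum>m<n. cst (var i ^ (m + j)) * h m)"
      by (rule sum.reindex_bij_witness[where i="\<lambda>m. m + j" and j="\<lambda>m. m - j"]) (auto simp: tp_def)
    also have "\<dots> = ?H i * cst (var i ^ j)"
      unfolding sum_distrib_right
      by (intro sum.cong refl) (simp add: power_add c.hom_mult mult.assoc mult.left_commute mult.commute)
    finally show "(map_mat cst ?Q * B) $$ (i, j) = mat k k (\<lambda>(i, j). ?H i * cst (var i ^ j)) $$ (i, j)" using ij by simp
  qed (auto simp: B_def)
  then have "det (map_mat cst ?Q) * det B = det (mat k k (\<lambda>(i, j). ?H i * cst (var i ^ j)))"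
    using det_mult[of "map_mat cst ?Q" k B] Bc by simp
  also have "\<dots> = (\<Prod>i<k. ?H i) * det (map_mat cst ?V)"
  proof -
    have "det (mat k k (\<lambda>(i, j). ?H i * cst (var i ^ j))) = (\<Sum>p | p permutes {0..<k}. signof p * ((\<Prod>i = 0..<k. ?H i) * (\<Prod>i = 0..<k. cst (var i ^ p i))))"
      by (subst det_def'[of _ k]) (auto simp: prod.distrib[symmetric] permutes_in_image[of _ "{0..<k}"] intro!: sum.cong arg_cong2[of _ _ _ _ "(*)"] prod.cong dest: permutes_in_image)
    also have "\<dots> = (\<Prod>i = 0..<k. ?H i) * (\<Sum>p | p permutes {0..<k}. signof p * (\<Prod>i = 0..<k. cst (var i ^ p i)))"
      by (simp add: sum_distrib_left mult.left_commute)
    also have "(\<Sum>p | p permutes {0..<k}. signof p * (\<Prod>i = 0..<k. cst (var i ^ p i))) = det (map_mat cst ?V)"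
      by (subst det_def'[of _ k]) (auto intro!: sum.cong arg_cong2[of _ _ _ _ "(*)"] prod.cong simp: permutes_in_image[of _ "{0..<k}"])
    finally show ?thesis by (simp add: atLeast0LessThan)
  qed
  finally have "det (map_mat cst ?V) * det B = det (map_mat cst ?V) * (\<Prod>i<k. ?H i)"
    using QV by (simp add: c.hom_det mult.commute)
  moreover have "det (map_mat cst ?V) \<noteq> 0"
  proof -
    have "Poly_Mapping.lookup (cst (det ?V)) 0 \<noteq> 0" using vandermonde_nonzero by simp
    then show ?thesis by (metis c.hom_det lookup_zero)
  qed
  ultimately show ?thesis by simp
qed

section \<open>Branching of Schur polynomials\<close>

text \<open>The partitions mu for which lam/mu is a horizontal strip, padded to the same
  length.\<close>

definition interl :: "nat list \<Rightarrow> nat list set" where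
  "interl lam = {mu. length mu = length lam \<and>
     (\<forall>i < length lam. mu ! i \<le> lam ! i \<and> (Suc i < length lam \<longrightarrow> lam ! Suc i \<le> mu ! i))}"

lemma diagram_Sigma: "diagram lam = (SIGMA i:{..<length lam}. {..<lam ! i})"
  by (auto simp: diagram_def)

lemma finite_diagram: "finite (diagram lam)"
  by (simp add: diagram_Sigma)

lemma card_diagram: "card (diagram lam) = sum_list lam"
  by (simp add: diagram_Sigma sum_list_sum_nth atLeast0LessThan)

lemma finite_ssyt: "finite (ssyt k lam)"
  by (rule finite_subset[of _ "diagram lam \<rightarrow>\<^sub>E {..<k}"]) (auto simp: ssyt_def finite_diagram intro!: finite_PiE)

lemma finite_interl: "finite (interl lam)"
proof -
  have "interl lam \<subseteq> {mu. set mu \<subseteq> {..sum_list lam} \<and> length mu = length lam}"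
  proof
    fix mu assume mu: "mu \<in> interl lam"
    have "x \<le> sum_list lam" if "x \<in> set mu" for x
    proof -
      obtain i where i: "i < length mu" "x = mu ! i" using \<open>x \<in> set mu\<close> by (metis in_set_conv_nth)
      then have "x \<le> lam ! i" "i < length lam" using mu by (auto simp: interl_def)
      then show ?thesis using elem_le_sum_list[of i lam] by simp
    qed
    then show "mu \<in> {mu. set mu \<subseteq> {..sum_list lam} \<and> length mu = length lam}" using mu by (auto simp: interl_def)
  qed
  then show ?thesis using finite_lists_length_eq finite_subset by (metis finite_atMost)
qed

lemma schur_poly_0: "schur_poly 0 lam = of_bool (\<forall>x\<in>set lam. x = 0)"
proof (cases "\<forall>x\<in>set lam. x = 0")
  case True
  then have "lam ! i = 0" if "i < length lam" for i using that nth_mem by blast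
  then have "diagram lam = {}" by (auto simp: diagram_def)
  then have "ssyt 0 lam = {\<lambda>_. undefined}" "diagram lam = {}" by (auto simp: ssyt_def)
  then show ?thesis using True by (simp add: schur_poly_def)
next
  case False
  then obtain i where "i < length lam" "lam ! i \<noteq> 0" by (metis in_set_conv_nth)
  then have "(i, 0) \<in> diagram lam" by (auto simp: diagram_def)
  then have "ssyt 0 lam = {}" by (auto simp: ssyt_def)
  then show ?thesis using False by (simp add: schur_poly_def)
qed

context
  fixes K :: nat and lam :: "nat list"
  assumes dec: "\<And>i. Suc i < length lam \<Longrightarrow> lam ! Suc i \<le> lam ! i"
begin

definition muT :: "(nat \<times> nat \<Rightarrow> nat) \<Rightarrow> nat list" where
  "muT T = map (\<lambda>i. card {j. j < lam ! i \<and> T (i, j) < K}) [0..<length lam]"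

definition extT :: "nat list \<Rightarrow> (nat \<times> nat \<Rightarrow> nat) \<Rightarrow> nat \<times> nat \<Rightarrow> nat" where
  "extT mu T' = (\<lambda>c\<in>diagram lam. if c \<in> diagram mu then T' c else K)"

text \<open>Rows increase weakly, so the entries below K form an initial segment of each
  row.\<close>

lemma muT_iff:
  assumes T: "T \<in> ssyt (Suc K) lam" and i: "i < length lam"
  shows "j < muT T ! i \<longleftrightarrow> j < lam ! i \<and> T (i, j) < K"
proof -
  let ?S = "{j. j < lam ! i \<and> T (i, j) < K}"
  have "?S = {..<card ?S}"
  proof (rule nat_down_closed)
    fix j assume j: "Suc j \<in> ?S"
    then have "(i, Suc j) \<in> diagram lam" using i by (auto simp: diagram_def)
    then have "T (i, j) \<le> T (i, Suc j)" using T by (auto simp: ssyt_def)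
    then show "j \<in> ?S" using j by auto
  qed simp
  then have "j \<in> ?S \<longleftrightarrow> j < card ?S" by blast
  then show ?thesis using i by (simp add: muT_def)
qed

lemma muT_diagram:
  assumes T: "T \<in> ssyt (Suc K) lam"
  shows "c \<in> diagram (muT T) \<longleftrightarrow> c \<in> diagram lam \<and> T c < K"
  using muT_iff[OF T] by (cases c) (auto simp: diagram_def muT_def)

text \<open>Columns increase strictly and entries are at most K, so the cell above any cell holds an
  entry below K.\<close>

lemma muT_interl:
  assumes T: "T \<in> ssyt (Suc K) lam" shows "muT T \<in> interl lam"
  unfolding interl_def
proof (intro CollectI conjI allI impI)
  show "length (muT T) = length lam" by (simp add: muT_def)
  fix i assume i: "i < length lam"
  show "muT T ! i \<le> lam ! i" using muT_iff[OF T i, of "lam ! i"] by (simp add: not_less[symmetric])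
  assume Si: "Suc i < length lam"
  show "lam ! Suc i \<le> muT T ! i"
  proof (rule ccontr)
    assume h: "\<not> lam ! Suc i \<le> muT T ! i"
    let ?j = "muT T ! i"
    have d: "(Suc i, ?j) \<in> diagram lam" using h Si by (auto simp: diagram_def)
    then have "T (i, ?j) < T (Suc i, ?j)" using T by (auto simp: ssyt_def)
    moreover have "T (Suc i, ?j) < Suc K" using T d by (auto simp: ssyt_def)
    ultimately have "T (i, ?j) < K" by simp
    moreover have "?j < lam ! i" using h dec[OF Si] by simp
    ultimately show False using muT_iff[OF T i, of ?j] by simp
  qed
qed

lemma restrict_ssyt:
  assumes T: "T \<in> ssyt (Suc K) lam" shows "restrict T (diagram (muT T)) \<in> ssyt K (muT T)"
proof -
  note D = muT_diagram[OF T]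
  have I: "muT T \<in> interl lam" by (rule muT_interl[OF T])
  have row: "(i, j) \<in> diagram (muT T)" if "(i, Suc j) \<in> diagram (muT T)" for i j
    using that by (auto simp: diagram_def)
  have col: "(i, j) \<in> diagram (muT T)" if "(Suc i, j) \<in> diagram (muT T)" for i j
  proof -
    have h: "Suc i < length lam" "j < muT T ! Suc i" using that by (auto simp: diagram_def muT_def)
    then have "muT T ! Suc i \<le> lam ! Suc i" "lam ! Suc i \<le> muT T ! i" using I by (auto simp: interl_def)
    then show ?thesis using h by (auto simp: diagram_def muT_def)
  qed
  have 1: "restrict T (diagram (muT T)) \<in> diagram (muT T) \<rightarrow>\<^sub>E {..<K}" using D by simp
  have 2: "T (i, j) \<le> T (i, Suc j)" if "(i, Suc j) \<in> diagram (muT T)" for i j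
    using D[of "(i, Suc j)"] that T by (simp add: ssyt_def)
  have 3: "T (i, j) < T (Suc i, j)" if "(Suc i, j) \<in> diagram (muT T)" for i j
    using D[of "(Suc i, j)"] that T by (simp add: ssyt_def)
  show ?thesis unfolding ssyt_def
  proof (intro CollectI conjI allI impI 1)
    fix i j assume h: "(i, Suc j) \<in> diagram (muT T)"
    show "restrict T (diagram (muT T)) (i, j) \<le> restrict T (diagram (muT T)) (i, Suc j)"
      using 2[OF h] row[OF h] h by simp
  next
    fix i j assume h: "(Suc i, j) \<in> diagram (muT T)"
    show "restrict T (diagram (muT T)) (i, j) < restrict T (diagram (muT T)) (Suc i, j)"
      using 3[OF h] col[OF h] h by simp
  qed
qed

lemma interl_diagram:
  assumes mu: "mu \<in> interl lam"
  shows "diagram mu \<subseteq> diagram lam" "(Suc i, j) \<in> diagram lam \<Longrightarrow> (i, j) \<in> diagram mu"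
proof -
  show "diagram mu \<subseteq> diagram lam"
  proof
    fix c assume "c \<in> diagram mu"
    then obtain i j where c: "c = (i, j)" "i < length mu" "j < mu ! i" by (auto simp: diagram_def)
    then have "mu ! i \<le> lam ! i" "i < length lam" using mu by (auto simp: interl_def)
    then show "c \<in> diagram lam" using c by (auto simp: diagram_def)
  qed
  assume "(Suc i, j) \<in> diagram lam"
  then have h: "Suc i < length lam" "j < lam ! Suc i" by (auto simp: diagram_def)
  then have "lam ! Suc i \<le> mu ! i" "length mu = length lam" using mu by (auto simp: interl_def)
  then show "(i, j) \<in> diagram mu" using h by (auto simp: diagram_def)
qed

lemma extT_ssyt:
  assumes mu: "mu \<in> interl lam" and T: "T' \<in> ssyt K mu" shows "extT mu T' \<in> ssyt (Suc K) lam"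
proof -
  note D = interl_diagram[OF mu]
  have lt: "T' c < K" if "c \<in> diagram mu" for c using T that by (auto simp: ssyt_def)
  have rowm: "(i, j) \<in> diagram mu" if "(i, Suc j) \<in> diagram mu" for i j
    using that by (auto simp: diagram_def)
  have rowl: "(i, j) \<in> diagram lam" if "(i, Suc j) \<in> diagram lam" for i j
    using that by (auto simp: diagram_def)
  have 1: "extT mu T' \<in> diagram lam \<rightarrow>\<^sub>E {..<Suc K}"
    using lt by (auto simp: extT_def less_Suc_eq)
  have 2: "extT mu T' (i, j) \<le> extT mu T' (i, Suc j)" if h: "(i, Suc j) \<in> diagram lam" for i j
  proof (cases "(i, Suc j) \<in> diagram mu")
    case True
    then have "T' (i, j) \<le> T' (i, Suc j)" using T by (auto simp: ssyt_def)
    then show ?thesis using True h rowm[OF True] rowl[OF h] by (simp add: extT_def)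
  next
    case False
    then show ?thesis using h rowl[OF h] lt[of "(i, j)"] by (auto simp: extT_def)
  qed
  have 3: "extT mu T' (i, j) < extT mu T' (Suc i, j)" if h: "(Suc i, j) \<in> diagram lam" for i j
  proof -
    have m: "(i, j) \<in> diagram mu" using D(2)[OF h] .
    then have l: "(i, j) \<in> diagram lam" using D(1) by blast
    show ?thesis
    proof (cases "(Suc i, j) \<in> diagram mu")
      case True
      then have "T' (i, j) < T' (Suc i, j)" using T by (auto simp: ssyt_def)
      then show ?thesis using True h m l by (simp add: extT_def)
    next
      case False then show ?thesis using h m l lt[OF m] by (simp add: extT_def)
    qed
  qed
  show ?thesis unfolding ssyt_def using 1 2 3 by blast
qed

lemma muT_extT:
  assumes mu: "mu \<in> interl lam" and T: "T' \<in> ssyt K mu" shows "muT (extT mu T') = mu"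
proof (rule nth_equalityI)
  show len: "length (muT (extT mu T')) = length mu" using mu by (simp add: muT_def interl_def)
  fix i assume "i < length (muT (extT mu T'))"
  then have i: "i < length lam" "i < length mu" using len by (auto simp: muT_def)
  have le: "mu ! i \<le> lam ! i" using mu i by (auto simp: interl_def)
  have "j < muT (extT mu T') ! i \<longleftrightarrow> j < mu ! i" for j
  proof -
    have "j < lam ! i \<and> extT mu T' (i, j) < K \<longleftrightarrow> j < mu ! i"
    proof (cases "j < mu ! i")
      case True
      then have "(i, j) \<in> diagram mu" "(i, j) \<in> diagram lam" using i le by (auto simp: diagram_def)
      moreover have "T' (i, j) < K" using T \<open>(i, j) \<in> diagram mu\<close> by (auto simp: ssyt_def)
      ultimately show ?thesis using True le by (simp add: extT_def)
    next
      case False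
      then have "(i, j) \<notin> diagram mu" by (auto simp: diagram_def)
      then show ?thesis using False i by (auto simp: extT_def diagram_def)
    qed
    then show ?thesis using muT_iff[OF extT_ssyt[OF mu T] i(1)] by simp
  qed
  then show "muT (extT mu T') ! i = mu ! i" by (metis linorder_neqE_nat less_irrefl)
qed

text \<open>Deleting the cells with the largest entry K is a bijection onto tableaux of interlacing
  shape; its inverse refills the strip with K.\<close>

lemma schur_branch:
  "schur_poly (Suc K) lam = (\<Sum>mu\<in>interl lam. schur_poly K mu * var K ^ (sum_list lam - sum_list mu))"
proof -
  have wt: "(\<Prod>c\<in>diagram lam. var (T c)) = (\<Prod>c\<in>diagram mu. var (T' c)) * var K ^ (sum_list lam - sum_list mu)"
    if mu: "mu \<in> interl lam" and TT: "\<And>c. c \<in> diagram mu \<Longrightarrow> T c = T' c" "\<And>c. c \<in> diagram lam - diagram mu \<Longrightarrow> T c = K" for mu T T'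
  proof -
    have sub: "diagram mu \<subseteq> diagram lam" using interl_diagram[OF mu] by blast
    have "(\<Prod>c\<in>diagram lam. var (T c)) = (\<Prod>c\<in>diagram lam - diagram mu. var (T c)) * (\<Prod>c\<in>diagram mu. var (T c))"
      using prod.subset_diff[OF sub finite_diagram] by blast
    also have "(\<Prod>c\<in>diagram lam - diagram mu. var (T c)) = var K ^ card (diagram lam - diagram mu)"
      using TT(2) by simp
    also have "card (diagram lam - diagram mu) = sum_list lam - sum_list mu"
      using card_Diff_subset[OF finite_diagram sub] by (simp add: card_diagram)
    also have "(\<Prod>c\<in>diagram mu. var (T c)) = (\<Prod>c\<in>diagram mu. var (T' c))" using TT(1) by (intro prod.cong) auto
    finally show ?thesis by (simp add: mult.commute)
  qed
  have "schur_poly (Suc K) lam = (\<Sum>p\<in>(SIGMA mu:interl lam. ssyt K mu).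
      (\<Prod>c\<in>diagram (fst p). var (snd p c)) * var K ^ (sum_list lam - sum_list (fst p)))"
    unfolding schur_poly_def
  proof (rule sum.reindex_bij_witness[where j="\<lambda>T. (muT T, restrict T (diagram (muT T)))" and i="\<lambda>p. extT (fst p) (snd p)"])
    fix T assume T: "T \<in> ssyt (Suc K) lam"
    note D = muT_diagram[OF T]
    show "extT (fst (muT T, restrict T (diagram (muT T)))) (snd (muT T, restrict T (diagram (muT T)))) = T"
    proof
      fix c
      have "T c = undefined" if "c \<notin> diagram lam" using T that by (auto simp: ssyt_def)
      moreover have "T c < Suc K" if "c \<in> diagram lam" using T that by (auto simp: ssyt_def)
      ultimately show "extT (fst (muT T, restrict T (diagram (muT T)))) (snd (muT T, restrict T (diagram (muT T)))) c = T c"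
        using D[of c] by (auto simp: extT_def)
    qed
    show "(muT T, restrict T (diagram (muT T))) \<in> (SIGMA mu:interl lam. ssyt K mu)"
      using muT_interl[OF T] restrict_ssyt[OF T] by simp
    have lt: "T c < Suc K" if "c \<in> diagram lam" for c using T that by (auto simp: ssyt_def)
    have "(\<Prod>c\<in>diagram lam. var (T c)) = (\<Prod>c\<in>diagram (muT T). var (restrict T (diagram (muT T)) c)) * var K ^ (sum_list lam - sum_list (muT T))"
    proof (rule wt[OF muT_interl[OF T]])
      fix c assume "c \<in> diagram lam - diagram (muT T)"
      then show "T c = K" using D[of c] lt[of c] by auto
    qed simp
    then show "(\<Prod>c\<in>diagram (fst (muT T, restrict T (diagram (muT T)))). var (snd (muT T, restrict T (diagram (muT T))) c)) *
        var K ^ (sum_list lam - sum_list (fst (muT T, restrict T (diagram (muT T))))) = (\<Prod>c\<in>diagram lam. var (T c))" by simp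
  next
    fix p assume "p \<in> (SIGMA mu:interl lam. ssyt K mu)"
    then obtain mu T' where p: "p = (mu, T')" "mu \<in> interl lam" "T' \<in> ssyt K mu" by auto
    show "extT (fst p) (snd p) \<in> ssyt (Suc K) lam" using extT_ssyt p by simp
    have "restrict (extT mu T') (diagram mu) = T'"
    proof
      fix c
      show "restrict (extT mu T') (diagram mu) c = T' c"
      proof (cases "c \<in> diagram mu")
        case True then show ?thesis using interl_diagram(1)[OF p(2)] by (auto simp: extT_def)
      next
        case False
        have h: "T' \<in> diagram mu \<rightarrow>\<^sub>E {..<K}" using p(3) by (simp add: ssyt_def)
        show ?thesis using PiE_arb[OF h False] False by simp
      qed
    qed
    then show "(muT (extT (fst p) (snd p)), restrict (extT (fst p) (snd p)) (diagram (muT (extT (fst p) (snd p))))) = p"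
      using muT_extT[OF p(2,3)] p by simp
  qed
  also have "\<dots> = (\<Sum>mu\<in>interl lam. \<Sum>T\<in>ssyt K mu. (\<Prod>c\<in>diagram mu. var (T c)) * var K ^ (sum_list lam - sum_list mu))"
    by (subst sum.Sigma) (auto simp: finite_interl finite_ssyt case_prod_unfold)
  finally show ?thesis by (simp add: schur_poly_def sum_distrib_right)
qed

end

section \<open>Symmetric polynomials modulo the ideal\<close>

context
  fixes \<sigma> :: "nat \<Rightarrow> nat" and k :: nat
  assumes perm: "\<sigma> permutes {..<k}"
begin

private abbreviation "rho \<equiv> Poly_Mapping.map_key \<sigma> :: monom \<Rightarrow> monom"

lemma lookup_rho: "Poly_Mapping.lookup (rho m) i = Poly_Mapping.lookup m (\<sigma> i)"
  using map_key.rep_eq[OF permutes_inj[OF perm], of m] by simp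

lemma inj_rho: "inj rho"
proof (rule injI)
  fix m m' assume "rho m = rho m'"
  then have "Poly_Mapping.lookup m (\<sigma> i) = Poly_Mapping.lookup m' (\<sigma> i)" for i using lookup_rho by metis
  then show "m = m'" using permutes_surj[OF perm] by (intro poly_mapping_eqI) (metis surjD)
qed

lemma surj_rho: "\<exists>m'. m = rho m'"
proof -
  have "rho (Poly_Mapping.map_key (inv_into UNIV \<sigma>) m) = m"
    using map_key_compose[OF permutes_inj[OF perm] permutes_inj[OF permutes_inv[OF perm]], of m]
      permutes_inv_o(2)[OF perm] map_key_id[of m] by (simp add: id_def)
  then show ?thesis by metis
qed

lemma rho_add: "rho (a + b) = rho a + rho b" by (rule map_key_plus[OF permutes_inj[OF perm]])

text \<open>Permuting the variables is multiplicative. It suffices to check monomials, and each of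
  them lies in the image of the permutation.\<close>

lemma map_key_rho_mult:
  "Poly_Mapping.map_key rho (p * q) = Poly_Mapping.map_key rho p * Poly_Mapping.map_key rho (q :: mpoly)"
proof (induction p rule: poly_mapping_single_induct)
  case (single a x)
  obtain a' where a: "a = rho a'" using surj_rho by blast
  show ?case
  proof (induction q rule: poly_mapping_single_induct)
    case (single b y)
    obtain b' where b: "b = rho b'" using surj_rho by blast
    show ?case unfolding a b mult_single rho_add[symmetric]
      by (simp only: map_key_single[OF inj_rho] mult_single)
  next
    case (add p q) then show ?case by (simp add: distrib_left map_key_plus[OF inj_rho])
  qed
next
  case (add p q) then show ?case by (simp add: distrib_right map_key_plus[OF inj_rho])
qed

lemma map_key_rho_lookup: "Poly_Mapping.lookup (Poly_Mapping.map_key rho (p :: mpoly)) m = Poly_Mapping.lookup p (rho m)"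
  using map_key.rep_eq[OF inj_rho, of p] by simp

lemma invariant_mult:
  fixes p q :: mpoly
  assumes "\<And>m. Poly_Mapping.lookup p (rho m) = Poly_Mapping.lookup p m"
    "\<And>m. Poly_Mapping.lookup q (rho m) = Poly_Mapping.lookup q m"
  shows "Poly_Mapping.lookup (p * q) (rho m) = Poly_Mapping.lookup (p * q) m"
proof -
  have "Poly_Mapping.map_key rho p = p" "Poly_Mapping.map_key rho q = q"
    by (auto intro!: poly_mapping_eqI simp: map_key_rho_lookup assms)
  then have "Poly_Mapping.map_key rho (p * q) = p * q" by (simp add: map_key_rho_mult)
  then show ?thesis using map_key_rho_lookup[of "p * q" m] by simp
qed

lemma rho_keys: "Poly_Mapping.keys (rho m) \<subseteq> {..<k} \<longleftrightarrow> Poly_Mapping.keys m \<subseteq> {..<k}"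
proof -
  have "Poly_Mapping.keys (rho m) = \<sigma> -` Poly_Mapping.keys m" by (rule keys_map_key[OF permutes_inj[OF perm]])
  moreover have "\<sigma> -` {..<k} = {..<k}" using permutes_in_image[OF perm] by auto
  moreover have "\<sigma> ` {..<k} = {..<k}" using permutes_image[OF perm] .
  moreover have "Poly_Mapping.keys m = \<sigma> ` (\<sigma> -` Poly_Mapping.keys m)" using permutes_surj[OF perm] by (simp add: surj_image_vimage_eq)
  ultimately show ?thesis by (metis image_mono vimage_mono)
qed

lemma rho_degree: "(\<Sum>i<k. Poly_Mapping.lookup (rho m) i) = (\<Sum>i<k. Poly_Mapping.lookup m i)"
  unfolding lookup_rho using sum.permute[OF perm, of "Poly_Mapping.lookup m"] by (simp add: comp_def)

lemma rho_0: "rho m = 0 \<longleftrightarrow> m = 0"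
  using inj_rho map_key_zero[OF permutes_inj[OF perm]] by (metis injD)

end

abbreviation Sym :: "nat \<Rightarrow> mpoly set" where "Sym \<equiv> symmetric_polys"

lemma Sym_mult: assumes "p \<in> Sym k" "q \<in> Sym k" shows "p * q \<in> Sym k"
  unfolding symmetric_polys_def
proof (intro CollectI conjI allI impI)
  show "\<forall>m\<in>Poly_Mapping.keys (p * q). Poly_Mapping.keys m \<subseteq> {..<k}"
  proof
    fix m assume "m \<in> Poly_Mapping.keys (p * q)"
    then obtain a b where "m = a + b" "a \<in> Poly_Mapping.keys p" "b \<in> Poly_Mapping.keys q"
      using keys_mult[of p q] by blast
    then show "Poly_Mapping.keys m \<subseteq> {..<k}" using assms keys_add[of a b] by (auto simp: symmetric_polys_def) blast
  qed
  fix \<sigma> m assume "\<sigma> permutes {..<k}"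
  then show "Poly_Mapping.lookup (p * q) (Poly_Mapping.map_key \<sigma> m) = Poly_Mapping.lookup (p * q) m"
    using assms by (intro invariant_mult) (auto simp: symmetric_polys_def)
qed

lemma Sym_add: "p \<in> Sym k \<Longrightarrow> q \<in> Sym k \<Longrightarrow> p + q \<in> Sym k"
  using keys_add[of p q] by (fastforce simp: symmetric_polys_def lookup_add)

lemma Sym_of_int: "of_int z \<in> Sym k"
  by (auto simp: symmetric_polys_def lookup_of_int rho_0 when_def in_keys_iff split: if_splits)

lemma Sym_0: "0 \<in> Sym k" and Sym_1: "1 \<in> Sym k"
  using Sym_of_int[of 0] Sym_of_int[of 1] by auto

lemma Sym_uminus: "p \<in> Sym k \<Longrightarrow> - p \<in> Sym k"
  using Sym_mult[OF Sym_of_int[of "-1"]] by simp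

lemma Sym_complete_homogeneous: "complete_homogeneous k d \<in> Sym k"
  by (auto simp: symmetric_polys_def lookup_complete_homogeneous rho_keys rho_degree in_keys_iff split: if_splits)

lemma Sym_sum: "(\<And>x. x \<in> X \<Longrightarrow> f x \<in> Sym k) \<Longrightarrow> sum f X \<in> Sym k"
  by (rule sum_closed) (auto simp: Sym_0 Sym_add)

lemma sym_ring_simps [simp]:
  "carrier (sym_ring k) = Sym k" "mult (sym_ring k) = (*)" "one (sym_ring k) = 1" "zero (sym_ring k) = 0" "add (sym_ring k) = (+)"
  by (simp_all add: sym_ring_def)

lemma cring_sym_ring: "cring (sym_ring k)"
proof (rule cringI)
  show "abelian_group (sym_ring k)"
  proof (rule abelian_groupI)
    fix x assume "x \<in> carrier (sym_ring k)"
    then show "\<exists>y\<in>carrier (sym_ring k). y \<oplus>\<^bsub>sym_ring k\<^esub> x = \<zero>\<^bsub>sym_ring k\<^esub>"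
      using Sym_uminus[of x k] by (intro bexI[of _ "- x"]) auto
  qed (auto simp: Sym_add Sym_0 add.assoc add.commute)
  show "comm_monoid (sym_ring k)"
    by (rule comm_monoidI) (auto simp: Sym_mult Sym_1 mult.assoc mult.commute)
qed (auto simp: distrib_right)

abbreviation Lid :: "nat \<Rightarrow> nat \<Rightarrow> mpoly set" where "Lid \<equiv> Lambda_ideal"

lemma ideal_Lid: "ideal (Lid k n) (sym_ring k)"
proof -
  interpret R: cring "sym_ring k" by (rule cring_sym_ring)
  show ?thesis unfolding Lambda_ideal_def by (rule R.genideal_ideal) (auto simp: Sym_complete_homogeneous)
qed

lemma Lid_facts:
  shows Lid_0: "0 \<in> Lid k n" and Lid_add: "p \<in> Lid k n \<Longrightarrow> q \<in> Lid k n \<Longrightarrow> p + q \<in> Lid k n"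
    and Lid_mult: "s \<in> Sym k \<Longrightarrow> p \<in> Lid k n \<Longrightarrow> s * p \<in> Lid k n"
    and Lid_Sym: "p \<in> Lid k n \<Longrightarrow> p \<in> Sym k"
proof -
  interpret I: ideal "Lid k n" "sym_ring k" by (rule ideal_Lid)
  show "0 \<in> Lid k n" using additive_subgroup.zero_closed[OF I.additive_subgroup_axioms] by simp
  show "p \<in> Lid k n \<Longrightarrow> q \<in> Lid k n \<Longrightarrow> p + q \<in> Lid k n" using additive_subgroup.a_closed[OF I.additive_subgroup_axioms, of p q] by simp
  show "s \<in> Sym k \<Longrightarrow> p \<in> Lid k n \<Longrightarrow> s * p \<in> Lid k n" using I.I_l_closed[of p s] by simp
  show "p \<in> Lid k n \<Longrightarrow> p \<in> Sym k" using I.a_subset by auto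
qed

lemma Lid_sum: "(\<And>x. x \<in> X \<Longrightarrow> f x \<in> Lid k n) \<Longrightarrow> sum f X \<in> Lid k n"
  by (rule sum_closed) (auto simp: Lid_0 Lid_add)

lemma Lid_complete_homogeneous: "d > n - k \<Longrightarrow> complete_homogeneous k d \<in> Lid k n"
proof -
  assume d: "d > n - k"
  interpret R: cring "sym_ring k" by (rule cring_sym_ring)
  have "{complete_homogeneous k d | d. d > n - k} \<subseteq> Lid k n"
    unfolding Lambda_ideal_def by (rule R.genideal_self) (auto simp: Sym_complete_homogeneous)
  then show ?thesis using d by blast
qed

lemma Lambda_image_eq:
  assumes "p \<in> Sym k" "q \<in> Sym k" "p - q \<in> Lid k n" shows "Lambda_image k n p = Lambda_image k n q"
proof -
  interpret R: cring "sym_ring k" by (rule cring_sym_ring)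
  have "\<ominus>\<^bsub>sym_ring k\<^esub> q = - q" by (rule R.minus_equality) (use assms Sym_uminus in auto)
  then have "p \<ominus>\<^bsub>sym_ring k\<^esub> q = p - q" using assms by (simp add: a_minus_def)
  then show ?thesis unfolding Lambda_image_def
    using R.quotient_eq_iff_same_a_r_cos[OF ideal_Lid, of p q n] assms by simp
qed

text \<open>The quotient map is a ring homomorphism, so the sum may be formed among polynomials.
  Only the multiples 1 and -1 occur, the latter being the additive inverse.\<close>

lemma finsum_Lambda:
  assumes "finite A" "\<And>x. x \<in> A \<Longrightarrow> S x \<in> Sym k" "\<And>x. x \<in> A \<Longrightarrow> \<epsilon> x = (1::int) \<or> \<epsilon> x = -1"
  shows "(\<Oplus>\<^bsub>Lambda k n\<^esub> x \<in> A. [\<epsilon> x] \<cdot>\<^bsub>Lambda k n\<^esub> Lambda_image k n (S x))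
    = Lambda_image k n (\<Sum>x\<in>A. of_int (\<epsilon> x) * S x)"
proof -
  interpret R: cring "sym_ring k" by (rule cring_sym_ring)
  interpret I: ideal "Lid k n" "sym_ring k" by (rule ideal_Lid)
  interpret h: ring_hom_ring "sym_ring k" "Lambda k n" "Lambda_image k n"
    using I.rcos_ring_hom_ring by (simp add: Lambda_def Lambda_image_def[abs_def])
  have inv: "\<ominus>\<^bsub>sym_ring k\<^esub> q = - q" if "q \<in> Sym k" for q
    by (rule R.minus_equality) (use that Sym_uminus in auto)
  have cl: "Lambda_image k n s \<in> carrier (Lambda k n)" if "s \<in> Sym k" for s using h.hom_closed that by simp
  have sgn: "[\<epsilon> x] \<cdot>\<^bsub>Lambda k n\<^esub> Lambda_image k n (S x) = Lambda_image k n (of_int (\<epsilon> x) * S x)" if x: "x \<in> A" for x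
  proof -
    have one: "[(1::nat)] \<cdot>\<^bsub>Lambda k n\<^esub> Lambda_image k n (S x) = Lambda_image k n (S x)"
      using cl[OF assms(2)[OF x]] h.S.l_zero by (simp add: add_pow_def nat_pow_def)
    show ?thesis using assms(3)[OF x]
    proof
      assume "\<epsilon> x = 1" then show ?thesis using one add_pow_int_ge[of 1 "Lambda k n" "Lambda_image k n (S x)"] by simp
    next
      assume e: "\<epsilon> x = -1"
      have "[\<epsilon> x] \<cdot>\<^bsub>Lambda k n\<^esub> Lambda_image k n (S x) = \<ominus>\<^bsub>Lambda k n\<^esub> Lambda_image k n (S x)"
        using e one add_pow_int_lt[of "-1" "Lambda k n" "Lambda_image k n (S x)"] by simp
      also have "\<dots> = Lambda_image k n (- S x)" using assms(2)[OF x] h.hom_a_inv[of "S x"] inv by simp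
      finally show ?thesis using e by simp
    qed
  qed
  have ms: "of_int (\<epsilon> x) * S x \<in> Sym k" if "x \<in> A" for x using assms(2)[OF that] Sym_mult Sym_of_int by blast
  have "(\<Oplus>\<^bsub>Lambda k n\<^esub> x \<in> B. Lambda_image k n (of_int (\<epsilon> x) * S x)) = Lambda_image k n (\<Sum>x\<in>B. of_int (\<epsilon> x) * S x)"
    if "B \<subseteq> A" for B
  proof -
    have "finite B" using that assms(1) finite_subset by blast
    then show ?thesis using that
    proof (induction B)
      case empty then show ?case using h.hom_zero by simp
    next
      case (insert x F)
      have s: "(\<Sum>x\<in>F. of_int (\<epsilon> x) * S x) \<in> Sym k" using insert ms by (intro Sym_sum) auto
      have "(\<Oplus>\<^bsub>Lambda k n\<^esub> x \<in> insert x F. Lambda_image k n (of_int (\<epsilon> x) * S x)) =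
         Lambda_image k n (of_int (\<epsilon> x) * S x) \<oplus>\<^bsub>Lambda k n\<^esub> Lambda_image k n (\<Sum>x\<in>F. of_int (\<epsilon> x) * S x)"
        using insert ms cl by (subst h.S.finsum_insert) auto
      also have "\<dots> = Lambda_image k n (of_int (\<epsilon> x) * S x + (\<Sum>x\<in>F. of_int (\<epsilon> x) * S x))"
        using h.hom_add[of "of_int (\<epsilon> x) * S x" "\<Sum>x\<in>F. of_int (\<epsilon> x) * S x"] s ms insert by simp
      finally show ?case using insert by simp
    qed
  qed
  moreover have "(\<Oplus>\<^bsub>Lambda k n\<^esub> x \<in> A. [\<epsilon> x] \<cdot>\<^bsub>Lambda k n\<^esub> Lambda_image k n (S x))
     = (\<Oplus>\<^bsub>Lambda k n\<^esub> x \<in> A. Lambda_image k n (of_int (\<epsilon> x) * S x))"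
    using ms cl by (intro h.S.finsum_cong') (auto simp: sgn)
  ultimately show ?thesis by simp
qed

section \<open>Affine Stanley polynomials\<close>

declare psubsetE [rule del] psubsetI [rule del]

context affine_window begin

lemma proper_less: "proper J \<Longrightarrow> j \<in> J \<Longrightarrow> j < n"
  using psubset_imp_subset[of J "{..<n}"] by blast

lemma mem_elem: "proper J \<Longrightarrow> j \<in> J \<Longrightarrow> mem J (int j)"
  using proper_less mem_nat by blast

lemma proper_card_0: "{J. proper J \<and> card J = 0} = {{}}"
proof -
  have "proper J \<and> card J = 0 \<longleftrightarrow> J = {}" for J
    by (metis card.empty card_0_eq finite_proper proper_empty)
  then show ?thesis by simp
qed

lemma Lop_add: "Lop m (\<lambda>w. \<phi> w + \<psi> w) w = Lop m \<phi> w + Lop m \<psi> w"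
  unfolding Lop_def sum.distrib[symmetric] by (intro sum.cong) (auto simp: UJ_def)

lemma Lop_scale: "Lop m (\<lambda>w. a * \<phi> w) w = a * Lop m \<phi> w"
  unfolding Lop_def sum_distrib_left by (intro sum.cong) (auto simp: UJ_def)

lemma Lop_of_int: "Lop m (\<lambda>w. of_int (\<phi> w)) w = of_int (Lop m \<phi> w)"
  unfolding Lop_def of_int_sum by (intro sum.cong) (auto simp: UJ_def)

lemma Lop_0: "Lop 0 \<phi> w = \<phi> w"
  unfolding Lop_def proper_card_0 by (simp add: UJ_empty)

lemma Lop_ge: "n \<le> m \<Longrightarrow> Lop m \<phi> w = 0"
proof -
  assume nm: "n \<le> m"
  have "\<not> (proper J \<and> card J = m)" for J using card_proper[of J] nm by auto
  then have "{J. proper J \<and> card J = m} = {}" by simp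
  then show ?thesis unfolding Lop_def by (metis sum.empty)
qed

text \<open>The newest variable belongs to the leftmost factor, the reverse of the order in
  \<open>affine_stanley\<close>; \<open>Cf_perm\<close> reconciles the two in
  \<open>specialize_affine_stanley\<close>.\<close>

primrec FP :: "nat \<Rightarrow> (int \<Rightarrow> int) \<Rightarrow> mpoly" where
  "FP 0 = (\<lambda>w. of_bool (w = id))"
| "FP (Suc k) = (\<lambda>w. \<Sum>m<n. var k ^ m * Lop m (FP k) w)"

lemma Dop_FP: "aff v \<Longrightarrow> Dop r (FP k) v = 0"
proof (induction k arbitrary: v)
  case 0
  have "v \<circ> tr r j \<noteq> id" if "j \<in> Cov v r" for j
    using that len_id by (auto simp: Cov_def)
  then show ?case by (auto simp: Dop_def intro!: sum.neutral)
next
  case (Suc k)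
  have "Dop r (FP (Suc k)) v = (\<Sum>m<n. var k ^ m * Dop r (Lop m (FP k)) v)"
    unfolding Dop_def FP.simps sum_distrib_left by (subst sum.swap) (simp add: mult.left_commute)
  also have "\<dots> = 0"
  proof (rule sum.neutral, rule ballI)
    fix m
    have "Dop r (Lop m (FP k)) v = Lop m (Dop r (FP k)) v" by (rule Dop_Lop[OF Suc(2)])
    also have "\<dots> = Lop m (\<lambda>_. 0) v" using Suc by (intro Lop_cong) auto
    also have "\<dots> = 0" by (simp add: Lop_def UJ_def)
    finally show "var k ^ m * Dop r (Lop m (FP k)) v = 0" by simp
  qed
  finally show ?case .
qed

text \<open>The convolution inverse of \<open>Lop\<close>: cyclically increasing elements with the sign \<open>(-1)\<^sup>m\<close>.\<close>

definition Eb :: "nat \<Rightarrow> ((int \<Rightarrow> int) \<Rightarrow> 'b::comm_ring_1) \<Rightarrow> (int \<Rightarrow> int) \<Rightarrow> 'b" where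
  "Eb m \<phi> w = (-1) ^ m * (\<Sum>K | proper K \<and> card K = m. if len (cd K \<circ> w) + m = len w then \<phi> (cd K \<circ> w) else 0)"

lemma Eb_0: "Eb 0 \<phi> w = \<phi> w"
  unfolding Eb_def proper_card_0 by (simp add: cd_empty)

lemma pred_nonmem:
  assumes "proper J" "J \<noteq> {}" shows "\<exists>j\<in>J. \<not> mem J (int j - 1)"
proof (rule ccontr)
  assume "\<not> ?thesis"
  then have h: "\<And>j. j \<in> J \<Longrightarrow> mem J (int j - 1)" by blast
  obtain j0 where j0: "j0 \<in> J" using assms by blast
  have step: "mem J (x - 1)" if "mem J x" for x
  proof -
    have "mem J (int (nat (x mod int n)) - 1)" using that h[of "nat (x mod int n)"] by (simp only: mem_def)
    moreover have "cg (int (nat (x mod int n)) - 1) (x - 1)"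
      using cg_nat_mod[of x] by (intro cong_diff) (auto simp: cong_sym_eq)
    ultimately show ?thesis using mem_cg by blast
  qed
  have all: "mem J (int j0 - int d)" for d
  proof (induction d)
    case 0 then show ?case using mem_elem[OF assms(1) j0] by simp
  next
    case (Suc d) then show ?case using step[of "int j0 - int d"] by (simp add: algebra_simps)
  qed
  obtain d where d: "d < n" "\<not> mem J (int j0 - int n + int d)" using ex_nonmem[OF assms(1)] by blast
  then show False using all[of "n - d"] by (simp add: of_nat_diff algebra_simps)
qed

lemma cd_single: assumes "proper {c}" shows "cd {c} = sr (int c)"
proof -
  have "c < n" using proper_less[OF assms] by simp
  then have "cd {c} = sr (int c) \<circ> cd {}" using assms by (intro cd_insert) auto
  then show ?thesis by (simp add: cd_empty)
qed

text \<open>The mirror image of \<open>cd_insert\<close>: an element whose predecessor is absent can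
  be the rightmost factor.\<close>

lemma cd_split_last:
  assumes P: "proper S" and c: "c \<in> S" "\<not> mem S (int c - 1)"
  shows "cd S = cd (S - {c}) \<circ> sr (int c)"
proof -
  have e: "S = (S - {c}) \<union> {c}" using c by blast
  have Pc: "proper {c}" using proper_mono[OF P, of "{c}"] c by simp
  have cn: "c < n" using proper_less[OF P c(1)] .
  have "cd ((S - {c}) \<union> {c}) = cd (S - {c}) \<circ> cd {c}"
  proof (rule cd_union)
    show "proper (S - {c})" using proper_mono[OF P] by simp
    show "proper (S - {c} \<union> {c})" using P e by simp
    fix a assume a: "a \<in> S - {c}"
    show "\<not> mem {c} (int a + 1)"
    proof
      assume "mem {c} (int a + 1)"
      then have "cg (int a + 1) (int c)" using cg_nat_eq[OF cn, of "int a + 1"] by (simp add: mem_def)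
      then have "cg (int a) (int c - 1)" using cong_diff[of "int a + 1" "int c" "int n" 1 1] by simp
      moreover have "mem S (int a)" using a mem_elem[OF P] by blast
      ultimately show False using c mem_cg by blast
    qed
  qed auto
  then show ?thesis using cd_single[OF Pc] e by simp
qed

text \<open>Sign-reversing involution on pairs (J, K): choose a run start of the union and move it
  between J and K. Since m < n the union is proper, so a run start exists.\<close>

lemma Lop_Eb_sum:
  fixes \<phi> :: "(int \<Rightarrow> int) \<Rightarrow> 'b::comm_ring_1"
  assumes w: "aff w" and m: "1 \<le> m" "m < n"
  shows "(\<Sum>i\<le>m. Lop (m - i) (Eb i \<phi>) w) = 0"
proof -
  let ?A = "\<lambda>a. {J. proper J \<and> card J = a}"
  let ?x = "\<lambda>J K. cd K \<circ> (iv (cd J) \<circ> w)"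
  define T where "T = (\<lambda>J K. if len (?x J K) + m = len w then \<phi> (?x J K) else 0)"
  define P where "P = {(J, K). proper J \<and> proper K \<and> card J + card K = m}"
  have finP: "finite P" by (rule finite_subset[of _ "Pow {..<n} \<times> Pow {..<n}"]) (auto simp: P_def dest: proper_less)
  have e1: "Lop (m - i) (Eb i \<phi>) w = (\<Sum>J\<in>?A (m - i). \<Sum>K\<in>?A i. (-1) ^ card K * T J K)" if i: "i \<le> m" for i
    unfolding Lop_def
  proof (rule sum.cong[OF refl])
    fix J assume "J \<in> ?A (m - i)"
    then have J: "proper J" "card J = m - i" by auto
    let ?u = "iv (cd J) \<circ> w"
    have u: "aff ?u" using J w aff_comp aff_inv aff_cd by blast
    have "UJ J (Eb i \<phi>) w = (\<Sum>K\<in>?A i. if len ?u + card J = len w then (-1) ^ i * (if len (cd K \<circ> ?u) + i = len ?u then \<phi> (cd K \<circ> ?u) else 0) else 0)"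
      unfolding UJ_def Eb_def sum_distrib_left by simp
    also have "\<dots> = (\<Sum>K\<in>?A i. (-1) ^ card K * T J K)"
    proof (rule sum.cong[OF refl])
      fix K assume "K \<in> ?A i"
      then have K: "proper K" "card K = i" by auto
      show "(if len ?u + card J = len w then (-1) ^ i * (if len (cd K \<circ> ?u) + i = len ?u then \<phi> (cd K \<circ> ?u) else 0) else 0) = (-1) ^ card K * T J K"
        unfolding T_def using J K i len_cd_comp[OF K(1) u] len_ivcd_comp[OF J(1) w] by auto
    qed
    finally show "UJ J (Eb i \<phi>) w = (\<Sum>K\<in>?A i. (-1) ^ card K * T J K)" .
  qed
  have "(\<Sum>i\<le>m. Lop (m - i) (Eb i \<phi>) w) = (\<Sum>i\<le>m. \<Sum>p\<in>?A (m - i) \<times> ?A i. (-1) ^ card (snd p) * T (fst p) (snd p))"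
    by (rule sum.cong[OF refl]) (simp only: e1 atMost_iff sum.cartesian_product case_prod_unfold)
  also have "\<dots> = (\<Sum>i\<in>{..m}. \<Sum>p\<in>{p \<in> P. card (snd p) = i}. (-1) ^ card (snd p) * T (fst p) (snd p))"
  proof (rule sum.cong[OF refl])
    fix i assume "i \<in> {..m}"
    then have "?A (m - i) \<times> ?A i = {p \<in> P. card (snd p) = i}" by (auto simp: P_def)
    then show "(\<Sum>p\<in>?A (m - i) \<times> ?A i. (-1) ^ card (snd p) * T (fst p) (snd p)) = (\<Sum>p\<in>{p \<in> P. card (snd p) = i}. (-1) ^ card (snd p) * T (fst p) (snd p))"
      by (simp only:)
  qed
  also have "\<dots> = (\<Sum>p\<in>P. (-1) ^ card (snd p) * T (fst p) (snd p))"
    by (rule sum.group) (use finP in \<open>auto simp: P_def\<close>)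
  also have "\<dots> = 0"
  proof -
    \<comment> \<open>The choice depends on the union alone, which moving the element preserves;
      hence moving it twice returns the original pair.\<close>
    define c where "c = (\<lambda>S. SOME c. c \<in> S \<and> \<not> mem S (int c - 1))"
    let ?cp = "\<lambda>p. c (fst p \<union> snd p)"
    define s where "s = (\<lambda>p :: nat set \<times> nat set. (-1) ^ card (snd p) * T (fst p) (snd p))"
    have PU: "proper (J \<union> K)" and cU: "c (J \<union> K) \<in> J \<union> K" "\<not> mem (J \<union> K) (int (c (J \<union> K)) - 1)"
      if "(J, K) \<in> P" for J K
    proof -
      have JK: "proper J" "proper K" "card J + card K = m" using that by (auto simp: P_def)
      have "card (J \<union> K) < n" using card_Un_le[of J K] JK m by linarith
      then show PU: "proper (J \<union> K)" unfolding proper_iff using proper_less[OF JK(1)] proper_less[OF JK(2)] by auto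
      have "J \<union> K \<noteq> {}" using JK m by auto
      then have "\<exists>c. c \<in> J \<union> K \<and> \<not> mem (J \<union> K) (int c - 1)" using pred_nonmem[OF PU] by blast
      from someI_ex[OF this] show "c (J \<union> K) \<in> J \<union> K" "\<not> mem (J \<union> K) (int (c (J \<union> K)) - 1)"
        unfolding c_def by auto
    qed
    have ivJ: "iv (cd J) = sr (int d) \<circ> iv (cd (J - {d}))" if "proper J" "d \<in> J" "\<not> mem J (int d - 1)" for J d
    proof -
      have "proper (J - {d})" using proper_mono[OF that(1)] by simp
      then show ?thesis unfolding cd_split_last[OF that] by (simp add: aff_inv_distrib aff_cd aff_tr inv_tr)
    qed
    \<comment> \<open>s_d is at the same time the left end of the inverse of \<open>cd J\<close> and
      the right end of \<open>cd (insert d K)\<close>, so moving d leaves the product as it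
      is.\<close>
    have toggle: "T J K = T (J - {d}) (insert d K)" if P: "(J, K) \<in> P" and d: "d = c (J \<union> K)" "d \<in> J" "d \<notin> K" for J K d
    proof -
      have nm: "\<not> mem J (int d - 1)" "\<not> mem K (int d - 1)" using cU(2)[OF P] d by (auto simp: mem_Un)
      have PJ: "proper J" using P by (auto simp: P_def)
      have PdK: "proper (insert d K)" using proper_mono[OF PU[OF P], of "insert d K"] d by auto
      have "d < n" using proper_less[OF PJ d(2)] .
      have "insert d K - {d} = K" using d by simp
      moreover have "\<not> mem (insert d K) (int d - 1)"
      proof -
        have "\<not> cg (int d - 1) (int d)" using not_cg_Suc[OF proper_two[OF PdK], of "int d - 1"] by simp
        then show ?thesis using nm(2) mem_insert[OF \<open>d < n\<close>] by blast
      qed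
      ultimately have "cd (insert d K) = cd K \<circ> sr (int d)" using cd_split_last[OF PdK, of d] by simp
      then have "?x (J - {d}) (insert d K) = ?x J K" using ivJ[OF PJ d(2) nm(1)] by (simp add: comp_assoc)
      then show ?thesis by (simp only: T_def)
    qed
    \<comment> \<open>The two adjacent copies of s_d cancel, and the remaining factors are too few
      to change the length by m.\<close>
    have both: "T J K = 0" if P: "(J, K) \<in> P" and d: "d = c (J \<union> K)" "d \<in> J" "d \<in> K" for J K d
    proof -
      have nm: "\<not> mem J (int d - 1)" "\<not> mem K (int d - 1)" using cU(2)[OF P] d by (auto simp: mem_Un)
      have JK: "proper J" "proper K" "card J + card K = m" using P by (auto simp: P_def)
      have Pm: "proper (J - {d})" "proper (K - {d})" using proper_mono[OF JK(1)] proper_mono[OF JK(2)] by auto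
      have xe: "?x J K = cd (K - {d}) \<circ> (iv (cd (J - {d})) \<circ> w)"
        using ivJ[OF JK(1) d(2) nm(1)] cd_split_last[OF JK(2) d(3) nm(2)] by (simp add: comp_assoc tr_invol2)
      have au: "aff (iv (cd (J - {d})) \<circ> w)" using w aff_comp aff_inv aff_cd Pm by blast
      have "card (J - {d}) < card J" using d finite_proper[OF JK(1)] by (intro card_Diff1_less)
      moreover have "card (K - {d}) \<le> card K" using finite_proper[OF JK(2)] by (intro card_Diff1_le)
      ultimately have "len (?x J K) + m \<noteq> len w"
        unfolding xe using JK(3) len_ivcd_comp[OF Pm(1) w] len_cd_comp[OF Pm(2) au] by linarith
      then show ?thesis by (simp only: T_def if_False)
    qed
    define P1 P2 P3 where "P1 = {p \<in> P. ?cp p \<in> fst p - snd p}" and "P2 = {p \<in> P. ?cp p \<in> snd p - fst p}"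
      and "P3 = {p \<in> P. ?cp p \<in> fst p \<inter> snd p}"
    have "P = P1 \<union> P2 \<union> P3" using cU(1) unfolding P1_def P2_def P3_def by fastforce
    moreover have "P1 \<inter> P2 = {}" "(P1 \<union> P2) \<inter> P3 = {}" unfolding P1_def P2_def P3_def by auto
    moreover have "finite P1" "finite P2" "finite P3" using finP unfolding P1_def P2_def P3_def by auto
    ultimately have "sum s P = sum s P1 + sum s P2 + sum s P3" by (metis finite_Un sum.union_disjoint)
    moreover have "sum s P3 = 0" by (rule sum.neutral) (auto simp: s_def P3_def both)
    moreover have "sum s P1 = (\<Sum>p\<in>P2. - s p)"
    proof (rule sum.reindex_bij_witness[where j="\<lambda>p. (fst p - {?cp p}, insert (?cp p) (snd p))"
          and i="\<lambda>p. (insert (?cp p) (fst p), snd p - {?cp p})"])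
      fix p assume p: "p \<in> P1"
      obtain J K where pe: "p = (J, K)" by fastforce
      define d where "d = c (J \<union> K)"
      have d: "d \<in> J" "d \<notin> K" "(J, K) \<in> P" using p pe by (auto simp: P1_def d_def)
      have JK: "proper J" "proper K" "card J + card K = m" using d(3) by (auto simp: P_def)
      have U: "(J - {d}) \<union> insert d K = J \<union> K" using d by auto
      have cc: "card (J - {d}) = card J - 1" "card J > 0" "card (insert d K) = card K + 1"
        using d finite_proper[OF JK(1)] finite_proper[OF JK(2)] by (auto simp: card_gt_0_iff)
      have inP: "(J - {d}, insert d K) \<in> P"
      proof -
        have "proper (J - {d})" using proper_mono[OF JK(1)] by simp
        moreover have "proper (insert d K)" using proper_mono[OF PU[OF d(3)], of "insert d K"] d by auto
        ultimately show ?thesis using cc JK by (simp add: P_def)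
      qed
      show "(\<lambda>p. (insert (?cp p) (fst p), snd p - {?cp p})) ((\<lambda>p. (fst p - {?cp p}, insert (?cp p) (snd p))) p) = p"
        using U d unfolding pe d_def by auto
      show "(\<lambda>p. (fst p - {?cp p}, insert (?cp p) (snd p))) p \<in> P2"
        using inP U d unfolding pe P2_def d_def by simp
      show "- s ((\<lambda>p. (fst p - {?cp p}, insert (?cp p) (snd p))) p) = s p"
        using toggle[OF d(3) d_def d(1,2)] cc unfolding pe s_def d_def by simp
    next
      fix p assume p: "p \<in> P2"
      obtain J K where pe: "p = (J, K)" by fastforce
      define d where "d = c (J \<union> K)"
      have d: "d \<in> K" "d \<notin> J" "(J, K) \<in> P" using p pe by (auto simp: P2_def d_def)
      have JK: "proper J" "proper K" "card J + card K = m" using d(3) by (auto simp: P_def)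
      have U: "insert d J \<union> (K - {d}) = J \<union> K" using d by auto
      have cc: "card (K - {d}) = card K - 1" "card K > 0" "card (insert d J) = card J + 1"
        using d finite_proper[OF JK(1)] finite_proper[OF JK(2)] by (auto simp: card_gt_0_iff)
      have inP: "(insert d J, K - {d}) \<in> P"
      proof -
        have "proper (K - {d})" using proper_mono[OF JK(2)] by simp
        moreover have "proper (insert d J)" using proper_mono[OF PU[OF d(3)], of "insert d J"] d by auto
        ultimately show ?thesis using cc JK by (simp add: P_def)
      qed
      show "(\<lambda>p. (fst p - {?cp p}, insert (?cp p) (snd p))) ((\<lambda>p. (insert (?cp p) (fst p), snd p - {?cp p})) p) = p"
        using U d unfolding pe d_def by auto
      show "(\<lambda>p. (insert (?cp p) (fst p), snd p - {?cp p})) p \<in> P1"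
        using inP U d unfolding pe P1_def d_def by simp
    qed
    ultimately have "sum s P = 0" by (simp add: sum_negf)
    then show ?thesis by (simp add: s_def)
  qed
  finally show ?thesis .
qed

end

section \<open>Vanishing outside the bounded range\<close>

text \<open>An arbitrary ordering of the variables of a monomial; by commutation of the \<open>Lop\<close> the choice does not matter.\<close>

definition lst :: "monom \<Rightarrow> nat list" where
  "lst \<gamma> = (SOME xs. \<forall>m. count (mset xs) m = Poly_Mapping.lookup \<gamma> m)"

lemma lst: "count (mset (lst \<gamma>)) m = Poly_Mapping.lookup \<gamma> m"
proof -
  have "\<exists>xs. \<forall>m. count (mset xs) m = Poly_Mapping.lookup \<gamma> m"
  proof (induction \<gamma> rule: poly_mapping_single_induct)
    case (single k v)
    show ?case by (rule exI[of _ "replicate v k"]) (simp add: lookup_single when_def)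
  next
    case (add p q)
    then obtain xs ys where "\<forall>m. count (mset xs) m = Poly_Mapping.lookup p m" "\<forall>m. count (mset ys) m = Poly_Mapping.lookup q m" by blast
    then show ?case by (intro exI[of _ "xs @ ys"]) (simp add: lookup_add)
  qed
  from someI_ex[OF this] show ?thesis unfolding lst_def by blast
qed

lemma mset_lst_single: "mset (lst (Poly_Mapping.single m 1 + \<gamma>)) = mset (m # lst \<gamma>)"
  by (rule multiset_eqI) (simp add: lst lookup_add lookup_single when_def)

lemma lst_0: "lst 0 = []"
proof -
  have "mset (lst 0) = {#}" by (rule multiset_eqI) (simp add: lst)
  then show ?thesis by simp
qed

context affine_window begin

text \<open>Substitutes the operators \<open>Lop m\<close> for the variables of \<open>q\<close> and takes the coefficient of \<open>w\<close>.\<close>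

definition Phi :: "upoly \<Rightarrow> (int \<Rightarrow> int) \<Rightarrow> mpoly" where
  "Phi q w = (\<Sum>\<gamma>\<in>Poly_Mapping.keys q. Poly_Mapping.lookup q \<gamma> * of_int (Cf (lst \<gamma>) w))"

lemma Phi_superset:
  "finite S \<Longrightarrow> Poly_Mapping.keys q \<subseteq> S \<Longrightarrow> Phi q w = (\<Sum>\<gamma>\<in>S. Poly_Mapping.lookup q \<gamma> * of_int (Cf (lst \<gamma>) w))"
  unfolding Phi_def by (rule sum.mono_neutral_left) (auto simp: in_keys_iff)

lemma Phi_add: "Phi (p + q) w = Phi p w + Phi q w"
proof -
  let ?S = "Poly_Mapping.keys p \<union> Poly_Mapping.keys q"
  show ?thesis using Phi_superset[of ?S "p + q" w] Phi_superset[of ?S p w] Phi_superset[of ?S q w] keys_add[of p q]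
    by (simp add: lookup_add distrib_right sum.distrib)
qed

lemma Phi_single: "Phi (Poly_Mapping.single \<gamma> a) w = a * of_int (Cf (lst \<gamma>) w)"
  using Phi_superset[of "{\<gamma>}" "Poly_Mapping.single \<gamma> a" w] by simp

lemma Phi_0: "Phi 0 w = 0" by (simp add: Phi_def)

lemma Phi_sum: "Phi (sum f X) w = (\<Sum>x\<in>X. Phi (f x) w)"
  by (induction X rule: infinite_finite_induct) (auto simp: Phi_0 Phi_add)

lemma Phi_cst: "Phi (cst a * q) w = a * Phi q w"
  by (induction q rule: poly_mapping_single_induct)
    (auto simp: mult_single Phi_single distrib_left Phi_add mult.assoc)

lemma Phi_uminus: "Phi (- q) w = - Phi q w"
proof -
  have "cst (- 1) = - 1" by (simp add: single_uminus)
  then show ?thesis using Phi_cst[of "-1" q w] by simp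
qed

lemma Phi_diff: "Phi (p - q) w = Phi p w - Phi q w"
  using Phi_add[of p "- q" w] by (simp add: Phi_uminus)

lemma Phi_1: "Phi 1 w = of_bool (w = id)"
  using Phi_single[of 0 1 w] by (simp add: lst_0)

lemma Phi_of_int: "Phi (of_int z * q) w = of_int z * Phi q w"
  using Phi_cst[of "of_int z" q w] by simp

text \<open>Multiplying by a variable changes the arbitrary ordering \<open>lst\<close>;
  \<open>Cf_perm\<close>, that is, commutation of the \<open>Lop\<close>, lets the new factor be
  taken as the outermost one.\<close>

lemma Phi_hvar:
  assumes w: "aff w" shows "Phi (Poly_Mapping.single (Poly_Mapping.single m 1) 1 * q) w = Lop m (Phi q) w"
  using w
proof (induction q rule: poly_mapping_single_induct)
  case (single \<gamma> a)
  have "Phi (Poly_Mapping.single (Poly_Mapping.single m 1) 1 * Poly_Mapping.single \<gamma> a) w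
    = a * of_int (Cf (m # lst \<gamma>) w)"
    unfolding mult_single Phi_single using Cf_perm[OF w mset_lst_single[of m \<gamma>]] by simp
  also have "\<dots> = Lop m (\<lambda>w. a * of_int (Cf (lst \<gamma>) w)) w" by (simp add: Lop_scale Lop_of_int)
  also have "\<dots> = Lop m (Phi (Poly_Mapping.single \<gamma> a)) w" by (rule Lop_cong) (use w in \<open>auto simp: Phi_single\<close>)
  finally show ?case .
next
  case (add p q)
  have "Lop m (Phi (p + q)) w = Lop m (\<lambda>w. Phi p w + Phi q w) w" by (rule Lop_cong) (use w in \<open>auto simp: Phi_add\<close>)
  then show ?case using add by (simp add: distrib_left Phi_add Lop_add)
qed

text \<open>The boundary values mirror the operators: \<open>Lop 0\<close> is the identity, and no
  proper subset has n or more elements.\<close>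

definition hh :: "nat \<Rightarrow> upoly" where
  "hh m = (if m = 0 then 1 else if m < n then Poly_Mapping.single (Poly_Mapping.single m 1) 1 else 0)"

lemma Phi_hh: "aff w \<Longrightarrow> Phi (hh m * q) w = Lop m (Phi q) w"
  unfolding hh_def using Phi_hvar[of w m q] by (auto simp: Lop_0 Lop_ge Phi_0)

lemma hh_0: "hh 0 = 1" by (simp add: hh_def)

text \<open>Below n both sides satisfy the recursion of a reciprocal series; for \<open>Eb\<close>
  this is \<open>Lop_Eb_sum\<close>.\<close>

lemma Phi_ee: "aff w \<Longrightarrow> m < n \<Longrightarrow> Phi (seqinv hh m * q) w = Eb m (Phi q) w"
proof (induction m arbitrary: w rule: less_induct)
  case (less m)
  show ?case
  proof (cases "m = 0")
    case True then show ?thesis by (simp add: seqinv_0 Eb_0)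
  next
    case False
    have "Phi (seqinv hh m * q) w = - Phi (\<Sum>i<m. hh (m - i) * (seqinv hh i * q)) w"
      using False by (subst seqinv.simps) (simp add: Phi_uminus[symmetric] sum_distrib_right mult.assoc)
    also have "\<dots> = - (\<Sum>i<m. Lop (m - i) (Eb i (Phi q)) w)"
    proof -
      have "Phi (hh (m - i) * (seqinv hh i * q)) w = Lop (m - i) (Eb i (Phi q)) w" if "i < m" for i
        unfolding Phi_hh[OF less(2)] by (rule Lop_cong[OF less(2)]) (use less that in auto)
      then show ?thesis by (simp add: Phi_sum)
    qed
    also have "\<dots> = Eb m (Phi q) w"
    proof -
      have "(\<Sum>i\<le>m. Lop (m - i) (Eb i (Phi q)) w) = 0" using Lop_Eb_sum[OF less(2), of m] False less(3) by simp
      then have "(\<Sum>i<m. Lop (m - i) (Eb i (Phi q)) w) + Lop 0 (Eb m (Phi q)) w = 0"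
        by (simp add: lessThan_Suc_atMost[symmetric])
      then show ?thesis by (simp add: Lop_0 add_eq_0_iff)
    qed
    finally show ?thesis .
  qed
qed

lemma FP_Phi: "aff w \<Longrightarrow> FP k w = Phi (\<Prod>i<k. \<Sum>m<n. cst (var i ^ m) * hh m) w"
proof (induction k arbitrary: w)
  case 0 then show ?case by (simp add: Phi_1)
next
  case (Suc k)
  let ?P = "\<Prod>i<k. \<Sum>m<n. cst (var i ^ m) * hh m"
  have "(\<Prod>i<Suc k. \<Sum>m<n. cst (var i ^ m) * hh m) = (\<Sum>m<n. cst (var k ^ m) * (hh m * ?P))"
    unfolding prod.lessThan_Suc sum_distrib_left
    by (intro sum.cong refl) (simp only: mult.assoc mult.commute mult.left_commute)
  then have "Phi (\<Prod>i<Suc k. \<Sum>m<n. cst (var i ^ m) * hh m) w = (\<Sum>m<n. var k ^ m * Lop m (Phi ?P) w)"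
    by (simp only: Phi_sum Phi_cst Phi_hh[OF Suc(2)])
  also have "\<dots> = FP (Suc k) w" unfolding FP.simps
    by (intro sum.cong refl arg_cong2[of _ _ _ _ "(*)"] Lop_cong) (use Suc in auto)
  finally show ?case by simp
qed

text \<open>q acts as a linear combination of the \<open>Eb t\<close>, with coefficients uniform in
  the argument. One such operator consults only elements whose values are at most one lower.\<close>

definition Lin :: "upoly \<Rightarrow> bool" where
  "Lin q \<longleftrightarrow> (\<exists>c. \<forall>p w. aff w \<longrightarrow> Phi (q * p) w = (\<Sum>t<n. c t * Eb t (Phi p) w))"

lemma Lin_0: "Lin 0"
  unfolding Lin_def by (rule exI[of _ "\<lambda>_. 0"]) (simp add: Phi_0)

lemma Lin_add: assumes "Lin p" "Lin q" shows "Lin (p + q)"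
proof -
  obtain c where c: "\<forall>r w. aff w \<longrightarrow> Phi (p * r) w = (\<Sum>t<n. c t * Eb t (Phi r) w)"
    using assms(1) unfolding Lin_def by (elim exE)
  obtain d where d: "\<forall>r w. aff w \<longrightarrow> Phi (q * r) w = (\<Sum>t<n. d t * Eb t (Phi r) w)"
    using assms(2) unfolding Lin_def by (elim exE)
  show ?thesis unfolding Lin_def
    by (intro exI[of _ "\<lambda>t. c t + d t"]) (simp add: c d distrib_right Phi_add sum.distrib)
qed

lemma Lin_sum: "(\<And>x. x \<in> X \<Longrightarrow> Lin (f x)) \<Longrightarrow> Lin (sum f X)"
  by (induction X rule: infinite_finite_induct) (auto simp: Lin_0 Lin_add)

lemma Lin_ee: assumes "m < n" shows "Lin (seqinv hh m * cst a)"
proof -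
  have "Phi (seqinv hh m * cst a * p) w = (\<Sum>t<n. (if t = m then a else 0) * Eb t (Phi p) w)" if "aff w" for p w
  proof -
    have "Phi (seqinv hh m * cst a * p) w = a * Eb m (Phi p) w"
      using Phi_cst[of a "seqinv hh m * p" w] Phi_ee[OF that assms, of p] by (simp add: mult.commute mult.left_commute)
    also have "\<dots> = (\<Sum>t<n. if t = m then a * Eb t (Phi p) w else 0)" using assms by simp
    also have "\<dots> = (\<Sum>t<n. (if t = m then a else 0) * Eb t (Phi p) w)" by (rule sum.cong) auto
    finally show ?thesis .
  qed
  then show ?thesis unfolding Lin_def by (intro exI[of _ "\<lambda>t. if t = m then a else 0"]) blast
qed

lemma Eb_vanish:
  assumes "aff w" "w x > x + int (Suc r)" "\<And>u. aff u \<Longrightarrow> u x > x + int r \<Longrightarrow> \<phi> u = 0"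
  shows "Eb t \<phi> w = 0"
proof -
  have "\<phi> (cd K \<circ> w) = 0" if "proper K" for K
    using assms(3)[of "cd K \<circ> w"] aff_comp[OF aff_cd[OF that] assms(1)] cd_ge[OF that, of "w x"] assms(2) by simp
  then have "(if len (cd K \<circ> w) + t = len w then \<phi> (cd K \<circ> w) else 0) = 0" if "K \<in> {K. proper K \<and> card K = t}" for K
    using that by simp
  then have "(\<Sum>K | proper K \<and> card K = t. if len (cd K \<circ> w) + t = len w then \<phi> (cd K \<circ> w) else 0) = 0"
    by (rule sum.neutral[rule_format])
  then show ?thesis by (simp only: Eb_def mult_zero_right)
qed

text \<open>After r steps, each lowering the value at x by at most one, the identity would have to
  be reached, which is impossible from a value above x + r.\<close>

lemma Phi_prod_vanish:
  "(\<And>i. i < r \<Longrightarrow> Lin (q i)) \<Longrightarrow> aff w \<Longrightarrow> w x > x + int r \<Longrightarrow> Phi (\<Prod>i<r. q i) w = 0"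
proof (induction r arbitrary: w)
  case 0 then show ?case by (auto simp: Phi_1)
next
  case (Suc r)
  obtain c where c: "\<And>p w. aff w \<Longrightarrow> Phi (q r * p) w = (\<Sum>t<n. c t * Eb t (Phi p) w)"
    using Suc(2)[of r] unfolding Lin_def by blast
  have "Phi (\<Prod>i<Suc r. q i) w = (\<Sum>t<n. c t * Eb t (Phi (\<Prod>i<r. q i)) w)"
    using c[OF Suc(3), of "\<Prod>i<r. q i"] by (simp add: mult.commute)
  also have "\<dots> = 0"
    by (rule sum.neutral) (use Suc in \<open>auto intro!: Eb_vanish[where r=r and x=x]\<close>)
  finally show ?case .
qed

text \<open>\<open>N = n + k\<close> gives the matrix of \<open>det_cauchy\<close>. Cutting off at
  \<open>N = n\<close> drops only terms of index m >= n in row l < k, whose complete homogeneous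
  factor has degree above n - k.\<close>

definition Bmat :: "nat \<Rightarrow> nat \<Rightarrow> upoly mat" where
  "Bmat N k = mat k k (\<lambda>(l, j). \<Sum>m<N. cst (tp (complete_homogeneous k) m l) * tp hh m j)"

text \<open>The truncated matrix is the leading k x k block of a product of two unitriangular n x n
  Toeplitz matrices. Its determinant is therefore the complementary minor of size n - k of the
  inverse, a signed sum of products of n - k factors satisfying \<open>Lin\<close>.\<close>

lemma det_Bmat_vanish:
  assumes k: "k \<le> n" and w: "aff w" "w x > x + int (n - k)"
  shows "Phi (det (Bmat n k)) w = 0"
proof -
  interpret c: comm_ring_hom cst by (rule cst_hom)
  let ?ch = "complete_homogeneous k"
  let ?X = "mat n n (\<lambda>(l, m). cst (tp ?ch m l))" and ?H = "mat n n (\<lambda>(m, j). tp hh m j)"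
  let ?Hi = "mat n n (\<lambda>(i, l). tp (seqinv hh) i l)" and ?Xi = "mat n n (\<lambda>(l, j). cst (tp (seqinv ?ch) j l))"
  have HHi: "?H * ?Hi = 1\<^sub>m n"
    by (rule eq_matI) (auto simp: scalar_prod_def atLeast0LessThan tp_inverse(1)[of hh, OF hh_0])
  have XXi: "?X * ?Xi = 1\<^sub>m n"
  proof (rule eq_matI)
    fix i j assume "i < dim_row (1\<^sub>m n)" "j < dim_col (1\<^sub>m n)"
    then have ij: "i < n" "j < n" by auto
    have "(?X * ?Xi) $$ (i, j) = (\<Sum>m<n. cst (tp ?ch m i) * cst (tp (seqinv ?ch) j m))"
      using ij by (simp add: scalar_prod_def atLeast0LessThan)
    also have "\<dots> = cst (\<Sum>m<n. tp (seqinv ?ch) j m * tp ?ch m i)"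
      by (simp add: c.hom_sum c.hom_mult mult.commute)
    also have "\<dots> = cst (of_bool (j = i))" using tp_inverse(2)[of ?ch, OF complete_homogeneous_0 ij(2,1)] by simp
    finally show "(?X * ?Xi) $$ (i, j) = 1\<^sub>m n $$ (i, j)" using ij by auto
  qed auto
  let ?N = "?X * ?H" and ?Ni = "?Hi * ?Xi"
  have N: "?N \<in> carrier_mat n n" "?Ni \<in> carrier_mat n n" by auto
  have NNi: "?N * ?Ni = 1\<^sub>m n"
  proof -
    have "?N * ?Ni = ?X * (?H * (?Hi * ?Xi))" by (rule assoc_mult_mat) auto
    also have "?H * (?Hi * ?Xi) = (?H * ?Hi) * ?Xi" by (rule assoc_mult_mat[symmetric]) auto
    also have "\<dots> = ?Xi" by (simp add: HHi)
    finally show ?thesis using XXi by simp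
  qed
  have "det ?X = 1"
    by (subst det_upper_triangular[of _ n])
      (auto simp: upper_triangular_def tp_def diag_mat_def complete_homogeneous_0 intro!: prod_list_ones)
  moreover have "det ?H = 1"
    by (subst det_lower_triangular[of n]) (auto simp: tp_def diag_mat_def hh_0 intro!: prod_list_ones)
  ultimately have dN: "det ?N = 1" by (simp add: det_mult[of _ n])
  have "Bmat n k = mat k k (\<lambda>(i, j). ?N $$ (i, j))"
    unfolding Bmat_def by (rule eq_matI) (use k in \<open>auto simp: scalar_prod_def atLeast0LessThan\<close>)
  then have "det (Bmat n k) = det (mat (n - k) (n - k) (\<lambda>(i, j). ?Ni $$ (k + i, k + j)))"
    using det_principal_minor[OF N NNi k] dN by simp
  also have "\<dots> = (\<Sum>p | p permutes {0..<n - k}. signof p * (\<Prod>i<n - k. ?Ni $$ (k + i, k + p i)))"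
    by (subst det_def'[of _ "n - k"])
      (auto simp: atLeast0LessThan permutes_in_image[of _ "{..<n - k}"] intro!: sum.cong arg_cong2[of _ _ _ _ "(*)"] prod.cong)
  finally have d: "det (Bmat n k) = (\<Sum>p | p permutes {0..<n - k}. signof p * (\<Prod>i<n - k. ?Ni $$ (k + i, k + p i)))" .
  have "Phi (\<Prod>i<n - k. ?Ni $$ (k + i, k + p i)) w = 0" if p: "p permutes {0..<n - k}" for p
  proof (rule Phi_prod_vanish[OF _ w])
    fix i assume i: "i < n - k"
    have pi: "p i < n - k" using permutes_in_image[OF p, of i] i by simp
    have Ne: "?Ni $$ (k + i, k + p i) = (\<Sum>l<n. tp (seqinv hh) (k + i) l * cst (tp (seqinv ?ch) (k + p i) l))"
      using i pi by (simp add: scalar_prod_def atLeast0LessThan)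
    \<comment> \<open>The index k + i - l stays below n, the range in which \<open>seqinv hh\<close>
      acts as \<open>Eb\<close>.\<close>
    have "Lin (tp (seqinv hh) (k + i) l * cst a)" for l a
      using Lin_ee[of "k + i - l" a] Lin_0 i by (auto simp: tp_def)
    then show "Lin (?Ni $$ (k + i, k + p i))" unfolding Ne by (rule Lin_sum)
  qed
  then show ?thesis unfolding d Phi_sum Phi_of_int by (intro sum.neutral) auto
qed

section \<open>Reducing the determinant modulo the ideal\<close>

context
  fixes k :: nat
begin

text \<open>The ideal lives in the ring of symmetric polynomials, so it absorbs only symmetric
  coefficients; \<open>Sy\<close> is tracked next to \<open>Iy\<close> for that reason.\<close>

definition Sy :: "upoly \<Rightarrow> bool" where "Sy q \<longleftrightarrow> (\<forall>\<gamma>. Poly_Mapping.lookup q \<gamma> \<in> Sym k)"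
definition Iy :: "upoly \<Rightarrow> bool" where "Iy q \<longleftrightarrow> (\<forall>\<gamma>. Poly_Mapping.lookup q \<gamma> \<in> Lid k n)"

lemma Sy_mult: "Sy p \<Longrightarrow> Sy q \<Longrightarrow> Sy (p * q)"
  unfolding Sy_def by (intro allI lookup_mult_closed[of "Sym k" p "Sym k" q "Sym k"]) (auto simp: Sym_0 Sym_add Sym_mult)

lemma Iy_mult: "Sy p \<Longrightarrow> Iy q \<Longrightarrow> Iy (p * q)"
  unfolding Sy_def Iy_def
  by (intro allI lookup_mult_closed[of "Lid k n" p "Sym k" q "Lid k n"]) (auto simp: Lid_0 Lid_add Lid_mult)

lemma Sy_add: "Sy p \<Longrightarrow> Sy q \<Longrightarrow> Sy (p + q)" by (auto simp: Sy_def lookup_add Sym_add)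
lemma Iy_add: "Iy p \<Longrightarrow> Iy q \<Longrightarrow> Iy (p + q)" by (auto simp: Iy_def lookup_add Lid_add)

lemma Sy_single: "a \<in> Sym k \<Longrightarrow> Sy (Poly_Mapping.single \<gamma> a)"
  by (auto simp: Sy_def lookup_single when_def Sym_0)

lemma Iy_single: "a \<in> Lid k n \<Longrightarrow> Iy (Poly_Mapping.single \<gamma> a)"
  by (auto simp: Iy_def lookup_single when_def Lid_0)

lemma Sy_0: "Sy 0" by (simp add: Sy_def Sym_0)
lemma Iy_0: "Iy 0" by (simp add: Iy_def Lid_0)
lemma Sy_1: "Sy 1" using Sy_single[OF Sym_1, of 0] by simp
lemma Sy_of_int: "Sy (of_int z)" using Sy_single[OF Sym_of_int, of 0 z] by simp

lemma Sy_sum: "(\<And>x. x \<in> X \<Longrightarrow> Sy (f x)) \<Longrightarrow> Sy (sum f X)"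
  by (induction X rule: infinite_finite_induct) (auto simp: Sy_0 Sy_add)

lemma Iy_sum: "(\<And>x. x \<in> X \<Longrightarrow> Iy (f x)) \<Longrightarrow> Iy (sum f X)"
  by (induction X rule: infinite_finite_induct) (auto simp: Iy_0 Iy_add)

lemma Sy_prod: "(\<And>x. x \<in> X \<Longrightarrow> Sy (f x)) \<Longrightarrow> Sy (prod f X)"
  by (induction X rule: infinite_finite_induct) (auto simp: Sy_1 Sy_mult)

lemma Iy_prod_diff:
  "(\<And>x. x \<in> X \<Longrightarrow> Sy (f x) \<and> Sy (g x) \<and> Iy (f x - g x)) \<Longrightarrow> Iy (prod f X - prod g X)"
proof (induction X rule: infinite_finite_induct)
  case (insert x F)
  have "prod f (insert x F) - prod g (insert x F) = f x * (prod f F - prod g F) + prod g F * (f x - g x)"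
    using insert by (simp add: algebra_simps)
  moreover have "Sy (prod g F)" using insert by (intro Sy_prod) auto
  ultimately show ?case using insert by (auto intro!: Iy_add Iy_mult)
qed (auto simp: Iy_0)

lemma Sy_hh: "Sy (tp hh m j)"
  by (auto simp: tp_def hh_def Sy_1 Sy_0 intro!: Sy_single Sym_1)

lemma Sy_Bmat: "l < k \<Longrightarrow> j < k \<Longrightarrow> Sy (Bmat N k $$ (l, j))"
  unfolding Bmat_def
  by (simp, intro Sy_sum Sy_mult Sy_single Sy_hh) (simp add: tp_def Sym_complete_homogeneous Sym_0)

lemma Iy_Bmat_diff:
  assumes "k \<le> n" "l < k" "j < k" shows "Iy (Bmat (n + k) k $$ (l, j) - Bmat n k $$ (l, j))"
proof -
  let ?f = "\<lambda>m. cst (tp (complete_homogeneous k) m l) * tp hh m j"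
  have "Bmat (n + k) k $$ (l, j) - Bmat n k $$ (l, j) = sum ?f {..<n + k} - sum ?f {..<n}"
    using assms by (simp add: Bmat_def)
  also have "\<dots> = sum ?f ({..<n + k} - {..<n})" by (subst sum_diff) auto
  also have "Iy \<dots>"
  proof (rule Iy_sum)
    fix m assume m: "m \<in> {..<n + k} - {..<n}"
    \<comment> \<open>m >= n and l < k give m - l > n - k, the degree from which the generators of
      the ideal start.\<close>
    have "tp (complete_homogeneous k) m l \<in> Lid k n"
      unfolding tp_def by (cases "l \<le> m") (use m assms in \<open>auto simp: Lid_0 intro!: Lid_complete_homogeneous\<close>)
    then show "Iy (?f m)" using Iy_mult[OF Sy_hh[of m j] Iy_single[of "tp (complete_homogeneous k) m l" 0]] by (simp add: mult.commute)
  qed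
  finally show ?thesis .
qed

lemma det_Bmat: "det (Bmat N k) = (\<Sum>p | p permutes {0..<k}. signof p * (\<Prod>i<k. Bmat N k $$ (i, p i)))"
  by (subst det_def'[of _ k]) (auto simp: Bmat_def atLeast0LessThan)

lemma Phi_Sy: "Sy q \<Longrightarrow> Phi q w \<in> Sym k"
  unfolding Phi_def Sy_def by (intro Sym_sum Sym_mult Sym_of_int) auto

lemma Phi_Iy: "Iy q \<Longrightarrow> Phi q w \<in> Lid k n"
  unfolding Phi_def Iy_def using Lid_mult[OF Sym_of_int] by (intro Lid_sum) (simp add: mult.commute)

lemma FP_det: "aff w \<Longrightarrow> FP k w = Phi (det (Bmat (n + k) k)) w"
proof -
  assume w: "aff w"
  have "hh m = 0" if "n \<le> m" for m using that n_pos by (simp add: hh_def)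
  then show ?thesis unfolding FP_Phi[OF w] Bmat_def using det_cauchy[of n hh k] by simp
qed

text \<open>Symmetry is invisible in the recursion for \<open>FP\<close> but evident from the
  determinant, whose coefficients are complete homogeneous.\<close>

lemma FP_Sym: "aff w \<Longrightarrow> FP k w \<in> Sym k"
proof -
  assume w: "aff w"
  show ?thesis unfolding FP_det[OF w] det_Bmat
proof (intro Phi_Sy Sy_sum Sy_mult Sy_of_int Sy_prod)
  fix p i assume "p \<in> {p. p permutes {0..<k}}" "i \<in> {..<k}"
  then show "Sy (Bmat (n + k) k $$ (i, p i))" using permutes_in_image[of p "{0..<k}" i] by (intro Sy_Bmat) auto
qed
qed

lemma FP_large:
  assumes "k \<le> n" "aff w" "w x > x + int (n - k)" shows "FP k w \<in> Lid k n"
proof -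
  have "Iy (det (Bmat (n + k) k) - det (Bmat n k))"
    unfolding det_Bmat sum_subtractf[symmetric] right_diff_distrib[symmetric]
  proof (intro Iy_sum Iy_mult Sy_of_int Iy_prod_diff)
    fix p i assume "p \<in> {p. p permutes {0..<k}}" "i \<in> {..<k}"
    then have "i < k" "p i < k" using permutes_in_image[of p "{0..<k}" i] by auto
    then show "Sy (Bmat (n + k) k $$ (i, p i)) \<and> Sy (Bmat n k $$ (i, p i)) \<and>
        Iy (Bmat (n + k) k $$ (i, p i) - Bmat n k $$ (i, p i))"
      using Sy_Bmat Iy_Bmat_diff[OF assms(1)] by blast
  qed
  then have "Phi (det (Bmat (n + k) k) - det (Bmat n k)) w \<in> Lid k n" by (rule Phi_Iy)
  then show ?thesis using FP_det[OF assms(2)] det_Bmat_vanish[OF assms] by (simp add: Phi_diff)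
qed

end

lemma FP_small: "aff w \<Longrightarrow> w x < x - int k \<Longrightarrow> FP k w = 0"
proof (induction k arbitrary: w)
  case 0 then show ?case by auto
next
  case (Suc k)
  have "UJ J (FP k) w = 0" if J: "proper J" for J
  proof -
    define u where "u = iv (cd J) \<circ> w"
    have u: "aff u" using J Suc aff_comp aff_inv aff_cd by (simp add: u_def)
    have "cd J (u x) = w x" using aff_cd[OF J] by (simp add: u_def)
    then have "u x \<le> w x + 1" using cd_ge[OF J, of "u x"] by simp
    then have "FP k u = 0" using Suc u by simp
    then show ?thesis by (simp add: UJ_def u_def)
  qed
  then have "Lop m (FP k) w = 0" for m unfolding Lop_def by (intro sum.neutral) auto
  then show ?case by simp
qed

end

section \<open>Grassmannian elements\<close>

context affine_window begin

lemma run_start: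
  assumes P: "proper J" and z: "mem J z"
  obtains x0 where "x0 \<le> z" "\<not> mem J (x0 - 1)" "\<And>y. x0 \<le> y \<Longrightarrow> y \<le> z \<Longrightarrow> mem J y"
proof -
  let ?P = "\<lambda>d. \<not> mem J (z - int d)"
  obtain d where d: "d < n" "\<not> mem J (z - int n + int d)" using ex_nonmem[OF P] by blast
  then have "?P (n - d)" by (simp add: of_nat_diff algebra_simps)
  then have L: "?P (LEAST d. ?P d)" by (rule LeastI)
  have min: "mem J (z - int e)" if "e < (LEAST d. ?P d)" for e using not_less_Least[OF that] by blast
  define D where "D = (LEAST d. ?P d)"
  have D0: "D \<noteq> 0" using L z by (metis D_def diff_zero of_nat_0)
  show ?thesis
  proof (rule that[of "z - int D + 1"])
    show "z - int D + 1 \<le> z" using D0 by simp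
    show "\<not> mem J (z - int D + 1 - 1)" using L by (simp add: D_def)
    fix y assume "z - int D + 1 \<le> y" "y \<le> z"
    then have "nat (z - y) < D" "z - int (nat (z - y)) = y" by auto
    then show "mem J y" using min[of "nat (z - y)"] by (simp add: D_def)
  qed
qed

text \<open>Periodic extensions of ordinary permutations of 1, ..., n.\<close>

definition window_stable :: "(int \<Rightarrow> int) \<Rightarrow> bool" where
  "window_stable w \<longleftrightarrow> aff w \<and> (\<forall>i. 1 \<le> i \<and> i \<le> int n \<longrightarrow> 1 \<le> w i \<and> w i \<le> int n)"

lemma window_stableD: "window_stable w \<Longrightarrow> 1 \<le> i \<Longrightarrow> i \<le> int n \<Longrightarrow> 1 \<le> w i \<and> w i \<le> int n"
  by (simp add: window_stable_def)

lemma window_stable_iff: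
  assumes w: "window_stable w" shows "w x \<le> int n \<longleftrightarrow> x \<le> int n" "1 \<le> w x \<longleftrightarrow> 1 \<le> x"
proof -
  have a: "aff w" using w by (simp add: window_stable_def)
  have *: "w x \<le> int n \<longleftrightarrow> x \<le> int n" for x
  proof -
    obtain c where c: "1 \<le> x + c * int n" "x + c * int n \<le> int n" using window_shift .
    then have "1 \<le> w (x + c * int n)" "w (x + c * int n) \<le> int n" using window_stableD[OF w] by auto
    then have wc: "1 \<le> w x + c * int n" "w x + c * int n \<le> int n" by (auto simp: aff_shift[OF a])
    consider "c \<ge> 0" | "c \<le> -1" by linarith
    then show ?thesis
    proof cases
      case 1
      then have "c * int n \<ge> 0" by simp
      then show ?thesis using c wc by linarith
    next
      case 2
      then have "c * int n \<le> -1 * int n" by (intro mult_right_mono) auto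
      then show ?thesis using c wc by linarith
    qed
  qed
  show "w x \<le> int n \<longleftrightarrow> x \<le> int n" by (rule *)
  have "w (x + int n) = w x + int n" using aff_shift[OF a, of x 1] by simp
  then show "1 \<le> w x \<longleftrightarrow> 1 \<le> x" using *[of "x + int n"] by auto
qed

lemma window_stable_bij: assumes "window_stable w" shows "bij_betw w {1..int n} {1..int n}"
proof -
  have a: "aff w" using assms by (simp add: window_stable_def)
  have i: "inj_on w {1..int n}" using aff_inj[OF a] by (auto intro: inj_onI)
  moreover have "w ` {1..int n} \<subseteq> {1..int n}" using window_stableD[OF assms] by auto
  ultimately show ?thesis unfolding bij_betw_def using endo_inj_surj[of "{1..int n}" w] by blast
qed

lemma window_stable_inv: assumes "window_stable w" shows "window_stable (iv w)"
proof -
  have a: "aff w" using assms by (simp add: window_stable_def)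
  have "1 \<le> iv w z \<and> iv w z \<le> int n" if "1 \<le> z" "z \<le> int n" for z
    using window_stable_iff[OF assms, of "iv w z"] a that by simp
  then show ?thesis using aff_inv[OF a] by (simp add: window_stable_def)
qed

lemma window_stable_comp: "window_stable v \<Longrightarrow> window_stable w \<Longrightarrow> window_stable (v \<circ> w)"
  by (auto simp: window_stable_def aff_comp)

lemma window_stable_cd: assumes P: "proper J" and m: "\<not> mem J 0" shows "window_stable (cd J)"
proof -
  have mn: "\<not> mem J (int n)" using mem_shift[of J 0 1] m by simp
  have "1 \<le> cd J x \<and> cd J x \<le> int n" if x: "1 \<le> x" "x \<le> int n" for x
  proof (cases "mem J (x - 1)")
    case True
    then have "x \<noteq> 1" using m by auto
    then show ?thesis using True x by (simp add: cd_def)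
  next
    case False
    have "nxt J x \<le> int n" using nxt_props(3)[OF P, of x "int n"] mn x by (meson linorder_not_le)
    then show ?thesis using False x nxt_props(1)[OF P, of x] by (simp add: cd_def)
  qed
  then show ?thesis using aff_cd[OF P] by (simp add: window_stable_def)
qed

text \<open>Ordinary Grassmannian permutations with a descent at most at k, extended
  periodically.\<close>

definition Gr :: "nat \<Rightarrow> (int \<Rightarrow> int) \<Rightarrow> bool" where
  "Gr k w \<longleftrightarrow> window_stable w \<and> (\<forall>i j. 1 \<le> i \<and> i < j \<and> j \<le> int k \<longrightarrow> w i < w j) \<and>
     (\<forall>i j. int k < i \<and> i < j \<and> j \<le> int n \<longrightarrow> w i < w j)"

context
  fixes k :: nat
  assumes kn: "k \<le> n"
begin

text \<open>Exactly \<open>w t - 1\<close> window entries are smaller than \<open>w t\<close>, and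
  the t - 1 earlier ones are all among them.\<close>

lemma Gr_code:
  assumes w: "Gr k w" and t: "1 \<le> t" "t \<le> int k"
  shows "int (card {u. t < u \<and> u \<le> int n \<and> w u < w t}) = w t - t"
proof -
  have ws: "window_stable w" using w by (simp add: Gr_def)
  have b: "bij_betw w {1..int n} {1..int n}" using window_stable_bij[OF ws] .
  have wt: "1 \<le> w t" "w t \<le> int n" using window_stableD[OF ws, of t] t kn by auto
  let ?A = "{u \<in> {1..int n}. w u < w t}" and ?B = "{u. t < u \<and> u \<le> int n \<and> w u < w t}"
  have "w ` ?A = {1..<w t}"
  proof
    show "w ` ?A \<subseteq> {1..<w t}" using window_stableD[OF ws] by fastforce
    show "{1..<w t} \<subseteq> w ` ?A"
    proof
      fix v assume v: "v \<in> {1..<w t}"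
      have "v \<in> w ` {1..int n}" unfolding bij_betw_imp_surj_on[OF b] using v wt by simp
      then show "v \<in> w ` ?A" using v by auto
    qed
  qed
  moreover have "inj_on w ?A" using bij_betw_imp_inj_on[OF b] by (rule inj_on_subset) blast
  ultimately have "card ?A = card {1..<w t}" using card_image[of w ?A] by simp
  then have cA: "int (card ?A) = w t - 1" using wt by simp
  have "?A = {1..<t} \<union> ?B"
  proof -
    have "w u < w t" if "1 \<le> u" "u < t" for u using w that t by (simp add: Gr_def)
    then have "x \<in> ?A \<longleftrightarrow> x \<in> {1..<t} \<union> ?B" for x
      by (cases x t rule: linorder_cases) (use t kn in auto)
    then show ?thesis by blast
  qed
  moreover have "finite ?B" by (rule finite_subset[of _ "{1..int n}"]) (use t in auto)
  ultimately have "card ?A = card {1..<t} + card ?B" by (simp add: card_Un_disjoint disjoint_iff)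
  then show ?thesis using cA t by simp
qed

lemma Gr_code_0:
  assumes w: "Gr k w" and t: "int k < t" shows "{u. t < u \<and> u \<le> int n \<and> w u < w t} = {}"
proof -
  have "w t < w u" if "t < u" "u \<le> int n" for u using w t that by (simp add: Gr_def)
  then show ?thesis by force
qed

lemma Gr_ge: "Gr k w \<Longrightarrow> 1 \<le> t \<Longrightarrow> t \<le> int k \<Longrightarrow> t \<le> w t"
  using Gr_code[of w t] by linarith

lemma Gr_len: assumes w: "Gr k w" shows "int (len w) = (\<Sum>t\<in>{1..int k}. w t - t)"
proof -
  have ws: "window_stable w" using w by (simp add: Gr_def)
  let ?S = "\<lambda>t. {u. t < u \<and> u \<le> int n \<and> w u < w t}"
  have "Inv w = (SIGMA t:{1..int n}. ?S t)"
  proof -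
    have jn: "j \<le> int n" if "1 \<le> i" "i \<le> int n" "w i > w j" for i j
      using window_stable_iff(1)[OF ws, of i] window_stable_iff(1)[OF ws, of j] that by linarith
    have "(i, j) \<in> Inv w \<longleftrightarrow> (i, j) \<in> (SIGMA t:{1..int n}. ?S t)" for i j
      using jn[of i j] by (auto simp: Inv_def)
    then show ?thesis by (simp add: set_eq_iff)
  qed
  moreover have "finite (?S t)" if "t \<in> {1..int n}" for t by (rule finite_subset[of _ "{1..int n}"]) (use that in auto)
  ultimately have "len w = (\<Sum>t\<in>{1..int n}. card (?S t))" unfolding len_Inv by (simp add: card_SigmaI)
  also have "\<dots> = (\<Sum>t\<in>{1..int k}. card (?S t))"
  proof (rule sum.mono_neutral_right)
    show "\<forall>t\<in>{1..int n} - {1..int k}. card (?S t) = 0"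
    proof
      fix t assume "t \<in> {1..int n} - {1..int k}"
      then have "int k < t" by auto
      then show "card (?S t) = 0" by (simp only: Gr_code_0[OF w] card.empty)
    qed
  qed (use kn in auto)
  finally have "int (len w) = (\<Sum>t\<in>{1..int k}. int (card (?S t)))" by simp
  also have "\<dots> = (\<Sum>t\<in>{1..int k}. w t - t)" by (rule sum.cong) (use Gr_code[OF w] in auto)
  finally show ?thesis .
qed

text \<open>Part j is the code at position k - j; reading backwards makes the parts decrease, and
  zeros pad to the length of \<open>ls_shape\<close>. By \<open>Gr_ge\<close> the conversion
  \<open>nat\<close> loses nothing.\<close>

definition sh :: "(int \<Rightarrow> int) \<Rightarrow> nat list" where
  "sh w = map (\<lambda>j. if j < k then nat (w (int k - int j) - (int k - int j)) else 0) [0..<n]"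

lemma sh_length: "length (sh w) = n" by (simp add: sh_def)

lemma sh_nth: "j < n \<Longrightarrow> sh w ! j = (if j < k then nat (w (int k - int j) - (int k - int j)) else 0)"
  by (simp add: sh_def)

lemma sh_nth_int:
  assumes "Gr k w" "1 \<le> t" "t \<le> int k" shows "int (sh w ! (nat (int k - t))) = w t - t"
proof -
  have "nat (int k - t) < k" "nat (int k - t) < n" using assms kn by auto
  then show ?thesis using assms sh_nth[of "nat (int k - t)" w] Gr_ge[OF assms] by simp
qed

lemma sum_list_sh: assumes "Gr k w" shows "sum_list (sh w) = len w"
proof -
  have "sum_list (sh w) = (\<Sum>j<n. sh w ! j)" by (simp add: sum_list_sum_nth sh_length atLeast0LessThan)
  also have "\<dots> = (\<Sum>j<k. sh w ! j)" by (rule sum.mono_neutral_right) (use kn in \<open>auto simp: sh_nth\<close>)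
  finally have "int (sum_list (sh w)) = (\<Sum>j<k. int (sh w ! j))" by simp
  also have "\<dots> = (\<Sum>t\<in>{1..int k}. w t - t)"
    by (rule sum.reindex_bij_witness[where i="\<lambda>t. nat (int k - t)" and j="\<lambda>j. int k - int j"])
      (use Gr_ge[OF assms] kn in \<open>auto simp: sh_nth\<close>)
  finally show ?thesis using Gr_len[OF assms] by simp
qed

lemma sh_dec: assumes "Gr k w" "Suc i < length (sh w)" shows "sh w ! Suc i \<le> sh w ! i"
proof (cases "Suc i < k")
  case True
  have "w (int k - int (Suc i)) < w (int k - int i)" using assms(1) True by (simp add: Gr_def)
  then show ?thesis using True assms kn by (simp add: sh_nth sh_length)
next
  case False then show ?thesis using assms by (simp add: sh_nth sh_length)
qed

lemma Gr_id_iff: assumes w: "Gr k w" shows "w = id \<longleftrightarrow> (\<forall>x\<in>set (sh w). x = 0)"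
proof
  assume "w = id"
  then show "\<forall>x\<in>set (sh w). x = 0" by (auto simp: sh_def)
next
  assume "\<forall>x\<in>set (sh w). x = 0"
  then have "sum_list (sh w) = 0" by simp
  then have l0: "len w = 0" using sum_list_sh[OF w] by simp
  have ws: "window_stable w" and a: "aff w" using w by (auto simp: Gr_def window_stable_def)
  have inc: "w i < w j" if "1 \<le> i" "i < j" "i \<le> int n" for i j
  proof (rule ccontr)
    assume "\<not> w i < w j"
    then have "(i, j) \<in> Inv w" using that aff_inj[OF a, of i j] by (simp add: Inv_def)
    then show False using l0 finite_Inv[OF a] by (simp add: len_Inv)
  qed
  have le: "w i \<ge> i" if "1 \<le> i" "i \<le> int n" for i
    using that
  proof (induction "nat i" arbitrary: i)
    case 0 then show ?case by simp
  next
    case (Suc m)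
    show ?case
    proof (cases "i = 1")
      case True then show ?thesis using window_stableD[OF ws, of i] Suc by auto
    next
      case False
      then have "w (i - 1) \<ge> i - 1" using Suc(1)[of "i - 1"] Suc(2-4) by simp
      moreover have "w (i - 1) < w i" using inc[of "i - 1" i] Suc(3,4) False by simp
      ultimately show ?thesis by simp
    qed
  qed
  have ge: "w i \<le> i" if "1 \<le> i" "i \<le> int n" for i
    using that
  proof (induction "nat (int n - i)" arbitrary: i)
    case 0 then show ?case using window_stableD[OF ws] by auto
  next
    case (Suc m)
    then have "w (i + 1) \<le> i + 1" using Suc(1)[of "i + 1"] by simp
    moreover have "w i < w (i + 1)" using inc[of i "i + 1"] Suc by simp
    ultimately show ?case by simp
  qed
  show "w = id"
  proof
    fix x
    obtain c where c: "1 \<le> x + c * int n" "x + c * int n \<le> int n" using window_shift .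
    then have "w (x + c * int n) = x + c * int n" using le[OF c] ge[OF c] by simp
    then show "w x = id x" by (simp add: aff_shift[OF a])
  qed
qed

definition JJ :: "(int \<Rightarrow> int) \<Rightarrow> nat set set" where
  "JJ w = {J. proper J \<and> len (iv (cd J) \<circ> w) + card J = len w}"

lemma FP_Suc_JJ: "FP (Suc K) w = (\<Sum>J\<in>JJ w. var K ^ card J * FP K (iv (cd J) \<circ> w))"
proof -
  let ?PJ = "{J. proper J}"
  have fin: "finite ?PJ" by (rule finite_subset[of _ "Pow {..<n}"]) (auto dest: proper_less)
  have "FP (Suc K) w = (\<Sum>m<n. \<Sum>J\<in>{J \<in> ?PJ. card J = m}. var K ^ card J * UJ J (FP K) w)"
    by (simp add: Lop_def sum_distrib_left)
  also have "\<dots> = (\<Sum>J\<in>?PJ. var K ^ card J * UJ J (FP K) w)"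
    by (rule sum.group) (use fin card_proper in auto)
  also have "\<dots> = (\<Sum>J\<in>JJ w. var K ^ card J * UJ J (FP K) w)"
    by (rule sum.mono_neutral_right) (use fin in \<open>auto simp: JJ_def UJ_def\<close>)
  also have "\<dots> = (\<Sum>J\<in>JJ w. var K ^ card J * FP K (iv (cd J) \<circ> w))"
    by (rule sum.cong) (auto simp: JJ_def UJ_def)
  finally show ?thesis .
qed

context
  fixes w :: "int \<Rightarrow> int"
  assumes w: "Gr k w"
begin

text \<open>Inversions of y persist in w by \<open>inversion_mono\<close>, so y inherits the
  Grassmannian order. The outcome is that J consists, within the window, of the separated intervals
  from \<open>y t\<close> to \<open>w t - 1\<close> with t <= k: a horizontal strip is
  removed.\<close>

lemma JJ_facts:
  assumes J: "J \<in> JJ w" defines "y \<equiv> iv (cd J) \<circ> w"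
  shows "proper J" "\<not> mem J 0" "Gr k y" "\<And>t. cd J (y t) = w t"
    "\<And>t. 1 \<le> t \<Longrightarrow> t \<le> int k \<Longrightarrow> \<not> mem J (y t - 1)"
    "\<And>z. 1 \<le> z \<Longrightarrow> z \<le> int n \<Longrightarrow> mem J z \<longleftrightarrow> (\<exists>t. 1 \<le> t \<and> t \<le> int k \<and> y t \<le> z \<and> z < w t)"
    "\<And>t. 1 \<le> t \<Longrightarrow> t \<le> int k \<Longrightarrow> y t \<le> w t"
    "\<And>t. 1 \<le> t \<Longrightarrow> t < int k \<Longrightarrow> w t < y (t + 1)"
proof -
  have ws: "window_stable w" and wa: "aff w" using w by (auto simp: Gr_def window_stable_def)
  have inc1: "w i < w j" if "1 \<le> i" "i < j" "j \<le> int k" for i j using w that by (simp add: Gr_def)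
  have inc2: "w i < w j" if "int k < i" "i < j" "j \<le> int n" for i j using w that by (simp add: Gr_def)
  show P: "proper J" using J by (simp add: JJ_def)
  have y: "aff y" using wa aff_comp aff_inv aff_cd[OF P] by (simp add: y_def)
  have wy: "cd J \<circ> y = w" unfolding y_def by (rule aff_inv_comp2[OF aff_cd[OF P]])
  show cy: "cd J (y t) = w t" for t using wy by (metis comp_apply)
  have add: "len (cd J \<circ> y) = card J + len y" unfolding wy using J by (simp add: JJ_def y_def)
  have im: "w i > w j" if "i < j" "y i > y j" for i j
    using inversion_mono[OF P y add that] cy by simp
  have ivy: "y (iv y x) = x" for x using y by simp
  have wiv: "w (iv y x) = cd J x" for x using cy[of "iv y x"] ivy by simp
  \<comment> \<open>A run through 0 sends 1 to 0 and some value x0 <= 0 above 0. As w preserves the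
    window, 1 then sits to the left of x0 in y, an inversion that w lacks.\<close>
  show m0: "\<not> mem J 0"
  proof
    assume m: "mem J 0"
    obtain x0 where x0: "x0 \<le> 0" "\<not> mem J (x0 - 1)" "\<And>y. x0 \<le> y \<Longrightarrow> y \<le> 0 \<Longrightarrow> mem J y" using run_start[OF P m] by blast
    have c1: "cd J 1 = 0" using m by (simp add: cd_def)
    have "cd J x0 > cd J 1" by (rule cd_jump[OF P]) (use x0 in auto)
    then have c0: "w (iv y x0) > 0" "w (iv y 1) = 0" using wiv c1 by auto
    have q: "iv y x0 \<ge> 1" using window_stable_iff(2)[OF ws, of "iv y x0"] c0 by simp
    have p: "iv y 1 \<le> 0" using window_stable_iff(2)[OF ws, of "iv y 1"] c0 by simp
    have "w (iv y 1) > w (iv y x0)" by (rule im) (use p q x0 ivy in auto)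
    then show False using c0 by simp
  qed
  have yst: "window_stable y" unfolding y_def
    using window_stable_comp[OF window_stable_inv[OF window_stable_cd[OF P m0]] ws] .
  have yinc1: "y i < y j" if "1 \<le> i" "i < j" "j \<le> int k" for i j
    using im[of i j] inc1[OF that] aff_inj[OF y, of i j] that by linarith
  have yinc2: "y i < y j" if "int k < i" "i < j" "j \<le> int n" for i j
    using im[of i j] inc2[OF that] aff_inj[OF y, of i j] that by linarith
  show gy: "Gr k y" using yst yinc1 yinc2 by (simp add: Gr_def)
  have ywin: "1 \<le> iv y x" "iv y x \<le> int n" if "1 \<le> x" "x \<le> int n" for x
    using window_stableD[OF window_stable_inv[OF yst], of x] that by auto
  have pos: "x0 \<ge> 1" if "x0 \<le> z" "\<And>y. x0 \<le> y \<Longrightarrow> y \<le> z \<Longrightarrow> mem J y" "1 \<le> z" for x0 z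
  proof (rule ccontr)
    assume "\<not> x0 \<ge> 1"
    then have "mem J 0" using that by simp
    then show False using m0 by blast
  qed
  \<comment> \<open>Otherwise the run start before \<open>y t\<close> jumps above
    \<open>w t\<close>. If its position is left of t, w fails to increase on 1, ..., k; if right of
    t, an inversion of y is lost.\<close>
  show nm: "\<not> mem J (y t - 1)" if t: "1 \<le> t" "t \<le> int k" for t
  proof
    assume m: "mem J (y t - 1)"
    have y1: "1 \<le> y t" "y t \<le> int n" using window_stableD[OF yst, of t] t kn by auto
    then have yt: "1 \<le> y t - 1" using m m0 by (cases "y t = 1") auto
    obtain x0 where x0: "x0 \<le> y t - 1" "\<not> mem J (x0 - 1)" "\<And>z. x0 \<le> z \<Longrightarrow> z \<le> y t - 1 \<Longrightarrow> mem J z"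
      using run_start[OF P m] by blast
    have x1: "1 \<le> x0" using pos[OF x0(1,3) yt] by simp
    have "cd J x0 > cd J (y t)" by (rule cd_jump[OF P]) (use x0 in auto)
    then have gt: "w (iv y x0) > w t" using wiv cy by simp
    define q where "q = iv y x0"
    have q: "1 \<le> q" "y q = x0" using ywin[of x0] x1 x0(1) y1 ivy by (auto simp: q_def)
    have "q \<noteq> t" using q x0 by auto
    then consider "q < t" | "t < q" by linarith
    then show False
    proof cases
      case 1 then show False using inc1[of q t] q t gt by (simp add: q_def)
    next
      case 2 then show False using im[of t q] q x0 gt by (simp add: q_def)
    qed
  qed
  have wn: "w t = nxt J (y t)" if t: "1 \<le> t" "t \<le> int k" for t
    using cy[of t] nm[OF t] by (simp add: cd_def)
  show yw: "y t \<le> w t" if t: "1 \<le> t" "t \<le> int k" for t using wn[OF t] nxt_props(1)[OF P, of "y t"] by simp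
  show "w t < y (t + 1)" if t: "1 \<le> t" "t < int k" for t
  proof (rule ccontr)
    assume h: "\<not> w t < y (t + 1)"
    have "y t < y (t + 1)" using yinc1[of t "t + 1"] t by simp
    then have "mem J (y (t + 1) - 1)" using nxt_props(3)[OF P, of "y t" "y (t + 1) - 1"] wn[of t] h t by simp
    then show False using nm[of "t + 1"] t by simp
  qed
  show "mem J z \<longleftrightarrow> (\<exists>t. 1 \<le> t \<and> t \<le> int k \<and> y t \<le> z \<and> z < w t)" if z: "1 \<le> z" "z \<le> int n" for z
  proof
    assume m: "mem J z"
    obtain x0 where x0: "x0 \<le> z" "\<not> mem J (x0 - 1)" "\<And>y. x0 \<le> y \<Longrightarrow> y \<le> z \<Longrightarrow> mem J y" using run_start[OF P m] by blast
    have x1: "1 \<le> x0" using pos[OF x0(1,3) z(1)] by simp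
    define q where "q = iv y x0"
    have q: "1 \<le> q" "q \<le> int n" "y q = x0" using ywin[of x0] x1 x0(1) z ivy by (auto simp: q_def)
    show "\<exists>t. 1 \<le> t \<and> t \<le> int k \<and> y t \<le> z \<and> z < w t"
    proof (cases "q \<le> int k")
      case True
      have "z < nxt J x0"
      proof (rule ccontr)
        assume "\<not> z < nxt J x0"
        then show False using x0(3)[of "nxt J x0"] nxt_props(1,2)[OF P, of x0] by simp
      qed
      then show ?thesis using wn[of q] q True x0 by (intro exI[of _ q]) auto
    next
      \<comment> \<open>If the run started at a value from a position beyond k, then so does the
        next value x0 + 1, because \<open>y t - 1\<close> is never in J for t <= k;
        \<open>cd J\<close> would put these two in the wrong order.\<close>
      case False
      have mx: "mem J x0" using x0 by simp
      have "x0 \<noteq> int n" using mx m0 mem_shift[of J 0 1] by auto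
      then have xn: "x0 + 1 \<le> int n" using x0(1) z by simp
      define q' where "q' = iv y (x0 + 1)"
      have q': "1 \<le> q'" "q' \<le> int n" "y q' = x0 + 1" using ywin[of "x0 + 1"] x1 xn ivy by (auto simp: q'_def)
      have kq': "int k < q'"
      proof (rule ccontr)
        assume "\<not> int k < q'"
        then show False using nm[of q'] q' mx by simp
      qed
      have "q < q'"
      proof (rule ccontr)
        assume "\<not> q < q'"
        then have "q' < q" using q q' by (cases "q = q'") auto
        then show False using yinc2[OF kq', of q] q q' by simp
      qed
      then have "w q < w q'" using inc2[of q q'] False q' by simp
      moreover have "cd J x0 > cd J (x0 + 1)"
      proof (rule cd_jump[OF P _ x0(2)])
        fix z assume "x0 \<le> z" "z < x0 + 1"
        then have "z = x0" by simp
        then show "mem J z" using mx by simp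
      qed simp
      ultimately show ?thesis using wiv by (simp add: q_def q'_def)
    qed
  next
    assume "\<exists>t. 1 \<le> t \<and> t \<le> int k \<and> y t \<le> z \<and> z < w t"
    then obtain t where t: "1 \<le> t" "t \<le> int k" "y t \<le> z" "z < w t" by blast
    then show "mem J z" using nxt_props(3)[OF P, of "y t" z] wn[of t] by simp
  qed
qed

end
end

context
  fixes k :: nat and w :: "int \<Rightarrow> int"
  assumes kn: "k \<le> n" and w: "Gr k w"
begin

lemma JJ_interl:
  assumes J: "J \<in> JJ w" shows "sh k (iv (cd J) \<circ> w) \<in> interl (sh k w)"
proof -
  note F = JJ_facts[OF kn w J]
  define y where "y = iv (cd J) \<circ> w"
  note F = F[folded y_def]
  have gy: "Gr k y" by (rule F(3))
  have "sh k y \<in> interl (sh k w)" unfolding interl_def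
  proof (intro CollectI conjI allI impI)
    show "length (sh k y) = length (sh k w)" by (simp add: sh_length[OF kn])
    fix i assume "i < length (sh k w)"
    then have i: "i < n" by (simp add: sh_length[OF kn])
    show "sh k y ! i \<le> sh k w ! i"
      using F(7)[of "int k - int i"] i by (auto simp: sh_nth[OF kn])
    assume "Suc i < length (sh k w)"
    then have si: "Suc i < n" by (simp add: sh_length[OF kn])
    show "sh k w ! Suc i \<le> sh k y ! i"
    proof (cases "Suc i < k")
      case True
      have "w (int k - int (Suc i)) < y (int k - int (Suc i) + 1)" using F(8)[of "int k - int (Suc i)"] True by simp
      then show ?thesis using True i si by (simp add: sh_nth[OF kn])
    next
      case False then show ?thesis using si by (simp add: sh_nth[OF kn])
    qed
  qed
  then show ?thesis by (simp add: y_def)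
qed

text \<open>The shape fixes \<open>y t\<close> for t <= k, hence the intervals that make up
  J.\<close>

lemma JJ_inj: "inj_on (\<lambda>J. sh k (iv (cd J) \<circ> w)) (JJ w)"
proof (rule inj_onI)
  fix J J' assume h: "J \<in> JJ w" "J' \<in> JJ w" "sh k (iv (cd J) \<circ> w) = sh k (iv (cd J') \<circ> w)"
  note F = JJ_facts[OF kn w h(1)] and F' = JJ_facts[OF kn w h(2)]
  have e: "(iv (cd J) \<circ> w) t = (iv (cd J') \<circ> w) t" if "1 \<le> t" "t \<le> int k" for t
    using sh_nth_int[OF kn F(3) that] sh_nth_int[OF kn F'(3) that] h(3) by simp
  have m: "mem J z \<longleftrightarrow> mem J' z" if "1 \<le> z" "z \<le> int n" for z
    unfolding F(6)[OF that] F'(6)[OF that] using e by metis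
  have "c \<in> J \<longleftrightarrow> c \<in> J'" if c: "c < n" for c
  proof (cases "c = 0")
    case True then show ?thesis using F(2) F'(2) mem_nat[OF c, of J] mem_nat[OF c, of J'] by simp
  next
    case False then show ?thesis using m[of "int c"] mem_nat[OF c, of J] mem_nat[OF c, of J'] c by simp
  qed
  then show "J = J'" using proper_less[OF F(1)] proper_less[OF F'(1)] by blast
qed

text \<open>The partition prescribes the values \<open>a t\<close> of y on 1, ..., k, and J has to
  be the union of the intervals from \<open>a t\<close> to \<open>w t - 1\<close>. Interlacing says
  precisely that \<open>a t \<le> w t < a (t + 1)\<close>, so the intervals are separated.\<close>

lemma JJ_surj:
  assumes mu: "mu \<in> interl (sh k w)"
  shows "\<exists>J\<in>JJ w. sh k (iv (cd J) \<circ> w) = mu"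
proof -
  have ws: "window_stable w" and wa: "aff w" using w by (auto simp: Gr_def window_stable_def)
  have inc1: "w i < w j" if "1 \<le> i" "i < j" "j \<le> int k" for i j using w that by (simp add: Gr_def)
  have inc2: "w i < w j" if "int k < i" "i < j" "j \<le> int n" for i j using w that by (simp add: Gr_def)
  define a where "a = (\<lambda>t. int (mu ! nat (int k - t)) + t)"
  have lmu: "length mu = n" using mu by (simp add: interl_def sh_length[OF kn])
  have aw: "a t \<le> w t" if t: "1 \<le> t" "t \<le> int k" for t
  proof -
    have "nat (int k - t) < n" using t kn by linarith
    then have "mu ! nat (int k - t) \<le> sh k w ! nat (int k - t)" using mu by (simp add: interl_def sh_length[OF kn])
    then show ?thesis using sh_nth_int[OF kn w t] by (simp add: a_def)
  qed
  have wa1: "w t < a (t + 1)" if t: "1 \<le> t" "t < int k" for t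
  proof -
    define j where "j = nat (int k - (t + 1))"
    have j: "Suc j = nat (int k - t)" "Suc j < n" using t kn by (auto simp: j_def)
    have "sh k w ! Suc j \<le> mu ! j" using mu j(2) unfolding interl_def sh_length[OF kn] by simp
    then have "sh k w ! nat (int k - t) \<le> mu ! j" unfolding j(1) .
    then show ?thesis using sh_nth_int[OF kn w, of t] t by (simp add: a_def j_def)
  qed
  have wlt: "w s < a t" if "1 \<le> s" "s < t" "t \<le> int k" for s t
  proof -
    have "w s \<le> w (t - 1)" using inc1[of s "t - 1"] that by (cases "s = t - 1") auto
    also have "\<dots> < a t" using wa1[of "t - 1"] that by simp
    finally show ?thesis .
  qed
  have a1: "1 \<le> a t" if t: "1 \<le> t" "t \<le> int k" for t using t by (simp add: a_def)
  have ainc: "a s < a t" if "1 \<le> s" "s < t" "t \<le> int k" for s t using aw[of s] wlt[OF that] that by simp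
  have wN: "w t \<le> int n" if t: "1 \<le> t" "t \<le> int k" for t using window_stableD[OF ws, of t] t kn by simp
  define U where "U = (\<Union>t\<in>{1..int k}. {a t..<w t})"
  define J where "J = nat ` U"
  have Uwin: "1 \<le> z \<and> z < int n" if "z \<in> U" for z using that a1 wN by (force simp: U_def)
  have J0: "0 \<notin> J" using Uwin by (force simp: J_def)
  have Jn: "J \<subseteq> {..<n}" using Uwin by (force simp: J_def)
  have P: "proper J" by (rule psubsetI[OF Jn]) (use J0 n_pos in auto)
  have m0: "\<not> mem J 0" using J0 by (simp add: mem_def)
  have mn: "\<not> mem J (int n)" using J0 by (simp add: mem_def)
  have memJ: "mem J z \<longleftrightarrow> z \<in> U" if z: "1 \<le> z" "z \<le> int n" for z
  proof (cases "z = int n")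
    case True then show ?thesis using mn Uwin by auto
  next
    case False
    then have zm: "z mod int n = z" using z by simp
    have "nat z \<in> J \<longleftrightarrow> z \<in> U"
    proof
      assume "nat z \<in> J"
      then obtain z' where z': "z' \<in> U" "nat z = nat z'" by (auto simp: J_def)
      then have "z = z'" using Uwin[of z'] z by (simp add: eq_nat_nat_iff)
      then show "z \<in> U" using z' by simp
    qed (simp add: J_def)
    then show ?thesis by (simp add: mem_def zm)
  qed
  have Uiff: "z \<in> U \<longleftrightarrow> (\<exists>t. 1 \<le> t \<and> t \<le> int k \<and> a t \<le> z \<and> z < w t)" for z by (auto simp: U_def)
  have cda: "cd J (a t) = w t" if t: "1 \<le> t" "t \<le> int k" for t
  proof -
    have "\<not> mem J (a t - 1)"
    proof
      assume m: "mem J (a t - 1)"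
      have "a t \<noteq> 1" using m m0 by auto
      then have "a t - 1 \<in> U" using m memJ[of "a t - 1"] a1[OF t] aw[OF t] wN[OF t] by simp
      then obtain s where s: "1 \<le> s" "s \<le> int k" "a s \<le> a t - 1" "a t - 1 < w s" using Uiff by blast
      have "s < t"
      proof (rule ccontr)
        assume "\<not> s < t"
        then have "s = t \<or> t < s" by linarith
        then show False using ainc[of t s] s t by auto
      qed
      then show False using wlt[of s t] s t by simp
    qed
    moreover have "nxt J (a t) = w t"
    proof (rule nxt_eqI[OF P aw[OF t]])
      show "\<not> mem J (w t)"
      proof
        assume "mem J (w t)"
        then have "w t \<in> U" using memJ[of "w t"] a1[OF t] aw[OF t] wN[OF t] by simp
        then obtain s where s: "1 \<le> s" "s \<le> int k" "a s \<le> w t" "w t < w s" using Uiff by blast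
        have "t < s"
        proof (rule ccontr)
          assume "\<not> t < s"
          then have "s = t \<or> s < t" by linarith
          then show False using inc1[of s t] s t by auto
        qed
        then show False using wlt[of t s] s t by simp
      qed
      fix z assume z: "a t \<le> z" "z < w t"
      then have "z \<in> U" using Uiff t by blast
      then show "mem J z" using memJ[of z] Uwin[of z] by simp
    qed
    ultimately show ?thesis by (simp add: cd_def)
  qed
  \<comment> \<open>A point just after a member of J and itself outside J ends an interval, so it is
    some \<open>w t\<close> with t <= k and not a value from a position beyond k.\<close>
  have edge: "\<exists>t. 1 \<le> t \<and> t \<le> int k \<and> z = w t" if "mem J (z - 1)" "\<not> mem J z" "1 \<le> z" "z \<le> int n" for z
  proof -
    have "z \<noteq> 1" using that m0 by auto
    then have "z - 1 \<in> U" using memJ[of "z - 1"] that by simp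
    then obtain t where t: "1 \<le> t" "t \<le> int k" "a t \<le> z - 1" "z - 1 < w t" using Uiff by blast
    have "\<not> z < w t"
    proof
      assume "z < w t"
      then have "z \<in> U" using Uiff t by force
      then show False using that memJ[of z] by simp
    qed
    then show ?thesis using t by (intro exI[of _ t]) auto
  qed
  have notw: "w u \<noteq> w t" if "int k < u" "1 \<le> t" "t \<le> int k" for u t
    using aff_inj[OF wa, of u t] that by auto
  define y where "y = iv (cd J) \<circ> w"
  have ya: "aff y" using aff_comp aff_inv aff_cd[OF P] wa by (simp add: y_def)
  have yI: "y t = x" if "cd J x = w t" for t x using that aff_cd[OF P] by (metis aff_inv_f comp_apply y_def)
  have yt: "y t = a t" if "1 \<le> t" "t \<le> int k" for t using yI[OF cda[OF that]] .
  \<comment> \<open>Beyond k, a value in J is the image of its successor under \<open>cd J\<close>;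
    any other value is fixed.\<close>
  have yu: "y u = (if mem J (w u) then w u + 1 else w u)" if u: "int k < u" "u \<le> int n" for u
  proof (rule yI)
    have wu: "1 \<le> w u" "w u \<le> int n" using window_stableD[OF ws, of u] u by auto
    show "cd J (if mem J (w u) then w u + 1 else w u) = w u"
    proof (cases "mem J (w u)")
      case True then show ?thesis by (simp add: cd_def)
    next
      case False
      have "\<not> mem J (w u - 1)" using edge[OF _ False wu] notw[OF u(1)] by metis
      then show ?thesis using False nxt_self[OF P False] by (simp add: cd_def)
    qed
  qed
  have yst: "window_stable y" unfolding y_def
    using window_stable_comp[OF window_stable_inv[OF window_stable_cd[OF P m0]] ws] .
  have "y i < y j" if ij: "int k < i" "i < j" "j \<le> int n" for i j
  proof -
    have lt: "w i < w j" using inc2[OF ij] .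
    have wj: "1 \<le> w j" "w j \<le> int n" using window_stableD[OF ws, of j] ij by auto
    show ?thesis
    proof (cases "mem J (w i) \<and> \<not> mem J (w j) \<and> w j = w i + 1")
      case True
      then have "mem J (w j - 1)" "\<not> mem J (w j)" by auto
      then have "\<exists>t. 1 \<le> t \<and> t \<le> int k \<and> w j = w t" using edge wj by blast
      then show ?thesis using notw[of j] ij by force
    next
      case False then show ?thesis using lt yu[of i] yu[of j] ij by auto
    qed
  qed
  moreover have "y i < y j" if "1 \<le> i" "i < j" "j \<le> int k" for i j using ainc[OF that] yt[of i] yt[of j] that by simp
  ultimately have gy: "Gr k y" using yst by (simp add: Gr_def)
  have cJ: "int (card J) = (\<Sum>t\<in>{1..int k}. w t - a t)"
  proof -
    have "inj_on nat U"
      by (rule inj_onI) (use Uwin in \<open>force simp: eq_nat_nat_iff\<close>)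
    then have "card J = card U" by (simp add: J_def card_image)
    also have "\<dots> = (\<Sum>t\<in>{1..int k}. card {a t..<w t})" unfolding U_def
    proof (rule card_UN_disjoint)
      show "\<forall>i\<in>{1..int k}. \<forall>j\<in>{1..int k}. i \<noteq> j \<longrightarrow> {a i..<w i} \<inter> {a j..<w j} = {}"
      proof (intro ballI impI)
        fix i j assume h: "i \<in> {1..int k}" "j \<in> {1..int k}" "i \<noteq> j"
        then consider "i < j" | "j < i" by linarith
        then show "{a i..<w i} \<inter> {a j..<w j} = {}"
        proof cases
          case 1 then show ?thesis using wlt[of i j] h by auto
        next
          case 2 then show ?thesis using wlt[of j i] h by auto
        qed
      qed
    qed auto
    finally have "int (card J) = (\<Sum>t\<in>{1..int k}. int (card {a t..<w t}))" by simp
    also have "\<dots> = (\<Sum>t\<in>{1..int k}. w t - a t)" by (rule sum.cong) (use aw in auto)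
    finally show ?thesis .
  qed
  have "(\<Sum>t\<in>{1..int k}. y t - t) = (\<Sum>t\<in>{1..int k}. a t - t)" by (rule sum.cong) (use yt in auto)
  then have "int (len y) + int (card J) = int (len w)"
    unfolding Gr_len[OF kn gy] Gr_len[OF kn w] cJ by (simp add: sum.distrib[symmetric])
  then have "len y + card J = len w" by linarith
  then have JJ: "J \<in> JJ w" using P unfolding JJ_def[OF kn] y_def by simp
  have "sh k y = mu"
  proof (rule nth_equalityI)
    show "length (sh k y) = length mu" by (simp add: sh_length[OF kn] lmu)
    fix i assume "i < length (sh k y)"
    then have i: "i < n" by (simp add: sh_length[OF kn])
    show "sh k y ! i = mu ! i"
    proof (cases "i < k")
      case True
      then show ?thesis using yt[of "int k - int i"] i by (simp add: sh_nth[OF kn] a_def)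
    next
      case False
      have "mu ! i \<le> sh k w ! i" using mu i by (simp add: interl_def sh_length[OF kn])
      then show ?thesis using False i by (simp add: sh_nth[OF kn])
    qed
  qed
  then show ?thesis using JJ by (auto simp: y_def)
qed

end

text \<open>Splitting off the leftmost factor matches \<open>schur_branch\<close> term by term. The
  number K of variables is kept independent of the descent k, as the induction requires.\<close>

lemma FP_Gr: "k \<le> n \<Longrightarrow> Gr k w \<Longrightarrow> FP K w = schur_poly K (sh k w)"
proof (induction K arbitrary: w)
  case 0
  then show ?case using Gr_id_iff[OF 0] by (simp add: schur_poly_0)
next
  case (Suc K)
  note kn = Suc(2) and w = Suc(3)
  let ?f = "\<lambda>J. sh k (iv (cd J) \<circ> w)"
  have bij: "bij_betw ?f (JJ w) (interl (sh k w))"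
    unfolding bij_betw_def
  proof
    show "inj_on ?f (JJ w)" by (rule JJ_inj[OF kn w])
    show "?f ` JJ w = interl (sh k w)"
    proof
      show "?f ` JJ w \<subseteq> interl (sh k w)" using JJ_interl[OF kn w] by blast
      show "interl (sh k w) \<subseteq> ?f ` JJ w" using JJ_surj[OF kn w] by blast
    qed
  qed
  have "FP (Suc K) w = (\<Sum>J\<in>JJ w. var K ^ card J * FP K (iv (cd J) \<circ> w))" by (rule FP_Suc_JJ[OF kn])
  also have "\<dots> = (\<Sum>J\<in>JJ w. schur_poly K (?f J) * var K ^ (sum_list (sh k w) - sum_list (?f J)))"
  proof (rule sum.cong[OF refl])
    fix J assume J: "J \<in> JJ w"
    have gy: "Gr k (iv (cd J) \<circ> w)" by (rule JJ_facts(3)[OF kn w J])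
    have "card J = len w - len (iv (cd J) \<circ> w)" using J unfolding JJ_def[OF kn] by auto
    then have "card J = sum_list (sh k w) - sum_list (?f J)" by (simp only: sum_list_sh[OF kn w] sum_list_sh[OF kn gy])
    then show "var K ^ card J * FP K (iv (cd J) \<circ> w) = schur_poly K (?f J) * var K ^ (sum_list (sh k w) - sum_list (?f J))"
      using Suc(1)[OF kn gy] by (simp only: mult.commute)
  qed
  also have "\<dots> = (\<Sum>mu\<in>interl (sh k w). schur_poly K mu * var K ^ (sum_list (sh k w) - sum_list mu))"
    by (rule sum.reindex_bij_betw[OF bij, of "\<lambda>mu. schur_poly K mu * var K ^ (sum_list (sh k w) - sum_list mu)"])
  also have "\<dots> = schur_poly (Suc K) (sh k w)"
    by (rule schur_branch[symmetric]) (rule sh_dec[OF kn w])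
  finally show ?case .
qed

section \<open>Conjugation by the shift, and the Schur polynomial of a leaf\<close>

lemma len_tau_right: assumes "aff f" shows "len (f \<circ> tau_pow m) = len f"
proof -
  have z: "len (tau_pow m) = 0" for m using len_tau_left[of m id] len_id by simp
  have "len (f \<circ> tau_pow m) \<le> len f" using len_comp_le[OF assms aff_tau, of m] z by simp
  moreover have "len f \<le> len (f \<circ> tau_pow m)"
    using len_comp_le[OF aff_comp[OF assms aff_tau] aff_tau, of m "- m"] z by (simp add: comp_assoc tau_tau)
  ultimately show ?thesis by simp
qed

definition cnj :: "(int \<Rightarrow> int) \<Rightarrow> int \<Rightarrow> int" where "cnj w = tau_pow 1 \<circ> w \<circ> tau_pow (- 1)"

lemma cnj_apply: "cnj w x = w (x - 1) + 1" by (simp add: cnj_def tau_pow_def)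

lemma len_cnj: "aff w \<Longrightarrow> len (cnj w) = len w"
  unfolding cnj_def comp_assoc len_tau_left by (rule len_tau_right)

lemma cnj_comp: "cnj (v \<circ> w) = cnj v \<circ> cnj w"
  by (rule ext) (simp add: cnj_apply)

lemma cnj_inv: assumes "aff v" shows "iv (cnj v) = cnj (iv v)"
  by (rule inv_unique_comp) (use assms in \<open>auto simp: cnj_apply fun_eq_iff\<close>)

lemma cnj_id_iff: "cnj w = id \<longleftrightarrow> w = id"
proof
  assume "cnj w = id"
  then have "cnj w (x + 1) = x + 1" for x by simp
  then show "w = id" by (auto simp: cnj_apply fun_eq_iff)
qed (auto simp: cnj_apply fun_eq_iff)

text \<open>Conjugation by \<open>\<tau>\<close> rotates supports, hence preserves \<open>FP\<close>; it turns \<open>\<tau>\<^sup>-\<^sup>k g\<close> into \<open>g \<tau>\<^sup>-\<^sup>k\<close>.\<close>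

definition rotJ :: "nat set \<Rightarrow> nat set" where "rotJ J = (\<lambda>j. nat ((int j + 1) mod int n)) ` J"

lemma mem_rotJ: assumes "J \<subseteq> {..<n}" shows "mem (rotJ J) x \<longleftrightarrow> mem J (x - 1)"
proof
  assume "mem (rotJ J) x"
  then obtain j where j: "j \<in> J" "nat (x mod int n) = nat ((int j + 1) mod int n)" by (auto simp: mem_def rotJ_def)
  then have "cg x (int j + 1)" using n_pos by (simp add: cong_def eq_nat_nat_iff)
  then have "cg (x - 1) (int j)" using cong_diff[of x "int j + 1" "int n" 1 1] by simp
  moreover have "mem J (int j)" using j assms mem_nat by blast
  ultimately show "mem J (x - 1)" using mem_cg by blast
next
  assume m: "mem J (x - 1)"
  define j where "j = nat ((x - 1) mod int n)"
  have "j \<in> J" using m by (simp add: mem_def j_def)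
  moreover have "nat (x mod int n) = nat ((int j + 1) mod int n)" using n_pos by (simp add: j_def mod_simps)
  ultimately show "mem (rotJ J) x" by (auto simp: mem_def rotJ_def)
qed

lemma card_rotJ: assumes "J \<subseteq> {..<n}" shows "card (rotJ J) = card J"
  unfolding rotJ_def
proof (rule card_image, rule inj_onI)
  fix i j assume h: "i \<in> J" "j \<in> J" "nat ((int i + 1) mod int n) = nat ((int j + 1) mod int n)"
  then have "cg (int i + 1) (int j + 1)" using n_pos by (simp add: cong_def eq_nat_nat_iff)
  then have "cg (int i) (int j)" by (simp add: cong_add_rcancel)
  moreover have "i < n" "j < n" using h assms by auto
  ultimately show "i = j" by (simp add: cong_def)
qed

lemma proper_rotJ: assumes "proper J" shows "proper (rotJ J)"
proof -
  have "J \<subseteq> {..<n}" "card J < n" using assms by (auto simp: proper_iff)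
  then show ?thesis unfolding proper_iff using card_rotJ[of J] nat_mod_less by (auto simp: rotJ_def)
qed

lemma cd_rotJ: assumes "proper J" shows "cd (rotJ J) = cnj (cd J)"
proof
  fix x
  have M: "mem (rotJ J) z \<longleftrightarrow> mem J (z - 1)" for z by (rule mem_rotJ[OF psubset_imp_subset[OF assms]])
  note N = nxt_props[OF assms, of "x - 1"]
  have "nxt (rotJ J) x = nxt J (x - 1) + 1"
    by (rule nxt_eqI[OF proper_rotJ[OF assms]]) (use N M in auto)
  then show "cd (rotJ J) x = cnj (cd J) x" using M[of "x - 1"] by (simp add: cd_def cnj_apply)
qed

lemma Lop_cnj:
  fixes \<phi> :: "(int \<Rightarrow> int) \<Rightarrow> 'b::comm_ring_1"
  assumes w: "aff w" and inv: "\<And>u. aff u \<Longrightarrow> \<phi> (cnj u) = \<phi> u" shows "Lop m \<phi> (cnj w) = Lop m \<phi> w"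
proof -
  let ?A = "{J. proper J \<and> card J = m}"
  have sub: "rotJ ` ?A \<subseteq> ?A"
  proof (rule image_subsetI)
    fix J assume "J \<in> ?A"
    then have J: "proper J" "card J = m" by simp_all
    show "rotJ J \<in> ?A" using proper_rotJ[OF J(1)] card_rotJ[OF psubset_imp_subset[OF J(1)]] J(2) by simp
  qed
  have inj: "inj_on rotJ ?A"
  proof (rule inj_onI)
    fix J K assume h: "J \<in> ?A" "K \<in> ?A" "rotJ J = rotJ K"
    have sJ: "J \<subseteq> {..<n}" "K \<subseteq> {..<n}" using h(1,2) by (simp_all add: psubset_imp_subset)
    have "mem J x \<longleftrightarrow> mem K x" for x using mem_rotJ[OF sJ(1), of "x + 1"] mem_rotJ[OF sJ(2), of "x + 1"] h(3) by simp
    then have "c \<in> J \<longleftrightarrow> c \<in> K" if "c < n" for c using mem_nat[OF that] by blast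
    then show "J = K" using sJ by blast
  qed
  have "bij_betw rotJ ?A ?A" unfolding bij_betw_def using endo_inj_surj[OF finite_sets sub inj] inj by blast
  then have "Lop m \<phi> (cnj w) = (\<Sum>J\<in>?A. UJ (rotJ J) \<phi> (cnj w))"
    unfolding Lop_def using sum.reindex_bij_betw[of rotJ ?A ?A "\<lambda>J. UJ J \<phi> (cnj w)"] by simp
  also have "\<dots> = Lop m \<phi> w" unfolding Lop_def
  proof (rule sum.cong[OF refl])
    fix J assume "J \<in> ?A"
    then have J: "proper J" "card J = m" by auto
    have a: "aff (iv (cd J) \<circ> w)" using aff_comp aff_inv aff_cd[OF J(1)] w by blast
    have "iv (cd (rotJ J)) \<circ> cnj w = cnj (iv (cd J) \<circ> w)"
      unfolding cd_rotJ[OF J(1)] cnj_inv[OF aff_cd[OF J(1)]] cnj_comp ..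
    then show "UJ (rotJ J) \<phi> (cnj w) = UJ J \<phi> w"
      unfolding UJ_def using card_rotJ[OF psubset_imp_subset[OF J(1)]] len_cnj[OF a] len_cnj[OF w] inv[OF a] by simp
  qed
  finally show ?thesis .
qed

lemma FP_cnj: "aff w \<Longrightarrow> FP K (cnj w) = FP K w"
proof (induction K arbitrary: w)
  case 0 then show ?case by (simp add: cnj_id_iff)
next
  case (Suc K) then show ?case unfolding FP.simps by (intro sum.cong refl arg_cong2[of _ _ _ _ "(*)"] Lop_cnj) auto
qed

lemma FP_conj: "aff w \<Longrightarrow> FP K (tau_pow (int a) \<circ> w \<circ> tau_pow (- int a)) = FP K w"
proof (induction a)
  case 0 then show ?case by (simp add: tau_tau)
next
  case (Suc a)
  have "tau_pow (int (Suc a)) \<circ> w \<circ> tau_pow (- int (Suc a)) = cnj (tau_pow (int a) \<circ> w \<circ> tau_pow (- int a))"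
    by (rule ext) (simp add: cnj_apply tau_pow_def algebra_simps)
  moreover have "FP K (cnj (tau_pow (int a) \<circ> w \<circ> tau_pow (- int a))) = FP K (tau_pow (int a) \<circ> w \<circ> tau_pow (- int a))"
    by (rule FP_cnj) (intro aff_comp aff_tau Suc(2))
  ultimately show ?case using Suc(1)[OF Suc(2)] by metis
qed

text \<open>g increases on the window, so its k values above n occupy the last k positions; the
  shift by k brings these to the front, one period lower.\<close>

lemma grassmannian_Bound:
  assumes kn: "k \<le> n" and g: "g \<in> Bound k n" "window_inversions n g = {}"
  shows "Gr k (g \<circ> tau_pow (- int k))"
proof -
  have ga: "aff g" and b: "\<And>i. i \<le> g i" "\<And>i. g i \<le> i + int n" and c: "card {i \<in> {1..int n}. g i > int n} = k"
    using g by (auto simp: Bound_def)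
  have inc: "g i < g j" if "1 \<le> i" "i < j" "j \<le> int n" for i j
  proof -
    have "(i, j) \<notin> window_inversions n g" using g by blast
    then show ?thesis using that aff_inj[OF ga, of i j] by (simp add: window_inversions_def)
  qed
  let ?S = "{i \<in> {1..int n}. g i > int n}"
  have fS: "finite ?S" by (rule finite_subset[of _ "{1..int n}"]) auto
  have big: "g i > int n \<longleftrightarrow> i > int n - int k" if i: "1 \<le> i" "i \<le> int n" for i
  proof
    assume h: "g i > int n"
    have "{i..int n} \<subseteq> ?S"
    proof
      fix j assume j: "j \<in> {i..int n}"
      then show "j \<in> ?S" using inc[of i j] i h by (cases "i = j") auto
    qed
    then have "card {i..int n} \<le> k" using card_mono[OF fS] c by metis
    then show "i > int n - int k" using i by simp
  next
    assume h: "i > int n - int k"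
    show "g i > int n"
    proof (rule ccontr)
      assume ni: "\<not> g i > int n"
      have "?S \<subseteq> {i + 1..int n}"
      proof
        fix j assume j: "j \<in> ?S"
        have "\<not> j \<le> i"
        proof
          assume "j \<le> i"
          then show False using inc[of j i] j i ni by (cases "i = j") auto
        qed
        then show "j \<in> {i + 1..int n}" using j by simp
      qed
      then have "k \<le> card {i + 1..int n}" using card_mono[of "{i + 1..int n}" ?S] c by simp
      then show False using h i by simp
    qed
  qed
  define w where "w = g \<circ> tau_pow (- int k)"
  have wa: "aff w" using ga aff_comp aff_tau by (simp add: w_def)
  have w1: "w i = g (i - int k + int n) - int n" for i
    using aff_shift[OF ga, of "i - int k" 1] by (simp add: w_def tau_pow_def)
  have w2: "w i = g (i - int k)" for i by (simp add: w_def tau_pow_def)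
  have "1 \<le> w i \<and> w i \<le> int n" if i: "1 \<le> i" "i \<le> int n" for i
  proof (cases "i \<le> int k")
    case True
    have "g (i - int k + int n) > int n" using big[of "i - int k + int n"] i True kn by simp
    then show ?thesis using b(2)[of "i - int k + int n"] w1[of i] True by simp
  next
    case False
    have "\<not> g (i - int k) > int n" using big[of "i - int k"] i False by simp
    then show ?thesis using b(1)[of "i - int k"] w2[of i] False by simp
  qed
  moreover have "w i < w j" if "1 \<le> i" "i < j" "j \<le> int k" for i j
    using inc[of "i - int k + int n" "j - int k + int n"] that kn by (simp add: w1)
  moreover have "w i < w j" if "int k < i" "i < j" "j \<le> int n" for i j
    using inc[of "i - int k" "j - int k"] that by (simp add: w2)
  ultimately show ?thesis using wa unfolding w_def[symmetric] by (simp add: Gr_def window_stable_def)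
qed

text \<open>The code increases weakly on the first k positions and vanishes afterwards, so sorting
  it decreasingly merely reverses that first block.\<close>

lemma ls_shape_Gr:
  assumes kn: "k \<le> n" and w: "Gr k (g \<circ> tau_pow (- int k))"
  shows "ls_shape k n g = sh k (g \<circ> tau_pow (- int k))"
proof -
  define w' where "w' = g \<circ> tau_pow (- int k)"
  note w = w[folded w'_def]
  define xs where "xs = map (perm_code n w') [1..int n]"
  have lx: "length xs = n" by (simp add: xs_def)
  have xj: "xs ! j = perm_code n w' (int j + 1)" if "j < n" for j using that by (simp add: xs_def add.commute)
  have code: "perm_code n w' t = nat (w' t - t)" if "1 \<le> t" "t \<le> int k" for t
    using Gr_code[OF kn w that] unfolding perm_code_def by linarith
  have code0: "perm_code n w' t = 0" if "int k < t" for t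
    using Gr_code_0[OF kn w that] unfolding perm_code_def by (metis card.empty)
  have sh: "sh k w' = rev (take k xs) @ drop k xs"
  proof (rule nth_equalityI)
    show "length (sh k w') = length (rev (take k xs) @ drop k xs)" using kn by (simp add: sh_length[OF kn] lx)
    fix j assume "j < length (sh k w')"
    then have j: "j < n" by (simp add: sh_length[OF kn])
    show "sh k w' ! j = (rev (take k xs) @ drop k xs) ! j"
    proof (cases "j < k")
      case True
      have "(rev (take k xs) @ drop k xs) ! j = xs ! (k - 1 - j)" using True kn lx by (simp add: nth_append rev_nth)
      also have "\<dots> = perm_code n w' (int k - int j)" using xj[of "k - 1 - j"] True kn by (simp add: of_nat_diff)
      also have "\<dots> = sh k w' ! j" using code[of "int k - int j"] True j by (simp add: sh_nth[OF kn])
      finally show ?thesis by simp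
    next
      case False
      have "(rev (take k xs) @ drop k xs) ! j = xs ! j" using False kn lx j by (simp add: nth_append)
      also have "\<dots> = 0" using xj[OF j] code0[of "int j + 1"] False by simp
      finally show ?thesis using False j by (simp add: sh_nth[OF kn])
    qed
  qed
  have "mset (rev (sh k w')) = mset xs"
    unfolding sh mset_rev mset_append[of "rev (take k xs)"] by (metis append_take_drop_id mset_append mset_rev)
  moreover have "sorted (rev (sh k w'))"
    unfolding sorted_rev_iff_nth_Suc using sh_dec[OF kn w] by blast
  ultimately have "sort xs = rev (sh k w')" by (rule properties_for_sort)
  then show ?thesis unfolding ls_shape_def w'_def[symmetric] xs_def[symmetric] by simp
qed

lemma FP_leaf:
  assumes kn: "k \<le> n" and g: "g \<in> Bound k n" "window_inversions n g = {}"
  shows "FP k (tau_pow (- int k) \<circ> g) = schur_poly k (ls_shape k n g)"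
proof -
  have ga: "aff g" using g by (auto simp: Bound_def)
  have G: "Gr k (g \<circ> tau_pow (- int k))" by (rule grassmannian_Bound[OF assms])
  have "FP k (tau_pow (- int k) \<circ> g) = FP k (tau_pow (int k) \<circ> (tau_pow (- int k) \<circ> g) \<circ> tau_pow (- int k))"
    by (rule FP_conj[symmetric]) (intro aff_comp aff_tau ga)
  also have "tau_pow (int k) \<circ> (tau_pow (- int k) \<circ> g) \<circ> tau_pow (- int k) = g \<circ> tau_pow (- int k)"
    by (rule ext) (simp add: tau_pow_def)
  finally show ?thesis unfolding FP_Gr[OF kn G] ls_shape_Gr[OF kn G] .
qed

end

section \<open>Factorizations into cyclically decreasing elements\<close>

context affine_window begin

text \<open>On the window the values lie between 1 and 2 n; subtracting n from those above n leaves
  a permutation of the window, so each of them contributes n.\<close>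

lemma lev_bounded:
  assumes f: "aff f" and b: "\<And>i. i \<le> f i \<and> f i \<le> i + int n"
  shows "lev f = int (card {i \<in> {1..int n}. f i > int n}) * int n"
proof -
  have red: "f i = red (f i) + (if f i > int n then int n else 0)" if i: "i \<in> {1..int n}" for i
  proof -
    have *: "red y = y" if "1 \<le> y" "y \<le> int n" for y using that by (simp add: red_def)
    show ?thesis
    proof (cases "f i > int n")
      case True
      have "cg (f i) (f i - int n)" by (simp add: cong_iff_dvd_diff)
      then have "red (f i) = f i - int n" using *[of "f i - int n"] red_eq_iff[of "f i" "f i - int n"] b[of i] i True by simp
      then show ?thesis using True by simp
    next
      case False then show ?thesis using *[of "f i"] b[of i] i by simp
    qed
  qed
  have "(\<Sum>i\<in>{1..int n}. f i) = (\<Sum>i\<in>{1..int n}. red (f i)) + (\<Sum>i\<in>{1..int n}. if f i > int n then int n else 0)"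
    unfolding sum.distrib[symmetric] by (rule sum.cong[OF refl]) (rule red)
  moreover have "(\<Sum>i\<in>{1..int n}. red (f i)) = (\<Sum>i\<in>{1..int n}. i)"
    using sum.reindex_bij_betw[OF red_bij[OF f], of "\<lambda>x. x"] by simp
  moreover have "(\<Sum>i\<in>{1..int n}. if f i > int n then int n else 0) = int (card {i \<in> {1..int n}. f i > int n}) * int n"
    by (subst sum.inter_filter[symmetric]) simp_all
  ultimately show ?thesis by (simp add: lev_def sum_subtractf)
qed

text \<open>In terms of \<open>lev\<close> the counting condition is invariant under right
  multiplication by reflections, so only the pointwise bounds remain to be checked for a
  child.\<close>

lemma Bound_iff: "f \<in> Bound k n \<longleftrightarrow> aff f \<and> (\<forall>i. i \<le> f i \<and> f i \<le> i + int n) \<and> lev f = int k * int n"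
proof (cases "aff f \<and> (\<forall>i. i \<le> f i \<and> f i \<le> i + int n)")
  case True
  then have "lev f = int (card {i \<in> {1..int n}. f i > int n}) * int n" using lev_bounded by blast
  then show ?thesis using True n_pos by (simp add: Bound_def)
qed (auto simp: Bound_def)

section \<open>The subgroup generated by simple reflections, and \<open>av\<close>\<close>

lemma increasing_tau:
  assumes f: "aff f" and inc: "\<And>i. f i < f (i + 1)" shows "f = tau_pow (f 0)"
proof -
  have mono: "f i < f j" if "i < j" for i j
    using that by (induction j rule: int_gr_induct) (use inc less_trans in blast)+
  have step: "f (i + 1) = f i + 1" for i
  proof -
    obtain x where x: "f x = f i + 1" using aff_bij[OF f] by (metis bij_pointE)
    have "\<not> x \<le> i" using mono[of x i] x by (cases "x = i") auto
    moreover have "\<not> x > i + 1" using mono[of "i + 1" x] inc[of i] x by auto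
    ultimately have "x = i + 1" by linarith
    then show ?thesis using x by simp
  qed
  have *: "f i = i + f 0" for i
  proof (induction i rule: int_induct[of _ 0])
    case (step2 i) then show ?case using step[of "i - 1"] by simp
  qed (auto simp: step)
  show ?thesis unfolding tau_pow_def by (rule ext) (rule *)
qed

lemma simple_refl_sr: "simple_refl n j = sr (int j)" by (simp add: simple_refl_def fun_eq_iff)

lemma BijGroup_UNIV:
  shows "\<one>\<^bsub>BijGroup UNIV\<^esub> = (id :: int \<Rightarrow> int)"
    and "bij f \<Longrightarrow> bij g \<Longrightarrow> f \<otimes>\<^bsub>BijGroup UNIV\<^esub> g = f \<circ> g"
    and "bij f \<Longrightarrow> inv\<^bsub>BijGroup UNIV\<^esub> f = iv f"
proof -
  have B: "f \<in> Bij UNIV" if "bij f" for f :: "int \<Rightarrow> int" using that by (simp add: Bij_def)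
  show "\<one>\<^bsub>BijGroup UNIV\<^esub> = (id :: int \<Rightarrow> int)" by (auto simp: BijGroup_def)
  show "f \<otimes>\<^bsub>BijGroup UNIV\<^esub> g = f \<circ> g" if "bij f" "bij g"
    using B[OF that(1)] B[OF that(2)] by (simp add: BijGroup_def compose_def fun_eq_iff)
  show "inv\<^bsub>BijGroup UNIV\<^esub> f = iv f" if "bij f"
    using inv_BijGroup[OF B[OF that]] by (simp add: fun_eq_iff)
qed

text \<open>Simple reflections have \<open>lev\<close> zero. Conversely, removing descents shortens
  g until it is increasing, hence a power of the shift, and \<open>lev g = 0\<close> makes that
  power trivial.\<close>

lemma affine_perms0_eq: "affine_perms0 n = {g. aff g \<and> lev g = 0}"
proof
  show "affine_perms0 n \<subseteq> {g. aff g \<and> lev g = 0}"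
  proof
    fix g assume "g \<in> affine_perms0 n"
    then have "g \<in> generate (BijGroup UNIV) (simple_refl n ` {..<n})" by (simp add: affine_perms0_def)
    then have "aff g \<and> lev g = 0"
    proof (induction rule: generate.induct)
      case one then show ?case unfolding BijGroup_UNIV(1) using aff_id lev_id by blast
    next
      case (incl h) then obtain j where "h = sr (int j)" by (auto simp: simple_refl_sr)
      then show ?case using aff_tr lev_tr by simp
    next
      case (inv h)
      then obtain j where h: "h = sr (int j)" by (auto simp: simple_refl_sr)
      show ?case unfolding h BijGroup_UNIV(3)[OF aff_bij[OF aff_tr]] inv_tr using aff_tr lev_tr by simp
    next
      case (eng h1 h2)
      then have "aff h1" "aff h2" "lev h1 = 0" "lev h2 = 0" by auto
      then show ?case unfolding BijGroup_UNIV(2)[OF aff_bij[OF \<open>aff h1\<close>] aff_bij[OF \<open>aff h2\<close>]]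
        using aff_comp[OF \<open>aff h1\<close> \<open>aff h2\<close>] lev_comp[OF \<open>aff h1\<close> \<open>aff h2\<close>] \<open>lev h1 = 0\<close> \<open>lev h2 = 0\<close>
        by (metis add.right_neutral)
    qed
    then show "g \<in> {g. aff g \<and> lev g = 0}" by simp
  qed
  have "aff g \<Longrightarrow> lev g = 0 \<Longrightarrow> g \<in> affine_perms0 n" for g
  proof (induction "len g" arbitrary: g rule: less_induct)
    case less
    show ?case
    proof (cases "\<exists>i. g (i + 1) < g i")
      case False
      have "g i < g (i + 1)" for i using False aff_inj[OF less(2), of i "i + 1"] by (metis antisym_conv3 less_add_one less_irrefl)
      then have t: "g = tau_pow (g 0)" by (rule increasing_tau[OF less(2)])
      then have "g 0 * int n = 0" using less(3) lev_tau by metis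
      then have "g = id" using t n_pos tau_tau(2) by simp
      then show ?thesis unfolding affine_perms0_def using generate.one BijGroup_UNIV(1) by metis
    next
      case True
      then obtain i where i: "g (i + 1) < g i" by blast
      have n2: "2 \<le> n"
      proof (rule ccontr)
        assume "\<not> 2 \<le> n"
        then have "n = 1" using n_pos by simp
        then show False using aff_shift[OF less(2), of i 1] i by simp
      qed
      define j where "j = nat (i mod int n)"
      have j: "j < n" using nat_mod_less by (simp add: j_def)
      have "i = int j + (i div int n) * int n" using n_pos by (simp add: j_def)
      then have e: "sr i = sr (int j)" using tr_shift[of "int j" "i div int n" "int j + 1"]
        by (metis add.commute add.left_commute)
      have "len (g \<circ> sr i) < len g" using len_tr_greater[OF _ not_cg_Suc[OF n2] less(2) i] by simp
      then have "g \<circ> sr i \<in> affine_perms0 n"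
        by (rule less(1)) (use less aff_comp aff_tr lev_comp_tr in auto)
      moreover have "simple_refl n j \<in> affine_perms0 n"
        unfolding affine_perms0_def by (rule generate.incl) (use j in blast)
      ultimately have "(g \<circ> sr i) \<otimes>\<^bsub>BijGroup UNIV\<^esub> simple_refl n j \<in> affine_perms0 n"
        unfolding affine_perms0_def by (rule generate.eng)
      moreover have "(g \<circ> sr i) \<otimes>\<^bsub>BijGroup UNIV\<^esub> simple_refl n j = g"
        unfolding simple_refl_sr e
        using BijGroup_UNIV(2)[OF aff_bij[OF aff_comp[OF less(2) aff_tr]] aff_bij[OF aff_tr]] tr_invol2(2) by metis
      ultimately show ?thesis by simp
    qed
  qed
  then show "{g. aff g \<and> lev g = 0} \<subseteq> affine_perms0 n" by blast
qed

lemma av_eq: assumes f: "aff f" and l: "lev f = m * int n" shows "av n f = m"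
  unfolding av_def
proof (rule the_equality)
  have "aff (tau_pow (- m) \<circ> f)" "lev (tau_pow (- m) \<circ> f) = 0"
    using aff_comp[OF aff_tau f] lev_comp[OF aff_tau f] by (simp_all add: lev_tau l)
  moreover have "f = tau_pow m \<circ> (tau_pow (- m) \<circ> f)" by (simp add: fun_eq_iff tau_pow_def)
  ultimately show "\<exists>g\<in>affine_perms0 n. f = tau_pow m \<circ> g" unfolding affine_perms0_eq by blast
next
  fix m' assume "\<exists>g\<in>affine_perms0 n. f = tau_pow m' \<circ> g"
  then obtain g where "aff g" "lev g = 0" "f = tau_pow m' \<circ> g" unfolding affine_perms0_eq by blast
  then have "lev f = m' * int n" using lev_comp[OF aff_tau] by (simp add: lev_tau)
  then show "m' = m" using l n_pos by simp
qed

section \<open>Cyclically decreasing sequences and their supports\<close>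

lemma perm_product_simps: "perm_product [] = id" "perm_product (g # gs) = g \<circ> perm_product gs"
  by (simp_all add: perm_product_def)

lemma perm_product_snoc: "perm_product (gs @ [g]) = perm_product gs \<circ> g"
  by (induction gs) (simp_all add: perm_product_simps comp_assoc)

lemma cyc_decreasing_seq_tail: assumes "cyc_decreasing_seq n (j # js)" shows "cyc_decreasing_seq n js"
proof -
  have "q < p" if "p < length js" "q < length js" "js ! q = (js ! p + 1) mod n" for p q
  proof -
    have "\<forall>p<length (j # js). \<forall>q<length (j # js). (j # js) ! q = ((j # js) ! p + 1) mod n \<longrightarrow> q < p"
      using assms unfolding cyc_decreasing_seq_def by blast
    from this[rule_format, of "Suc p" "Suc q"] that show ?thesis by simp
  qed
  moreover have "set js \<subseteq> {..<n}" "distinct js" using assms by (simp_all add: cyc_decreasing_seq_def)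
  ultimately show ?thesis unfolding cyc_decreasing_seq_def by blast
qed

lemma mem_Suc_iff: "mem K (int j + 1) \<longleftrightarrow> (j + 1) mod n \<in> K"
proof -
  have "(int j + 1) mod int n = int ((j + 1) mod n)" by (simp add: zmod_int add.commute)
  then show ?thesis by (simp add: mem_def)
qed

text \<open>Nothing can precede the head j, so j + 1 mod n does not occur in the sequence. This
  makes the support proper and supplies the condition of \<open>cd_insert\<close>.\<close>

lemma cyc_decreasing_seq_cd:
  "cyc_decreasing_seq n js \<Longrightarrow> proper (set js) \<and> perm_product (map (simple_refl n) js) = cd (set js)"
proof (induction js)
  case Nil then show ?case using proper_empty by (simp add: perm_product_simps cd_empty)
next
  case (Cons j js)
  have IH: "perm_product (map (simple_refl n) js) = cd (set js)" using Cons cyc_decreasing_seq_tail by blast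
  have no: "(j + 1) mod n \<notin> set (j # js)"
  proof
    assume "(j + 1) mod n \<in> set (j # js)"
    then obtain q where q: "q < length (j # js)" "(j # js) ! q = (j + 1) mod n" by (metis in_set_conv_nth)
    have "\<forall>p<length (j # js). \<forall>q<length (j # js). (j # js) ! q = ((j # js) ! p + 1) mod n \<longrightarrow> q < p"
      using Cons(2) unfolding cyc_decreasing_seq_def by blast
    from this[rule_format, of 0 q] q show False by simp
  qed
  have sub: "set (j # js) \<subseteq> {..<n}" and d: "j \<notin> set js" using Cons(2) unfolding cyc_decreasing_seq_def by auto
  have P: "proper (insert j (set js))"
  proof (rule psubsetI)
    show "insert j (set js) \<subseteq> {..<n}" using sub by simp
    have "(j + 1) mod n \<in> {..<n}" using n_pos by simp
    then show "insert j (set js) \<noteq> {..<n}" using no by (metis list.simps(15))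
  qed
  have "cd (insert j (set js)) = sr (int j) \<circ> cd (set js)"
    by (rule cd_insert[OF P _ d]) (use sub no mem_Suc_iff in auto)
  then have "perm_product (map (simple_refl n) (j # js)) = cd (set (j # js))"
    by (simp add: perm_product_simps IH simple_refl_sr)
  moreover have "proper (set (j # js))" using P by simp
  ultimately show ?case by blast
qed

lemma cyc_decreasing_seq_exists: "proper J \<Longrightarrow> \<exists>js. cyc_decreasing_seq n js \<and> set js = J"
proof (induction rule: proper_induct)
  case empty show ?case by (rule exI[of _ "[]"]) (simp add: cyc_decreasing_seq_def)
next
  case (insert j K)
  then obtain js where js: "cyc_decreasing_seq n js" "set js = K" by blast
  have n2: "2 \<le> n" by (rule proper_two[OF insert(1)])
  have no: "(j + 1) mod n \<notin> K" using insert(4) mem_Suc_iff by blast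
  have nj: "j \<noteq> (j + 1) mod n" using insert(2) n2 by (cases "j + 1 = n") auto
  have "q < p" if h: "p < length (j # js)" "q < length (j # js)" "(j # js) ! q = ((j # js) ! p + 1) mod n" for p q
  proof (cases p)
    case 0
    then have e: "(j # js) ! q = (j + 1) mod n" using h by simp
    show ?thesis
    proof (cases q)
      case 0 then show ?thesis using e nj by simp
    next
      case (Suc q')
      then have "(j + 1) mod n \<in> K" using e h js(2) by (metis length_Cons nth_Cons_Suc nth_mem Suc_less_eq)
      then show ?thesis using no by simp
    qed
  next
    case (Suc p')
    show ?thesis
    proof (cases q)
      case (Suc q')
      then have "q' < p'" using js(1) h \<open>p = Suc p'\<close> unfolding cyc_decreasing_seq_def by simp
      then show ?thesis using Suc \<open>p = Suc p'\<close> by simp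
    qed (simp add: Suc)
  qed
  moreover have "set (j # js) \<subseteq> {..<n}" "distinct (j # js)"
    using js insert(2,3) by (simp_all add: cyc_decreasing_seq_def)
  ultimately have "cyc_decreasing_seq n (j # js)" unfolding cyc_decreasing_seq_def by blast
  then show ?case using js by (intro exI[of _ "j # js"]) simp
qed

lemma cyc_decreasing_eq: "cyc_decreasing n = cd ` {J. proper J}"
proof
  show "cyc_decreasing n \<subseteq> cd ` {J. proper J}" unfolding cyc_decreasing_def using cyc_decreasing_seq_cd by blast
  show "cd ` {J. proper J} \<subseteq> cyc_decreasing n"
  proof (rule image_subsetI)
    fix J assume "J \<in> {J. proper J}"
    then obtain js where js: "cyc_decreasing_seq n js" "set js = J" using cyc_decreasing_seq_exists by blast
    have "cd J = perm_product (map (simple_refl n) js)" using cyc_decreasing_seq_cd[OF js(1)] unfolding js(2) by (rule conjE) (rule sym)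
    then show "cd J \<in> cyc_decreasing n" unfolding cyc_decreasing_def using js(1) by blast
  qed
qed

section \<open>Counting factorizations by their supports\<close>

definition FS :: "nat list \<Rightarrow> (int \<Rightarrow> int) \<Rightarrow> nat set list set" where
  "FS as w = {Js. list_all2 (\<lambda>J a. proper J \<and> card J = a) Js as \<and> perm_product (map cd Js) = w}"

lemma finite_FS: "finite (FS as w)"
proof (rule finite_subset)
  show "FS as w \<subseteq> {Js. set Js \<subseteq> Pow {..<n} \<and> length Js = length as}"
  proof
    fix Js assume "Js \<in> FS as w"
    then have l: "list_all2 (\<lambda>J a. proper J \<and> card J = a) Js as" by (simp add: FS_def)
    have "set Js \<subseteq> Pow {..<n}"
    proof
      fix J assume "J \<in> set Js"
      then obtain i where i: "i < length Js" "J = Js ! i" unfolding in_set_conv_nth by blast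
      then have "proper J" using list_all2_nthD[OF l i(1)] by simp
      then show "J \<in> Pow {..<n}" using psubset_imp_subset[of J] by simp
    qed
    then show "Js \<in> {Js. set Js \<subseteq> Pow {..<n} \<and> length Js = length as}" using list_all2_lengthD[OF l] by simp
  qed
qed (simp add: finite_lists_length_eq)

lemma FS_aff_len: "list_all2 (\<lambda>J a. proper J \<and> card J = a) Js as \<Longrightarrow>
    aff (perm_product (map cd Js)) \<and> len (perm_product (map cd Js)) \<le> sum_list as"
proof (induction rule: list_all2_induct)
  case Nil
  show ?case unfolding list.map perm_product_simps(1) len_id sum_list.Nil using aff_id by blast
next
  case (Cons J Js a as)
  have a: "aff (cd J)" "len (cd J) = a" using aff_cd len_cd Cons by auto
  have p: "aff (perm_product (map cd Js))" "len (perm_product (map cd Js)) \<le> sum_list as" using Cons.IH by auto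
  show ?case unfolding list.map perm_product_simps(2) sum_list.Cons
    using aff_comp[OF a(1) p(1)] len_comp_le[OF a(1) p(1)] a(2) p(2) by linarith
qed

lemma FS_Cons:
  "FS (a # as) w = (\<Union>J\<in>{J. proper J \<and> card J = a}. (#) J ` FS as (iv (cd J) \<circ> w))"
proof (rule Set.set_eqI)
  have key: "cd J \<circ> y = w \<longleftrightarrow> y = iv (cd J) \<circ> w" if "proper J" for J y
    using aff_inv_comp2[OF aff_cd[OF that]] by metis
  fix Ks
  show "Ks \<in> FS (a # as) w \<longleftrightarrow> Ks \<in> (\<Union>J\<in>{J. proper J \<and> card J = a}. (#) J ` FS as (iv (cd J) \<circ> w))"
  proof (cases Ks)
    case Nil then show ?thesis by (auto simp: FS_def)
  next
    case (Cons J Js)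
    have "Ks \<in> FS (a # as) w \<longleftrightarrow> (proper J \<and> card J = a) \<and> list_all2 (\<lambda>J a. proper J \<and> card J = a) Js as
        \<and> cd J \<circ> perm_product (map cd Js) = w"
      unfolding FS_def Cons by (simp add: perm_product_simps)
    also have "\<dots> \<longleftrightarrow> (proper J \<and> card J = a) \<and> Js \<in> FS as (iv (cd J) \<circ> w)"
      unfolding FS_def using key[of J "perm_product (map cd Js)"] by blast
    also have "\<dots> \<longleftrightarrow> Ks \<in> (\<Union>J\<in>{J. proper J \<and> card J = a}. (#) J ` FS as (iv (cd J) \<circ> w))"
      unfolding Cons by blast
    finally show ?thesis .
  qed
qed

text \<open>Lengths are subadditive, so once the sizes add up to \<open>len w\<close>, every step of
  the factorization is automatically additive.\<close>

lemma Cf_FS: "aff w \<Longrightarrow> Cf as w = (if sum_list as = len w then int (card (FS as w)) else 0)"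
proof (induction as arbitrary: w)
  case Nil
  have "FS [] w = (if w = id then {[]} else {})" by (auto simp: FS_def perm_product_simps)
  then show ?case using len_id by auto
next
  case (Cons a as)
  note w = Cons(2)
  have y: "aff (iv (cd J) \<circ> w)" if "proper J" for J using aff_comp aff_inv aff_cd[OF that] w by blast
  have U: "UJ J (Cf as) w = (if a + sum_list as = len w then int (card (FS as (iv (cd J) \<circ> w))) else 0)"
    if J: "proper J" "card J = a" for J
  proof -
    let ?y = "iv (cd J) \<circ> w"
    have IH: "Cf as ?y = (if sum_list as = len ?y then int (card (FS as ?y)) else 0)" by (rule Cons(1)[OF y[OF J(1)]])
    have U1: "UJ J (Cf as) w = (if len ?y + a = len w then Cf as ?y else 0)" unfolding UJ_def J(2) ..
    show ?thesis
    proof (cases "len ?y + a = len w")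
      case True then show ?thesis unfolding U1 IH by auto
    next
      case False
      have "FS as ?y = {}" if s: "a + sum_list as = len w"
      proof (rule ccontr)
        assume "FS as ?y \<noteq> {}"
        then obtain Js where "list_all2 (\<lambda>J a. proper J \<and> card J = a) Js as" "perm_product (map cd Js) = ?y"
          unfolding FS_def by blast
        then have "len ?y \<le> sum_list as" using FS_aff_len by metis
        then show False using len_ivcd_comp[OF J(1) w] s False J(2) by linarith
      qed
      then show ?thesis unfolding U1 using False by (metis card.empty of_nat_0)
    qed
  qed
  have C: "Cf (a # as) w = (\<Sum>J | proper J \<and> card J = a. if a + sum_list as = len w then int (card (FS as (iv (cd J) \<circ> w))) else 0)"
    unfolding Cf.simps Lop_def by (rule sum.cong[OF refl]) (use U in blast)
  have "card (FS (a # as) w) = (\<Sum>J | proper J \<and> card J = a. card ((#) J ` FS as (iv (cd J) \<circ> w)))"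
    unfolding FS_Cons by (rule card_UN_disjoint[OF finite_sets]) (use finite_FS in \<open>blast intro: finite_imageI\<close>)+
  also have "\<dots> = (\<Sum>J | proper J \<and> card J = a. card (FS as (iv (cd J) \<circ> w)))"
    by (rule sum.cong[OF refl]) (simp add: card_image)
  finally show ?case unfolding C by auto
qed

text \<open>The cutoff in \<open>cyc_factorizations\<close> is only existential; this allows
  replacing it by k.\<close>

lemma perm_product_stable:
  assumes "\<And>i. i \<ge> N \<Longrightarrow> fs i = id" "\<And>i. i \<ge> M \<Longrightarrow> fs i = id"
  shows "perm_product (map fs [0..<N]) = perm_product (map fs [0..<M])"
proof -
  have *: "perm_product (map fs [0..<N + d]) = perm_product (map fs [0..<N])" if "\<forall>i\<ge>N. fs i = id" for N d
    by (induction d) (simp_all add: perm_product_snoc that)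
  show ?thesis using *[of N M] *[of M N] assms by (simp add: add.commute)
qed

lemma sum_stable:
  fixes h :: "nat \<Rightarrow> nat"
  assumes "\<And>i. i \<ge> N \<Longrightarrow> h i = 0" "\<And>i. i \<ge> M \<Longrightarrow> h i = 0" shows "(\<Sum>i<N. h i) = (\<Sum>i<M. h i)"
proof -
  have *: "(\<Sum>i<N + d. h i) = (\<Sum>i<N. h i)" if "\<forall>i\<ge>N. h i = 0" for N d
    by (induction d) (simp_all add: that)
  show ?thesis using *[of N M] *[of M N] assms by (simp add: add.commute)
qed

text \<open>A factor is the same as its support by \<open>cd_inj\<close>, and factors of length zero
  are trivial, so the infinite factorizations correspond to lists of k supports.\<close>

lemma affine_stanley_Cf:
  assumes f: "aff f" and m: "Poly_Mapping.keys m \<subseteq> {..<k}"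
  defines "as \<equiv> map (Poly_Mapping.lookup m) [0..<k]"
  shows "affine_stanley n f m = Cf as (tau_pow (- av n f) \<circ> f)"
proof -
  define w where "w = tau_pow (- av n f) \<circ> f"
  have w: "aff w" using aff_comp[OF aff_tau f] by (simp add: w_def)
  have lw: "len w = len f" using len_tau_left by (simp add: w_def)
  have m0: "Poly_Mapping.lookup m i = 0" if "k \<le> i" for i using m that by (auto simp: in_keys_iff)
  define S where "S = {fs \<in> cyc_factorizations n f. \<forall>i. len (fs i) = Poly_Mapping.lookup m i}"
  have sas: "sum_list as = (\<Sum>i<k. Poly_Mapping.lookup m i)" unfolding as_def by (simp add: sum_list_distinct_conv_sum_set atLeast0LessThan)
  have fsJ: "\<exists>J. proper J \<and> fs i = cd J \<and> card J = Poly_Mapping.lookup m i" if fs: "fs \<in> S" for fs i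
  proof -
    have l: "len (fs i) = Poly_Mapping.lookup m i" and "fs i \<in> cyc_decreasing n"
      using fs by (simp_all add: S_def cyc_factorizations_def)
    then have "fs i \<in> cd ` {J. proper J}" unfolding cyc_decreasing_eq by blast
    then obtain J where J: "proper J" "fs i = cd J" unfolding image_iff by blast
    then have "card J = Poly_Mapping.lookup m i" using len_cd[OF J(1)] l by simp
    then show ?thesis using J by blast
  qed
  have fs0: "fs i = id" if fs: "fs \<in> S" and i: "k \<le> i" for fs i
  proof -
    obtain J where J: "proper J" "fs i = cd J" "card J = 0" using fsJ[OF fs, of i] unfolding m0[OF i] by blast
    have "J = {}" using J(3) finite_proper[OF J(1)] by simp
    then show ?thesis using J cd_empty by simp
  qed
  have S_sum: "sum_list as = len w" and S_prod: "perm_product (map fs [0..<k]) = w" if fs: "fs \<in> S" for fs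
  proof -
    obtain N where N: "\<And>i. i \<ge> N \<Longrightarrow> fs i = id" "perm_product (map fs [0..<N]) = w" "(\<Sum>i<N. len (fs i)) = len w"
      using fs unfolding S_def cyc_factorizations_def lw w_def[symmetric] mem_Collect_eq by blast
    show "perm_product (map fs [0..<k]) = w" unfolding N(2)[symmetric] by (rule perm_product_stable) (use N(1) fs0[OF fs] in blast)+
    have "(\<Sum>i<N. len (fs i)) = (\<Sum>i<k. len (fs i))" by (rule sum_stable) (use N(1) fs0[OF fs] len_id in simp_all)
    moreover have "(\<Sum>i<k. len (fs i)) = (\<Sum>i<k. Poly_Mapping.lookup m i)" using fs by (simp add: S_def)
    ultimately show "sum_list as = len w" using N(3) sas by simp
  qed
  have "int (card S) = Cf as w"
  proof (cases "sum_list as = len w")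
    case False
    then have "S = {}" using S_sum by blast
    then show ?thesis using Cf_FS[OF w] False by simp
  next
    case True
    define F where "F = (\<lambda>Js i. if i < k then cd (Js ! i) else id)"
    have Js: "length Js = k" "\<And>i. i < k \<Longrightarrow> proper (Js ! i)" "\<And>i. i < k \<Longrightarrow> card (Js ! i) = Poly_Mapping.lookup m i"
        "perm_product (map cd Js) = w" if "Js \<in> FS as w" for Js
    proof -
      have l: "list_all2 (\<lambda>J a. proper J \<and> card J = a) Js as" "perm_product (map cd Js) = w" using that by (simp_all add: FS_def)
      show "length Js = k" using list_all2_lengthD[OF l(1)] by (simp add: as_def)
      then show "proper (Js ! i)" "card (Js ! i) = Poly_Mapping.lookup m i" if "i < k" for i
        using list_all2_nthD[OF l(1), of i] that by (simp_all add: as_def)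
      show "perm_product (map cd Js) = w" by (rule l(2))
    qed
    have mapF: "map (F Js) [0..<k] = map cd Js" if "Js \<in> FS as w" for Js
      by (rule nth_equalityI) (use Js(1)[OF that] in \<open>simp_all add: F_def\<close>)
    have lenF: "len (F Js i) = Poly_Mapping.lookup m i" if "Js \<in> FS as w" for Js i
      using Js[OF that] len_cd[of "Js ! i"] m0[of i] len_id by (cases "i < k") (simp_all add: F_def)
    have inS: "F Js \<in> S" if J: "Js \<in> FS as w" for Js
    proof -
      have "F Js i \<in> cyc_decreasing n" for i
      proof (cases "i < k")
        case True then show ?thesis unfolding cyc_decreasing_eq F_def using Js(2)[OF J True] by simp
      next
        case False
        have "id \<in> cyc_decreasing n" unfolding cyc_decreasing_eq using proper_empty cd_empty[symmetric] by blast
        then show ?thesis using False by (simp add: F_def)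
      qed
      moreover have "(\<Sum>i<k. len (F Js i)) = len f" using True lenF[OF J] sas lw by simp
      moreover have "perm_product (map (F Js) [0..<k]) = w" using mapF[OF J] Js(4)[OF J] by simp
      moreover have "\<forall>i\<ge>k. F Js i = id" by (simp add: F_def)
      ultimately have "F Js \<in> cyc_factorizations n f" unfolding cyc_factorizations_def w_def by blast
      then show ?thesis using lenF[OF J] by (simp add: S_def)
    qed
    have "bij_betw F (FS as w) S" unfolding bij_betw_def
    proof
      show "inj_on F (FS as w)"
      proof (rule inj_onI)
        fix Js Ks assume h: "Js \<in> FS as w" "Ks \<in> FS as w" "F Js = F Ks"
        have "Js ! i = Ks ! i" if "i < k" for i
          using fun_cong[OF h(3), of i] that cd_inj[OF Js(2)[OF h(1) that] Js(2)[OF h(2) that]] by (simp add: F_def)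
        then show "Js = Ks" using Js(1)[OF h(1)] Js(1)[OF h(2)] by (simp add: nth_equalityI)
      qed
      have "S \<subseteq> F ` FS as w"
      proof
        fix fs assume fs: "fs \<in> S"
        have "\<forall>i. \<exists>J. proper J \<and> fs i = cd J \<and> card J = Poly_Mapping.lookup m i" by (intro allI fsJ[OF fs])
        from choice[OF this] obtain J where "\<forall>i. proper (J i) \<and> fs i = cd (J i) \<and> card (J i) = Poly_Mapping.lookup m i"
          by (rule exE)
        then have J: "\<And>i. proper (J i)" "\<And>i. fs i = cd (J i)" "\<And>i. card (J i) = Poly_Mapping.lookup m i" by simp_all
        let ?Js = "map J [0..<k]"
        have "map cd ?Js = map fs [0..<k]" using J(2) by simp
        then have "perm_product (map cd ?Js) = w" using S_prod[OF fs] by argo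
        moreover have "list_all2 (\<lambda>J a. proper J \<and> card J = a) ?Js as"
          using J(1,3) by (simp add: as_def list_all2_conv_all_nth)
        ultimately have "?Js \<in> FS as w" unfolding FS_def by blast
        moreover have "F ?Js = fs" using fs0[OF fs] J(2) by (auto simp: F_def fun_eq_iff)
        ultimately show "fs \<in> F ` FS as w" by blast
      qed
      then show "F ` FS as w = S" using inS by blast
    qed
    then show ?thesis using bij_betw_same_card[of F "FS as w" S] Cf_FS[OF w] True by simp
  qed
  then show ?thesis by (simp add: affine_stanley_def S_def w_def)
qed

section \<open>Coefficients of \<open>FP\<close>\<close>

lemma lookup_var_power_mult:
  "Poly_Mapping.lookup (var k ^ e * p) m =
    (if e \<le> Poly_Mapping.lookup m k then Poly_Mapping.lookup p (m - Poly_Mapping.single k e) else 0)"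
proof (induction e arbitrary: m)
  case (Suc e)
  have "m - Poly_Mapping.single k 1 - Poly_Mapping.single k e = m - Poly_Mapping.single k (Suc e)"
    by (rule poly_mapping_eqI) (simp add: lookup_minus lookup_single when_def)
  then show ?case by (auto simp: mult.assoc lookup_var_mult Suc lookup_minus lookup_single)
qed simp

lemma lookup_Lop:
  fixes \<phi> :: "(int \<Rightarrow> int) \<Rightarrow> mpoly"
  shows "Poly_Mapping.lookup (Lop e \<phi> w) m = Lop e (\<lambda>w. Poly_Mapping.lookup (\<phi> w) m) w"
  unfolding Lop_def lookup_sum by (rule sum.cong[OF refl]) (simp add: UJ_def)

lemma Lop_zero: "Lop e (\<lambda>w. 0) w = (0 :: 'b::comm_ring_1)"
  using Lop_scale[of e 0 "\<lambda>w. 0" w] by simp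

lemma keys_subset_lessThan: "Poly_Mapping.keys m \<subseteq> {..<k::nat} \<longleftrightarrow> (\<forall>i\<ge>k. Poly_Mapping.lookup m i = 0)"
proof (intro iffI allI impI subsetI)
  show "Poly_Mapping.lookup m i = 0" if "Poly_Mapping.keys m \<subseteq> {..<k}" "k \<le> i" for i
  proof -
    have "i \<notin> Poly_Mapping.keys m" using subsetD[OF that(1), of i] that(2) by fastforce
    then show ?thesis by (simp add: in_keys_iff)
  qed
  show "i \<in> {..<k}" if "\<forall>i\<ge>k. Poly_Mapping.lookup m i = 0" "i \<in> Poly_Mapping.keys m" for i
    using that(1)[rule_format, of i] that(2) by (auto simp: in_keys_iff not_le[symmetric])
qed

lemma lookup_FP:
  "aff w \<Longrightarrow> Poly_Mapping.lookup (FP k w) m =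
    (if Poly_Mapping.keys m \<subseteq> {..<k} then Cf (rev (map (Poly_Mapping.lookup m) [0..<k])) w else 0)"
proof (induction k arbitrary: w m)
  case 0
  then show ?case by (auto simp: lookup_one when_def)
next
  case (Suc k)
  note w = Suc(2)
  let ?l = "\<lambda>m. rev (map (Poly_Mapping.lookup m) [0..<k])"
  let ?e = "Poly_Mapping.lookup m k"
  have T: "Poly_Mapping.lookup (Lop e (FP k) w) m' = (if Poly_Mapping.keys m' \<subseteq> {..<k} then Lop e (Cf (?l m')) w else 0)" for e m'
  proof (cases "Poly_Mapping.keys m' \<subseteq> {..<k}")
    case True
    have "Lop e (\<lambda>w. Poly_Mapping.lookup (FP k w) m') w = Lop e (Cf (?l m')) w"
      by (rule Lop_cong[OF w]) (use Suc(1) True in auto)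
    then show ?thesis unfolding lookup_Lop using True by simp
  next
    case False
    have "Lop e (\<lambda>w. Poly_Mapping.lookup (FP k w) m') w = Lop e (\<lambda>w. 0) w"
      by (rule Lop_cong[OF w]) (use Suc(1) False in auto)
    then show ?thesis unfolding lookup_Lop Lop_zero using False by simp
  qed
  \<comment> \<open>Only removing the full exponent of \<open>var k\<close> leaves a monomial in the
    earlier variables, so a single term of the sum over e survives.\<close>
  have K: "e \<le> ?e \<and> Poly_Mapping.keys (m - Poly_Mapping.single k e) \<subseteq> {..<k} \<longleftrightarrow>
      e = ?e \<and> Poly_Mapping.keys m \<subseteq> {..<Suc k}" for e
  proof -
    have l: "Poly_Mapping.lookup (m - Poly_Mapping.single k e) i = Poly_Mapping.lookup m i - (if i = k then e else 0)" for i
      by (simp add: lookup_minus lookup_single when_def)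
    show ?thesis unfolding keys_subset_lessThan l
    proof (intro iffI conjI allI impI; elim conjE)
      assume h: "e \<le> ?e" "\<forall>i\<ge>k. Poly_Mapping.lookup m i - (if i = k then e else 0) = 0"
      show "e = ?e" using h(2)[rule_format, of k] h(1) by simp
      show "Poly_Mapping.lookup m i = 0" if "Suc k \<le> i" for i using h(2)[rule_format, of i] that by simp
    next
      assume h: "e = ?e" "\<forall>i\<ge>Suc k. Poly_Mapping.lookup m i = 0"
      show "e \<le> ?e" using h(1) by simp
      show "Poly_Mapping.lookup m i - (if i = k then e else 0) = 0" if "k \<le> i" for i
        using h(1) h(2)[rule_format, of i] that by (cases "i = k") simp_all
    qed
  qed
  have L: "?l (m - Poly_Mapping.single k e) = ?l m" for e
    by (simp add: lookup_minus lookup_single when_def)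
  have "Poly_Mapping.lookup (FP (Suc k) w) m = (\<Sum>e<n. if e \<le> ?e then Poly_Mapping.lookup (Lop e (FP k) w) (m - Poly_Mapping.single k e) else 0)"
    unfolding FP.simps lookup_sum lookup_var_power_mult ..
  also have "\<dots> = (\<Sum>e<n. if e = ?e then (if Poly_Mapping.keys m \<subseteq> {..<Suc k} then Lop ?e (Cf (?l m)) w else 0) else 0)"
  proof (rule sum.cong[OF refl])
    fix e
    show "(if e \<le> ?e then Poly_Mapping.lookup (Lop e (FP k) w) (m - Poly_Mapping.single k e) else 0) =
      (if e = ?e then (if Poly_Mapping.keys m \<subseteq> {..<Suc k} then Lop ?e (Cf (?l m)) w else 0) else 0)"
      unfolding T L using K[of e] by auto
  qed
  also have "\<dots> = (if Poly_Mapping.keys m \<subseteq> {..<Suc k} then Lop ?e (Cf (?l m)) w else 0)"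
    using Lop_ge[of ?e "Cf (?l m)" w] by (simp add: not_less)
  finally show ?case by simp
qed

lemma specialize_affine_stanley:
  assumes f: "aff f" and l: "lev f = int k * int n"
  shows "specialize k (affine_stanley n f) = FP k (tau_pow (- int k) \<circ> f)"
proof -
  define w where "w = tau_pow (- int k) \<circ> f"
  have w: "aff w" using aff_comp[OF aff_tau f] by (simp add: w_def)
  have F: "affine_stanley n f m = Cf (map (Poly_Mapping.lookup m) [0..<k]) w" if "Poly_Mapping.keys m \<subseteq> {..<k}" for m
    using affine_stanley_Cf[OF f that] unfolding av_eq[OF f l] w_def .
  let ?M = "{m. Poly_Mapping.keys m \<subseteq> {..<k} \<and> affine_stanley n f m \<noteq> 0}"
  \<comment> \<open>Homogeneity of degree \<open>len w\<close> makes the index set in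
    \<open>specialize\<close> finite; an infinite sum would default to 0.\<close>
  have "?M \<subseteq> {m. Poly_Mapping.keys m \<subseteq> {..<k} \<and> (\<Sum>i<k. Poly_Mapping.lookup m i) = len w}"
  proof
    fix m assume m: "m \<in> ?M"
    then have "Poly_Mapping.keys m \<subseteq> {..<k}" "affine_stanley n f m \<noteq> 0" by simp_all
    then have "Cf (map (Poly_Mapping.lookup m) [0..<k]) w \<noteq> 0" using F[of m] by argo
    then have "sum_list (map (Poly_Mapping.lookup m) [0..<k]) = len w" unfolding Cf_FS[OF w] by metis
    then show "m \<in> {m. Poly_Mapping.keys m \<subseteq> {..<k} \<and> (\<Sum>i<k. Poly_Mapping.lookup m i) = len w}"
      using m by (simp add: sum_list_distinct_conv_sum_set atLeast0LessThan)
  qed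
  then have fin: "finite ?M" using finite_degree_monoms finite_subset by blast
  have "specialize k (affine_stanley n f) = FP k w"
  proof (rule poly_mapping_eqI)
    fix m
    have "Poly_Mapping.lookup (specialize k (affine_stanley n f)) m = (if m \<in> ?M then affine_stanley n f m else 0)"
      unfolding specialize_def by (rule lookup_sum_single[OF fin])
    also have "\<dots> = (if Poly_Mapping.keys m \<subseteq> {..<k} then Cf (rev (map (Poly_Mapping.lookup m) [0..<k])) w else 0)"
      using F[of m] Cf_perm[OF w, of "map (Poly_Mapping.lookup m) [0..<k]" "rev (map (Poly_Mapping.lookup m) [0..<k])"] by auto
    finally show "Poly_Mapping.lookup (specialize k (affine_stanley n f)) m = Poly_Mapping.lookup (FP k w) m"
      unfolding lookup_FP[OF w] .
  qed
  then show ?thesis unfolding w_def .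
qed

end

section \<open>The bounded Lascoux--Schuetzenberger tree\<close>

lemma vertex_label_Cons: "vertex_label f (c # p) = vertex_label (snd c) p"
  by (simp add: vertex_label_def)

text \<open>Paths are built by appending at the lower end, whereas the induction along the tree
  needs to split them at the root.\<close>

lemma ls_vertices_Cons:
  assumes c: "c \<in> ls_children k n f" shows "p \<in> ls_vertices k n (snd c) \<Longrightarrow> c # p \<in> ls_vertices k n f"
proof (induction rule: ls_vertices.induct)
  case root
  show ?case using ls_vertices.child[OF ls_vertices.root, of c k n f] c by (simp add: vertex_label_def)
next
  case (child p d)
  then show ?case using ls_vertices.child[of "c # p" k n f d] by (simp add: vertex_label_Cons)
qed

lemma ls_vertices_cases:
  "p \<in> ls_vertices k n f \<Longrightarrow> p = [] \<or> (\<exists>c q. p = c # q \<and> c \<in> ls_children k n f \<and> q \<in> ls_vertices k n (snd c))"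
proof (induction rule: ls_vertices.induct)
  case root then show ?case by simp
next
  case (child p d)
  show ?case
  proof (cases "p = []")
    case True
    then show ?thesis using child ls_vertices.root by (simp add: vertex_label_def)
  next
    case False
    then obtain c q where q: "p = c # q" "c \<in> ls_children k n f" "q \<in> ls_vertices k n (snd c)" using child by blast
    then have "q @ [d] \<in> ls_vertices k n (snd c)" using child ls_vertices.child by (simp add: vertex_label_Cons)
    then show ?thesis using q by simp
  qed
qed

lemma ls_leaves_leaf: "ls_children k n f = {} \<Longrightarrow> ls_leaves k n f = {[]}"
  unfolding ls_leaves_def using ls_vertices_cases[of _ k n f] ls_vertices.root by (auto simp: vertex_label_def)

lemma ls_leaves_node:
  assumes "ls_children k n f \<noteq> {}"
  shows "ls_leaves k n f = (\<Union>c\<in>ls_children k n f. (#) c ` ls_leaves k n (snd c))"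
proof
  show "ls_leaves k n f \<subseteq> (\<Union>c\<in>ls_children k n f. (#) c ` ls_leaves k n (snd c))"
  proof
    fix p assume "p \<in> ls_leaves k n f"
    then have p: "p \<in> ls_vertices k n f" "ls_children k n (vertex_label f p) = {}" by (auto simp: ls_leaves_def)
    then have "p \<noteq> []" using assms by (auto simp: vertex_label_def)
    then obtain c q where q: "p = c # q" "c \<in> ls_children k n f" "q \<in> ls_vertices k n (snd c)"
      using ls_vertices_cases[OF p(1)] by blast
    then have "q \<in> ls_leaves k n (snd c)" using p(2) by (simp add: ls_leaves_def vertex_label_Cons)
    then show "p \<in> (\<Union>c\<in>ls_children k n f. (#) c ` ls_leaves k n (snd c))" using q by blast
  qed
  show "(\<Union>c\<in>ls_children k n f. (#) c ` ls_leaves k n (snd c)) \<subseteq> ls_leaves k n f"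
    using ls_vertices_Cons by (auto simp: ls_leaves_def vertex_label_Cons)
qed

lemma path_sign_simps: "path_sign [] = 1" "path_sign (c # p) = fst c * path_sign p"
  by (simp_all add: path_sign_def)

context affine_window begin

text \<open>The chain r < s <= f s < f r <= r + n keeps both exchanged values within their
  bounds.\<close>

lemma max_inversion_Bound:
  assumes f: "f \<in> Bound k n" and m: "is_max_inversion n f r s"
  shows "f \<circ> tr r s \<in> Bound k n" "r < (f \<circ> tr r s) r" "(f \<circ> tr r s) r < r + int n"
proof -
  have fa: "aff f" and b: "\<And>i. i \<le> f i \<and> f i \<le> i + int n" and l: "lev f = int k * int n" using f Bound_iff by auto
  note F = max_inv_facts[OF fa m]
  have vr: "(f \<circ> tr r s) r = f s" and vs: "(f \<circ> tr r s) s = f r" using tr_at0[OF F(5)] by simp_all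
  show "r < (f \<circ> tr r s) r" "(f \<circ> tr r s) r < r + int n" unfolding vr using F(2,4) b[of s] b[of r] by linarith+
  have "x \<le> f (tr r s x) \<and> f (tr r s x) \<le> x + int n" for x
  proof (cases rule: tr_cases[where x = x and a = r and b = s])
    case (1 c)
    have "f (tr r s x) = f s + c * int n" unfolding 1 tr_at(1)[OF F(5)] by (rule aff_shift[OF fa])
    then show ?thesis unfolding 1 using F(2,4) b[of s] b[of r] by linarith
  next
    case (2 c)
    have "f (tr r s x) = f r + c * int n" unfolding 2 tr_at(2)[OF F(5)] by (rule aff_shift[OF fa])
    then show ?thesis unfolding 2 using F(2,4) b[of s] b[of r] by linarith
  next
    case 3 then show ?thesis using tr_other[OF 3] b[of x] by simp
  qed
  then show "f \<circ> tr r s \<in> Bound k n" unfolding Bound_iff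
    using aff_comp[OF fa aff_tr] lev_comp_tr[OF fa] l by simp
qed

text \<open>Counting residues: the \<open>v r - r\<close> values in \<open>[r, v r)\<close> cannot all be taken at positions congruent
  to an element of \<open>(r, v r)\<close>.\<close>

lemma bounded_preimage:
  assumes v: "v \<in> Bound k n" and r: "r < v r" "v r < r + int n"
  shows "\<exists>i. v r - int n \<le> i \<and> i < r \<and> r \<le> v i \<and> v i < v r"
proof (rule ccontr)
  assume no: "\<not> ?thesis"
  have va: "aff v" and b: "\<And>i. i \<le> v i \<and> v i \<le> i + int n" using v Bound_iff by auto
  define x where "x = iv v"
  have vx: "v (x y) = y" for y by (simp add: x_def va)
  define g where "g = (\<lambda>y. if x y > r then x y else x y + int n)"
  have "g ` {r..v r - 1} \<subseteq> {r + 1..v r - 1}"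
  proof (rule image_subsetI)
    fix y assume y: "y \<in> {r..v r - 1}"
    have xy: "x y \<le> y" "y \<le> x y + int n" using b[of "x y"] vx[of y] by auto
    have "\<not> (v r - int n \<le> x y \<and> x y < r)" using no vx[of y] y by force
    moreover have "x y \<noteq> r" using vx[of y] y by auto
    moreover have "x y \<noteq> r - int n" using vx[of y] y aff_shift[OF va, of "r - int n" 1] r by auto
    ultimately show "g y \<in> {r + 1..v r - 1}" using xy y by (auto simp: g_def)
  qed
  moreover have "inj_on g {r..v r - 1}"
  proof (rule inj_onI)
    fix y y' assume y: "y \<in> {r..v r - 1}" "y' \<in> {r..v r - 1}" "g y = g y'"
    have "cg (x z) (g z)" for z by (simp add: g_def cong_def)
    then have "cg (x y) (x y')" using y(3) by (metis cong_sym cong_trans)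
    then have c: "cg y y'" using aff_cg[OF va, of "x y" "x y'"] vx by simp
    then obtain c where c: "y' = y + c * int n" using cg_iff by blast
    have "\<bar>c * int n\<bar> < int n" using c y r by auto
    then have "c = 0" using n_pos by (simp add: abs_mult)
    then show "y = y'" using c by simp
  qed
  ultimately have "card {r..v r - 1} \<le> card {r + 1..v r - 1}" by (intro card_inj_on_le) auto
  then show False using r by simp
qed

definition TF :: "nat \<Rightarrow> (int \<Rightarrow> int) \<Rightarrow> mpoly" where "TF k f = FP k (tau_pow (- int k) \<circ> f)"

text \<open>After the shift by -k, \<open>h i < i\<close> is a drop of more than k, and
  \<open>h i > i + n\<close> a rise of more than n - k.\<close>

lemma TF_unbounded:
  assumes "k \<le> n" "aff h" "lev h = int k * int n" "h \<notin> Bound k n" shows "TF k h \<in> Lid k n"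
proof -
  have a: "aff (tau_pow (- int k) \<circ> h)" using aff_comp[OF aff_tau assms(2)] .
  have e: "(tau_pow (- int k) \<circ> h) x = h x - int k" for x by (simp add: tau_pow_def)
  obtain i where "h i < i \<or> h i > i + int n" using assms unfolding Bound_iff by (meson not_le)
  then show ?thesis
  proof
    assume "h i < i"
    then have "TF k h = 0" unfolding TF_def using FP_small[OF a, of i k] e[of i] by simp
    then show ?thesis using Lid_0 by simp
  next
    assume "h i > i + int n"
    then show ?thesis unfolding TF_def using FP_large[OF assms(1) a, of i] e[of i] assms(1) by (simp add: of_nat_diff)
  qed
qed

context
  fixes k :: nat and f :: "int \<Rightarrow> int" and r s :: int
  assumes f: "f \<in> Bound k n" and m: "is_max_inversion n f r s"
begin

abbreviation pivot :: "int \<Rightarrow> int" where "pivot \<equiv> f \<circ> tr r s"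

definition Kids :: "int set" where "Kids = {j \<in> Cov pivot r. j \<noteq> s \<and> pivot \<circ> tr r j \<in> Bound k n}"

lemma aff_root: "aff f" using f by (simp add: Bound_iff)

lemma aff_pivot: "aff pivot" using aff_comp[OF aff_root aff_tr] .

lemma kid_inj: "\<not> cg r j \<Longrightarrow> \<not> cg r j' \<Longrightarrow> pivot \<circ> tr r j = pivot \<circ> tr r j' \<Longrightarrow> j = j'"
proof -
  assume h: "\<not> cg r j" "\<not> cg r j'" "pivot \<circ> tr r j = pivot \<circ> tr r j'"
  have "tr r j = tr r j'" using aff_inv_comp2(1)[OF aff_pivot] h(3) by metis
  then show "j = j'" using tr_inj h by blast
qed

text \<open>Edge signs are opposite to those in \<open>Dop\<close>, because f is isolated by moving
  all other covers across the equation.\<close>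

lemma ls_children_eq: "ls_children k n f = (\<lambda>j. (- sgn (j - r), pivot \<circ> tr r j)) ` Kids"
proof -
  note F = max_inv_facts[OF aff_root m]
  have m_iff: "is_max_inversion n f r' s' \<longleftrightarrow> r' = r \<and> s' = s" for r' s' using m max_inversion_unique by blast
  have CB: "ls_children k n f = {(1, h) | h. h \<in> BPhi_minus k n pivot r} \<union> {(-1, h) | h. h \<in> BPhi_plus k n pivot r - {f}}"
    unfolding ls_children_def m_iff by simp
  have minus: "h \<in> BPhi_minus k n pivot r \<longleftrightarrow> (\<exists>j\<in>Kids. j < r \<and> h = pivot \<circ> tr r j)" for h
  proof -
    have c: "bruhat_cover n pivot j r \<longleftrightarrow> j < r \<and> j \<in> Cov pivot r" for j
      unfolding bruhat_cover_def Cov_def tr_commute[of j r] cong_sym_eq[of j r "int n"] by blast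
    have "h \<in> BPhi_minus k n pivot r \<longleftrightarrow> (\<exists>j. h = pivot \<circ> tr j r \<and> bruhat_cover n pivot j r) \<and> h \<in> Bound k n"
      unfolding BPhi_minus_def Phi_minus_def by blast
    also have "\<dots> \<longleftrightarrow> (\<exists>j. h = pivot \<circ> tr r j \<and> j < r \<and> j \<in> Cov pivot r) \<and> h \<in> Bound k n"
      unfolding c tr_commute[of _ r] ..
    also have "\<dots> \<longleftrightarrow> (\<exists>j\<in>Kids. j < r \<and> h = pivot \<circ> tr r j)"
      unfolding Kids_def using less_asym[OF F(2)] by blast
    finally show ?thesis .
  qed
  have plus: "h \<in> BPhi_plus k n pivot r - {f} \<longleftrightarrow> (\<exists>j\<in>Kids. j > r \<and> h = pivot \<circ> tr r j)" for h
  proof -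
    have A: "h \<in> BPhi_plus k n pivot r \<longleftrightarrow> (\<exists>j. h = pivot \<circ> tr r j \<and> j > r \<and> j \<in> Cov pivot r) \<and> h \<in> Bound k n"
      unfolding BPhi_plus_def Phi_plus_def bruhat_cover_def Cov_def by blast
    have B: "pivot \<circ> tr r j = f \<longleftrightarrow> j = s" if "j \<in> Cov pivot r" for j
    proof
      have nj: "\<not> cg r j" using that by (simp add: Cov_def)
      assume "pivot \<circ> tr r j = f"
      then have "pivot \<circ> tr r j = pivot \<circ> tr r s" using F(9) by (rule trans[OF _ sym])
      then show "j = s" by (rule kid_inj[OF nj F(5)])
    next
      assume js: "j = s"
      show "pivot \<circ> tr r j = f" unfolding js by (rule F(9))
    qed
    show ?thesis
    proof
      assume h: "h \<in> BPhi_plus k n pivot r - {f}"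
      then obtain j where j: "h = pivot \<circ> tr r j" "j > r" "j \<in> Cov pivot r" "h \<in> Bound k n" "h \<noteq> f" using A by blast
      then have "j \<in> Kids" using B[OF j(3)] unfolding Kids_def j(1) by simp
      then show "\<exists>j\<in>Kids. j > r \<and> h = pivot \<circ> tr r j" using j(1,2) by blast
    next
      assume "\<exists>j\<in>Kids. j > r \<and> h = pivot \<circ> tr r j"
      then obtain j where j: "j \<in> Kids" "j > r" "h = pivot \<circ> tr r j" by blast
      then have j': "j \<in> Cov pivot r" "j \<noteq> s" "h \<in> Bound k n" unfolding Kids_def by simp_all
      have "h \<noteq> f" using B[OF j'(1)] j'(2) j(3) by simp
      then show "h \<in> BPhi_plus k n pivot r - {f}" using A j(2,3) j'(1,3) by blast
    qed
  qed
  have ne: "j \<noteq> r" if "j \<in> Kids" for j using that by (auto simp: Kids_def Cov_def)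
  show ?thesis
  proof
    show "ls_children k n f \<subseteq> (\<lambda>j. (- sgn (j - r), pivot \<circ> tr r j)) ` Kids"
    proof
      fix c assume "c \<in> ls_children k n f"
      then consider h where "c = (1, h)" "h \<in> BPhi_minus k n pivot r" | h where "c = (-1, h)" "h \<in> BPhi_plus k n pivot r - {f}"
        unfolding CB by blast
      then show "c \<in> (\<lambda>j. (- sgn (j - r), pivot \<circ> tr r j)) ` Kids"
      proof cases
        case 1
        then obtain j where j: "j \<in> Kids" "j < r" "h = pivot \<circ> tr r j" using minus by blast
        show ?thesis unfolding 1(1) j(3) by (rule image_eqI[OF _ j(1)]) (use j(2) in simp)
      next
        case 2
        then obtain j where j: "j \<in> Kids" "j > r" "h = pivot \<circ> tr r j" using plus by blast
        show ?thesis unfolding 2(1) j(3) by (rule image_eqI[OF _ j(1)]) (use j(2) in simp)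
      qed
    qed
    show "(\<lambda>j. (- sgn (j - r), pivot \<circ> tr r j)) ` Kids \<subseteq> ls_children k n f"
    proof (rule image_subsetI)
      fix j assume j: "j \<in> Kids"
      then consider "j < r" | "j > r" using ne by force
      then show "(- sgn (j - r), pivot \<circ> tr r j) \<in> ls_children k n f"
      proof cases
        case 1
        then have "pivot \<circ> tr r j \<in> BPhi_minus k n pivot r" "- sgn (j - r) = 1" using minus j by auto
        then show ?thesis unfolding CB by blast
      next
        case 2
        then have "pivot \<circ> tr r j \<in> BPhi_plus k n pivot r - {f}" "- sgn (j - r) = -1" using plus j by auto
        then show ?thesis unfolding CB by blast
      qed
    qed
  qed
qed

lemma finite_Kids: "finite Kids" using finite_Cov[OF aff_pivot, of r] by (simp add: Kids_def)

lemma Kids_inj: "inj_on (\<lambda>j. (- sgn (j - r), pivot \<circ> tr r j)) Kids"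
proof (rule inj_onI)
  fix j j' assume h: "j \<in> Kids" "j' \<in> Kids" "(- sgn (j - r), pivot \<circ> tr r j) = (- sgn (j' - r), pivot \<circ> tr r j')"
  then have "\<not> cg r j" "\<not> cg r j'" by (simp_all add: Kids_def Cov_def)
  moreover have "pivot \<circ> tr r j = pivot \<circ> tr r j'" using h(3) by (rule Pair_inject)
  ultimately show "j = j'" by (rule kid_inj)
qed

text \<open>This makes childless vertices 0-Grassmannian. Among the positions from
  \<open>bounded_preimage\<close> take the largest: maximality excludes intermediate points, so it
  gives a cover, and the bounds on i and on its value keep the result in
  \<open>Bound k n\<close>.\<close>

lemma Kids_nonempty: "Kids \<noteq> {}"
proof -
  note B = max_inversion_Bound[OF f m] and F = max_inv_facts[OF aff_root m]
  define u where "u = pivot"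
  note B = B[folded u_def]
  have ua: "aff u" and b: "\<And>i. i \<le> u i \<and> u i \<le> i + int n" and l: "lev u = int k * int n" using B(1) Bound_iff by auto
  let ?I = "{i. u r - int n \<le> i \<and> i < r \<and> r \<le> u i \<and> u i < u r}"
  have "finite ?I" by (rule finite_subset[of _ "{u r - int n..r}"]) auto
  moreover have "?I \<noteq> {}" using bounded_preimage[OF B] by blast
  ultimately have "Max ?I \<in> ?I" and mx: "\<And>j. j \<in> ?I \<Longrightarrow> j \<le> Max ?I" by (rule Max_in, simp)
  then obtain i where i: "u r - int n \<le> i" "i < r" "r \<le> u i" "u i < u r" and mi: "\<And>j. j \<in> ?I \<Longrightarrow> j \<le> i" by blast
  have nc: "\<not> cg i r"
  proof
    assume "cg i r"
    then obtain c where c: "r = i + c * int n" using cg_iff by blast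
    have "0 < c * int n" "c * int n < 1 * int n" using c i B(2) by linarith+
    then show False using mult_less_cancel_right_pos[of "int n" c 1] n_pos by (simp add: zero_less_mult_iff)
  qed
  have "len (u \<circ> tr i r) = len u + 1"
  proof (subst cover_iff[OF i(2) nc ua i(4)], rule notI)
    assume "\<exists>m. i < m \<and> m < r \<and> u i < u m \<and> u m < u r"
    then obtain m where m: "i < m" "m < r" "u i < u m" "u m < u r" by blast
    then have "m \<in> ?I" using i by simp
    then show False using mi m(1) by force
  qed
  then have C: "i \<in> Cov u r" using nc unfolding Cov_def tr_commute[of i r] by (simp add: cong_sym_eq)
  have "x \<le> u (tr i r x) \<and> u (tr i r x) \<le> x + int n" for x
  proof (cases rule: tr_cases[where x = x and a = i and b = r])
    case (1 c)
    have "u (tr i r x) = u r + c * int n" unfolding 1 tr_at(1)[OF nc] by (rule aff_shift[OF ua])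
    then show ?thesis unfolding 1 using i B by linarith
  next
    case (2 c)
    have "u (tr i r x) = u i + c * int n" unfolding 2 tr_at(2)[OF nc] by (rule aff_shift[OF ua])
    then show ?thesis unfolding 2 using i B by linarith
  next
    case 3 then show ?thesis using tr_other[OF 3] b[of x] by simp
  qed
  then have "u \<circ> tr i r \<in> Bound k n" unfolding Bound_iff
    using aff_comp[OF ua aff_tr] lev_comp_tr[OF ua] l by simp
  then have "u \<circ> tr r i \<in> Bound k n" unfolding tr_commute[of r i] .
  then have "i \<in> Kids" unfolding Kids_def u_def[symmetric] using C i(2) F(2) by simp
  then show ?thesis by blast
qed

lemma transition: assumes kn: "k \<le> n"
  shows "TF k f - (\<Sum>c\<in>ls_children k n f. of_int (fst c) * TF k (snd c)) \<in> Lid k n"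
proof -
  note F = max_inv_facts[OF aff_root m]
  let ?T = "tau_pow (- int k)"
  let ?g = "\<lambda>j. of_int (- sgn (j - r)) * TF k (pivot \<circ> tr r j)"
  have "Cov (?T \<circ> pivot) r = Cov pivot r" unfolding Cov_def comp_assoc len_tau_left ..
  then have "Dop r (FP k) (?T \<circ> pivot) = (\<Sum>j\<in>Cov pivot r. of_int (sgn (j - r)) * TF k (pivot \<circ> tr r j))"
    unfolding Dop_def TF_def comp_assoc by simp
  then have "(\<Sum>j\<in>Cov pivot r. ?g j) = 0" using Dop_FP[OF aff_comp[OF aff_tau aff_pivot], of r k "- int k"]
    by (simp add: sum_negf)
  moreover have "(\<Sum>j\<in>Cov pivot r. ?g j) = ?g s + (\<Sum>j\<in>Cov pivot r - {s}. ?g j)" by (rule sum.remove[OF finite_Cov[OF aff_pivot] F(8)])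
  moreover have "?g s = - TF k f" using F(2) unfolding F(9) by simp
  ultimately have 1: "TF k f = (\<Sum>j\<in>Cov pivot r - {s}. ?g j)" by (simp add: add_eq_0_iff)
  have K: "Kids \<subseteq> Cov pivot r - {s}" by (auto simp: Kids_def)
  have 2: "(\<Sum>c\<in>ls_children k n f. of_int (fst c) * TF k (snd c)) = (\<Sum>j\<in>Kids. ?g j)"
    unfolding ls_children_eq sum.reindex[OF Kids_inj] by (rule sum.cong[OF refl]) (simp only: comp_apply[of "\<lambda>c. of_int (fst c) * TF k (snd c)"] fst_conv snd_conv)
  have "TF k f - (\<Sum>c\<in>ls_children k n f. of_int (fst c) * TF k (snd c)) = (\<Sum>j\<in>Cov pivot r - {s} - Kids. ?g j)"
    unfolding 1 2 by (rule sum_diff[symmetric]) (use finite_Cov[OF aff_pivot] K in auto)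
  also have "\<dots> \<in> Lid k n"
  proof (rule Lid_sum)
    fix j assume j: "j \<in> Cov pivot r - {s} - Kids"
    then have u: "pivot \<circ> tr r j \<notin> Bound k n" unfolding Kids_def by blast
    have "lev (pivot \<circ> tr r j) = int k * int n" unfolding lev_comp_tr[OF aff_pivot] lev_comp_tr[OF aff_root] using f Bound_iff by blast
    then have "TF k (pivot \<circ> tr r j) \<in> Lid k n" using TF_unbounded[OF kn aff_comp[OF aff_pivot aff_tr] _ u] by blast
    then show "?g j \<in> Lid k n" by (rule Lid_mult[OF Sym_of_int])
  qed
  finally show ?thesis .
qed

lemma children_facts:
  "ls_children k n f \<noteq> {}" "finite (ls_children k n f)"
  "c \<in> ls_children k n f \<Longrightarrow> (fst c = 1 \<or> fst c = -1) \<and> snd c \<in> Bound k n \<and>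
    (energy (snd c) > energy f \<or> energy (snd c) = energy f \<and> invcode (snd c) < invcode f)"
proof -
  show "ls_children k n f \<noteq> {}" "finite (ls_children k n f)" unfolding ls_children_eq using Kids_nonempty finite_Kids by auto
  assume "c \<in> ls_children k n f"
  then obtain j where j: "j \<in> Kids" "c = (- sgn (j - r), pivot \<circ> tr r j)" unfolding ls_children_eq by blast
  have "j \<noteq> r" "j \<in> Cov pivot r" "j \<noteq> s" "pivot \<circ> tr r j \<in> Bound k n" using j(1) by (auto simp: Kids_def Cov_def)
  then show "(fst c = 1 \<or> fst c = -1) \<and> snd c \<in> Bound k n \<and>
    (energy (snd c) > energy f \<or> energy (snd c) = energy f \<and> invcode (snd c) < invcode f)"
    unfolding j(2) fst_conv snd_conv using child_measure[OF aff_root m, of j] by (auto simp: sgn_if)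
qed

end

section \<open>Termination and the expansion over the leaves\<close>

lemma energy_Bound: assumes "f \<in> Bound k n" shows "energy f \<le> int n * (2 * int n)\<^sup>2"
proof -
  have b: "\<And>i. i \<le> f i \<and> f i \<le> i + int n" using assms Bound_iff by auto
  \<comment> \<open>Window values satisfy 0 <= f i <= i + n <= 2 n.\<close>
  have "energy f \<le> (\<Sum>i\<in>{1..int n}. (2 * int n)\<^sup>2)" unfolding energy_def
  proof (rule sum_mono)
    fix i assume "i \<in> {1..int n}"
    then show "(f i)\<^sup>2 \<le> (2 * int n)\<^sup>2" using b[of i] by (intro power_mono) auto
  qed
  then show ?thesis by simp
qed

lemma invcode_nonneg: "0 \<le> invcode f"
  unfolding invcode_def by (rule Max_ge) (use finite_winv in auto)

text \<open>Finiteness, the description of the leaves and the expansion are proved together, because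
  the sum over the leaves of f splits over the children only once their leaf sets are known to be
  finite.\<close>

lemma ls_tree_expansion:
  assumes kn: "k \<le> n"
  shows "f \<in> Bound k n \<Longrightarrow> finite (ls_leaves k n f) \<and>
    (\<forall>p\<in>ls_leaves k n f. (path_sign p = 1 \<or> path_sign p = -1) \<and>
      vertex_label f p \<in> Bound k n \<and> window_inversions n (vertex_label f p) = {}) \<and>
    TF k f - (\<Sum>p\<in>ls_leaves k n f. of_int (path_sign p) * TF k (vertex_label f p)) \<in> Lid k n"
\<comment> \<open>Energy grows down the tree, so its distance from the upper bound serves as the
  first component; the code breaks ties.\<close>
proof (induction f rule: wf_induct_rule[OF wf_measures[of "[\<lambda>f. nat (int n * (2 * int n)\<^sup>2 - energy f), \<lambda>f. nat (invcode f)]"]])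
  case (1 f)
  note f = 1(2)
  show ?case
  proof (cases "window_inversions n f = {}")
    case True
    then have "ls_children k n f = {}" by (auto simp: ls_children_def is_max_inversion_def)
    then have "ls_leaves k n f = {[]}" by (rule ls_leaves_leaf)
    then show ?thesis using True f Lid_0 by (simp add: path_sign_simps vertex_label_def)
  next
    case False
    then obtain r s where m: "is_max_inversion n f r s" using max_inversion_exists by blast
    let ?C = "ls_children k n f"
    note ne = children_facts(1)[OF f m] and fin = children_facts(2)[OF f m] and C = children_facts(3)[OF f m]
    note L = ls_leaves_node[OF ne]
    have IH: "finite (ls_leaves k n (snd c)) \<and>
        (\<forall>p\<in>ls_leaves k n (snd c). (path_sign p = 1 \<or> path_sign p = -1) \<and>
          vertex_label (snd c) p \<in> Bound k n \<and> window_inversions n (vertex_label (snd c) p) = {}) \<and>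
        TF k (snd c) - (\<Sum>p\<in>ls_leaves k n (snd c). of_int (path_sign p) * TF k (vertex_label (snd c) p)) \<in> Lid k n"
      if c: "c \<in> ?C" for c
    proof (rule 1(1))
      show "snd c \<in> Bound k n" using C[OF c] by blast
      have "energy (snd c) \<le> int n * (2 * int n)\<^sup>2" using energy_Bound C[OF c] by blast
      then show "(snd c, f) \<in> measures [\<lambda>f. nat (int n * (2 * int n)\<^sup>2 - energy f), \<lambda>f. nat (invcode f)]"
        using C[OF c] invcode_nonneg[of "snd c"] invcode_nonneg[of f] by auto
    qed
    have finL: "finite (ls_leaves k n f)" unfolding L using fin IH by blast
    have sgnL: "(path_sign p = 1 \<or> path_sign p = -1) \<and>
      vertex_label f p \<in> Bound k n \<and> window_inversions n (vertex_label f p) = {}" if p: "p \<in> ls_leaves k n f" for p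
    proof -
      obtain c q where q: "c \<in> ?C" "p = c # q" "q \<in> ls_leaves k n (snd c)" using p unfolding L by blast
      then show ?thesis using IH[OF q(1)] C[OF q(1)] by (auto simp: vertex_label_Cons path_sign_simps)
    qed
    let ?S = "\<lambda>f. \<Sum>p\<in>ls_leaves k n f. of_int (path_sign p) * TF k (vertex_label f p)"
    have "?S f = (\<Sum>c\<in>?C. \<Sum>p\<in>(#) c ` ls_leaves k n (snd c). of_int (path_sign p) * TF k (vertex_label f p))"
      unfolding L by (rule sum.UNION_disjoint[OF fin]) (use IH in blast)+
    also have "\<dots> = (\<Sum>c\<in>?C. of_int (fst c) * ?S (snd c))"
      by (rule sum.cong[OF refl]) (simp add: sum.reindex path_sign_simps vertex_label_Cons sum_distrib_left mult.assoc)
    finally have S: "?S f = (\<Sum>c\<in>?C. of_int (fst c) * ?S (snd c))" .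
    have "TF k f - ?S f = (TF k f - (\<Sum>c\<in>?C. of_int (fst c) * TF k (snd c))) +
        (\<Sum>c\<in>?C. of_int (fst c) * (TF k (snd c) - ?S (snd c)))"
      unfolding S by (simp add: right_diff_distrib sum_subtractf)
    also have "\<dots> \<in> Lid k n"
    proof (rule Lid_add[OF transition[OF f m kn] Lid_sum])
      fix c assume "c \<in> ?C"
      then show "of_int (fst c) * (TF k (snd c) - ?S (snd c)) \<in> Lid k n" using IH by (intro Lid_mult[OF Sym_of_int]) blast
    qed
    finally show ?thesis using finL sgnL by blast
  qed
qed

end

theorem theorem3p9:
  fixes k n :: nat and f :: "int \<Rightarrow> int"
  assumes "1 \<le> n" and "k \<le> n" and "f \<in> Bound k n"
  shows "finite (ls_leaves k n f) \<and>
    G_class k n f =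
      (\<Oplus>\<^bsub>Lambda k n\<^esub> p \<in> ls_leaves k n f.
         [path_sign p] \<cdot>\<^bsub>Lambda k n\<^esub> schur_class k n (ls_shape k n (vertex_label f p)))"
proof -
  interpret affine_window n by unfold_locales (rule assms(1))
  let ?L = "ls_leaves k n f" and ?S = "\<lambda>p. schur_poly k (ls_shape k n (vertex_label f p))"
  have aff: "g \<in> affine_perms n" if "g \<in> Bound k n" for g using that by (simp add: Bound_def)
  have TF_Sym: "TF k g \<in> Sym k" if "g \<in> Bound k n" for g
    unfolding TF_def by (rule FP_Sym[OF aff_comp[OF aff_tau aff[OF that]]])
  note E = ls_tree_expansion[OF assms(2,3)]
  have S: "?S p = TF k (vertex_label f p)" if "p \<in> ?L" for p
    using E that FP_leaf[OF assms(2), of "vertex_label f p"] unfolding TF_def by metis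
  have SS: "?S p \<in> Sym k" if "p \<in> ?L" for p unfolding S[OF that] using E that TF_Sym by blast
  have sum: "(\<Sum>p\<in>?L. of_int (path_sign p) * TF k (vertex_label f p)) = (\<Sum>p\<in>?L. of_int (path_sign p) * ?S p)"
    by (rule sum.cong[OF refl]) (simp only: S)
  have "G_class k n f = Lambda_image k n (TF k f)"
    using specialize_affine_stanley[OF aff[OF assms(3)], of k] assms(3) Bound_iff unfolding G_class_def TF_def by simp
  also have "\<dots> = Lambda_image k n (\<Sum>p\<in>?L. of_int (path_sign p) * ?S p)"
  proof (rule Lambda_image_eq)
    show "TF k f \<in> Sym k" by (rule TF_Sym[OF assms(3)])
    show "(\<Sum>p\<in>?L. of_int (path_sign p) * ?S p) \<in> Sym k" by (intro Sym_sum Sym_mult Sym_of_int SS)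
    show "TF k f - (\<Sum>p\<in>?L. of_int (path_sign p) * ?S p) \<in> Lid k n" using E unfolding sum by blast
  qed
  also have "\<dots> = (\<Oplus>\<^bsub>Lambda k n\<^esub> p \<in> ?L. [path_sign p] \<cdot>\<^bsub>Lambda k n\<^esub> Lambda_image k n (?S p))"
    by (rule finsum_Lambda[symmetric]) (use E SS in blast)+
  finally show ?thesis using E unfolding schur_class_def by blast
qed

end
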